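(* Let $K$ be a number field, let $n,d\ge 1$, and let $\varphi:\mathbb{P}^n\to\mathbb{P}^n$ be a morphism defined over $K$, given by $n+1$ homogeneous polynomials of degree $d$ without common zero in $\mathbb{P}^n(\overline K)$. Then there is a finite algebraic extension $L$ of $K$ such that $\varphi$, considered as a morphism over $L$, has a (globally) minimal presentation; that is, there is a single choice of homogeneous coordinates $[X_0,\dots,X_n]$ on $\mathbb{P}^n$ over $L$ such that the presentation of $\varphi$ with respect to $[X_0,\dots,X_n]$ is minimal at $p$ for every closed point $p$ of $\mathrm{Spec}(\mathcal{O}_L)$.
   Context: Let $L$ be a number field. With respect to homogeneous coordinates $[X_0,\dots,X_n]$ on $\mathbb{P}^n$ over $L$, $\varphi$ is written $[F_0,\dots,F_n]$ with $F_i\in L[X_0,\dots,X_n]$ homogeneous of degree $d$. Let $\mathbf{a}_i$ be the tuple of the $\binom{n+d}{d}$ coefficients of $F_i$, and $N=(n+1)\binom{n+d}{d}-1$. The point $[\mathbf{a}_0,\dots,\mathbf{a}_n]\in\mathbb{P}^N(L)$ is the presentation of $\varphi$ with respect to $[X_0,\dots,X_n]$; it is determined by the choice of coordinates, while the tuple $(\mathbf{a}_0,\dots,\mathbf{a}_n)$ is determined only up to a common nonzero scalar. A change of coordinates by $\Gamma\in\mathrm{GL}_{n+1}(L)$ replaces $F=(F_0,\dots,F_n)$ by $\mathrm{adj}(\Gamma)\cdot F(\Gamma X)$, where $\mathrm{adj}(\Gamma)$ is the adjugate matrix (that is, it conjugates $\varphi$ by $\Gamma$, up to scaling). The presentations of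 $\varphi$ over $L$ are exactly those obtained from one of them by such changes of coordinates. $\rho=\rho(\mathbf{a}_0,\dots,\mathbf{a}_n)$ is the (Macaulay) resultant of $n+1$ forms of degree $d$ in $n+1$ variables, a polynomial with integer coefficients, homogeneous of total degree $(n+1)d^n$ in the coefficients, equal to $1$ on $(X_0^d,\dots,X_n^d)$; over any field it is nonzero exactly when the forms have no common zero in $\mathbb{P}^n$ over the algebraic closure. Let $p$ be a closed point of $\mathrm{Spec}(\mathcal{O}_L)$, with local ring $\mathcal{O}_p$ and normalized discrete valuation $\mathrm{ord}_p$. A tuple $(\mathbf{a}_0,\dots,\mathbf{a}_n)$ is normalized at $p$ if all its entries lie in $\mathcal{O}_p$ and not all of them vanish modulo $p$. For a choice of coordinates $[X_0,\dots,X_n]$ over $L$, with presentation represented by a tuple $(\mathbf{a}_0,\dots,\mathbf{a}_n)$ normalized at $p$, set $(R_{\varphi,[X_0,\dots,X_n]})_p=\mathrm{ord}_p(\rho(\mathbf{a}_0,\dots,\mathbf{a}_n))$. The presentation is minimal at $p$ if $(R_{\varphi,[X_0,\dots,X_n]})_p$ is minimal among all choices of homogeneous coordinates on $\mathbb{P}^n$ over $L$. (The normalized representative may depend on $p$; the coordinates $[X_0,\dots,X_n]$ in a globally minimal presentation may not.) *)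

theory Defs
  imports
    Complex_Main
    "HOL-Library.Poly_Mapping"
    "HOL-Computational_Algebra.Polynomial"
    "HOL-Algebra.Embedded_Algebras"
    "HOL-Algebra.Algebraic_Closure_Type"
    "Jordan_Normal_Form.Determinant"
begin

section \<open>Number fields and their primes\<close>

text \<open>
  Number fields are realised as subfields of the complex numbers. Every number field embeds into
  the complex numbers, and so does every finite extension of it, compatibly with the embedding
  of the base.
\<close>

abbreviation CC :: "complex ring" where
  "CC \<equiv> ring_of_type_algebra"

definition number_field :: "complex set \<Rightarrow> bool" where
  "number_field K \<longleftrightarrow> subfield K CC \<and> ring.finite_dimension CC \<rat> K"

definition finite_extension :: "complex set \<Rightarrow> complex set \<Rightarrow> bool" where
  "finite_extension K L \<longleftrightarrow> subfield L CC \<and> K \<subseteq> L \<and> ring.finite_dimension CC K L"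

definition integers_of :: "complex set \<Rightarrow> complex set" where
  "integers_of L = {x \<in> L. algebraic_int x}"

text \<open>The closed points of the spectrum of the ring of integers are its maximal ideals.\<close>

definition closed_point :: "complex set \<Rightarrow> complex set \<Rightarrow> bool" where
  "closed_point L p \<longleftrightarrow> maximalideal p (CC\<lparr>carrier := integers_of L\<rparr>)"

definition local_ring :: "complex set \<Rightarrow> complex set \<Rightarrow> complex set" where
  "local_ring L p = {a / s | a s. a \<in> integers_of L \<and> s \<in> integers_of L - p}"

definition local_max_ideal :: "complex set \<Rightarrow> complex set \<Rightarrow> complex set" where
  "local_max_ideal L p = {a / s | a s. a \<in> p \<and> s \<in> integers_of L - p}"

definition uniformizer :: "complex set \<Rightarrow> complex set \<Rightarrow> complex \<Rightarrow> bool" where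
  "uniformizer L p \<pi> \<longleftrightarrow> local_max_ideal L p = {\<pi> * a | a. a \<in> local_ring L p}"

text \<open>
  The normalized valuation: \<open>x\<close> is a unit of the local ring times the \<open>k\<close>-th power of a
  uniformizer. Meaningful only for \<open>x \<in> L - {0}\<close>; it is unspecified at 0 and never used there.
\<close>

definition ord_at :: "complex set \<Rightarrow> complex set \<Rightarrow> complex \<Rightarrow> int" where
  "ord_at L p x = (THE k. \<exists>\<pi> u. uniformizer L p \<pi> \<and>
     u \<in> local_ring L p - local_max_ideal L p \<and> x = u * \<pi> powi k)"


section \<open>Multivariate polynomials and forms\<close>

text \<open>
  A polynomial with variables in \<open>'v\<close> and coefficients in \<open>'c\<close> is a finitely supported map from
  exponent vectors to coefficients; addition and multiplication are those of
  \<^theory>\<open>HOL-Library.Poly_Mapping\<close>.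
\<close>

type_synonym ('v, 'c) mpoly = "('v \<Rightarrow>\<^sub>0 nat) \<Rightarrow>\<^sub>0 'c"

definition mconst :: "'c \<Rightarrow> ('v, 'c::zero) mpoly" where
  "mconst c = Poly_Mapping.single 0 c"

definition mvar :: "'v \<Rightarrow> ('v, 'c::zero_neq_one) mpoly" where
  "mvar v = Poly_Mapping.single (Poly_Mapping.single v 1) 1"

text \<open>Substitution of \<open>x v\<close> for the variable \<open>v\<close>, the coefficients being mapped by \<open>h\<close>.\<close>

definition msubst ::
  "('c \<Rightarrow> 'b) \<Rightarrow> ('v \<Rightarrow> 'b) \<Rightarrow> ('v, 'c::zero) mpoly \<Rightarrow> 'b::comm_semiring_1" where
  "msubst h x P = (\<Sum>m\<in>Poly_Mapping.keys P. h (Poly_Mapping.lookup P m) * (\<Prod>v\<in>Poly_Mapping.keys m. x v ^ Poly_Mapping.lookup m v))"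

abbreviation meval :: "('v \<Rightarrow> 'c) \<Rightarrow> ('v, 'c) mpoly \<Rightarrow> 'c::comm_semiring_1" where
  "meval \<equiv> msubst (\<lambda>c. c)"

definition mdegree :: "('v \<Rightarrow>\<^sub>0 nat) \<Rightarrow> nat" where
  "mdegree m = (\<Sum>v\<in>Poly_Mapping.keys m. Poly_Mapping.lookup m v)"

text \<open>Exponents of the monomials of degree \<open>d\<close> in the \<open>n + 1\<close> variables \<open>X\<^sub>0, \<dots>, X\<^sub>n\<close>.\<close>

definition monomials :: "nat \<Rightarrow> nat \<Rightarrow> (nat \<Rightarrow>\<^sub>0 nat) set" where
  "monomials n d = {m. Poly_Mapping.keys m \<subseteq> {..n} \<and> mdegree m = d}"

definition form :: "complex set \<Rightarrow> nat \<Rightarrow> nat \<Rightarrow> (nat, complex) mpoly \<Rightarrow> bool" where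
  "form K n d P \<longleftrightarrow> Poly_Mapping.keys P \<subseteq> monomials n d \<and> (\<forall>m. Poly_Mapping.lookup P m \<in> K)"

text \<open>
  A common zero in \<open>n\<close>-dimensional projective space over \<open>A\<close>, given by homogeneous coordinates.
\<close>

definition has_common_zero ::
  "complex set \<Rightarrow> nat \<Rightarrow> (nat \<Rightarrow> (nat, complex) mpoly) \<Rightarrow> bool" where
  "has_common_zero A n F \<longleftrightarrow>
     (\<exists>x. (\<forall>j\<le>n. x j \<in> A) \<and> (\<exists>j\<le>n. x j \<noteq> 0) \<and> (\<forall>i\<le>n. meval x (F i) = 0))"

text \<open>
  The tuple \<open>F\<^sub>0, \<dots>, F\<^sub>n\<close> defines a morphism of projective space of dimension \<open>n\<close> over the number
  field \<open>K\<close>. The algebraic closure of \<open>K\<close> in the complex numbers is the field of all algebraic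
  numbers.
\<close>

definition defines_morphism ::
  "complex set \<Rightarrow> nat \<Rightarrow> nat \<Rightarrow> (nat \<Rightarrow> (nat, complex) mpoly) \<Rightarrow> bool" where
  "defines_morphism K n d F \<longleftrightarrow>
     (\<forall>i\<le>n. form K n d (F i)) \<and> \<not> has_common_zero {z. algebraic z} n F"


section \<open>The Macaulay resultant\<close>

text \<open>
  Polynomials in the coefficients of \<open>n + 1\<close> generic forms have variables \<open>(i, m)\<close>, standing for
  the coefficient of the monomial \<open>m\<close> in the \<open>i\<close>-th form.
\<close>

definition eval_at_forms ::
  "(nat \<times> (nat \<Rightarrow>\<^sub>0 nat), int) mpoly \<Rightarrow> (nat \<Rightarrow> (nat, complex) mpoly) \<Rightarrow> complex" where
  "eval_at_forms \<rho> F = msubst of_int (\<lambda>(i, m). Poly_Mapping.lookup (F i) m) \<rho>"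

text \<open>
  Integer coefficients, total degree \<open>(n + 1) d\<^sup>n\<close>, value 1 at the powers of the variables, and
  non-vanishing exactly at the systems without nontrivial common zero. For \<open>n, d \<ge> 1\<close> these
  conditions have exactly one solution: the systems with a common zero form an
  irreducible hypersurface over the complex numbers, so the vanishing condition determines \<open>\<rho>\<close>
  up to a constant and an exponent, which are then fixed by the value and the degree. The
  vanishing criterion over other fields is a consequence.
\<close>

definition is_macaulay_resultant ::
  "nat \<Rightarrow> nat \<Rightarrow> (nat \<times> (nat \<Rightarrow>\<^sub>0 nat), int) mpoly \<Rightarrow> bool" where
  "is_macaulay_resultant n d \<rho> \<longleftrightarrow>
     (\<forall>t\<in>Poly_Mapping.keys \<rho>. Poly_Mapping.keys t \<subseteq> {..n} \<times> monomials n d \<and> mdegree t = (n + 1) * d ^ n) \<and>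
     eval_at_forms \<rho> (\<lambda>i. mvar i ^ d) = 1 \<and>
     (\<forall>F. (\<forall>i\<le>n. form UNIV n d (F i)) \<longrightarrow>
        (eval_at_forms \<rho> F \<noteq> 0 \<longleftrightarrow> \<not> has_common_zero UNIV n F))"

definition macaulay_resultant :: "nat \<Rightarrow> nat \<Rightarrow> (nat \<times> (nat \<Rightarrow>\<^sub>0 nat), int) mpoly" where
  "macaulay_resultant n d = (SOME \<rho>. is_macaulay_resultant n d \<rho>)"


section \<open>Presentations and minimality\<close>

definition GL :: "nat \<Rightarrow> complex set \<Rightarrow> complex mat set" where
  "GL n L = {\<Gamma> \<in> carrier_mat (n + 1) (n + 1). elements_mat \<Gamma> \<subseteq> L \<and> det \<Gamma> \<noteq> 0}"

text \<open>The tuple \<open>adj(\<Gamma>) \<cdot> F(\<Gamma> X)\<close>; only the components with index at most \<open>n\<close> matter.\<close>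

definition change_coords ::
  "nat \<Rightarrow> complex mat \<Rightarrow> (nat \<Rightarrow> (nat, complex) mpoly) \<Rightarrow> nat \<Rightarrow> (nat, complex) mpoly" where
  "change_coords n \<Gamma> F i =
     (\<Sum>j\<le>n. mconst (adj_mat \<Gamma> $$ (i, j)) *
        msubst mconst (\<lambda>k. \<Sum>l\<le>n. mconst (\<Gamma> $$ (k, l)) * mvar l) (F j))"

definition normalized_at ::
  "complex set \<Rightarrow> complex set \<Rightarrow> nat \<Rightarrow> (nat \<Rightarrow> (nat, complex) mpoly) \<Rightarrow> bool" where
  "normalized_at L p n G \<longleftrightarrow>
     (\<forall>i\<le>n. \<forall>m. Poly_Mapping.lookup (G i) m \<in> local_ring L p) \<and>
     (\<exists>i\<le>n. \<exists>m. Poly_Mapping.lookup (G i) m \<notin> local_max_ideal L p)"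

text \<open>
  The order of the resultant of a normalized representative of the point with homogeneous
  coordinates the coefficients of \<open>G\<close>. Two normalized representatives differ by a unit of the
  local ring, so the choice of \<open>c\<close> does not matter.
\<close>

definition resultant_order ::
  "complex set \<Rightarrow> complex set \<Rightarrow> nat \<Rightarrow> nat \<Rightarrow> (nat \<Rightarrow> (nat, complex) mpoly) \<Rightarrow> int" where
  "resultant_order L p n d G =
     (let c = (SOME c. c \<in> L - {0} \<and> normalized_at L p n (\<lambda>i. mconst c * G i))
      in ord_at L p (eval_at_forms (macaulay_resultant n d) (\<lambda>i. mconst c * G i)))"

text \<open>
  Choices of homogeneous coordinates over \<open>L\<close> are given by matrices relative to the coordinates
  in which \<open>F\<close> is written.
\<close>

definition minimal_at ::
  "complex set \<Rightarrow> complex set \<Rightarrow> nat \<Rightarrow> nat \<Rightarrow> (nat \<Rightarrow> (nat, complex) mpoly) \<Rightarrow> complex mat \<Rightarrow> bool"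
  where
  "minimal_at L p n d F \<Gamma> \<longleftrightarrow>
     (\<forall>\<Gamma>'\<in>GL n L. resultant_order L p n d (change_coords n \<Gamma> F)
                 \<le> resultant_order L p n d (change_coords n \<Gamma>' F))"

definition has_globally_minimal_presentation ::
  "complex set \<Rightarrow> nat \<Rightarrow> nat \<Rightarrow> (nat \<Rightarrow> (nat, complex) mpoly) \<Rightarrow> bool" where
  "has_globally_minimal_presentation L n d F \<longleftrightarrow>
     (\<exists>\<Gamma>\<in>GL n L. \<forall>p. closed_point L p \<longrightarrow> minimal_at L p n d F \<Gamma>)"

end

theory Submission
  imports
    Defs
    "HOL-Library.Product_Lexorder"
    "Jordan_Normal_Form.Char_Poly"
    "HOL-Computational_Algebra.Computational_Algebra"
    "HOL-Library.Countable_Set"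
    "HOL-Analysis.Continuum_Not_Denumerable"
begin

text \<open>
  The order of the resultant of a normalized presentation is non-negative, and it is 0 for the
  given coordinates outside the finitely many primes \<open>p\<^sub>i\<close> that divide the resultant of an integral
  multiple of \<open>F\<close>. At each \<open>p\<^sub>i\<close> take a matrix over \<open>K\<close> that is minimal there. Right multiplication by
  \<open>GL(O\<^sub>p)\<close> does not change the order: along a line of invertible matrices the resultant is a
  polynomial without roots. So this matrix may be taken upper triangular.

  Some power of \<open>p\<^sub>i\<close> is principal. Let \<open>\<alpha>\<^sub>i\<close> be a root of a polynomial with constant term a generator
  of it, congruent modulo high powers of all the \<open>p\<^sub>j\<close> to a product of distinct linear factors.
  In the field \<open>L\<close> generated by the \<open>\<alpha>\<^sub>i\<close> all \<open>p\<^sub>j\<close> split completely. Hence \<open>K\<close> is dense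
  in the completions of \<open>L\<close> above \<open>p\<^sub>j\<close>, and matrices minimal over \<open>K\<close> stay minimal over \<open>L\<close>. Above
  \<open>p\<^sub>i\<close> the \<open>\<alpha>\<^sub>i\<close> are uniformizers and elsewhere units, so that one can write down a triangular matrix
  over \<open>L\<close> that agrees up to \<open>GL(O\<^sub>P)\<close> with the chosen one at all \<open>P\<close> above \<open>p\<^sub>i\<close>, for every \<open>i\<close>, and lies in
  \<open>GL(O\<^sub>Q)\<close> for the remaining \<open>Q\<close>. This replaces strong approximation and uses no stability theory.

  Existence of the resultant is by induction on \<open>n\<close>. The integer polynomials vanishing at all
  systems with a common zero form a principal ideal, by normality of the ring of integer
  polynomials. Zeros of its generator have common zeros because projective points can be specialised
  along places of the complex numbers. A Macaulay determinant bounds the degree of the generator in each form from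
  above, and systems with \<open>d\<^sup>n\<close> separated zeros bound it from below.
\<close>

section \<open>Evaluation of polynomials in several variables\<close>

text \<open>Two demands on \<open>L\<close> pull in opposite directions. Minimality need not survive
  an extension: over a ramified prime, for instance, new coordinates can lower the order. So the
  completions at the primes that matter must not grow. But local matrices can be glued only if
  diagonal entries have prescribed valuations at these primes and are units elsewhere, and over
  \<open>K\<close> the class group obstructs this. A polynomial whose constant term generates a
  power of the prime meets both demands: \<open>h\<close> roots of valuation 1 account for a
  constant term of valuation \<open>h\<close>, and locally they can be taken distinct and in
  \<open>K\<close>. The unipotent parts need additive approximation only, which is not obstructed.

  The resultant is a choice by specification, so its existence comes before any property.
  Integrality enters through the shift of a system by a multiple of the forms \<open>X_i^d\<close>:
  Macaulay determinants are monic in the shift parameter. For a generic system with a zero this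
  parameter is therefore integral over the ring of the shifted coefficients, and the constant term
  of its minimal polynomial generates the ideal.\<close>

abbreviation lookup :: "('a \<Rightarrow>\<^sub>0 'b::zero) => 'a => 'b" where "lookup \<equiv> Poly_Mapping.lookup"
abbreviation keys :: "('a \<Rightarrow>\<^sub>0 'b::zero) => 'a set" where "keys \<equiv> Poly_Mapping.keys"
abbreviation single :: "'a => 'b => ('a \<Rightarrow>\<^sub>0 'b::zero)" where "single \<equiv> Poly_Mapping.single"

definition mval :: "('v => 'b) => ('v \<Rightarrow>\<^sub>0 nat) => 'b::comm_semiring_1" where
  "mval x m = (\<Prod>v\<in>keys m. x v ^ lookup m v)"

lemma mval_superset:
  assumes "finite A" "keys m \<subseteq> A"
  shows "mval x m = (\<Prod>v\<in>A. x v ^ lookup m v)"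
  unfolding mval_def by (rule prod.mono_neutral_left) (use assms in \<open>auto simp: in_keys_iff\<close>)

lemma mval_0 [simp]: "mval x 0 = 1"
  by (simp add: mval_def)

lemma mval_add: "mval x (m + m') = mval x m * mval x m'"
proof -
  have "mval x m'' = (\<Prod>v\<in>keys m \<union> keys m'. x v ^ lookup m'' v)" if "m'' \<in> {m, m', m + m'}" for m''
    using that keys_add[of m m'] by (intro mval_superset) auto
  then show ?thesis by (simp add: lookup_add power_add prod.distrib)
qed

lemma mval_single [simp]: "mval x (single v k) = x v ^ k"
  by (cases "k = 0") (auto simp: mval_def)

lemma mval_mult: "mval (\<lambda>v. x v * y v) m = mval x m * mval y m"
  by (simp add: mval_def power_mult_distrib prod.distrib)

lemma mval_const: "mval (\<lambda>v. c) m = c ^ mdegree m"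
  by (simp add: mval_def mdegree_def power_sum)

lemma mval_cong: "(\<And>v. v \<in> keys m ==> x v = y v) ==> mval x m = mval y m"
  by (simp add: mval_def)

lemma msubst_mval: "msubst h x P = (\<Sum>m\<in>keys P. h (lookup P m) * mval x m)"
  by (simp add: msubst_def mval_def)

lemma msubst_superset:
  assumes "finite A" "keys P \<subseteq> A" "h 0 = 0"
  shows "msubst h x P = (\<Sum>m\<in>A. h (lookup P m) * mval x m)"
  unfolding msubst_mval by (rule sum.mono_neutral_left) (use assms in \<open>auto simp: in_keys_iff\<close>)

lemma msubst_0 [simp]: "msubst h x 0 = 0"
  by (simp add: msubst_mval)

lemma msubst_single: "h 0 = 0 ==> msubst h x (single m c) = h c * mval x m"
  by (subst msubst_superset[of "{m}"]) auto

lemma msubst_add: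
  assumes "h 0 = 0" "\<And>a b. h (a + b) = h a + h b"
  shows "msubst h x (P + Q) = msubst h x P + msubst h x Q"
proof -
  have "msubst h x R = (\<Sum>m\<in>keys P \<union> keys Q. h (lookup R m) * mval x m)" if "R \<in> {P, Q, P + Q}" for R
    using that keys_add[of P Q] assms(1) by (intro msubst_superset) auto
  then show ?thesis using assms(2) by (simp add: lookup_add distrib_right sum.distrib)
qed

lemma mpoly_as_sum: "P = (\<Sum>m\<in>keys P. single m (lookup P m))"
  by (rule poly_mapping_eqI)
     (auto simp: lookup_sum lookup_single when_def in_keys_iff sum.delta)

lemma msubst_sum:
  assumes "h 0 = 0" "\<And>a b. h (a + b) = h a + h b"
  shows "msubst h x (sum f A) = (\<Sum>i\<in>A. msubst h x (f i))"
  by (induction A rule: infinite_finite_induct) (simp_all add: msubst_add assms)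

lemma msubst_mult:
  assumes "h 0 = 0" "\<And>a b. h (a + b) = h a + h b" "\<And>a b. h (a * b) = h a * h b"
  shows "msubst h x (P * Q) = msubst h x P * msubst h x Q"
proof -
  have "P * Q = (\<Sum>m\<in>keys P. \<Sum>m'\<in>keys Q. single (m + m') (lookup P m * lookup Q m'))"
    by (subst mpoly_as_sum[of P], subst mpoly_as_sum[of Q])
       (simp add: sum_product mult_single)
  then have "msubst h x (P * Q)
      = (\<Sum>m\<in>keys P. \<Sum>m'\<in>keys Q. h (lookup P m * lookup Q m') * mval x (m + m'))"
    by (simp add: msubst_sum assms(1,2) msubst_single)
  also have "\<dots> = msubst h x P * msubst h x Q"
    by (simp add: msubst_mval sum_product assms(3) mval_add mult_ac)
  finally show ?thesis .
qed

lemma comm_ring_hom_msubst: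
  assumes "comm_ring_hom h"
  shows "comm_ring_hom (msubst h x)"
proof -
  interpret comm_ring_hom h by fact
  show ?thesis
    by unfold_locales
       (simp_all add: msubst_add msubst_mult hom_add hom_mult, simp add: msubst_mval)
qed

lemma comm_ring_hom_of_int: "comm_ring_hom (of_int :: int => 'a::comm_ring_1)"
  by unfold_locales auto

lemma comm_ring_hom_id: "comm_ring_hom (\<lambda>c::'a::comm_ring_1. c)"
  by unfold_locales auto

lemma comm_ring_hom_comp:
  assumes "comm_ring_hom g" "comm_ring_hom h" shows "comm_ring_hom (\<lambda>x. g (h x))"
proof -
  interpret g: comm_ring_hom g by fact
  interpret h: comm_ring_hom h by fact
  show ?thesis by unfold_locales (auto simp: h.hom_add g.hom_add h.hom_mult g.hom_mult)
qed

lemma comm_ring_hom_const_poly: "comm_ring_hom (\<lambda>c::'a::comm_ring_1. [:c:])"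
  by unfold_locales (auto simp: one_pCons)

lemma comm_ring_hom_mconst: "comm_ring_hom (mconst :: 'a::comm_ring_1 => ('v, 'a) mpoly)"
  by unfold_locales (auto simp: mconst_def single_add mult_single)

lemma comm_ring_hom_poly: "comm_ring_hom (\<lambda>p. poly p (t::'a::comm_ring_1))"
  by unfold_locales auto

lemma comm_ring_hom_map_poly:
  assumes "comm_ring_hom h" shows "comm_ring_hom (map_poly h)"
proof -
  interpret map_poly_comm_ring_hom h using assms by (simp add: map_poly_comm_ring_hom_def)
  show ?thesis by unfold_locales
qed

lemma mval_hom:
  assumes "comm_ring_hom g" shows "g (mval x m) = mval (\<lambda>v. g (x v)) m"
proof -
  interpret comm_ring_hom g by fact
  show ?thesis by (simp add: mval_def hom_prod hom_power)
qed

lemma msubst_hom: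
  assumes "comm_ring_hom g"
  shows "g (msubst h x P) = msubst (\<lambda>c. g (h c)) (\<lambda>v. g (x v)) P"
proof -
  interpret comm_ring_hom g by fact
  show ?thesis by (simp add: msubst_mval hom_sum hom_mult mval_hom[OF assms])
qed

definition mvars :: "('v, 'c::zero) mpoly => 'v set" where
  "mvars P = (\<Union>m\<in>keys P. keys m)"

lemma finite_mvars [simp]: "finite (mvars P)"
  by (simp add: mvars_def)

lemma msubst_cong: "(\<And>v. v \<in> mvars P ==> x v = y v) ==> msubst h x P = msubst h y P"
  unfolding msubst_mval by (intro sum.cong arg_cong2[where f = "(*)"] mval_cong) (auto simp: mvars_def)

lemma msubst_mconst: "h 0 = 0 ==> msubst h x (mconst c) = h c"
  by (simp add: mconst_def msubst_single)

lemma msubst_mvar: "h 0 = 0 ==> h 1 = 1 ==> msubst h x (mvar v) = x v"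
  by (simp add: mvar_def msubst_single)

lemma mval_mvar: "mval mvar m = (single m 1 :: ('v, 'c::comm_semiring_1) mpoly)"
proof (induction m rule: update_induct)
  case const
  then show ?case by simp
next
  case (update f a b)
  have "Poly_Mapping.update a b f = single a b + f"
    using update by (intro poly_mapping_eqI)
      (auto simp: lookup_update lookup_add lookup_single when_def in_keys_iff)
  moreover have "mvar a ^ k = (single (single a k) 1 :: ('v, 'c) mpoly)" for k
    by (induction k) (simp_all add: mvar_def mult_single flip: single_add)
  ultimately show ?case by (simp add: mval_add update mult_single)
qed

lemma msubst_mvar_id: "msubst mconst mvar P = (P :: ('v, 'c::comm_ring_1) mpoly)"
  by (subst (2) mpoly_as_sum) (simp add: msubst_mval mval_mvar mconst_def mult_single)

abbreviation ieval :: "('v => 'b) => ('v, int) mpoly => 'b::comm_ring_1" where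
  "ieval \<equiv> msubst of_int"

lemmas comm_ring_hom_ieval = comm_ring_hom_msubst[OF comm_ring_hom_of_int]
lemmas comm_ring_hom_meval = comm_ring_hom_msubst[OF comm_ring_hom_id]

lemma of_int_hom:
  assumes "comm_ring_hom g" shows "g (of_int k) = of_int k"
proof -
  interpret comm_ring_hom g by fact
  have "g (of_nat j) = of_nat j" for j by (induction j) (auto simp: hom_add)
  then show ?thesis by (cases k) (auto simp: hom_uminus hom_minus hom_add)
qed

text \<open>Resultants and determinants are polynomials over the integers, evaluated alike in the
  complex numbers, in \<open>\<complex>[t]\<close> and in polynomial rings. A path of systems is a
  point over \<open>\<complex>[t]\<close>; this lemma specialises it at a value of
  \<open>t\<close>.\<close>

lemma ieval_hom: "comm_ring_hom g ==> g (ieval x P) = ieval (\<lambda>v. g (x v)) P"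
  by (subst msubst_hom) (simp_all add: of_int_hom)

section \<open>Generic points\<close>

lemma countable_poly_mapping:
  assumes "countable (UNIV :: 'a set)" "countable (UNIV :: 'b::zero set)"
  shows "countable (UNIV :: ('a \<Rightarrow>\<^sub>0 'b) set)"
proof -
  define g where "g = (\<lambda>P :: 'a \<Rightarrow>\<^sub>0 'b. (\<lambda>k. (k, lookup P k)) ` keys P)"
  have "inj g"
  proof (rule injI, rule poly_mapping_eqI)
    fix P Q k assume e: "g P = g Q"
    have *: "lookup P k = c \<longleftrightarrow> (k, c) \<in> g P" if "c \<noteq> 0" for c and P :: "'a \<Rightarrow>\<^sub>0 'b"
      using that by (auto simp: g_def in_keys_iff)
    show "lookup P k = lookup Q k"
    proof (cases "lookup P k = 0")
      case True
      then have "\<not> lookup Q k \<noteq> 0" using *[of "lookup Q k" Q] *[of "lookup Q k" P] e by auto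
      then show ?thesis using True by simp
    next
      case False
      then show ?thesis using *[of "lookup P k" Q] *[of "lookup P k" P] e by auto
    qed
  qed
  moreover have "countable (g ` UNIV)"
  proof (rule countable_subset)
    show "g ` UNIV \<subseteq> {A. finite A \<and> A \<subseteq> UNIV}" by (auto simp: g_def)
    have "countable (UNIV :: ('a \<times> 'b) set)"
      using assms by (simp add: UNIV_Times_UNIV[symmetric] del: UNIV_Times_UNIV)
    then show "countable {A :: ('a \<times> 'b) set. finite A \<and> A \<subseteq> UNIV}"
      by (rule countable_Collect_finite_subset)
  qed
  ultimately show ?thesis by (rule countable_image_inj_on[rotated])
qed

lemma countable_int_mpoly:
  assumes "countable (UNIV :: 'v set)" shows "countable (UNIV :: ('v, int) mpoly set)"
  by (intro countable_poly_mapping assms) auto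

text \<open>Coordinates are chosen one after the other, each outside the countable set of roots of the
  polynomials over the ring generated by the preceding ones.\<close>

lemma ex_generic_point:
  assumes ct: "countable (UNIV :: 'v set)"
  shows "\<exists>x :: 'v => complex. \<forall>P :: ('v, int) mpoly. P \<noteq> 0 --> ieval x P \<noteq> 0"
proof -
  define i where "i = to_nat_on (UNIV :: 'v set)"
  have inj: "inj i" unfolding i_def by (rule inj_on_to_nat_on[OF ct])
  \<comment> \<open>\<open>p f k Q\<close> inserts the coordinates chosen so far and keeps variable
    number \<open>k\<close> as the indeterminate. For \<open>Q\<close> in \<open>S k\<close> it
    depends on \<open>f\<close> below \<open>k\<close> only, which the recursive choice
    requires.\<close>
  define p where "p = (\<lambda>(f :: nat => complex) k (Q :: ('v, int) mpoly).
    ieval (\<lambda>v. if i v = k then [:0, 1:] else [:f (i v):]) Q)"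
  define S where "S = (\<lambda>k. {Q :: ('v, int) mpoly. \<forall>v\<in>mvars Q. i v \<le> k})"
  have "\<exists>f. \<forall>k. \<forall>Q\<in>S k. p f k Q \<noteq> 0 --> poly (p f k Q) (f k) \<noteq> 0"
  proof (rule dependent_wellorder_choice)
    fix r :: complex and f g :: "nat => complex" and k :: nat
    assume fg: "\<And>y. y < k ==> f y = g y"
    have "p f k Q = p g k Q" if "Q \<in> S k" for Q
      unfolding p_def using that fg by (intro msubst_cong) (auto simp: S_def)
    then show "(\<forall>Q\<in>S k. p f k Q \<noteq> 0 --> poly (p f k Q) r \<noteq> 0) =
      (\<forall>Q\<in>S k. p g k Q \<noteq> 0 --> poly (p g k Q) r \<noteq> 0)" by auto
  next
    fix k and f :: "nat => complex"
    let ?B = "\<Union>Q\<in>{Q\<in>S k. p f k Q \<noteq> 0}. {z. poly (p f k Q) z = 0}"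
    have "countable ?B"
      by (intro countable_UN countable_subset[OF subset_UNIV countable_int_mpoly[OF ct]])
         (auto intro: countable_finite poly_roots_finite)
    then have "?B \<noteq> UNIV" using uncountable_UNIV_complex by metis
    then have "\<exists>r. r \<notin> ?B" by blast
    then show "\<exists>r. \<forall>Q\<in>S k. p f k Q \<noteq> 0 --> poly (p f k Q) r \<noteq> 0" by blast
  qed
  then obtain f where f: "\<And>k Q. Q \<in> S k ==> p f k Q \<noteq> 0 ==> poly (p f k Q) (f k) \<noteq> 0" by blast
  define x where "x = (\<lambda>v. f (i v))"
  have ev: "poly (p f k Q) (f k) = ieval x Q" for k Q
    unfolding p_def by (subst ieval_hom[OF comm_ring_hom_poly]) (auto simp: x_def intro!: msubst_cong)
  have main: "ieval x Q \<noteq> 0" if "Q \<noteq> 0" "\<forall>v\<in>mvars Q. i v < k" for Q :: "('v, int) mpoly" and k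
    using that
  proof (induction k arbitrary: Q)
    case 0
    then have "\<And>m. m \<in> keys Q ==> m = 0" by (auto simp: mvars_def in_keys_iff intro!: poly_mapping_eqI)
    moreover have "keys Q \<noteq> {}" using 0(1) by simp
    ultimately have "keys Q = {0}" by blast
    then show ?case by (auto simp: msubst_mval in_keys_iff[symmetric])
  next
    case (Suc k)
    show ?case
    proof (cases "\<exists>v. i v = k")
      case False
      then have "\<forall>v\<in>mvars Q. i v < k" using Suc.prems(2) by (auto simp: less_Suc_eq)
      with Suc show ?thesis by blast
    next
      case True
      then obtain v where v: "i v = k" by blast
      have iv: "i u = k \<longleftrightarrow> u = v" for u using v inj by (auto dest: injD)
      obtain m0 where m0: "m0 \<in> keys Q" using Suc.prems(1) by fastforce
      define j where "j = lookup m0 v"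
      define M where "M = {m\<in>keys Q. lookup m v = j}"
      \<comment> \<open>\<open>R\<close> is the coefficient of \<open>v ^ j\<close> in
        \<open>Q\<close>. Since \<open>j\<close> is the exponent of \<open>v\<close> in a monomial
        of \<open>Q\<close>, it is nonzero, and it involves earlier variables only. By induction
        \<open>p f k Q\<close> thus has a nonzero coefficient.\<close>
      define R where "R = (\<Sum>m\<in>M. single (m - single v j) (lookup Q m))"
      have m_eq: "m = (m - single v j) + single v j" if "m \<in> M" for m
        using that by (intro poly_mapping_eqI) (auto simp: M_def lookup_add lookup_minus lookup_single when_def)
      have fin: "finite M" by (simp add: M_def)
      have injM: "inj_on (\<lambda>m. m - single v j) M"
        by (rule inj_on_inverseI[where g = "\<lambda>m. m + single v j"]) (rule m_eq[symmetric])
      have lookR: "lookup R (m - single v j) = lookup Q m" if "m \<in> M" for m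
      proof -
        have "lookup R (m - single v j) = (\<Sum>m'\<in>M. if m' = m then lookup Q m' else 0)"
          unfolding R_def lookup_sum lookup_single when_def
          using injM that by (intro sum.cong) (auto dest: inj_onD)
        then show ?thesis using that fin by simp
      qed
      have "m0 \<in> M" using m0 by (simp add: M_def j_def)
      then have "R \<noteq> 0" using lookR[of m0] m0 by (auto simp: in_keys_iff)
      moreover have "\<forall>u\<in>mvars R. i u < k"
      proof
        fix u assume "u \<in> mvars R"
        then obtain m where "m \<in> keys R" "u \<in> keys m" by (auto simp: mvars_def)
        moreover have "keys R \<subseteq> (\<lambda>m. m - single v j) ` M"
          unfolding R_def by (rule order_trans[OF keys_sum]) auto
        ultimately obtain m' where m': "m' \<in> M" "u \<in> keys (m' - single v j)" by auto
        then have "u \<noteq> v" "u \<in> keys m'"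
          by (auto simp: in_keys_iff lookup_minus lookup_single when_def M_def split: if_splits)
        then show "i u < k" using m' Suc.prems(2) iv unfolding M_def mvars_def
          by (fastforce simp: less_Suc_eq)
      qed
      ultimately have R: "ieval x R \<noteq> 0" by (rule Suc.IH)
      have "coeff (p f k Q) j = ieval x R"
      proof -
        define y where "y = (\<lambda>u. if i u = k then [:0, 1:] else [:f (i u):])"
        define c where "c = (\<lambda>m. \<Prod>u\<in>keys m - {v}. x u ^ lookup m u)"
        have val: "mval y m = monom (c m) (lookup m v)" for m
        proof -
          have "mval y m = (\<Prod>u\<in>insert v (keys m). y u ^ lookup m u)" by (rule mval_superset) auto
          also have "\<dots> = y v ^ lookup m v * (\<Prod>u\<in>keys m - {v}. y u ^ lookup m u)"
            by (rule prod.insert_remove) simp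
          also have "(\<Prod>u\<in>keys m - {v}. y u ^ lookup m u) = (\<Prod>u\<in>keys m - {v}. [:x u ^ lookup m u:])"
            by (intro prod.cong) (auto simp: y_def iv x_def poly_const_pow)
          also have "\<dots> = [:c m:]" unfolding c_def
            by (induction rule: infinite_finite_induct) (simp_all add: one_pCons)
          also have "y v ^ lookup m v = monom 1 (lookup m v)" unfolding y_def using v by (simp only: x_as_monom x_pow_n if_True simp_thms)
          finally show ?thesis by (simp add: monom_altdef)
        qed
        have valR: "mval x (m - single v j) = c m" if "m \<in> M" for m
        proof -
          have "mval x (m - single v j) = (\<Prod>u\<in>keys m - {v}. x u ^ lookup (m - single v j) u)"
            by (rule mval_superset)
              (use that in \<open>auto simp: M_def in_keys_iff lookup_minus lookup_single when_def split: if_splits\<close>)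
          also have "\<dots> = c m" unfolding c_def
            by (intro prod.cong) (auto simp: lookup_minus lookup_single when_def)
          finally show ?thesis .
        qed
        have "coeff (p f k Q) j = (\<Sum>m\<in>keys Q. of_int (lookup Q m) * (if lookup m v = j then c m else 0))"
          unfolding p_def y_def[symmetric] msubst_mval val coeff_sum
          by (intro sum.cong) (simp_all add: of_int_poly)
        also have "\<dots> = (\<Sum>m\<in>M. of_int (lookup Q m) * c m)"
          unfolding M_def by (simp add: sum.inter_filter if_distrib[of "(*) _"] cong: if_cong)
        also have "\<dots> = ieval x R"
          unfolding R_def by (simp add: msubst_sum msubst_single valR)
        finally show ?thesis .
      qed
      with R have "p f k Q \<noteq> 0" by auto
      moreover have "Q \<in> S k" using Suc.prems(2) by (auto simp: S_def)
      ultimately show ?thesis using f ev by metis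
    qed
  qed
  have "ieval x P \<noteq> 0" if "P \<noteq> 0" for P :: "('v, int) mpoly"
  proof (rule main[OF that])
    show "\<forall>v\<in>mvars P. i v < Suc (Max (i ` mvars P))" by (auto simp: less_Suc_eq_le)
  qed
  then show ?thesis by blast
qed

section \<open>Normality of integer polynomial rings\<close>

text \<open>Gauss's lemma. The monic \<open>D\<close> is primitive, so
  \<open>content f * content q\<close> is \<open>l ^ j\<close> up to a unit, and the primitive parts
  multiply to a unit times \<open>D\<close>. Hence the primitive part of \<open>f\<close> has a unit
  as leading coefficient, and \<open>l\<close> divides the content of \<open>f\<close>: dividing by
  \<open>l\<close> makes \<open>f\<close> monic without denominators.\<close>

lemma lead_coeff_dvd_of_monic_dvd:
  fixes D f q :: "'a::{factorial_ring_gcd,semiring_gcd_mult_normalize} poly"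
  assumes eq: "smult (l ^ j) D = f * q" and D: "lead_coeff D = 1" and f: "lead_coeff f = l" and l: "l \<noteq> 0"
  shows "[:l:] dvd f"
proof -
  have nz: "f \<noteq> 0" "D \<noteq> 0" using l f D by auto
  then have "smult (l ^ j) D \<noteq> 0" using l by simp
  then have q: "q \<noteq> 0" unfolding eq by auto
  have "content D dvd 1" using content_dvd_coeff[of D "degree D"] D by simp
  then have cD: "content D = 1" by (metis is_unit_normalize normalize_content)
  have "normalize (l ^ j) = content f * content q"
    using arg_cong[OF eq, of content] cD by (simp add: content_mult)
  then have "normalize (l ^ j) = content f * content q" .
  then obtain u where u: "is_unit u" "l ^ j = (content f * content q) * u"
    by (metis unit_factor_mult_normalize mult.commute unit_factor_is_unit l power_not_zero)
  have "smult (content f * content q) (smult u D) = smult (content f * content q) (primitive_part f * primitive_part q)"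
  proof -
    have "smult (content f * content q) (smult u D) = f * q" using eq u(2) by simp
    also have "\<dots> = smult (content f) (primitive_part f) * smult (content q) (primitive_part q)" by simp
    also have "\<dots> = smult (content f * content q) (primitive_part f * primitive_part q)"
      by (simp only: mult_smult_left mult_smult_right smult_smult mult.commute)
    finally show ?thesis .
  qed
  moreover have cc: "content f * content q \<noteq> 0" using nz q by simp
  ultimately have "smult u D = primitive_part f * primitive_part q"
    by (metis smult_cancel)
  then have "u = lead_coeff (primitive_part f) * lead_coeff (primitive_part q)"
    using D by (metis lead_coeff_mult lead_coeff_smult mult.right_neutral)
  then have unit: "is_unit (lead_coeff (primitive_part f))" using u(1) by (metis is_unit_mult_iff)
  have "l = content f * lead_coeff (primitive_part f)"
    using f by (metis content_times_primitive_part lead_coeff_smult)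
  then have "l dvd content f" using unit by (metis dvd_refl mult_unit_dvd_iff)
  then show ?thesis by (simp add: const_poly_dvd_iff_dvd_content)
qed

definition mweight :: "('v => nat) => ('v \<Rightarrow>\<^sub>0 nat) => nat" where
  "mweight w m = (\<Sum>v\<in>keys m. w v * lookup m v)"

text \<open>Weights as in Kronecker's substitution: powers of an integer that avoids the roots of the
  finitely many univariate polynomials attached to the differences of exponents.\<close>

lemma ex_separating_weights:
  assumes fin: "finite M"
  shows "\<exists>w :: 'v => nat. (\<forall>v. w v \<ge> 1) \<and> inj_on (mweight w) M"
proof -
  define V where "V = (\<Union>m\<in>M. keys m)"
  have finV: "finite V" using fin by (auto simp: V_def)
  obtain i :: "'v => nat" where i: "inj_on i V" using finV finite_imp_inj_to_nat_seg by metis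
  define p :: "('v \<Rightarrow>\<^sub>0 nat) => int poly" where "p = (\<lambda>m. \<Sum>v\<in>V. monom (int (lookup m v)) (i v))"
  have coeff_p: "coeff (p m) (i v) = int (lookup m v)" if "v \<in> V" for m v
  proof -
    have "coeff (p m) (i v) = (\<Sum>u\<in>V. if u = v then int (lookup m v) else 0)"
      unfolding p_def coeff_sum coeff_monom using i that by (intro sum.cong) (auto dest: inj_onD)
    then show ?thesis using that finV by simp
  qed
  have p_inj: "m = m'" if "p m = p m'" "m \<in> M" "m' \<in> M" for m m'
  proof (rule poly_mapping_eqI)
    fix v show "lookup m v = lookup m' v"
    proof (cases "v \<in> V")
      case True then show ?thesis using coeff_p that(1) by (metis of_nat_eq_iff)
    next
      case False
      then have "v \<notin> keys m" "v \<notin> keys m'" using that by (auto simp: V_def)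
      then show ?thesis by (simp add: in_keys_iff)
    qed
  qed
  define B where "B = (\<Union>(m, m')\<in>M \<times> M. if p m = p m' then {} else {z. poly (p m - p m') z = 0})"
  have "finite B" unfolding B_def
    by (intro finite_UN_I finite_cartesian_product fin)
      (auto simp del: poly_diff intro!: poly_roots_finite)
  have "\<exists>x::nat. x \<ge> 1 \<and> int x \<notin> B"
  proof (rule ccontr)
    assume "\<not> ?thesis"
    then have "int ` {1..} \<subseteq> B" by auto
    then have "finite (int ` {1..})" using \<open>finite B\<close> finite_subset by blast
    then show False by (simp add: finite_image_iff inj_on_def infinite_Ici)
  qed
  then obtain x :: nat where x: "x \<ge> 1" "int x \<notin> B" by blast
  define w where "w = (\<lambda>v. x ^ i v)"
  have ev: "int (mweight w m) = poly (p m) (int x)" if "m \<in> M" for m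
  proof -
    have "(\<Sum>v\<in>keys m. w v * lookup m v) = (\<Sum>v\<in>V. w v * lookup m v)"
      by (rule sum.mono_neutral_left) (use that finV in \<open>auto simp: V_def in_keys_iff\<close>)
    then show ?thesis by (simp add: mweight_def p_def poly_sum poly_monom w_def mult.commute)
  qed
  have "inj_on (mweight w) M"
  proof (rule inj_onI)
    fix m m' assume a: "m \<in> M" "m' \<in> M" "mweight w m = mweight w m'"
    then have "poly (p m - p m') (int x) = 0" using ev by (metis diff_self poly_diff)
    then have "p m = p m'" using x(2) a unfolding B_def by (fastforce split: if_splits)
    then show "m = m'" using p_inj a by blast
  qed
  moreover have "\<forall>v. w v \<ge> 1" using x(1) by (simp add: w_def)
  ultimately show ?thesis by blast
qed

definition kron :: "('v => nat) => ('v, int) mpoly => int poly" where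
  "kron w = ieval (\<lambda>v. monom 1 (w v))"

lemma comm_ring_hom_kron: "comm_ring_hom (kron w)"
  unfolding kron_def by (rule comm_ring_hom_ieval)

lemma kron_mval: "mval (\<lambda>v. monom 1 (w v)) m = (monom 1 (mweight w m) :: 'a::comm_ring_1 poly)"
proof -
  have "(\<Prod>v\<in>A. monom 1 (w v) ^ f v) = (monom 1 (\<Sum>v\<in>A. w v * f v) :: 'a poly)" for A and f
    by (induction A rule: infinite_finite_induct) (simp_all add: monom_power mult_monom)
  then show ?thesis by (simp add: mval_def mweight_def)
qed

lemma coeff_kron:
  assumes "inj_on (mweight w) (keys P)" "m \<in> keys P"
  shows "coeff (kron w P) (mweight w m) = lookup P m"
proof -
  have "coeff (kron w P) (mweight w m) = (\<Sum>m'\<in>keys P. if m' = m then lookup P m else 0)"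
    unfolding kron_def msubst_mval kron_mval coeff_sum of_int_poly
    using assms by (intro sum.cong) (auto dest: inj_onD)
  then show ?thesis using assms(2) by simp
qed

text \<open>The translate of \<open>P\<close> along the curve \<open>t \<mapsto> (t ^ w v)\<^sub>v\<close>; its leading coefficient is a constant.\<close>

definition shift_curve :: "('v => nat) => ('v, int) mpoly => ('v, int) mpoly poly" where
  "shift_curve w = ieval (\<lambda>v. [:mvar v:] + monom 1 (w v))"

lemma comm_ring_hom_shift_curve: "comm_ring_hom (shift_curve w)"
  unfolding shift_curve_def by (rule comm_ring_hom_ieval)

lemma ieval_mvar [simp]: "ieval mvar P = (P :: ('v, int) mpoly)"
proof -
  have "(of_int :: int => ('v, int) mpoly) = mconst" by (rule ext) (simp add: mconst_def flip: single_of_int)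
  then show ?thesis by (simp add: msubst_mvar_id)
qed

text \<open>Positive weights let the curve pass through the base point at \<open>t = 0\<close>, so
  that a division carried out along the curve gives one for \<open>P\<close> itself.\<close>

lemma poly_shift_curve_0:
  fixes P :: "('v, int) mpoly"
  assumes "\<And>v. w v \<ge> 1" shows "poly (shift_curve w P) 0 = P"
proof -
  have "poly (monom 1 (w v)) 0 = (0 :: ('v, int) mpoly)" for v using assms[of v] by (simp add: poly_monom power_0_left)
  then show ?thesis unfolding shift_curve_def
    by (subst ieval_hom[OF comm_ring_hom_poly]) (use \<open>\<And>v. poly (monom 1 (w v)) 0 = 0\<close> in simp)
qed

lemma degree_monic_mult:
  fixes p q :: "'a::comm_ring_1 poly"
  assumes "lead_coeff p = 1" "lead_coeff q = 1" "(1::'a) \<noteq> 0"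
  shows "degree (p * q) = degree p + degree q" "lead_coeff (p * q) = 1"
proof -
  have c: "coeff (p * q) (degree p + degree q) = 1" using assms by (simp add: coeff_mult_degree_sum)
  show "degree (p * q) = degree p + degree q"
    by (rule antisym[OF degree_mult_le le_degree]) (use c assms(3) in simp)
  then show "lead_coeff (p * q) = 1" using c by simp
qed

lemma mval_monic:
  fixes x :: "'v => 'a::{comm_ring_1} poly"
  assumes one: "(1::'a) \<noteq> 0" and x: "\<And>v. degree (x v) = w v" "\<And>v. lead_coeff (x v) = 1"
  shows "degree (mval x m) = mweight w m \<and> lead_coeff (mval x m) = 1"
proof -
  define P where "P = (\<lambda>(p :: 'a poly) k. degree p = k \<and> lead_coeff p = 1)"
  have mult: "P (p * q) (i + j)" if "P p i" "P q j" for p q i j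
    using degree_monic_mult[of p q] that one by (auto simp: P_def)
  have P1: "P 1 0" by (simp add: P_def)
  have pow: "P (x v ^ k) (w v * k)" for v k
  proof (induction k)
    case (Suc k)
    have "P (x v) (w v)" using x by (simp add: P_def)
    from mult[OF this Suc] show ?case by simp
  qed (simp add: P1)
  have "P (\<Prod>v\<in>A. x v ^ f v) (\<Sum>v\<in>A. w v * f v)" for A f
  proof (induction A rule: infinite_finite_induct)
    case (insert v A)
    then show ?case using mult[OF pow insert.IH] by simp
  qed (simp_all add: P1)
  then have "P (mval x m) (mweight w m)" unfolding mval_def mweight_def by blast
  then show ?thesis unfolding P_def .
qed

text \<open>Every variable becomes a monic polynomial of degree \<open>w v\<close>, so the monomial
  \<open>m\<close> becomes monic of degree \<open>mweight w m\<close>. The weights separate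
  monomials, so a single term has the largest degree, and its integer coefficient is the leading
  one.\<close>

lemma shift_curve_lead:
  assumes w: "\<And>v. w v \<ge> 1" and inj: "inj_on (mweight w) (keys P)" and P: "P \<noteq> (0 :: ('v::linorder, int) mpoly)"
  shows "\<exists>c. c \<noteq> 0 \<and> lead_coeff (shift_curve w P) = of_int c"
proof -
  define x :: "'v => ('v, int) mpoly poly" where "x = (\<lambda>v. [:mvar v:] + monom 1 (w v))"
  have dx: "degree (x v) = w v" "lead_coeff (x v) = 1" for v
  proof -
    have d: "degree ([:mvar v:] :: ('v, int) mpoly poly) < degree (monom (1 :: ('v, int) mpoly) (w v))"
      using w[of v] by (simp add: degree_monom_eq)
    show "degree (x v) = w v" unfolding x_def using degree_add_eq_right[OF d] by (simp add: degree_monom_eq)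
    show "lead_coeff (x v) = 1" unfolding x_def lead_coeff_add_le[OF d] by (rule lead_coeff_monom)
  qed
  have mx: "degree (mval x m) = mweight w m" "lead_coeff (mval x m) = 1" for m
    using mval_monic[of x w m, OF _ dx] by auto
  have ne: "keys P \<noteq> {}" using P by simp
  then obtain m where m: "m \<in> keys P" "\<And>m'. m' \<in> keys P ==> mweight w m' \<le> mweight w m"
  proof -
    have "Max (mweight w ` keys P) \<in> mweight w ` keys P" using ne by (intro Max_in) auto
    then obtain m where "m \<in> keys P" "mweight w m = Max (mweight w ` keys P)" by auto
    then show thesis using that by (metis Max_ge finite_imageI finite_keys imageI)
  qed
  have sc: "shift_curve w P = (\<Sum>m'\<in>keys P. of_int (lookup P m') * mval x m')"
    by (simp add: shift_curve_def msubst_mval x_def)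
  have "coeff (shift_curve w P) (mweight w m) = (\<Sum>m'\<in>keys P. if m' = m then of_int (lookup P m) else 0)"
    unfolding sc coeff_sum
  proof (intro sum.cong refl)
    fix m' assume m': "m' \<in> keys P"
    show "coeff (of_int (lookup P m') * mval x m') (mweight w m) = (if m' = m then of_int (lookup P m) else 0)"
    proof (cases "m' = m")
      case True then show ?thesis using mx[of m] by (simp add: of_int_poly)
    next
      case False
      then have "mweight w m' < mweight w m" 
        using m(1) m(2)[OF m'] m' inj by (auto dest: inj_onD simp: order_less_le)
      then show ?thesis using False mx[of m'] by (simp add: of_int_poly coeff_eq_0)
    qed
  qed
  then have c: "coeff (shift_curve w P) (mweight w m) = of_int (lookup P m)" using m(1) by simp
  have nz: "lookup P m \<noteq> 0" using m(1) by (simp add: in_keys_iff)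
  have "degree (shift_curve w P) = mweight w m"
  proof (rule antisym)
    show "degree (shift_curve w P) \<le> mweight w m" unfolding sc
    proof (rule degree_sum_le)
      fix m' assume "m' \<in> keys P"
      then show "degree (of_int (lookup P m') * mval x m') \<le> mweight w m"
        using m(2)[of m'] mx[of m'] degree_smult_le[of "of_int (lookup P m')" "mval x m'"] by (simp add: of_int_poly)
    qed simp
    show "mweight w m \<le> degree (shift_curve w P)" by (rule le_degree) (use c nz in simp)
  qed
  with c nz show ?thesis by auto
qed

lemma lead_coeff_map_poly_hom:
  assumes "comm_ring_hom h" "h (lead_coeff p) \<noteq> 0"
  shows "degree (map_poly h p) = degree p" "lead_coeff (map_poly h p) = h (lead_coeff p)"
proof -
  interpret comm_ring_hom h by fact
  have c: "coeff (map_poly h p) (degree p) = h (lead_coeff p)" by simp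
  show "degree (map_poly h p) = degree p"
    by (rule antisym[OF degree_map_poly_le le_degree]) (use c assms(2) in simp)
  then show "lead_coeff (map_poly h p) = h (lead_coeff p)" by simp
qed

lemma of_int_dvd_mpoly:
  assumes "\<And>m. c dvd lookup P m"
  shows "(of_int c :: ('v, int) mpoly) dvd P"
proof
  have "P = (\<Sum>m\<in>keys P. of_int c * single m (lookup P m div c))"
    using assms by (subst mpoly_as_sum) (simp add: mult_single flip: single_of_int)
  then show "P = of_int c * (\<Sum>m\<in>keys P. single m (lookup P m div c))"
    by (simp add: sum_distrib_left)
qed

text \<open>This is normality of the ring of integer polynomials: the minimal polynomial, over the fraction
  field of \<open>\<int>[a]\<close> with \<open>a\<close> algebraically independent, of an element integral over \<open>\<int>[a]\<close>
  has coefficients in \<open>\<int>[a]\<close>. Gauss's lemma is applied in \<open>\<complex>[t][s]\<close>, on a curve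
  through \<open>a\<close>, to divide by the non-constant part of a leading coefficient, and in
  \<open>\<int>[t][s]\<close>, after Kronecker's substitution, to divide by its constant part.\<close>

lemma integral_minimal_polynomial:
  fixes a :: "'v::linorder => complex" and s :: complex and D :: "('v, int) mpoly poly"
  assumes gen: "\<And>e :: ('v, int) mpoly. e \<noteq> 0 ==> ieval a e \<noteq> 0"
    and D: "lead_coeff D = 1" "poly (map_poly (ieval a) D) s = 0"
  obtains \<chi> where "lead_coeff \<chi> = 1" "poly (map_poly (ieval a) \<chi>) s = 0"
    "\<And>Q. poly (map_poly (ieval a) Q) s = 0 ==> \<chi> dvd Q"
proof -
  define E where "E = (\<lambda>Q. poly (map_poly (ieval a) Q) s)"
  have homE: "comm_ring_hom E"
    unfolding E_def by (intro comm_ring_hom_comp[OF comm_ring_hom_poly] comm_ring_hom_map_poly comm_ring_hom_ieval)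
  interpret a: comm_ring_hom "ieval a :: ('v, int) mpoly => complex" by (rule comm_ring_hom_ieval)
  interpret E: comm_ring_hom E by (rule homE)
  have E_smult: "E (smult c Q) = ieval a c * E Q" for c Q
    by (simp add: E_def a.map_poly_hom_smult)
  have D0: "D \<noteq> 0" "E D = 0" using D by (auto simp: E_def)
  then obtain f where f: "f \<noteq> 0" "E f = 0" and min: "\<And>g. g \<noteq> 0 ==> E g = 0 ==> degree f \<le> degree g"
    using ex_has_least_nat[of "\<lambda>f. f \<noteq> 0 \<and> E f = 0" D degree] by blast
  \<comment> \<open>A relation of least degree divides every other one up to a power of its leading
    coefficient: the pseudo-remainder is again a relation, of smaller degree. This is used for
    \<open>f\<close>, for \<open>G\<close> and for \<open>\<chi>\<close>.\<close>
  have divides: "\<exists>q j. smult (lead_coeff g ^ j) Q = g * q" if g: "g \<noteq> 0" "E g = 0" "degree g = degree f" and Q: "E Q = 0" for g Q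
  proof -
    obtain q r where qr: "pseudo_divmod Q g = (q, r)" by force
    note pd = pseudo_divmod[OF g(1) qr]
    have "E (g * q + r) = 0" using arg_cong[OF pd(1), of E] Q by (simp add: E_smult)
    then have "E r = 0" using g(2) by (simp add: E.hom_add E.hom_mult)
    then have "r = 0" using pd(2) min[of r] g(3) by (metis leD)
    then show ?thesis using pd(1) by auto
  qed
  define l where "l = lead_coeff f"
  have l0: "l \<noteq> 0" using f by (simp add: l_def)
  obtain q j where fq: "smult (l ^ j) D = f * q" using divides[OF f refl D0(2)] by (auto simp: l_def)
  obtain w where w: "\<And>v. w v \<ge> 1" "inj_on (mweight w) (keys l)"
    using ex_separating_weights[of "keys l"] by auto
  define \<phi> where "\<phi> = (\<lambda>P. map_poly (ieval a) (shift_curve w P))"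
  have hom\<phi>: "comm_ring_hom \<phi>"
    unfolding \<phi>_def by (intro comm_ring_hom_comp[OF comm_ring_hom_map_poly[OF comm_ring_hom_ieval]] comm_ring_hom_shift_curve)
  interpret \<phi>: comm_ring_hom \<phi> by (rule hom\<phi>)
  interpret \<Phi>: comm_ring_hom "map_poly \<phi>" by (rule comm_ring_hom_map_poly[OF hom\<phi>])
  obtain c where c: "c \<noteq> 0" "lead_coeff (shift_curve w l) = of_int c"
    using shift_curve_lead[OF w l0] by blast
  have ac: "ieval a (of_int k :: ('v, int) mpoly) = of_int k" for k
    by (rule of_int_hom[OF comm_ring_hom_ieval])
  have deg\<phi>: "degree (\<phi> l) = degree (shift_curve w l)" and "lead_coeff (\<phi> l) = of_int c"
    unfolding \<phi>_def using lead_coeff_map_poly_hom[OF comm_ring_hom_ieval, of a "shift_curve w l"] c ac by auto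
  then have \<phi>l: "\<phi> l \<noteq> 0" using c by auto
  have "[:\<phi> l:] dvd map_poly \<phi> f"
  proof (rule lead_coeff_dvd_of_monic_dvd)
    show "smult (\<phi> l ^ j) (map_poly \<phi> D) = map_poly \<phi> f * map_poly \<phi> q"
      using arg_cong[OF fq, of "map_poly \<phi>"]
      by (simp add: \<phi>.map_poly_hom_smult \<phi>.hom_power \<Phi>.hom_mult)
    show "lead_coeff (map_poly \<phi> D) = 1"
      using lead_coeff_map_poly_hom[OF hom\<phi>, of D] D(1) by simp
    show "lead_coeff (map_poly \<phi> f) = \<phi> l"
      using lead_coeff_map_poly_hom[OF hom\<phi>, of f] \<phi>l by (simp add: l_def)
  qed fact
  then have dv: "\<phi> l dvd \<phi> (coeff f i)" for i by (auto simp: const_poly_dvd_iff)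
  have "\<exists>N. l dvd of_int c ^ N * coeff f i" for i
  proof -
    let ?L = "shift_curve w l"
    have L0: "?L \<noteq> 0" using c by auto
    \<comment> \<open>Pseudo-division by the shifted \<open>l\<close> costs only powers of the
      integer \<open>c\<close>. After specialisation at \<open>a\<close> the remainder is divisible
      by \<open>\<phi> l\<close> but of smaller degree, so it vanishes; then its coefficients vanish
      as well because \<open>a\<close> is generic.\<close>
    obtain q r where qr: "pseudo_divmod (shift_curve w (coeff f i)) ?L = (q, r)" by force
    note pd = pseudo_divmod[OF L0 qr]
    obtain N where N: "smult (of_int c ^ N) (shift_curve w (coeff f i)) = ?L * q + r" using pd(1) c(2) by metis
    interpret A: comm_ring_hom "map_poly (ieval a) :: ('v, int) mpoly poly => complex poly"
      by (rule comm_ring_hom_map_poly[OF comm_ring_hom_ieval])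
    let ?r = "map_poly (ieval a) r"
    have "smult (of_int c ^ N) (\<phi> (coeff f i)) = \<phi> l * map_poly (ieval a) q + ?r"
      using arg_cong[OF N, of "map_poly (ieval a)"]
      by (simp add: \<phi>_def a.map_poly_hom_smult a.hom_power ac A.hom_add A.hom_mult)
    then have dr: "\<phi> l dvd ?r" using dv[of i] by (metis dvd_add_right_iff dvd_smult dvd_triv_left)
    have "?r = 0"
    proof (rule ccontr)
      assume r: "?r \<noteq> 0"
      then have "r \<noteq> 0" by auto
      then have "degree ?r < degree (\<phi> l)"
        using pd(2) degree_map_poly_le[of "ieval a" r] deg\<phi> by auto
      then show False using dr r by (meson dvd_imp_degree_le leD)
    qed
    then have "ieval a (coeff r k) = 0" for k by (metis a.coeff_map_poly_hom coeff_0)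
    then have "r = 0" using gen by (metis poly_eqI coeff_0)
    then have "of_int c ^ N * coeff f i = l * poly q 0"
      using arg_cong[OF N, of "\<lambda>p. poly p 0"] poly_shift_curve_0[of w, OF w(1)] by simp
    then show ?thesis by (metis dvd_triv_left)
  qed
  then obtain N where N: "\<And>i. l dvd of_int c ^ N i * coeff f i" by metis
  define C where "C = c ^ (\<Sum>i\<le>degree f. N i)"
  have C0: "C \<noteq> 0" using c by (simp add: C_def)
  have "[:l:] dvd smult (of_int C) f"
    unfolding const_poly_dvd_iff
  proof
    fix i show "l dvd coeff (smult (of_int C) f) i"
    proof (cases "i \<le> degree f")
      case True
      then have "N i \<le> (\<Sum>i\<le>degree f. N i)" by (intro member_le_sum) auto
      then have "of_int c ^ N i dvd (of_int C :: ('v, int) mpoly)" by (simp add: C_def le_imp_power_dvd)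
      then have "of_int c ^ N i * coeff f i dvd of_int C * coeff f i" by (rule mult_dvd_mono) simp
      then show ?thesis using N[of i] dvd_trans by (auto simp only: coeff_smult)
    qed (simp add: coeff_eq_0)
  qed
  then obtain G where "smult (of_int C) f = [:l:] * G" by (elim dvdE)
  then have G: "smult (of_int C) f = smult l G" by simp
  have lG: "lead_coeff G = of_int C"
  proof -
    have "of_int C * l = l * lead_coeff G" 
      using arg_cong[OF G, of lead_coeff] by (simp only: lead_coeff_smult l_def)
    then show ?thesis using l0 by (metis mult.commute mult_left_cancel)
  qed
  have dG: "degree G = degree f" using arg_cong[OF G, of degree] l0 C0 by simp
  have EG: "E G = 0" using arg_cong[OF G, of E] f gen[OF l0] by (simp add: E_smult)
  have G0: "G \<noteq> 0" using lG C0 by auto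
  obtain q' j' where Gq: "smult (of_int C ^ j') D = G * q'" using divides[OF G0 EG dG D0(2)] lG by auto
  define M where "M = (\<Union>i\<le>degree G. keys (coeff G i))"
  obtain w' where w': "inj_on (mweight w') M"
    using ex_separating_weights[of M] by (auto simp: M_def)
  interpret k: comm_ring_hom "kron w'" by (rule comm_ring_hom_kron)
  interpret K: comm_ring_hom "map_poly (kron w')" by (rule comm_ring_hom_map_poly[OF comm_ring_hom_kron])
  have kc: "kron w' (of_int z) = of_int z" for z by (rule of_int_hom[OF comm_ring_hom_kron])
  have "[:of_int C:] dvd map_poly (kron w') G"
  proof (rule lead_coeff_dvd_of_monic_dvd)
    show "smult (of_int C ^ j') (map_poly (kron w') D) = map_poly (kron w') G * map_poly (kron w') q'"
      using arg_cong[OF Gq, of "map_poly (kron w')"]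
      by (simp add: k.map_poly_hom_smult k.hom_power K.hom_mult kc)
    show "lead_coeff (map_poly (kron w') D) = 1"
      using lead_coeff_map_poly_hom[OF comm_ring_hom_kron, of w' D] D(1) by simp
    show "lead_coeff (map_poly (kron w') G) = of_int C"
      using lead_coeff_map_poly_hom[OF comm_ring_hom_kron, of w' G] lG C0 kc by simp
    show "of_int C \<noteq> (0 :: int poly)" using C0 by simp
  qed
  then have "of_int C dvd kron w' (coeff G i)" for i by (auto simp: const_poly_dvd_iff)
  then have dvC: "C dvd coeff (kron w' (coeff G i)) n" for i n by (auto simp: of_int_poly const_poly_dvd_iff)
  have "C dvd lookup (coeff G i) m" for i m
  proof (cases "m \<in> keys (coeff G i)")
    case True
    then have "coeff G i \<noteq> 0" by auto
    then have "i \<le> degree G" by (rule le_degree)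
    then have "inj_on (mweight w') (keys (coeff G i))" by (intro inj_on_subset[OF w']) (auto simp: M_def)
    from coeff_kron[OF this True] show ?thesis using dvC by metis
  qed (simp add: in_keys_iff)
  then have "[:of_int C:] dvd G" unfolding const_poly_dvd_iff by (intro allI of_int_dvd_mpoly)
  then obtain \<chi> where "G = [:of_int C:] * \<chi>" by (elim dvdE)
  then have \<chi>: "G = smult (of_int C) \<chi>" by simp
  show thesis
  proof (rule that)
    have "of_int C * lead_coeff \<chi> = of_int C" using lG unfolding \<chi> by (simp only: lead_coeff_smult)
    moreover have "(of_int C :: ('v, int) mpoly) \<noteq> 0" using C0 by simp
    ultimately show 1: "lead_coeff \<chi> = 1" by (metis mult.right_neutral mult_left_cancel)
    show 2: "poly (map_poly (ieval a) \<chi>) s = 0"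
      using EG C0 ac unfolding \<chi> E_smult by (simp add: E_def)
    fix Q assume Q: "poly (map_poly (ieval a) Q) s = 0"
    have "degree \<chi> = degree f" using dG C0 unfolding \<chi> by simp
    moreover have "\<chi> \<noteq> 0" using 1 by auto
    ultimately obtain q j where "smult (lead_coeff \<chi> ^ j) Q = \<chi> * q"
      using divides[of \<chi> Q] 2 Q by (auto simp: E_def)
    then have "Q = \<chi> * q" by (simp add: 1)
    then show "\<chi> dvd Q" by simp
  qed
qed

section \<open>Places\<close>

section \<open>Extension of homomorphisms to valuation rings\<close>

text \<open>A homomorphism from a subring of the complex numbers to \<open>k\<close> is given by its graph.\<close>

definition place_graph :: "complex set => (complex \<times> complex) set => bool" where
  "place_graph k G \<longleftrightarrow> (1, 1) \<in> G \<and> snd ` G \<subseteq> k \<and> (\<forall>y. (0, y) \<in> G --> y = 0) \<and>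
     (\<forall>x y x' y'. (x, y) \<in> G --> (x', y') \<in> G --> (x - x', y - y') \<in> G \<and> (x * x', y * y') \<in> G)"

definition poly_graph :: "(complex \<times> complex) set => complex poly => complex poly => bool" where
  "poly_graph G A B \<longleftrightarrow> (\<forall>i. (coeff A i, coeff B i) \<in> G)"

locale place_graph_loc =
  fixes k G assumes pg: "place_graph k G"
begin

lemma one: "(1, 1) \<in> G" and diff: "(x, y) \<in> G ==> (x', y') \<in> G ==> (x - x', y - y') \<in> G"
  and mult: "(x, y) \<in> G ==> (x', y') \<in> G ==> (x * x', y * y') \<in> G"
  and fun0: "(0, y) \<in> G ==> y = 0" and rng: "(x, y) \<in> G ==> y \<in> k"
  using pg unfolding place_graph_def by force+

lemma zero: "(0, 0) \<in> G" using diff[OF one one] by simp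

lemma uminus: "(x, y) \<in> G ==> (- x, - y) \<in> G" using diff[OF zero] by force

lemma add: "(x, y) \<in> G ==> (x', y') \<in> G ==> (x + x', y + y') \<in> G"
  using diff[OF _ uminus] by force

lemma functional: "(x, y) \<in> G ==> (x, y') \<in> G ==> y = y'"
  using diff[of x y x y'] fun0 by force

lemma sum: "(\<And>i. i \<in> I ==> (f i, g i) \<in> G) ==> (sum f I, sum g I) \<in> G"
  by (induction I rule: infinite_finite_induct) (auto simp: zero intro: add)

lemma power: "(x, y) \<in> G ==> (x ^ j, y ^ j) \<in> G"
  by (induction j) (auto simp: one intro: mult)

lemma poly_diff: "poly_graph G A B ==> poly_graph G A' B' ==> poly_graph G (A - A') (B - B')"
  by (auto simp: poly_graph_def intro: diff)

lemma poly_mult: "poly_graph G A B ==> poly_graph G A' B' ==> poly_graph G (A * A') (B * B')"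
  by (auto simp: poly_graph_def coeff_mult intro!: sum mult)

lemma poly_monom: "(x, y) \<in> G ==> poly_graph G (monom x i) (monom y i)"
  by (auto simp: poly_graph_def zero)

end

text \<open>A homomorphism into an algebraically closed field \<open>k\<close> that extends to no
  larger subring of the complex numbers, as in Chevalley's theorem on the existence of
  places.\<close>

locale maximal_place = place_graph_loc +
  assumes k1: "1 \<in> k" and k_diff: "x \<in> k ==> y \<in> k ==> x - y \<in> k" and k_mult: "x \<in> k ==> y \<in> k ==> x * y \<in> k"
    and k_inv: "x \<in> k ==> inverse x \<in> k"
    and k_closed: "(\<And>i. coeff p i \<in> k) ==> degree p > 0 ==> \<exists>z\<in>k. poly p z = 0"
    and maximal: "place_graph k G' ==> G \<subseteq> G' ==> G' = G"
begin

lemma k0: "0 \<in> k" using k_diff[OF k1 k1] by simp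

lemma k_sum: "(\<And>i. i \<in> I ==> f i \<in> k) ==> sum f I \<in> k"
proof (induction I rule: infinite_finite_induct)
  case (insert i I)
  then have "f i - (0 - sum f I) \<in> k" by (intro k_diff k0) auto
  then show ?case using insert by simp
qed (auto simp: k0)

lemma k_power: "x \<in> k ==> x ^ j \<in> k" by (induction j) (auto simp: k1 k_mult)

text \<open>Fractions with powers of \<open>r\<close> as denominators can be mapped as well, because
  \<open>s\<close> is invertible in \<open>k\<close>; maximality excludes a proper extension. The
  domain is therefore a local ring.\<close>

lemma inverse_mem:
  assumes rs: "(r, s) \<in> G" "s \<noteq> 0" shows "(inverse r, inverse s) \<in> G"
proof -
  have r0: "r \<noteq> 0" using rs fun0 by blast
  define G' where "G' = {(a / r ^ j, b / s ^ j) | a b j. (a, b) \<in> G}"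
  have mem: "(a / r ^ j, b / s ^ j) \<in> G'" if "(a, b) \<in> G" for a b j using that by (auto simp: G'_def)
  have "place_graph k G'"
    unfolding place_graph_def
  proof (intro conjI allI impI)
    show "(1, 1) \<in> G'" using mem[OF one, of 0] by simp
    show "snd ` G' \<subseteq> k"
    proof
      fix y assume "y \<in> snd ` G'"
      then obtain a b j where "(a, b) \<in> G" "y = b / s ^ j" unfolding G'_def by fastforce
      then show "y \<in> k" using rng rs k_power k_inv k_mult by (auto simp: divide_inverse)
    qed
    fix y assume "(0, y) \<in> G'"
    then show "y = 0" using r0 fun0 by (auto simp: G'_def)
  next
    fix x y x' y' assume "(x, y) \<in> G'" "(x', y') \<in> G'"
    then obtain a b j a' b' j' where e: "x = a / r ^ j" "y = b / s ^ j" "x' = a' / r ^ j'" "y' = b' / s ^ j'"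
      and ab: "(a, b) \<in> G" "(a', b') \<in> G" unfolding G'_def by blast
    have "(a * r ^ j' - a' * r ^ j, b * s ^ j' - b' * s ^ j) \<in> G" by (intro diff mult ab power rs)
    from mem[OF this, of "j + j'"] show "(x - x', y - y') \<in> G'"
      using r0 rs(2) by (simp add: e power_add diff_frac_eq)
    from mem[OF mult[OF ab], of "j + j'"] show "(x * x', y * y') \<in> G'" by (simp add: e power_add)
  qed
  moreover have "G \<subseteq> G'" using mem[of _ _ 0] by auto
  ultimately have "G' = G" by (rule maximal)
  then show ?thesis using mem[OF one, of 1] by (simp add: divide_inverse)
qed

text \<open>The reductions \<open>I\<close> of the polynomials vanishing at \<open>z\<close> form an
  ideal over the residue field. If all of them vanished at some \<open>c\<close> in
  \<open>k\<close>, mapping \<open>z\<close> to \<open>c\<close> would extend the homomorphism. So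
  \<open>I\<close> has no common root, and its generator \<open>B0\<close> is constant because
  \<open>k\<close> is algebraically closed.\<close>

lemma relation_of_not_mem:
  assumes z: "z \<notin> fst ` G"
  shows "\<exists>A. poly_graph G A 1 \<and> poly A z = 0"
proof -
  define I where "I = {B. \<exists>A. poly_graph G A B \<and> poly A z = 0}"
  have no_root: "\<exists>B\<in>I. poly B c \<noteq> 0" if c: "c \<in> k" for c
  proof (rule ccontr)
    assume none: "\<not> ?thesis"
    define G' where "G' = {(poly A z, poly B c) | A B. poly_graph G A B}"
    have mem: "(poly A z, poly B c) \<in> G'" if "poly_graph G A B" for A B using that by (auto simp: G'_def)
    have const: "poly_graph G [:x:] [:y:]" if "(x, y) \<in> G" for x y
      using poly_monom[OF that, of 0] by (simp add: monom_0)
    have "place_graph k G'"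
      unfolding place_graph_def
    proof (intro conjI allI impI)
      show "(1, 1) \<in> G'" using mem[OF const[OF one]] by simp
      show "snd ` G' \<subseteq> k"
        using rng c by (force simp: G'_def poly_graph_def poly_altdef intro!: k_sum k_mult k_power)
      fix y assume "(0, y) \<in> G'"
      then show "y = 0" using none by (auto simp: G'_def I_def)
    next
      fix x y x' y' assume "(x, y) \<in> G'" "(x', y') \<in> G'"
      then obtain A B A' B' where e: "x = poly A z" "y = poly B c" "x' = poly A' z" "y' = poly B' c"
        and AB: "poly_graph G A B" "poly_graph G A' B'" unfolding G'_def by blast
      show "(x - x', y - y') \<in> G'" using mem[OF poly_diff[OF AB]] by (simp add: e)
      show "(x * x', y * y') \<in> G'" using mem[OF poly_mult[OF AB]] by (simp add: e)
    qed
    moreover have "G \<subseteq> G'" using mem[OF const] by auto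
    ultimately have "G' = G" by (rule maximal)
    moreover have "(z, c) \<in> G'" using mem[OF poly_monom[OF one, of 1]] by (simp add: Polynomial.poly_monom)
    ultimately show False using z by force
  qed
  from no_root[OF k0] obtain B1 where "B1 \<in> I" "B1 \<noteq> 0" by force
  then obtain B0 where B0: "B0 \<in> I" "B0 \<noteq> 0" and min: "\<And>B. B \<in> I ==> B \<noteq> 0 ==> degree B0 \<le> degree B"
    using ex_has_least_nat[of "\<lambda>B. B \<in> I \<and> B \<noteq> 0" B1 degree] by blast
  obtain A0 where A0: "poly_graph G A0 B0" "poly A0 z = 0" using B0 by (auto simp: I_def)
  have lc: "(inverse (coeff A0 (degree B0)), inverse (lead_coeff B0)) \<in> G"
    using A0 B0 by (intro inverse_mem) (auto simp: poly_graph_def)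
  have dvd: "B0 dvd B" if "B \<in> I" for B
    using that
  proof (induction "degree B" arbitrary: B rule: less_induct)
    case less
    show ?case
    proof (cases "B = 0")
      case False
      obtain A where A: "poly_graph G A B" "poly A z = 0" using less.prems by (auto simp: I_def)
      define m where "m = monom (lead_coeff B * inverse (lead_coeff B0)) (degree B - degree B0)"
      define m' where "m' = monom (coeff A (degree B) * inverse (coeff A0 (degree B0))) (degree B - degree B0)"
      have "poly_graph G m' m" unfolding m_def m'_def
        by (intro poly_monom mult lc) (use A in \<open>auto simp: poly_graph_def\<close>)
      then have "poly_graph G (A - m' * A0) (B - m * B0)" by (intro poly_diff poly_mult A A0)
      then have I: "B - m * B0 \<in> I" using A A0 by (auto simp: I_def)
      have dB: "degree B0 \<le> degree B" using min less.prems False by blast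
      have m0: "m \<noteq> 0" using False B0 by (simp add: m_def)
      have dm: "degree (m * B0) = degree B" using dB m0 B0 False
      proof -
        have "degree m = degree B - degree B0" unfolding m_def by (rule degree_monom_eq) (use False B0 in simp)
        then show ?thesis using dB m0 B0 by (simp add: degree_mult_eq)
      qed
      have lm: "lead_coeff (m * B0) = lead_coeff B" 
      unfolding lead_coeff_mult unfolding m_def lead_coeff_monom using B0 by simp
      have "B0 dvd B - m * B0"
      proof (cases "degree B = 0")
        case True
        have "coeff B i = coeff (m * B0) i" for i
          using True dm lm by (cases "i = 0") (simp_all add: coeff_eq_0)
        then have "B = m * B0" by (rule poly_eqI)
        then show ?thesis by simp
      next
        case False
        have "degree (B - m * B0) < degree B"
        proof (rule ccontr)
          assume "\<not> ?thesis"
          then have "degree (B - m * B0) = degree B" using degree_diff_le_max[of B "m * B0"] dm by simp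
          moreover have "coeff (B - m * B0) (degree B) = 0" using lm dm by simp
          ultimately have "B - m * B0 = 0" by (intro iffD1[OF leading_coeff_0_iff]) (simp only:)
          then show False using False \<open>degree (B - m * B0) = degree B\<close> by simp
        qed
        then show ?thesis using less.hyps I by blast
      qed
      then have "B0 dvd (B - m * B0) + m * B0" by (rule dvd_add) simp
      then show ?thesis by simp
    qed simp
  qed
  have "degree B0 = 0"
  proof (rule ccontr)
    assume "degree B0 \<noteq> 0"
    moreover have "coeff B0 i \<in> k" for i using A0 rng by (auto simp: poly_graph_def)
    ultimately obtain c where c: "c \<in> k" "poly B0 c = 0" using k_closed[of B0] by auto
    obtain B where B: "B \<in> I" "poly B c \<noteq> 0" using no_root[OF c(1)] by blast
    from dvd[OF B(1)] c(2) B(2) show False by (auto elim: dvdE)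
  qed
  then obtain \<beta> where \<beta>: "B0 = [:\<beta>:]" by (rule degree_eq_zeroE)
  have "poly_graph G (monom (inverse (coeff A0 (degree B0))) 0 * A0) (monom (inverse (lead_coeff B0)) 0 * B0)"
    by (intro poly_mult poly_monom lc A0)
  moreover have "monom (inverse (lead_coeff B0)) 0 * B0 = 1" using B0 \<beta> by (simp add: monom_0 one_pCons)
  ultimately show ?thesis using A0(2) by (intro exI[of _ "monom (inverse (coeff A0 (degree B0))) 0 * A0"]) simp
qed

text \<open>The relations \<open>A\<close> for \<open>z\<close> and \<open>C\<close> for
  \<open>1 / z\<close> reduce to 1, so all their coefficients except the constant ones lie in the
  maximal ideal. The reversed \<open>C\<close> is a relation for \<open>z\<close> whose leading
  coefficient reduces to 1; it cancels the leading term of \<open>A\<close>, against the minimality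
  of \<open>A\<close>.\<close>

lemma valuation_ring_aux:
  assumes z: "z \<noteq> 0" and A: "poly_graph G A 1" "poly A z = 0"
    and minA: "\<And>A'. poly_graph G A' 1 ==> poly A' z = 0 ==> degree A \<le> degree A'"
    and C: "poly_graph G C 1" "poly C (inverse z) = 0" and le: "degree C \<le> degree A"
  shows False
proof -
  have c0: "(coeff C 0, 1) \<in> G" using C(1)[unfolded poly_graph_def, rule_format, of 0] by simp
  then have C0: "coeff C 0 \<noteq> 0" using fun0 by force
  have m: "degree A > 0"
  proof (rule ccontr)
    assume "\<not> ?thesis"
    then obtain a where "A = [:a:]" by (auto elim: degree_eq_zeroE)
    then have "A = 0" using A by simp
    then have "(0, 1) \<in> G" using A(1)[unfolded poly_graph_def, rule_format, of 0] by simp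
    then show False using fun0 by force
  qed
  have am: "(lead_coeff A, 0) \<in> G" using A(1)[unfolded poly_graph_def, rule_format, of "degree A"] m by simp
  have refl: "poly_graph G (reflect_poly C) (monom 1 (degree C))"
    unfolding poly_graph_def
  proof
    fix i
    show "(coeff (reflect_poly C) i, coeff (monom 1 (degree C)) i) \<in> G"
    proof (cases "i > degree C")
      case True then show ?thesis by (simp add: coeff_reflect_poly zero)
    next
      case False
      have "(coeff C (degree C - i), coeff 1 (degree C - i)) \<in> G" using C(1) unfolding poly_graph_def by blast
      then show ?thesis using False by (cases "i = degree C") (auto simp: coeff_reflect_poly)
    qed
  qed
  have rz: "poly (reflect_poly C) z = 0" using poly_reflect_poly_nz[of z C] z C by simp
  define A' where "A' = monom (coeff C 0) 0 * A - monom (lead_coeff A) (degree A - degree C) * reflect_poly C"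
  have "poly_graph G A' (monom 1 0 * 1 - monom 0 (degree A - degree C) * monom 1 (degree C))"
    unfolding A'_def by (intro poly_diff poly_mult poly_monom c0 am A refl)
  then have A'1: "poly_graph G A' 1" by simp
  have "poly A' z = 0" using A rz by (simp add: A'_def)
  from minA[OF A'1 this] have ge: "degree A \<le> degree A'" .
  have dr: "degree (reflect_poly C) = degree C" using C0 by (simp add: degree_reflect_poly_eq)
  have "degree A' \<le> degree A" unfolding A'_def
  proof (rule degree_diff_le)
    show "degree (monom (coeff C 0) 0 * A) \<le> degree A" by (simp add: monom_0)
    show "degree (monom (lead_coeff A) (degree A - degree C) * reflect_poly C) \<le> degree A"
      by (rule order_trans[OF degree_mult_le]) (use le dr degree_monom_le[of "lead_coeff A" "degree A - degree C"] in linarith)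
  qed
  then have dA': "degree A' = degree A" using ge by simp
  have "coeff (monom (lead_coeff A) (degree A - degree C) * reflect_poly C) (degree A) = lead_coeff A * coeff C 0"
  proof -
    have "degree A - (degree A - degree C) = degree C" using le by simp
    then show ?thesis by (simp add: coeff_monom_mult coeff_reflect_poly)
  qed
  then have "coeff A' (degree A) = 0" unfolding A'_def coeff_diff by (simp only:) (simp add: monom_0)
  then have "A' = 0" by (intro iffD1[OF leading_coeff_0_iff]) (simp only: dA')
  then show False using dA' m by simp
qed

lemma valuation_ring:
  assumes z: "z \<noteq> 0" shows "z \<in> fst ` G \<or> inverse z \<in> fst ` G"
proof (rule ccontr)
  assume "\<not> ?thesis"
  then have n: "z \<notin> fst ` G" "inverse z \<notin> fst ` G" by auto
  have least: "\<exists>A. (poly_graph G A 1 \<and> poly A y = 0) \<and> (\<forall>A'. poly_graph G A' 1 \<and> poly A' y = 0 --> degree A \<le> degree A')"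
    if "y \<notin> fst ` G" for y
    using relation_of_not_mem[OF that] ex_has_least_nat[of "\<lambda>A. poly_graph G A 1 \<and> poly A y = 0" _ degree] by blast
  from least[OF n(1)] obtain A where A: "(poly_graph G A 1 \<and> poly A z = 0) \<and>
    (\<forall>A'. poly_graph G A' 1 \<and> poly A' z = 0 --> degree A \<le> degree A')" by (elim exE)
  from least[OF n(2)] obtain C where C: "(poly_graph G C 1 \<and> poly C (inverse z) = 0) \<and>
    (\<forall>A'. poly_graph G A' 1 \<and> poly A' (inverse z) = 0 --> degree C \<le> degree A')" by (elim exE)
  have iz: "inverse z \<noteq> 0" "inverse (inverse z) = z" using z by auto
  show False
  proof (cases "degree C \<le> degree A")
    case True
    show False by (rule valuation_ring_aux[OF z _ _ _ _ _ True]) (use A C in auto)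
  next
    case False
    then have le: "degree A \<le> degree C" by simp
    show False by (rule valuation_ring_aux[OF iz(1) _ _ _ _ _ le]) (use A C iz in auto)
  qed
qed

end

text \<open>Chevalley's theorem, by Zorn's lemma on graphs ordered by inclusion. That
  \<open>z\<close> or \<open>1 / z\<close> belongs to the domain is what allows projective points to
  be specialised. The target \<open>k\<close> is a set because both all complex numbers and the
  algebraic ones occur in this role.\<close>

theorem place_extension:
  assumes G0: "place_graph k G0"
    and k: "1 \<in> k" "\<And>x y. x \<in> k ==> y \<in> k ==> x - y \<in> k" "\<And>x y. x \<in> k ==> y \<in> k ==> x * y \<in> k"
      "\<And>x. x \<in> k ==> inverse x \<in> k"
    and closed: "\<And>p. (\<And>i. coeff p i \<in> k) ==> degree p > 0 ==> \<exists>z\<in>k. poly p z = 0"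
  obtains G where "G0 \<subseteq> G" "place_graph k G" "\<And>z. z \<noteq> 0 ==> z \<in> fst ` G \<or> inverse z \<in> fst ` G"
proof -
  define GS where "GS = {G. place_graph k G \<and> G0 \<subseteq> G}"
  have "\<exists>G1\<in>GS. \<forall>H\<in>GS. G1 \<subseteq> H --> H = G1"
  proof (rule subset_Zorn_nonempty)
    show "GS \<noteq> {}" using G0 by (auto simp: GS_def)
    fix Ch assume ne: "Ch \<noteq> {}" and ch: "subset.chain GS Ch"
    have pg: "place_graph k H" "G0 \<subseteq> H" if "H \<in> Ch" for H using ch that by (auto simp: subset.chain_def GS_def)
    have two: "\<exists>H\<in>Ch. p \<in> H \<and> q \<in> H" if pq: "p \<in> \<Union> Ch" "q \<in> \<Union> Ch" for p q
      
    proof -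
      obtain H Y where XY: "H \<in> Ch" "p \<in> H" "Y \<in> Ch" "q \<in> Y" using pq by blast
      moreover have "H \<subseteq> Y \<or> Y \<subseteq> H" using ch XY unfolding subset.chain_def by blast
      ultimately show ?thesis by blast
    qed
    have "place_graph k (\<Union> Ch)"
      unfolding place_graph_def
    proof (intro conjI allI impI)
      show "(1, 1) \<in> \<Union> Ch" using ne pg(1) unfolding place_graph_def by blast
      show "snd ` \<Union> Ch \<subseteq> k" using pg(1) unfolding place_graph_def by blast
      show "y = 0" if "(0, y) \<in> \<Union> Ch" for y using that pg(1) unfolding place_graph_def by blast
    next
      fix x y x' y' assume "(x, y) \<in> \<Union> Ch" "(x', y') \<in> \<Union> Ch"
      then obtain H where "H \<in> Ch" "(x, y) \<in> H" "(x', y') \<in> H" using two by blast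
      then show "(x - x', y - y') \<in> \<Union> Ch" "(x * x', y * y') \<in> \<Union> Ch"
        using pg(1)[of H] unfolding place_graph_def by blast+
    qed
    then show "\<Union> Ch \<in> GS" using ne pg(2) by (auto simp: GS_def)
  qed
  then obtain G1 where G1: "G1 \<in> GS" "\<And>H. H \<in> GS ==> G1 \<subseteq> H ==> H = G1" by blast
  have pgG1: "place_graph k G1" "G0 \<subseteq> G1" using G1(1) by (auto simp: GS_def)
  have max: "H = G1" if "place_graph k H" "G1 \<subseteq> H" for H using G1(2)[of H] that pgG1 by (auto simp: GS_def)
  have "maximal_place_axioms k G1"
  proof (rule maximal_place_axioms.intro)
    show "1 \<in> k" by (rule k(1))
    show "x - y \<in> k" if "x \<in> k" "y \<in> k" for x y by (rule k(2)[OF that])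
    show "x * y \<in> k" if "x \<in> k" "y \<in> k" for x y by (rule k(3)[OF that])
    show "inverse x \<in> k" if "x \<in> k" for x by (rule k(4)[OF that])
    show "\<exists>z\<in>k. poly p z = 0" if "\<And>i. coeff p i \<in> k" "degree p > 0" for p by (rule closed[OF that])
    show "H = G1" if "place_graph k H" "G1 \<subseteq> H" for H by (rule max[OF that])
  qed
  with pgG1(1) have mp: "maximal_place k G1" by (rule maximal_place.intro[OF place_graph_loc.intro])
  show thesis by (rule that[OF pgG1(2,1) maximal_place.valuation_ring[OF mp]])
qed

section \<open>Macaulay determinants\<close>

section \<open>Forms and Macaulay's determinants\<close>

type_synonym fcoeff = "nat \<times> (nat \<Rightarrow>\<^sub>0 nat)"

definition fval :: "nat => nat => (fcoeff => 'b) => nat => (nat => 'b) => 'b::comm_semiring_1" where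
  "fval n d a i x = (\<Sum>m\<in>monomials n d. a (i, m) * mval x m)"

definition zero_locus :: "nat => nat => (fcoeff => complex) set" where
  "zero_locus n d = {a. \<exists>x. (\<exists>k\<le>n. x k \<noteq> 0) \<and> (\<forall>i\<le>n. fval n d a i x = 0)}"

definition power_form :: "nat => nat => fcoeff => 'b::zero_neq_one" where
  "power_form n d v = (if fst v \<le> n \<and> snd v = single (fst v) d then 1 else 0)"

lemma mdegree_superset: "finite A ==> keys m \<subseteq> A ==> mdegree m = (\<Sum>v\<in>A. lookup m v)"
  unfolding mdegree_def by (rule sum.mono_neutral_left) (auto simp: in_keys_iff)

lemma mdegree_add: "mdegree (m + m') = mdegree m + mdegree m'"
proof -
  have "mdegree m'' = (\<Sum>v\<in>keys m \<union> keys m'. lookup m'' v)" if "m'' \<in> {m, m', m + m'}" for m''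
    using that keys_add[of m m'] by (intro mdegree_superset) auto
  then show ?thesis by (simp add: lookup_add sum.distrib)
qed

lemma mdegree_single [simp]: "mdegree (single v k) = k"
  by (cases "k = 0") (auto simp: mdegree_def)

lemma mdegree_0 [simp]: "mdegree 0 = 0"
  by (simp add: mdegree_def)

lemma lookup_le_mdegree: "lookup m v \<le> mdegree m"
proof (cases "v \<in> keys m")
  case True
  then show ?thesis unfolding mdegree_def by (intro member_le_sum) auto
qed (simp add: in_keys_iff)

lemma finite_monomials [simp]: "finite (monomials n d)"
proof (rule finite_subset)
  show "monomials n d \<subseteq> (\<lambda>f. \<Sum>i\<le>n. single i (f i)) ` (\<Pi>\<^sub>E i\<in>{..n}. {..d})"
  proof
    fix m assume m: "m \<in> monomials n d"
    have "m = (\<Sum>i\<le>n. single i (restrict (lookup m) {..n} i))"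
    proof (rule poly_mapping_eqI)
      fix k
      have "lookup (\<Sum>i\<le>n. single i (restrict (lookup m) {..n} i)) k = (\<Sum>i\<le>n. if i = k then lookup m k else 0)"
        unfolding lookup_sum lookup_single when_def by (intro sum.cong) auto
      also have "\<dots> = (if k \<le> n then lookup m k else 0)" by simp
      also have "\<dots> = lookup m k" using m by (auto simp: monomials_def in_keys_iff)
      finally show "lookup m k = lookup (\<Sum>i\<le>n. single i (restrict (lookup m) {..n} i)) k" by simp
    qed
    moreover have "restrict (lookup m) {..n} \<in> (\<Pi>\<^sub>E i\<in>{..n}. {..d})"
      unfolding restrict_PiE_iff using m lookup_le_mdegree[of m] by (simp add: monomials_def)
    ultimately show "m \<in> (\<lambda>f. \<Sum>i\<le>n. single i (f i)) ` (\<Pi>\<^sub>E i\<in>{..n}. {..d})" by (rule image_eqI)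
  qed
  show "finite ((\<lambda>f. \<Sum>i\<le>n. single i (f i)) ` (\<Pi>\<^sub>E i\<in>{..n}. {..d}))"
    by (intro finite_imageI finite_PiE) auto
qed

lemma single_in_monomials [simp]: "i \<le> n ==> single i d \<in> monomials n d"
  by (cases "d = 0") (auto simp: monomials_def)

lemma add_in_monomials: "m \<in> monomials n d ==> m' \<in> monomials n e ==> m + m' \<in> monomials n (d + e)"
  using keys_add[of m m'] by (auto simp: monomials_def mdegree_add)

lemma mval_scale: "mval (\<lambda>v. c * x v) m = c ^ mdegree m * mval x m"
  by (simp add: mval_mult mval_const)

lemma fval_scale: "fval n d a i (\<lambda>v. c * x v) = c ^ d * fval n d a i x"
  by (simp add: fval_def mval_scale sum_distrib_left mult_ac monomials_def)

lemma fval_hom: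
  assumes "comm_ring_hom g" shows "g (fval n d a i x) = fval n d (\<lambda>v. g (a v)) i (\<lambda>k. g (x k))"
proof -
  interpret comm_ring_hom g by fact
  show ?thesis by (simp add: fval_def hom_sum hom_mult mval_hom[OF assms])
qed

lemma fval_add: "fval n d (\<lambda>v. a v + b v) i x = fval n d a i x + fval n d b i x"
  by (simp add: fval_def distrib_right sum.distrib)

lemma fval_single:
  assumes "m \<in> monomials n d"
  shows "fval n d (\<lambda>v. if v = (i, m) then c else 0) j x = (if i = j then c * mval x m else 0)"
proof -
  have "fval n d (\<lambda>v. if v = (i, m) then c else 0) j x
      = (\<Sum>m'\<in>monomials n d. if m' = m then (if i = j then c * mval x m else 0) else 0)"
    unfolding fval_def by (intro sum.cong) auto
  then show ?thesis using assms by simp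
qed

lemma fval_power_form: "i \<le> n ==> fval n d (power_form n d) i x = x i ^ d"
proof -
  assume i: "i \<le> n"
  have "fval n d (power_form n d) i x = (\<Sum>m\<in>monomials n d. if m = single i d then x i ^ d else 0)"
    unfolding fval_def power_form_def using i by (intro sum.cong) auto
  then show ?thesis using i by simp
qed

lemma fval_cong: "(\<And>m. m \<in> monomials n d ==> a (i, m) = b (i, m)) ==> (\<And>k. k \<le> n ==> x k = y k) ==> fval n d a i x = fval n d b i y"
  unfolding fval_def by (intro sum.cong refl arg_cong2[where f = "(*)"] mval_cong) (auto simp: monomials_def)

text \<open>The coefficient of \<open>X^\<gamma>\<close> in \<open>X^(\<beta> - d e_i) F_i\<close>.\<close>

definition mac_entry :: "nat => nat => (fcoeff => 'b) => nat => (nat \<Rightarrow>\<^sub>0 nat) => (nat \<Rightarrow>\<^sub>0 nat) => 'b::comm_ring_1" where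
  "mac_entry n d a i \<beta> \<gamma> = (\<Sum>m\<in>monomials n d. if \<gamma> + single i d = \<beta> + m then a (i, m) else 0)"

text \<open>The degree is so large that each monomial is divisible by \<open>X_i^d\<close> for some
  \<open>i\<close>. So every monomial can index a row as well as a column.\<close>

definition mac_monomials :: "nat => nat => (nat \<Rightarrow>\<^sub>0 nat) set" where
  "mac_monomials n d = monomials n ((n + 1) * d)"

text \<open>The index \<open>j\<close> is used only if no other one fits; this keeps the number of
  rows taken from the form \<open>j\<close> down to \<open>d ^ n\<close>.\<close>

definition mac_index :: "nat => nat => nat => (nat \<Rightarrow>\<^sub>0 nat) => nat" where
  "mac_index n d j \<beta> = (if \<exists>i\<le>n. i \<noteq> j \<and> lookup \<beta> i \<ge> d then SOME i. i \<le> n \<and> i \<noteq> j \<and> lookup \<beta> i \<ge> d else j)"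

definition mac_list :: "nat => nat => (nat \<Rightarrow>\<^sub>0 nat) list" where
  "mac_list n d = (SOME bs. distinct bs \<and> set bs = mac_monomials n d)"

definition mac_mat :: "nat => nat => nat => (fcoeff => 'b) => 'b::comm_ring_1 mat" where
  "mac_mat n d j a = (let bs = mac_list n d; N = length bs in
     mat N N (\<lambda>(r, c). mac_entry n d a (mac_index n d j (bs ! r)) (bs ! r) (bs ! c)))"

definition mac_det :: "nat => nat => nat => (fcoeff => 'b) => 'b::comm_ring_1" where
  "mac_det n d j a = det (mac_mat n d j a)"

lemma mac_list: "distinct (mac_list n d)" "set (mac_list n d) = mac_monomials n d"
proof -
  have "finite (mac_monomials n d)" by (simp add: mac_monomials_def)
  then have "\<exists>bs. distinct bs \<and> set bs = mac_monomials n d" using finite_distinct_list by blast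
  then have "distinct (mac_list n d) \<and> set (mac_list n d) = mac_monomials n d"
    unfolding mac_list_def by (rule someI_ex)
  then show "distinct (mac_list n d)" "set (mac_list n d) = mac_monomials n d" by auto
qed

lemma mac_index:
  assumes \<beta>: "\<beta> \<in> mac_monomials n d" and j: "j \<le> n"
  shows "mac_index n d j \<beta> \<le> n" "lookup \<beta> (mac_index n d j \<beta>) \<ge> d"
proof -
  have "mac_index n d j \<beta> \<le> n \<and> lookup \<beta> (mac_index n d j \<beta>) \<ge> d"
  proof (cases "\<exists>i\<le>n. i \<noteq> j \<and> lookup \<beta> i \<ge> d")
    case True
    then have "\<exists>i. i \<le> n \<and> i \<noteq> j \<and> lookup \<beta> i \<ge> d" by auto
    from someI_ex[OF this] show ?thesis unfolding mac_index_def if_P[OF True] by blast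
  next
    case False
    have "(n + 1) * d = (\<Sum>i\<le>n. lookup \<beta> i)"
      using \<beta> mdegree_superset[of "{..n}" \<beta>] by (simp add: mac_monomials_def monomials_def)
    also have "\<dots> = lookup \<beta> j + (\<Sum>i\<in>{..n} - {j}. lookup \<beta> i)" using j by (intro sum.remove) auto
    also have "(\<Sum>i\<in>{..n} - {j}. lookup \<beta> i) \<le> (\<Sum>i\<in>{..n} - {j}. d)"
      using False by (intro sum_mono) (use linorder_le_cases in blast)
    also have "\<dots> = n * d" using j by simp
    finally have "lookup \<beta> j \<ge> d" by simp
    moreover have "mac_index n d j \<beta> = j" unfolding mac_index_def by (rule if_not_P[OF False])
    ultimately show ?thesis using j by simp
  qed
  then show "mac_index n d j \<beta> \<le> n" "lookup \<beta> (mac_index n d j \<beta>) \<ge> d" by auto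
qed

lemma mac_mat_carrier [simp]: "mac_mat n d j a \<in> carrier_mat (length (mac_list n d)) (length (mac_list n d))"
  by (simp add: mac_mat_def Let_def)

lemma mac_det_hom:
  assumes "comm_ring_hom g" shows "g (mac_det n d j a) = mac_det n d j (\<lambda>v. g (a v))"
proof -
  interpret comm_ring_hom g by fact
  have "map_mat g (mac_mat n d j a) = mac_mat n d j (\<lambda>v. g (a v))"
    by (rule eq_matI) (auto simp: mac_mat_def Let_def mac_entry_def hom_sum if_distrib[of g] cong: if_cong)
  then show ?thesis by (simp add: mac_det_def flip: hom_det)
qed

lemma mac_row:
  assumes \<beta>: "\<beta> \<in> mac_monomials n d" and i: "i \<le> n" "lookup \<beta> i \<ge> d"
  shows "(\<Sum>\<gamma>\<in>mac_monomials n d. mac_entry n d a i \<beta> \<gamma> * mval x \<gamma>) = mval x (\<beta> - single i d) * fval n d a i x"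
proof -
  define \<beta>' where "\<beta>' = \<beta> - single i d"
  have \<beta>': "\<beta> = \<beta>' + single i d"
    using i by (intro poly_mapping_eqI) (auto simp: \<beta>'_def lookup_add lookup_minus lookup_single when_def)
  have iff: "\<gamma> + single i d = \<beta> + m \<longleftrightarrow> \<gamma> = \<beta>' + m" for \<gamma> m
  proof -
    have "\<beta> + m = \<beta>' + m + single i d" unfolding \<beta>' by (simp only: ac_simps)
    then show ?thesis by (simp only: add_right_cancel)
  qed
  have mem: "\<beta>' + m \<in> mac_monomials n d" if "m \<in> monomials n d" for m
  proof -
    have "\<beta>' \<in> monomials n (n * d)"
      using \<beta> i by (auto simp: mac_monomials_def monomials_def \<beta>' mdegree_add in_keys_iff lookup_add subset_iff)
    from add_in_monomials[OF this that] show ?thesis by (simp add: mac_monomials_def algebra_simps)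
  qed
  have fin: "finite (mac_monomials n d)" by (simp add: mac_monomials_def)
  have "(\<Sum>\<gamma>\<in>mac_monomials n d. mac_entry n d a i \<beta> \<gamma> * mval x \<gamma>)
      = (\<Sum>m\<in>monomials n d. \<Sum>\<gamma>\<in>mac_monomials n d. (if \<gamma> = \<beta>' + m then a (i, m) * mval x \<gamma> else 0))"
    unfolding mac_entry_def iff sum_distrib_right by (subst sum.swap) (intro sum.cong, auto)
  also have "\<dots> = (\<Sum>m\<in>monomials n d. a (i, m) * mval x (\<beta>' + m))"
    using mem fin by (intro sum.cong) (auto simp: sum.delta)
  also have "\<dots> = mval x \<beta>' * fval n d a i x"
    by (simp add: fval_def mval_add sum_distrib_left mult_ac)
  finally show ?thesis by (simp add: \<beta>'_def)
qed

text \<open>At a common zero \<open>x\<close> the vector of all monomial values lies in the kernel,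
  since every row evaluates to a multiple of the value of some form at \<open>x\<close>. The vector
  is nonzero because of the power of \<open>x k\<close> among its entries.\<close>

lemma mac_det_zero_locus:
  assumes a: "a \<in> zero_locus n d" and j: "j \<le> n"
  shows "mac_det n d j a = 0"
proof -
  obtain x k where k: "k \<le> n" "x k \<noteq> 0" and x: "\<And>i. i \<le> n ==> fval n d a i x = 0"
    using a unfolding zero_locus_def by blast
  define bs where "bs = mac_list n d"
  define N where "N = length bs"
  define v where "v = Matrix.vec N (\<lambda>c. mval x (bs ! c))"
  have bs: "distinct bs" "set bs = mac_monomials n d" using mac_list by (auto simp: bs_def)
  have "mac_mat n d j a *\<^sub>v v = 0\<^sub>v N"
  proof (rule eq_vecI)
    fix r assume "r < dim_vec (0\<^sub>v N :: complex Matrix.vec)"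
    then have r: "r < N" by simp
    have \<beta>: "bs ! r \<in> mac_monomials n d" using nth_mem[of r bs] r unfolding bs(2) N_def by blast
    note mi = mac_index[OF \<beta> j]
    have ent: "mac_mat n d j a $$ (r, c) = mac_entry n d a (mac_index n d j (bs ! r)) (bs ! r) (bs ! c)" if "c < N" for c
      using r that by (simp add: mac_mat_def Let_def bs_def[symmetric] N_def[symmetric])
    have dims: "dim_row (mac_mat n d j a) = N" "dim_col (mac_mat n d j a) = N"
      by (simp_all add: mac_mat_def Let_def bs_def[symmetric] N_def[symmetric])
    have "(mac_mat n d j a *\<^sub>v v) $ r
        = (\<Sum>c<N. mac_entry n d a (mac_index n d j (bs ! r)) (bs ! r) (bs ! c) * mval x (bs ! c))"
      using r dims unfolding lessThan_atLeast0 by (simp add: scalar_prod_def v_def ent)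
    also have "\<dots> = (\<Sum>\<gamma>\<in>mac_monomials n d. mac_entry n d a (mac_index n d j (bs ! r)) (bs ! r) \<gamma> * mval x \<gamma>)"
      by (rule sum.reindex_bij_betw[of "\<lambda>c. bs ! c"]) (use bs in \<open>simp add: bij_betw_nth N_def\<close>)
    also have "\<dots> = 0" using mac_row[OF \<beta> mi, of a x] x[OF mi(1)] by simp
    finally show "(mac_mat n d j a *\<^sub>v v) $ r = 0\<^sub>v N $ r" using r by simp
  qed (simp add: mac_mat_def Let_def N_def bs_def)
  moreover have "v \<noteq> 0\<^sub>v N"
  proof -
    have "single k ((n + 1) * d) \<in> set bs" using k by (simp only: bs mac_monomials_def single_in_monomials)
    then obtain c where c: "c < N" "bs ! c = single k ((n + 1) * d)" unfolding in_set_conv_nth N_def by blast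
    have "v $ c = x k ^ ((n + 1) * d)" unfolding v_def using c by (simp only: index_vec mval_single)
    then show ?thesis using c(1) k(2) by (metis index_zero_vec(1) power_not_zero)
  qed
  moreover have "v \<in> carrier_vec N" by (simp add: v_def)
  moreover have "mac_mat n d j a \<in> carrier_mat N N" unfolding N_def bs_def by (rule mac_mat_carrier)
  ultimately show ?thesis unfolding mac_det_def
    by (subst det_0_iff_vec_prod_zero) (assumption, intro exI[of _ v] conjI)
qed

text \<open>For the forms \<open>X_i^d\<close> row \<open>\<beta>\<close> represents the monomial
  \<open>\<beta>\<close> itself, so the matrix is the identity. Shifting a system along the power
  forms therefore adds a scalar matrix, and the determinant is monic in the shift.\<close>

lemma mac_mat_add_power_form:
  assumes j: "j \<le> n"
  shows "mac_mat n d j (\<lambda>v. a v + s * power_form n d v) = mac_mat n d j a + s \<cdot>\<^sub>m 1\<^sub>m (length (mac_list n d))"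
proof (rule eq_matI)
  fix r c assume "r < dim_row (mac_mat n d j a + s \<cdot>\<^sub>m 1\<^sub>m (length (mac_list n d)))"
    "c < dim_col (mac_mat n d j a + s \<cdot>\<^sub>m 1\<^sub>m (length (mac_list n d)))"
  then have rc: "r < length (mac_list n d)" "c < length (mac_list n d)" by auto
  let ?bs = "mac_list n d"
  define i where "i = mac_index n d j (?bs ! r)"
  have "?bs ! r \<in> mac_monomials n d" using rc mac_list(2)[of n d] nth_mem by blast
  from mac_index[OF this j] have i: "i \<le> n" by (simp add: i_def)
  have "mac_entry n d (\<lambda>v. a v + s * power_form n d v) i (?bs ! r) (?bs ! c)
      = mac_entry n d a i (?bs ! r) (?bs ! c) + (\<Sum>m\<in>monomials n d. if m = single i d then (if ?bs ! c = ?bs ! r then s else 0) else 0)"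
    unfolding mac_entry_def sum.distrib[symmetric] using i by (intro sum.cong) (auto simp: power_form_def)
  also have "(\<Sum>m\<in>monomials n d. if m = single i d then (if ?bs ! c = ?bs ! r then s else 0) else 0) = (if r = c then s else 0)"
    using i rc mac_list(1)[of n d] by (auto simp: nth_eq_iff_index_eq sum.delta)
  finally show "mac_mat n d j (\<lambda>v. a v + s * power_form n d v) $$ (r, c) = (mac_mat n d j a + s \<cdot>\<^sub>m 1\<^sub>m (length ?bs)) $$ (r, c)"
    using rc by (simp add: mac_mat_def Let_def i_def)
qed (auto simp: mac_mat_def Let_def)

text \<open>The sign is chosen so that the characteristic polynomial at \<open>s\<close> is the
  determinant for the system shifted by \<open>s\<close>.\<close>

definition mac_poly :: "nat => nat => nat => (fcoeff, int) mpoly poly" where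
  "mac_poly n d j = char_poly (- mac_mat n d j mvar)"

lemma mac_poly_monic: "lead_coeff (mac_poly n d j) = 1"
proof -
  have "- mac_mat n d j mvar \<in> carrier_mat (length (mac_list n d)) (length (mac_list n d))"
    by (simp only: uminus_carrier_iff_mat mac_mat_carrier)
  note c = conjunct1[OF degree_monic_char_poly[OF this]] conjunct2[OF degree_monic_char_poly[OF this]]
  show ?thesis unfolding mac_poly_def c(1) by (rule c(2))
qed

lemma mac_poly_eval:
  assumes j: "j \<le> n"
  shows "poly (map_poly (ieval a) (mac_poly n d j)) s = mac_det n d j (\<lambda>v. a v + s * power_form n d v :: complex)"
proof -
  interpret comm_ring_hom "ieval a :: (fcoeff, int) mpoly => complex" by (rule comm_ring_hom_ieval)
  let ?N = "length (mac_list n d)"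
  have "map_mat (ieval a) (- mac_mat n d j mvar) = - mac_mat n d j a"
    by (rule eq_matI) (auto simp: mac_mat_def Let_def mac_entry_def hom_sum hom_uminus if_distrib[of "ieval a"] msubst_mvar cong: if_cong)
  then have "map_poly (ieval a) (mac_poly n d j) = char_poly (- mac_mat n d j a)"
    unfolding mac_poly_def
    using char_poly_hom[of "- mac_mat n d j mvar" ?N] by simp
  moreover have "poly (char_poly (- mac_mat n d j a)) s = det (- char_matrix (- mac_mat n d j a) s)"
    by (rule char_poly_matrix[of _ ?N]) simp
  moreover have "- char_matrix (- mac_mat n d j a) s = mac_mat n d j a + s \<cdot>\<^sub>m 1\<^sub>m ?N"
    by (rule eq_matI) (auto simp: char_matrix_def mac_mat_def Let_def)
  ultimately show ?thesis by (simp add: mac_det_def mac_mat_add_power_form[OF j])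
qed

lemma mac_det_power_form: "j \<le> n ==> mac_det n d j (power_form n d) = (1 :: 'b::comm_ring_1)"
proof -
  assume j: "j \<le> n"
  have "mac_mat n d j (\<lambda>v. 0 + 1 * power_form n d v :: 'b) = mac_mat n d j (\<lambda>v. 0) + 1 \<cdot>\<^sub>m 1\<^sub>m (length (mac_list n d))"
    by (rule mac_mat_add_power_form[OF j])
  also have "\<dots> = 1\<^sub>m (length (mac_list n d))"
    by (rule eq_matI) (auto simp: mac_mat_def Let_def mac_entry_def)
  finally show ?thesis by (simp add: mac_det_def)
qed

text \<open>This is the degree of \<open>mac_det n d j\<close> in the coefficients of the form
  \<open>j\<close>.\<close>

definition mac_size :: "nat => nat => nat => nat" where
  "mac_size n d j = card {r. r < length (mac_list n d) \<and> mac_index n d j (mac_list n d ! r) = j}"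

lemma mac_det_scale:
  "mac_det n d j (\<lambda>v. (if fst v = j then t else 1) * a v) = t ^ mac_size n d j * mac_det n d j (a :: fcoeff => 'b::comm_ring_1)"
proof -
  let ?bs = "mac_list n d"
  let ?N = "length ?bs"
  define D where "D = mat ?N ?N (\<lambda>(r, c). if r = c then (if mac_index n d j (?bs ! r) = j then t else 1) else (0::'b))"
  have D: "D \<in> carrier_mat ?N ?N" by (simp add: D_def)
  have "mac_mat n d j (\<lambda>v. (if fst v = j then t else 1) * a v) = D * mac_mat n d j a"
  proof (rule eq_matI)
    fix r c assume "r < dim_row (D * mac_mat n d j a)" "c < dim_col (D * mac_mat n d j a)"
    then have rc: "r < ?N" "c < ?N" using D mac_mat_carrier[of n d j a] by auto
    have "(D * mac_mat n d j a) $$ (r, c) = (\<Sum>k<?N. D $$ (r, k) * mac_mat n d j a $$ (k, c))"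
      using rc D by (simp add: scalar_prod_def mac_mat_def Let_def lessThan_atLeast0)
    also have "\<dots> = (\<Sum>k<?N. if k = r then D $$ (r, r) * mac_mat n d j a $$ (r, c) else 0)"
      using rc by (intro sum.cong) (auto simp: D_def)
    also have "\<dots> = D $$ (r, r) * mac_mat n d j a $$ (r, c)" using rc by simp
    also have "\<dots> = mac_mat n d j (\<lambda>v. (if fst v = j then t else 1) * a v) $$ (r, c)"
      using rc by (auto simp: D_def mac_mat_def Let_def mac_entry_def sum_distrib_left intro!: sum.cong)
    finally show "mac_mat n d j (\<lambda>v. (if fst v = j then t else 1) * a v) $$ (r, c) = (D * mac_mat n d j a) $$ (r, c)" by simp
  qed (use D in \<open>auto simp: mac_mat_def Let_def\<close>)
  moreover have "det D = t ^ mac_size n d j"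
  proof -
    have "det D = prod_list (diag_mat D)" by (rule det_upper_triangular[OF _ D]) (auto simp: upper_triangular_def D_def)
    also have "\<dots> = (\<Prod>r<?N. D $$ (r, r))" using D
      by (simp add: diag_mat_def prod.list_conv_set_nth lessThan_atLeast0)
    also have "\<dots> = (\<Prod>r<?N. if mac_index n d j (?bs ! r) = j then t else 1)" by (intro prod.cong) (auto simp: D_def)
    also have "\<dots> = t ^ card ({..<?N} \<inter> {r. mac_index n d j (?bs ! r) = j})" by (simp add: prod.If_cases)
    also have "{..<?N} \<inter> {r. mac_index n d j (?bs ! r) = j} = {r. r < ?N \<and> mac_index n d j (?bs ! r) = j}" by auto
    finally show ?thesis by (simp add: mac_size_def)
  qed
  ultimately show ?thesis using det_mult[OF D mac_mat_carrier] by (simp add: mac_det_def)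
qed

text \<open>A row belongs to the form \<open>j\<close> only if all other exponents of its monomial
  are below \<open>d\<close>. These \<open>n\<close> exponents determine the monomial, since its
  degree is fixed.\<close>

lemma mac_size_le:
  assumes j: "j \<le> n" and d: "d \<ge> 1" shows "mac_size n d j \<le> d ^ n"
proof -
  let ?bs = "mac_list n d"
  let ?S = "{r. r < length ?bs \<and> mac_index n d j (?bs ! r) = j}"
  let ?T = "\<Pi>\<^sub>E i\<in>{..n} - {j}. {..<d}"
  define g where "g = (\<lambda>r. restrict (lookup (?bs ! r)) ({..n} - {j}))"
  have mem: "?bs ! r \<in> mac_monomials n d" if "r \<in> ?S" for r using that mac_list(2)[of n d] nth_mem by blast
  have small: "lookup (?bs ! r) i < d" if "r \<in> ?S" "i \<le> n" "i \<noteq> j" for r i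
  proof (rule ccontr)
    assume "\<not> ?thesis"
    then have ex: "\<exists>i. i \<le> n \<and> i \<noteq> j \<and> lookup (?bs ! r) i \<ge> d" using that by auto
    then have "mac_index n d j (?bs ! r) \<noteq> j" using someI_ex[OF ex] by (auto simp: mac_index_def)
    then show False using that by auto
  qed
  have "inj_on g ?S"
  proof (rule inj_onI)
    fix r r' assume r: "r \<in> ?S" "r' \<in> ?S" and e: "g r = g r'"
    have eq: "lookup (?bs ! r) i = lookup (?bs ! r') i" if "i \<le> n" "i \<noteq> j" for i
      using fun_cong[OF e, of i] that by (simp add: g_def)
    have deg: "(\<Sum>i\<le>n. lookup (?bs ! q) i) = (n + 1) * d" if "q \<in> ?S" for q
      using mem[OF that] mdegree_superset[of "{..n}" "?bs ! q"] by (simp add: mac_monomials_def monomials_def)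
    have "(\<Sum>i\<in>{..n} - {j}. lookup (?bs ! r) i) = (\<Sum>i\<in>{..n} - {j}. lookup (?bs ! r') i)"
      using eq by (intro sum.cong) auto
    then have eqj: "lookup (?bs ! r) j = lookup (?bs ! r') j"
      using deg[OF r(1)] deg[OF r(2)] j sum.remove[of "{..n}" j "lookup (?bs ! r)"] sum.remove[of "{..n}" j "lookup (?bs ! r')"] by simp
    have "?bs ! r = ?bs ! r'"
    proof (rule poly_mapping_eqI)
      fix i show "lookup (?bs ! r) i = lookup (?bs ! r') i"
      proof (cases "i \<le> n")
        case False
        then have "i \<notin> keys (?bs ! r)" "i \<notin> keys (?bs ! r')"
          using mem[OF r(1)] mem[OF r(2)] by (auto simp: mac_monomials_def monomials_def)
        then show ?thesis by (simp add: in_keys_iff)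
      qed (use eq eqj in auto)
    qed
    then show "r = r'" using r mac_list(1)[of n d] by (simp add: nth_eq_iff_index_eq)
  qed
  moreover have "g ` ?S \<subseteq> ?T" 
  proof
    fix f assume "f \<in> g ` ?S"
    then obtain r where r: "r \<in> ?S" "f = g r" by blast
    show "f \<in> ?T" unfolding r(2) g_def by (simp only: restrict_PiE_iff) (use small[OF r(1)] in auto)
  qed
  ultimately have "card ?S \<le> card ?T" by (rule card_inj_on_le) (auto intro: finite_PiE)
  also have "card ?T = d ^ n" using j by (simp add: card_PiE)
  finally show ?thesis by (simp add: mac_size_def)
qed

section \<open>Existence of the resultant\<close>

section \<open>The generic zero\<close>

abbreviation evs :: "('v => 'b) => 'b => ('v, int) mpoly poly => 'b::comm_ring_1" where
  "evs a s Q \<equiv> poly (map_poly (ieval a) Q) s"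

lemma evs_hom:
  assumes "comm_ring_hom g" shows "g (evs a s Q) = evs (\<lambda>v. g (a v)) (g s) Q"
proof -
  interpret g: comm_ring_hom g by fact
  have "g (evs a s Q) = poly (map_poly g (map_poly (ieval a) Q)) (g s)" by simp
  also have "map_poly g (map_poly (ieval a) Q) = map_poly (g \<circ> ieval a) Q"
    by (rule map_poly_map_poly) auto
  also have "g \<circ> ieval a = ieval (\<lambda>v. g (a v))" by (rule ext) (simp add: ieval_hom[OF assms])
  finally show ?thesis .
qed

definition shift_poly :: "('v => int) => ('v, int) mpoly => ('v, int) mpoly poly" where
  "shift_poly h P = ieval (\<lambda>v. [:mvar v, of_int (h v):]) P"

lemma evs_shift_poly: "evs a s (shift_poly h P) = ieval (\<lambda>v. a v + s * of_int (h v)) P"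
proof -
  have hom: "comm_ring_hom (evs a s)"
    by (intro comm_ring_hom_comp[OF comm_ring_hom_poly] comm_ring_hom_map_poly comm_ring_hom_ieval)
  interpret c: comm_ring_hom "ieval a" by (rule comm_ring_hom_ieval)
  have "evs a s (shift_poly h P) = ieval (\<lambda>v. evs a s [:mvar v, of_int (h v):]) P"
    unfolding shift_poly_def by (rule ieval_hom[OF hom])
  also have "\<dots> = ieval (\<lambda>v. a v + s * of_int (h v)) P"
  proof (rule msubst_cong)
    fix v
    have "evs a s [:mvar v, of_int (h v):] = ieval a (mvar v) + s * ieval a (of_int (h v))"
      by (simp add: c.map_poly_pCons_hom)
    then show "evs a s [:mvar v, of_int (h v):] = a v + s * of_int (h v)"
      by (simp only: of_int_hom[OF comm_ring_hom_ieval] msubst_mvar[where h = of_int, OF of_int_0 of_int_1])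
  qed
  finally show ?thesis .
qed

lemma poly_shift_poly_0: "poly (shift_poly h P) 0 = P"
  unfolding shift_poly_def by (subst ieval_hom[OF comm_ring_hom_poly]) simp

text \<open>The systems with a given zero \<open>x\<close>, \<open>x\<^sub>0 = 1\<close>, are parametrised by the coefficients other than those
  of \<open>X\<^sub>0^d\<close>. In \<open>w\<close>, the variable \<open>Inr 0\<close> stands for the shift and \<open>Inr k\<close> for \<open>x\<^sub>k\<close>.\<close>

definition chart_zero :: "(fcoeff + nat => 'b) => nat => 'b::comm_ring_1" where
  "chart_zero w k = (if k = 0 then 1 else w (Inr k))"

definition chart_system :: "nat => nat => (fcoeff + nat => 'b) => fcoeff => 'b::comm_ring_1" where
  "chart_system n d w v = (if fst v \<le> n \<and> snd v = single 0 d
     then - (\<Sum>m\<in>monomials n d - {single 0 d}. w (Inl (fst v, m)) * mval (chart_zero w) m) else w (Inl v))"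

lemma chart_zero_hom: "comm_ring_hom g ==> g (chart_zero w k) = chart_zero (\<lambda>v. g (w v)) k"
  by (auto simp: chart_zero_def comm_ring_hom_def ring_hom_def semiring_hom_def monoid_mult_hom_def one_hom_def)

lemma chart_system_hom:
  assumes "comm_ring_hom g" shows "g (chart_system n d w v) = chart_system n d (\<lambda>v. g (w v)) v"
proof -
  interpret comm_ring_hom g by fact
  show ?thesis by (simp add: chart_system_def hom_uminus hom_sum hom_mult mval_hom[OF assms] chart_zero_hom[OF assms])
qed

lemma fval_remove:
  assumes "m \<in> monomials n d"
  shows "fval n d a i x = a (i, m) * mval x m + (\<Sum>m'\<in>monomials n d - {m}. a (i, m') * mval x m')"
  unfolding fval_def using assms by (intro sum.remove) auto

lemma chart_system_zero: "i \<le> n ==> fval n d (chart_system n d w) i (chart_zero w) = 0"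
proof -
  assume i: "i \<le> n"
  have "(\<Sum>m'\<in>monomials n d - {single 0 d}. chart_system n d w (i, m') * mval (chart_zero w) m')
      = (\<Sum>m\<in>monomials n d - {single 0 d}. w (Inl (i, m)) * mval (chart_zero w) m)"
    by (intro sum.cong) (auto simp: chart_system_def)
  moreover have "chart_system n d w (i, single 0 d) = - (\<Sum>m\<in>monomials n d - {single 0 d}. w (Inl (i, m)) * mval (chart_zero w) m)"
    using i by (simp add: chart_system_def)
  moreover have "mval (chart_zero w) (single 0 d) = 1" by (simp add: chart_zero_def)
  ultimately show ?thesis by (simp add: fval_remove[of "single 0 d"])
qed

lemma chart_system_mem: "chart_system n d w \<in> zero_locus n d"
  unfolding zero_locus_def by (intro CollectI exI[of _ "chart_zero w"] conjI exI[of _ 0])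
    (auto simp: chart_zero_def chart_system_zero)

lemma poly_eq_0_if_infinite_roots:
  fixes p :: "complex poly"
  assumes "\<And>t. t \<noteq> 0 ==> poly p t = 0" shows "p = 0"
proof (rule ccontr)
  assume "p \<noteq> 0"
  then have "finite {t. poly p t = 0}" by (rule poly_roots_finite)
  then have "finite (insert 0 {t. poly p t = 0})" by simp
  moreover have "insert 0 {t. poly p t = 0} = UNIV" using assms by blast
  ultimately show False using infinite_UNIV_char_0[where 'a = complex] by simp
qed

text \<open>A system with a zero outside the chart is a limit of systems with a zero in the chart.\<close>

lemma chart_dense:
  assumes b: "b \<in> zero_locus n d"
    and Q: "\<And>w. w (Inr 0) = s ==> evs (\<lambda>v. chart_system n d w v - s * power_form n d v) s Q = 0"
  shows "evs (\<lambda>v. b v - s * power_form n d v) s Q = 0"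
proof -
  have chart: "evs (\<lambda>v. b' v - s * power_form n d v) s Q = 0"
    if y: "y 0 = 1" "\<And>i. i \<le> n ==> fval n d b' i y = 0" for b' y
  proof -
    define w where "w = (\<lambda>u. case u of Inl v => b' v | Inr k => if k = 0 then s else y k)"
    have cz: "chart_zero w = y" using y(1) by (auto simp: chart_zero_def w_def)
    have "chart_system n d w = b'"
    proof
      fix v :: fcoeff
      obtain i m where v: "v = (i, m)" by force
      show "chart_system n d w v = b' v"
      proof (cases "i \<le> n \<and> m = single 0 d")
        case True
        then have i: "i \<le> n" and m: "m = single 0 d" by auto
        have "mval y (single 0 d) = 1" using y(1) by simp
        then have "b' (i, single 0 d) + (\<Sum>m'\<in>monomials n d - {single 0 d}. b' (i, m') * mval y m') = 0"
          using y(2)[OF i] unfolding fval_remove[OF single_in_monomials[OF le0]] by simp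
        then show ?thesis using i m unfolding chart_system_def cz by (simp add: v w_def add_eq_0_iff)
      qed (auto simp: chart_system_def v w_def)
    qed
    then show ?thesis using Q[of w] by (simp add: w_def)
  qed
  obtain x k where k: "k \<le> n" "x k \<noteq> 0" and x: "\<And>i. i \<le> n ==> fval n d b i x = 0"
    using b unfolding zero_locus_def by blast
  show ?thesis
  proof (cases "x 0 = 0")
    case False
    show ?thesis
    proof (rule chart[of "\<lambda>k. inverse (x 0) * x k"])
      show "inverse (x 0) * x 0 = 1" using False by simp
      show "fval n d b i (\<lambda>k. inverse (x 0) * x k) = 0" if "i \<le> n" for i using x[OF that] by (simp only: fval_scale mult_zero_right)
    qed
  next
    case True
    then have k0: "k \<noteq> 0" using k by metis
    \<comment> \<open>The coordinate 0 of the point is moved from 0 to \<open>t\<close>, and the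
      coefficient of \<open>X_k^d\<close> in every form is corrected so that the moved point is
      still a zero. For \<open>t \<noteq> 0\<close> the point can be scaled into the chart, so the
      polynomial \<open>q\<close> vanishes at \<open>t\<close>; hence it vanishes at 0 too.\<close>
    define xp where "xp = (\<lambda>l. if l = 0 then [:0, 1:] else [:x l:])"
    define bp where "bp = (\<lambda>v. [:b v:] - (if snd v = single k d \<and> fst v \<le> n
      then [:inverse (x k ^ d):] * fval n d (\<lambda>v. [:b v:]) (fst v) xp else 0))"
    define q where "q = evs (\<lambda>v. bp v - [:s:] * [:power_form n d v:]) [:s:] Q"
    have ev: "poly q t = evs (\<lambda>v. poly (bp v) t - s * power_form n d v) s Q" for t
      unfolding q_def by (subst evs_hom[OF comm_ring_hom_poly]) (simp add: mult.commute[of s])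
    have "q = 0"
    proof (rule poly_eq_0_if_infinite_roots)
      fix t :: complex assume t: "t \<noteq> 0"
      define y where "y = (\<lambda>l. if l = 0 then t else x l)"
      have xpt: "poly (xp l) t = y l" for l by (simp add: xp_def y_def)
      have yk: "y k = x k" using k0 by (simp add: y_def)
      have bpt: "poly (bp v) t = b v - (if snd v = single k d \<and> fst v \<le> n then inverse (x k ^ d) * fval n d b (fst v) y else 0)" for v
        by (simp add: bp_def fval_hom[OF comm_ring_hom_poly] xpt)
      have z: "fval n d (\<lambda>v. poly (bp v) t) i y = 0" if i: "i \<le> n" for i
      proof -
        have "fval n d (\<lambda>v. poly (bp v) t) i y = poly (bp (i, single k d)) t * mval y (single k d)
          + (\<Sum>m'\<in>monomials n d - {single k d}. poly (bp (i, m')) t * mval y m')"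
          by (rule fval_remove) (simp add: k)
        also have "(\<Sum>m'\<in>monomials n d - {single k d}. poly (bp (i, m')) t * mval y m')
          = (\<Sum>m'\<in>monomials n d - {single k d}. b (i, m') * mval y m')"
          by (intro sum.cong) (auto simp: bpt)
        also have "poly (bp (i, single k d)) t * mval y (single k d) = b (i, single k d) * mval y (single k d) - fval n d b i y"
          using i k yk by (simp add: bpt field_simps)
        finally show ?thesis using fval_remove[of "single k d" n d b i y] k by simp
      qed
      have "evs (\<lambda>v. poly (bp v) t - s * power_form n d v) s Q = 0"
      proof (rule chart[of "\<lambda>k. inverse t * y k"])
        show "inverse t * y 0 = 1" using t by (simp add: y_def)
        show "fval n d (\<lambda>v. poly (bp v) t) i (\<lambda>k. inverse t * y k) = 0" if "i \<le> n" for i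
          using z[OF that] by (simp only: fval_scale mult_zero_right)
      qed
      then show "poly q t = 0" by (simp add: ev)
    qed
    moreover have "poly (bp v) 0 = b v" for v
    proof -
      have "(\<lambda>l. poly (xp l) 0) = x" using True by (auto simp: xp_def)
      then show ?thesis using x by (simp add: bp_def fval_hom[OF comm_ring_hom_poly])
    qed
    ultimately show ?thesis using ev[of 0] by simp
  qed
qed

lemma power_form_of_int: "of_int (power_form n d v) = power_form n d v"
  by (simp add: power_form_def)

lemma countable_fcoeff: "countable (UNIV :: fcoeff set)"
proof -
  have "countable (UNIV :: (nat \<Rightarrow>\<^sub>0 nat) set)" by (rule countable_poly_mapping) auto
  then show ?thesis by (simp add: UNIV_Times_UNIV[symmetric] del: UNIV_Times_UNIV)
qed

text \<open>A generic point \<open>z\<close> of the zero locus together with an independent shift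
  \<open>s\<close>. All parameters of the chart are algebraically independent, so a relation with
  integer coefficients that holds at this point is an identity in the parameters. It then holds on
  the whole chart and, by density, for every system with a zero.\<close>

lemma generic_zero:
  obtains z :: "fcoeff => complex" and s where "z \<in> zero_locus n d"
    "\<And>Q a t. evs (\<lambda>v. z v - s * power_form n d v) s Q = 0 ==> (\<lambda>v. a v + t * power_form n d v) \<in> zero_locus n d ==> evs a t Q = 0"
proof -
  have "countable (UNIV :: (fcoeff + nat) set)"
    using countable_fcoeff by (simp add: UNIV_Plus_UNIV[symmetric] del: UNIV_Plus_UNIV)
  from ex_generic_point[OF this] obtain w :: "fcoeff + nat => complex"
    where w: "\<And>P :: (fcoeff + nat, int) mpoly. P \<noteq> 0 ==> ieval w P \<noteq> 0" by blast
  define R :: "(fcoeff, int) mpoly poly => (fcoeff + nat, int) mpoly" where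
    "R = evs (\<lambda>v. chart_system n d mvar v - mvar (Inr 0) * power_form n d v) (mvar (Inr 0))"
  have R: "ieval w' (R Q) = evs (\<lambda>v. chart_system n d w' v - w' (Inr 0) * power_form n d v) (w' (Inr 0)) Q" for w' :: "fcoeff + nat => complex" and Q
  proof -
    interpret comm_ring_hom "ieval w' :: (fcoeff + nat, int) mpoly => complex" by (rule comm_ring_hom_ieval)
    have mv: "ieval w' (mvar u) = w' u" for u by (simp add: msubst_mvar)
    have pf: "ieval w' (power_form n d v :: (fcoeff + nat, int) mpoly) = power_form n d v" for v by (simp add: power_form_def)
    show ?thesis unfolding R_def
      by (subst evs_hom[OF comm_ring_hom_ieval])
         (simp only: hom_minus hom_mult chart_system_hom[OF comm_ring_hom_ieval] mv pf)
  qed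
  show thesis
  proof (rule that)
    show "chart_system n d w \<in> zero_locus n d" by (rule chart_system_mem)
    fix Q a and t :: complex
    assume Q: "evs (\<lambda>v. chart_system n d w v - w (Inr 0) * power_form n d v) (w (Inr 0)) Q = 0"
      and b: "(\<lambda>v. a v + t * power_form n d v) \<in> zero_locus n d"
    have "R Q = 0" using w[of "R Q"] Q R by auto
    then have z: "evs (\<lambda>v. chart_system n d w' v - t * power_form n d v) t Q = 0" if "w' (Inr 0) = t" for w'
      using R[of w' Q] that by simp
    have "evs (\<lambda>v. (a v + t * power_form n d v) - t * power_form n d v) t Q = 0"
      by (rule chart_dense[OF b z])
    then show "evs a t Q = 0" by simp
  qed
qed

section \<open>Existence of the resultant\<close>

text \<open>By induction on the index set: one of the quotients \<open>x j / x k\<close> and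
  \<open>x k / x j\<close> lies in the valuation ring. The coordinate found plays the part of one
  with least valuation.\<close>

lemma dominating_coordinate:
  fixes x :: "nat => complex"
  assumes fin: "finite I" and ex: "\<exists>i\<in>I. x i \<noteq> 0"
    and R: "0 \<in> R" "1 \<in> R" "\<And>u v. u \<in> R ==> v \<in> R ==> u * v \<in> R" "\<And>u. u \<noteq> 0 ==> u \<in> R \<or> inverse u \<in> R"
  shows "\<exists>k\<in>I. x k \<noteq> 0 \<and> (\<forall>i\<in>I. x i / x k \<in> R)"
  using fin ex
proof (induction I rule: finite_induct)
  case (insert j I)
  show ?case
  proof (cases "\<exists>i\<in>I. x i \<noteq> 0")
    case False
    then show ?thesis using insert.prems R(1,2) by (intro bexI[of _ j]) auto
  next
    case True
    then obtain k where k: "k \<in> I" "x k \<noteq> 0" "\<And>i. i \<in> I ==> x i / x k \<in> R" using insert.IH by blast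
    show ?thesis
    proof (cases "x j / x k \<in> R")
      case True
      then show ?thesis using k by (intro bexI[of _ k]) auto
    next
      case False
      then have j0: "x j / x k \<noteq> 0" using R(1) by metis
      then have jk: "x k / x j \<in> R" using R(4)[OF j0] False by (simp add: field_simps)
      have "x i / x j \<in> R" if "i \<in> I" for i
      proof -
        have e: "x i / x j = x i / x k * (x k / x j)" using k(2) by simp
        show ?thesis unfolding e by (rule R(3)[OF k(3)[OF that] jk])
      qed
      then show ?thesis using j0 R(2) by (intro bexI[of _ j]) auto
    qed
  qed
qed simp

text \<open>Projective space is proper: after division by a dominating coordinate all coordinates
  lie in the valuation ring and one of them is 1, so the reduced point is not zero. The equations
  reduce along with it.\<close>

lemma specialize_zero:
  assumes pg: "place_graph k G" and val: "\<And>z. z \<noteq> 0 ==> z \<in> fst ` G \<or> inverse z \<in> fst ` G"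
    and za: "\<And>i m. i \<le> n ==> m \<in> monomials n d ==> (z (i, m), a (i, m)) \<in> G"
    and x: "\<exists>k\<le>n. x k \<noteq> 0" "\<And>i. i \<le> n ==> fval n d z i x = 0"
  shows "\<exists>y. (\<exists>k\<le>n. y k \<noteq> 0) \<and> (\<forall>i\<le>n. y i \<in> k) \<and> (\<forall>i\<le>n. fval n d a i y = 0)"
proof -
  interpret place_graph_loc k G by unfold_locales (rule pg)
  have "\<exists>l\<in>{..n}. x l \<noteq> 0 \<and> (\<forall>i\<in>{..n}. x i / x l \<in> fst ` G)"
  proof (rule dominating_coordinate)
    show "0 \<in> fst ` G" using zero by force
    show "1 \<in> fst ` G" using one by force
    show "u * v \<in> fst ` G" if "u \<in> fst ` G" "v \<in> fst ` G" for u v using that mult by force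
  qed (use x val in auto)
  then obtain l where l: "l \<le> n" "x l \<noteq> 0" "\<And>i. i \<le> n ==> x i / x l \<in> fst ` G" by auto
  have "\<forall>i. \<exists>y. i \<le> n --> (x i / x l, y) \<in> G" using l(3) by force
  then obtain y where y: "\<And>i. i \<le> n ==> (x i / x l, y i) \<in> G" by metis
  have "(1, y l) \<in> G" using y[OF l(1)] l(2) by simp
  then have yl: "y l = 1" using functional[OF _ one] by blast
  have pr: "(prod f I, prod g I) \<in> G" if "\<And>i. i \<in> I ==> (f i, g i) \<in> G" for f g and I :: "nat set"
    using that by (induction I rule: infinite_finite_induct) (auto simp: one intro: mult)
  have "fval n d a i y = 0" if i: "i \<le> n" for i
  proof -
    have "(mval (\<lambda>i. x i / x l) m, mval y m) \<in> G" if "m \<in> monomials n d" for m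
      unfolding mval_def using that y by (intro pr power) (auto simp: monomials_def)
    then have "(fval n d z i (\<lambda>i. x i / x l), fval n d a i y) \<in> G"
      unfolding fval_def using za i by (intro sum mult) auto
    moreover have "fval n d z i (\<lambda>i. inverse (x l) * x i) = 0" using x(2)[OF i] by (simp only: fval_scale mult_zero_right)
    moreover have "(\<lambda>i. inverse (x l) * x i) = (\<lambda>i. x i / x l)" by (rule ext) (simp add: field_simps)
    ultimately show ?thesis using fun0 by metis
  qed
  moreover have "\<forall>i\<le>n. y i \<in> k" using y rng by blast
  ultimately show ?thesis using l(1) yl by (intro exI[of _ y] conjI exI[of _ l]) auto
qed

lemma ex_root_complex: "degree (p :: complex poly) > 0 ==> \<exists>z. poly p z = 0"
  using fundamental_theorem_of_algebra[of p] by (simp add: constant_degree)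

text \<open>The dimension theorem for \<open>n\<close> forms in \<open>n + 1\<close> variables. The
  construction of the resultant for \<open>n\<close> depends on it, and the resultant for
  \<open>n\<close> in turn yields it for \<open>n + 1\<close>.\<close>

definition forms_have_zero :: "nat => nat => bool" where
  "forms_have_zero n d \<longleftrightarrow> (\<forall>a :: fcoeff => complex. \<exists>x. (\<exists>k\<le>n. x k \<noteq> 0) \<and> (\<forall>i<n. fval n d a i x = 0))"

text \<open>The projection of the zero locus along the power forms is dominant. Otherwise let
  \<open>a\<close> be generic. For each \<open>s\<close> the first \<open>n\<close> forms of the
  system shifted by \<open>s\<close> have a zero, and adding a multiple \<open>t\<close> of
  \<open>X_k^d\<close> to the last form makes it vanish there too. These \<open>t\<close> are roots
  of the nonzero polynomial \<open>p\<close>, so infinitely many \<open>s\<close> share one value of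
  \<open>t\<close>; but all of them are roots of one monic Macaulay polynomial.\<close>

lemma shifts_meet_zero_locus:
  assumes nz: "forms_have_zero n d" and e: "e \<noteq> (0 :: (fcoeff, int) mpoly)"
  shows "\<exists>a t. (\<lambda>v. a v + t * power_form n d v) \<in> zero_locus n d \<and> ieval a e \<noteq> 0"
proof (rule ccontr)
  assume neg: "\<not> ?thesis"
  obtain a where a: "ieval a e \<noteq> (0 :: complex)" using ex_generic_point[OF countable_fcoeff] e by blast
  have "\<forall>s. \<exists>x k. k \<le> n \<and> x k \<noteq> 0 \<and> (\<forall>i<n. fval n d (\<lambda>v. a v + s * power_form n d v) i x = 0)"
    using nz unfolding forms_have_zero_def by blast
  then obtain xz kz where xk: "\<And>s. kz s \<le> n" "\<And>s. xz s (kz s) \<noteq> 0"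
    "\<And>s i. i < n ==> fval n d (\<lambda>v. a v + s * power_form n d v) i (xz s) = 0" by metis
  have "finite (kz ` (UNIV :: complex set))" by (rule finite_subset[of _ "{..n}"]) (use xk in auto)
  from pigeonhole_infinite[OF infinite_UNIV_char_0 this] obtain s0 where "infinite {s. kz s = kz s0}" by auto
  define k where "k = kz s0"
  define Ss where "Ss = {s. kz s = k}"
  have Ss: "infinite Ss" "k \<le> n"
    using \<open>infinite {s. kz s = kz s0}\<close> xk(1) by (auto simp: Ss_def k_def)
  have xzk: "xz s k \<noteq> 0" if "s \<in> Ss" for s using that xk(2)[of s] by (simp add: Ss_def)
  define tt where "tt = (\<lambda>s. - fval n d (\<lambda>v. a v + s * power_form n d v) n (xz s) / xz s k ^ d)"
  define b where "b = (\<lambda>t v. a v + (if v = (n, single k d) then t else 0))"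
  have mem: "(\<lambda>v. b (tt s) v + s * power_form n d v) \<in> zero_locus n d" if s: "s \<in> Ss" for s
  proof -
    have "fval n d (\<lambda>v. b (tt s) v + s * power_form n d v) i (xz s) = 0" if i: "i \<le> n" for i
    proof -
      have "(\<lambda>v. b (tt s) v + s * power_form n d v) = (\<lambda>v. (a v + s * power_form n d v) + (if v = (n, single k d) then tt s else 0))"
        by (rule ext) (simp add: b_def)
      then have "fval n d (\<lambda>v. b (tt s) v + s * power_form n d v) i (xz s)
        = fval n d (\<lambda>v. a v + s * power_form n d v) i (xz s) + (if n = i then tt s * mval (xz s) (single k d) else 0)"
        by (simp only: fval_add fval_single[OF single_in_monomials[OF Ss(2)]])
      then show ?thesis using xk(3)[of i s] i xzk[OF s] by (cases "i = n") (auto simp: tt_def)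
    qed
    then show ?thesis unfolding zero_locus_def using Ss(2) xzk[OF s] by (intro CollectI exI[of _ "xz s"]) auto
  qed
  define p where "p = ieval (\<lambda>v. [:a v:] + (if v = (n, single k d) then [:0, 1:] else 0)) e"
  have p: "poly p t = ieval (b t) e" for t
    unfolding p_def by (subst ieval_hom[OF comm_ring_hom_poly]) (auto simp: b_def intro!: msubst_cong)
  have "poly p 0 \<noteq> 0" using a by (simp add: p b_def)
  then have "p \<noteq> 0" by auto
  moreover have "tt ` Ss \<subseteq> {t. poly p t = 0}" using neg mem by (auto simp: p)
  ultimately have "finite (tt ` Ss)" using poly_roots_finite finite_subset by blast
  from pigeonhole_infinite[OF Ss(1) this] obtain s1 where s1: "infinite {s\<in>Ss. tt s = tt s1}" by blast
  let ?q = "map_poly (ieval (b (tt s1))) (mac_poly n d 0)"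
  have "?q \<noteq> 0" using lead_coeff_map_poly_hom[OF comm_ring_hom_ieval, of "b (tt s1)" "mac_poly n d 0"]
    unfolding mac_poly_monic by (auto simp: comm_ring_hom.axioms msubst_mval)
  moreover have "poly ?q s = 0" if "s \<in> Ss" "tt s = tt s1" for s
    using mac_det_zero_locus[OF mem[OF that(1)], of 0] that by (simp add: mac_poly_eval)
  ultimately show False using s1 poly_roots_finite[of ?q] finite_subset[of "{s\<in>Ss. tt s = tt s1}" "{s. poly ?q s = 0}"] by auto
qed

text \<open>The shift \<open>s\<close> is integral over the ring generated by the independent
  numbers \<open>a0\<close>, and its minimal polynomial \<open>\<chi>\<close> divides all relations.
  At shift 0 this says that \<open>poly \<chi> 0\<close> divides every polynomial vanishing at the
  generic system \<open>z\<close>. Conversely, if it vanishes at \<open>a\<close>, then mapping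
  \<open>z\<close> to \<open>a\<close> is a well-defined ring homomorphism; extended to a valuation
  ring it carries a zero of \<open>z\<close> to a zero of \<open>a\<close>.\<close>

lemma generator_of_zero_locus:
  assumes nz: "forms_have_zero n d"
  obtains \<rho> :: "(fcoeff, int) mpoly" where
    "\<And>P. (\<And>a. a \<in> zero_locus n d ==> ieval a P = 0) ==> \<rho> dvd P"
    "\<And>a. ieval a \<rho> = 0 \<longleftrightarrow> a \<in> zero_locus n d"
proof -
  obtain z s where z: "z \<in> zero_locus n d" and gen:
    "\<And>Q a t. evs (\<lambda>v. z v - s * power_form n d v) s Q = 0 ==> (\<lambda>v. a v + t * power_form n d v) \<in> zero_locus n d ==> evs a t Q = 0"
    using generic_zero by blast
  define a0 where "a0 = (\<lambda>v. z v - s * power_form n d v)"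
  have shift: "evs a t (shift_poly (power_form n d) P) = ieval (\<lambda>v. a v + t * power_form n d v) P" for a P and t :: complex
    by (simp add: evs_shift_poly power_form_of_int)
  have const: "evs a t [:e:] = ieval a e" for a and t :: complex and e :: "(fcoeff, int) mpoly"
  proof -
    interpret comm_ring_hom "ieval a :: (fcoeff, int) mpoly => complex" by (rule comm_ring_hom_ieval)
    show ?thesis by (simp add: map_poly_pCons_hom)
  qed
  have indep: "ieval a0 e \<noteq> 0" if "e \<noteq> 0" for e :: "(fcoeff, int) mpoly"
  proof
    assume "ieval a0 e = 0"
    then have "evs a0 s [:e:] = 0" by (simp only: const)
    then have "ieval a e = 0" if "(\<lambda>v. a v + t * power_form n d v) \<in> zero_locus n d" for a t
      using gen[of "[:e:]" a t] that by (simp only: const a0_def)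
    then show False using shifts_meet_zero_locus[OF nz that] by blast
  qed
  have "evs a0 s (mac_poly n d 0) = 0"
    using mac_det_zero_locus[OF z, of 0] by (simp add: mac_poly_eval a0_def)
  from integral_minimal_polynomial[OF indep mac_poly_monic this] obtain \<chi>
    where \<chi>: "lead_coeff \<chi> = 1" "evs a0 s \<chi> = 0" "\<And>Q. evs a0 s Q = 0 ==> \<chi> dvd Q" by blast
  have dvd: "poly \<chi> 0 dvd P" if "ieval z P = 0" for P
  proof -
    have "evs a0 s (shift_poly (power_form n d) P) = 0" using that by (simp add: shift a0_def)
    from \<chi>(3)[OF this] obtain q where "shift_poly (power_form n d) P = \<chi> * q" by (elim dvdE)
    then have "P = poly \<chi> 0 * poly q 0" by (metis poly_mult poly_shift_poly_0)
    then show ?thesis by simp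
  qed
  have vanish: "ieval a (poly \<chi> 0) = 0" if "a \<in> zero_locus n d" for a
  proof -
    have "evs a 0 \<chi> = 0" using gen[OF \<chi>(2)[unfolded a0_def], of a 0] that by simp
    moreover have "evs a 0 \<chi> = ieval a (poly \<chi> 0)"
    proof -
      interpret comm_ring_hom "ieval a :: (fcoeff, int) mpoly => complex" by (rule comm_ring_hom_ieval)
      show ?thesis by (simp add: poly_0_coeff_0)
    qed
    ultimately show ?thesis by simp
  qed
  show thesis
  proof (rule that[of "poly \<chi> 0"])
    show "poly \<chi> 0 dvd P" if "\<And>a. a \<in> zero_locus n d ==> ieval a P = 0" for P using dvd that z by blast
    fix a show "ieval a (poly \<chi> 0) = 0 \<longleftrightarrow> a \<in> zero_locus n d"
    proof
      assume a: "ieval a (poly \<chi> 0) = 0"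
      define G0 where "G0 = range (\<lambda>P :: (fcoeff, int) mpoly. (ieval z P, ieval a P))"
      have memG: "(ieval z P, ieval a P) \<in> G0" for P by (auto simp: G0_def)
      interpret za: comm_ring_hom "ieval z :: (fcoeff, int) mpoly => complex" by (rule comm_ring_hom_ieval)
      interpret aa: comm_ring_hom "ieval a :: (fcoeff, int) mpoly => complex" by (rule comm_ring_hom_ieval)
      have pgU: "place_graph UNIV G0"
        unfolding place_graph_def
      proof (intro conjI allI impI)
        show "(1, 1) \<in> G0" using memG[of 1] by simp
        fix y assume "(0, y) \<in> G0"
        then obtain P where P: "ieval z P = 0" "y = ieval a P" by (auto simp: G0_def)
        from dvd[OF P(1)] obtain q where "P = poly \<chi> 0 * q" by (elim dvdE)
        then show "y = 0" using a P(2) by (simp add: aa.hom_mult)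
      next
        fix x y x' y' assume "(x, y) \<in> G0" "(x', y') \<in> G0"
        then obtain P P' where e: "x = ieval z P" "y = ieval a P" "x' = ieval z P'" "y' = ieval a P'" by (auto simp: G0_def)
        show "(x - x', y - y') \<in> G0" using memG[of "P - P'"] by (simp add: e za.hom_minus aa.hom_minus)
        show "(x * x', y * y') \<in> G0" using memG[of "P * P'"] by (simp add: e za.hom_mult aa.hom_mult)
      qed simp
      obtain G where G: "G0 \<subseteq> G" "place_graph UNIV G" "\<And>u. u \<noteq> 0 ==> u \<in> fst ` G \<or> inverse u \<in> fst ` G"
        by (rule place_extension[OF pgU]) (auto intro: ex_root_complex)
      obtain x where x: "\<exists>k\<le>n. x k \<noteq> 0" "\<And>i. i \<le> n ==> fval n d z i x = 0" using z unfolding zero_locus_def by blast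
      have "(z v, a v) \<in> G" for v using G(1) memG[of "mvar v"] by (auto simp: msubst_mvar)
      from specialize_zero[OF G(2,3) this x] show "a \<in> zero_locus n d" unfolding zero_locus_def by blast
    qed (rule vanish)
  qed
qed

section \<open>Dimension theorem and degree of the resultant\<close>

definition is_res :: "nat => nat => (fcoeff, int) mpoly => bool" where
  "is_res n d \<rho> \<longleftrightarrow> (\<forall>t\<in>keys \<rho>. keys t \<subseteq> {..n} \<times> monomials n d \<and> mdegree t = (n + 1) * d ^ n) \<and>
     ieval (power_form n d) \<rho> = (1 :: complex) \<and> (\<forall>a. ieval a \<rho> = 0 \<longleftrightarrow> a \<in> zero_locus n d)"

lemma const_if_no_root: "(\<And>t. poly p t \<noteq> 0) ==> poly p t = poly p (u :: complex)"
  using ex_root_complex[of p] by (cases "degree p > 0") (auto elim!: degree_eq_zeroE)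

text \<open>Restriction of the forms to the hyperplane \<open>\<beta> X_n = \<alpha> X_(n+1)\<close>.\<close>

definition collapse :: "nat => (nat \<Rightarrow>\<^sub>0 nat) => (nat \<Rightarrow>\<^sub>0 nat)" where
  "collapse n m = m - single (Suc n) (lookup m (Suc n)) + single n (lookup m (Suc n))"

definition restrict_system :: "nat => nat => (fcoeff => 'b) => 'b => 'b => fcoeff => 'b::comm_ring_1" where
  "restrict_system n d a \<alpha> \<beta> v = (\<Sum>m\<in>monomials (Suc n) d.
     if collapse n m = snd v then a (fst v, m) * (\<alpha> ^ lookup m n * \<beta> ^ lookup m (Suc n)) else 0)"

lemma restrict_system_hom:
  assumes "comm_ring_hom g"
  shows "g (restrict_system n d a \<alpha> \<beta> v) = restrict_system n d (\<lambda>v. g (a v)) (g \<alpha>) (g \<beta>) v"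
proof -
  interpret comm_ring_hom g by fact
  show ?thesis by (simp add: restrict_system_def hom_sum hom_mult hom_power if_distrib[of g] cong: if_cong)
qed

lemma collapse_split:
  obtains r where "m = r + single n (lookup m n) + single (Suc n) (lookup m (Suc n))"
    "collapse n m = r + single n (lookup m n) + single n (lookup m (Suc n))" "n \<notin> keys r" "Suc n \<notin> keys r"
proof -
  define r where "r = m - single (Suc n) (lookup m (Suc n)) - single n (lookup m n)"
  have e: "m - single (Suc n) (lookup m (Suc n)) = r + single n (lookup m n)"
    by (rule poly_mapping_eqI) (auto simp: r_def lookup_add lookup_minus lookup_single when_def)
  show thesis
  proof (rule that[of r])
    show "m = r + single n (lookup m n) + single (Suc n) (lookup m (Suc n))"
      by (rule poly_mapping_eqI) (auto simp: r_def lookup_add lookup_minus lookup_single when_def)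
    show "collapse n m = r + single n (lookup m n) + single n (lookup m (Suc n))" by (simp add: collapse_def e)
  qed (auto simp: r_def in_keys_iff lookup_minus lookup_single when_def)
qed

lemma collapse_in_monomials:
  assumes m: "m \<in> monomials (Suc n) d" shows "collapse n m \<in> monomials n d"
proof -
  obtain r where r: "m = r + single n (lookup m n) + single (Suc n) (lookup m (Suc n))"
    "collapse n m = r + single n (lookup m n) + single n (lookup m (Suc n))" "n \<notin> keys r" "Suc n \<notin> keys r" by (rule collapse_split)
  have "mdegree (collapse n m) = mdegree r + lookup m n + lookup m (Suc n)" by (simp only: r(2) mdegree_add mdegree_single)
  also have "\<dots> = mdegree m" by (subst (3) r(1)) (simp only: mdegree_add mdegree_single)
  finally have "mdegree (collapse n m) = d" using m by (simp add: monomials_def)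
  moreover have "lookup (collapse n m) k = 0" if "k > n" for k
  proof (cases "k = Suc n")
    case True
    then show ?thesis by (simp add: collapse_def lookup_add lookup_minus lookup_single when_def)
  next
    case False
    then have "k \<notin> keys m" using m that by (auto simp: monomials_def)
    then show ?thesis using that False by (simp add: collapse_def lookup_add lookup_minus lookup_single when_def in_keys_iff)
  qed
  ultimately show ?thesis by (auto simp: monomials_def in_keys_iff not_le[symmetric])
qed

lemma fval_restrict_system:
  "fval n d (restrict_system n d a \<alpha> \<beta>) i y = fval (Suc n) d a i (\<lambda>k. if k = n then \<alpha> * y n else if k = Suc n then \<beta> * y n else y k)"
proof -
  let ?y = "\<lambda>k. if k = n then \<alpha> * y n else if k = Suc n then \<beta> * y n else y k"
  have val: "mval ?y m = \<alpha> ^ lookup m n * \<beta> ^ lookup m (Suc n) * mval y (collapse n m)" for m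
  proof -
    obtain r where r: "m = r + single n (lookup m n) + single (Suc n) (lookup m (Suc n))"
      "collapse n m = r + single n (lookup m n) + single n (lookup m (Suc n))" "n \<notin> keys r" "Suc n \<notin> keys r" by (rule collapse_split)
    have "mval ?y r = mval y r" using r(3,4) by (intro mval_cong) metis
    then have "mval ?y m = mval y r * (\<alpha> * y n) ^ lookup m n * (\<beta> * y n) ^ lookup m (Suc n)"
      by (subst r(1)) (simp add: mval_add)
    also have "\<dots> = \<alpha> ^ lookup m n * \<beta> ^ lookup m (Suc n) * mval y (collapse n m)"
      unfolding r(2) by (simp add: mval_add power_mult_distrib mult_ac)
    finally show ?thesis .
  qed
  have "fval n d (restrict_system n d a \<alpha> \<beta>) i y = (\<Sum>m'\<in>monomials n d. \<Sum>m\<in>monomials (Suc n) d.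
     if collapse n m = m' then a (i, m) * (\<alpha> ^ lookup m n * \<beta> ^ lookup m (Suc n)) * mval y m' else 0)"
    unfolding fval_def restrict_system_def sum_distrib_right by (intro sum.cong) auto
  also have "\<dots> = (\<Sum>m\<in>monomials (Suc n) d. \<Sum>m'\<in>monomials n d.
     if collapse n m = m' then a (i, m) * (\<alpha> ^ lookup m n * \<beta> ^ lookup m (Suc n)) * mval y m' else 0)"
    by (rule sum.swap)
  also have "\<dots> = (\<Sum>m\<in>monomials (Suc n) d. a (i, m) * mval ?y m)"
    using collapse_in_monomials by (intro sum.cong) (auto simp: val sum.delta mult_ac)
  finally show ?thesis by (simp add: fval_def)
qed

text \<open>If the forms had no common zero, the resultant \<open>p \<alpha> \<beta>\<close> of
  their restrictions to the hyperplanes of a pencil would be nonzero off the origin. Without roots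
  on a line, it is constant there; two lines avoiding the origin give
  \<open>p 0 \<beta> = p 1 0\<close> for \<open>\<beta> \<noteq> 0\<close>. This identity of
  polynomials extends to \<open>\<beta> = 0\<close>, where \<open>p\<close> vanishes.\<close>

lemma forms_have_zero_Suc:
  assumes d: "d \<ge> 1" and \<rho>: "\<And>a. ieval a \<rho> = 0 \<longleftrightarrow> a \<in> zero_locus n d"
  shows "forms_have_zero (Suc n) d"
proof (rule ccontr)
  assume "\<not> ?thesis"
  then obtain a :: "fcoeff => complex" where
    a: "\<And>x. (\<exists>k\<le>Suc n. x k \<noteq> 0) ==> \<exists>i<Suc n. fval (Suc n) d a i x \<noteq> 0" unfolding forms_have_zero_def by metis
  define p where "p = (\<lambda>\<alpha> \<beta>. ieval (restrict_system n d a \<alpha> \<beta>) \<rho>)"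
  have nz: "p \<alpha> \<beta> \<noteq> 0" if ab: "\<alpha> \<noteq> 0 \<or> \<beta> \<noteq> 0" for \<alpha> \<beta>
  proof
    assume "p \<alpha> \<beta> = 0"
    then have "restrict_system n d a \<alpha> \<beta> \<in> zero_locus n d" using \<rho> by (simp add: p_def)
    then obtain y k where k: "k \<le> n" "y k \<noteq> 0" and y: "\<And>i. i \<le> n ==> fval n d (restrict_system n d a \<alpha> \<beta>) i y = 0"
      unfolding zero_locus_def by blast
    let ?y = "\<lambda>k. if k = n then \<alpha> * y n else if k = Suc n then \<beta> * y n else y k"
    have "\<exists>k\<le>Suc n. ?y k \<noteq> 0"
    proof (cases "y n = 0")
      case True
      then have "k \<noteq> n" using k by metis
      then show ?thesis using k by (intro exI[of _ k]) auto
    next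
      case False
      have "?y n \<noteq> 0 \<or> ?y (Suc n) \<noteq> 0" using ab False by simp
      then show ?thesis using le_SucI[OF order_refl[of n]] order_refl[of "Suc n"] by blast
    qed
    from a[OF this] obtain i where "i < Suc n" "fval (Suc n) d a i ?y \<noteq> 0" by blast
    then show False using y[of i] by (simp add: fval_restrict_system)
  qed
  have z: "p 0 0 = 0"
  proof -
    have "fval n d (restrict_system n d a 0 0) i (\<lambda>k. if k = n then 1 else 0) = 0" for i
    proof -
      have "(\<lambda>k. if k = n then 0 * (if n = n then 1 else 0) else if k = Suc n then 0 * (if n = n then 1 else 0) else if k = n then 1 else 0)
        = (\<lambda>k::nat. 0 * (1::complex))" by auto
      then show ?thesis unfolding fval_restrict_system using d by (simp only: fval_scale power_0_left) simp
    qed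
    then have "restrict_system n d a 0 0 \<in> zero_locus n d" unfolding zero_locus_def
      by (intro CollectI exI[of _ "\<lambda>k. if k = n then 1 else 0"]) auto
    then show ?thesis using \<rho> by (simp add: p_def)
  qed
  define q where "q = (\<lambda>\<alpha> \<beta>. ieval (restrict_system n d (\<lambda>v. [:a v:]) \<alpha> \<beta>) \<rho>)"
  have q: "poly (q \<alpha> \<beta>) t = p (poly \<alpha> t) (poly \<beta> t)" for \<alpha> \<beta> t
    unfolding q_def p_def by (subst ieval_hom[OF comm_ring_hom_poly]) (simp add: restrict_system_hom[OF comm_ring_hom_poly])
  have "p 0 \<beta> = p 1 0" if "\<beta> \<noteq> 0" for \<beta>
  proof -
    have "poly (q [:0, 1:] [:\<beta>:]) 0 = poly (q [:0, 1:] [:\<beta>:]) 1" by (rule const_if_no_root) (simp add: q nz that)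
    moreover have "poly (q 1 [:0, 1:]) \<beta> = poly (q 1 [:0, 1:]) 0" by (rule const_if_no_root) (simp add: q nz)
    ultimately show ?thesis by (simp add: q)
  qed
  then have "q 0 [:0, 1:] - [:p 1 0:] = 0" by (intro poly_eq_0_if_infinite_roots) (simp add: q)
  then have "poly (q 0 [:0, 1:] - [:p 1 0:]) 0 = 0" by (simp only: poly_0)
  then have "p 0 0 = p 1 0" by (simp add: q)
  then show False using z nz by simp
qed

lemma forms_have_zero_0: "forms_have_zero 0 d"
  unfolding forms_have_zero_def by (intro allI exI[of _ "\<lambda>_. 1"]) auto

definition block_weight :: "nat => fcoeff => nat" where
  "block_weight j v = (if fst v = j then 1 else 0)"

lemma mval_monom: "mval (\<lambda>v. monom (a v) (w v)) t = (monom (mval a t) (mweight w t) :: 'a::comm_ring_1 poly)"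
proof -
  have "(\<Prod>v\<in>A. monom (a v) (w v) ^ f v) = (monom (\<Prod>v\<in>A. a v ^ f v) (\<Sum>v\<in>A. w v * f v) :: 'a poly)" for A and f
    by (induction A rule: infinite_finite_induct) (simp_all add: monom_power mult_monom)
  then show ?thesis by (simp add: mval_def mweight_def)
qed

lemma factor_of_monom:
  fixes p q :: "complex poly"
  assumes "p * q = monom c N" "c \<noteq> 0" shows "\<exists>b k. p = monom b k \<and> k \<le> N"
  using assms(1)
proof (induction N arbitrary: p q)
  case 0
  then have "degree (p * q) = 0" "p * q \<noteq> 0" using assms(2) by (auto simp: monom_0)
  then have "degree p = 0" by (auto simp: degree_mult_eq)
  then show ?case by (auto elim!: degree_eq_zeroE simp: monom_0[symmetric])
next
  case (Suc N)
  then have "poly (p * q) 0 = 0" by (simp add: poly_monom)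
  then consider "poly p 0 = 0" | "poly q 0 = 0" by auto
  then show ?case
  proof cases
    case 1
    then obtain p1 where p1: "p = pCons 0 p1" by (metis pCons_cases poly_pCons mult_zero_left add.right_neutral)
    have "pCons 0 (p1 * q) = pCons 0 (monom c N)" using Suc.prems by (simp add: p1 monom_Suc)
    then obtain b k where "p1 = monom b k" "k \<le> N" using Suc.IH[of p1 q] by auto
    then show ?thesis by (intro exI[of _ b] exI[of _ "Suc k"]) (simp add: p1 monom_Suc)
  next
    case 2
    then obtain q1 where q1: "q = pCons 0 q1" by (metis pCons_cases poly_pCons mult_zero_left add.right_neutral)
    have "pCons 0 (p * q1) = pCons 0 (monom c N)" using Suc.prems by (simp add: q1 monom_Suc)
    then obtain b k where "p = monom b k" "k \<le> N" using Suc.IH[of p q1] by auto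
    then show ?thesis by (intro exI[of _ b] exI[of _ k]) simp
  qed
qed

text \<open>Scale the coefficients of the form \<open>j\<close> by \<open>t\<close> at a generic
  point. The Macaulay determinant becomes a constant times a power of \<open>t\<close>, and a factor
  of a monomial in \<open>\<complex>[t]\<close> is a monomial. Terms of different degree in the
  block would show, as nothing cancels at a generic point.\<close>

lemma block_homogeneous:
  fixes P :: "(fcoeff, int) mpoly"
  assumes j: "j \<le> n" and dv: "P dvd mac_det n d j mvar"
  shows "\<exists>k\<le>mac_size n d j. \<forall>t\<in>keys P. mweight (block_weight j) t = k"
proof -
  obtain a :: "fcoeff => complex" where a: "\<And>e :: (fcoeff, int) mpoly. e \<noteq> 0 ==> ieval a e \<noteq> 0"
    using ex_generic_point[OF countable_fcoeff] by blast
  obtain Q where Q: "mac_det n d j mvar = P * Q" using dv by (elim dvdE)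
  define x where "x = (\<lambda>v. monom (a v) (block_weight j v))"
  interpret comm_ring_hom "ieval x :: (fcoeff, int) mpoly => complex poly" by (rule comm_ring_hom_ieval)
  have x: "x v = (if fst v = j then [:0, 1:] else 1) * [:a v:]" for v
    by (simp add: x_def block_weight_def monom_0 monom_Suc)
  have "ieval x (mac_det n d j mvar) = mac_det n d j x"
    by (subst mac_det_hom[OF comm_ring_hom_ieval]) (simp add: msubst_mvar)
  also have "mac_det n d j x = [:0, 1:] ^ mac_size n d j * mac_det n d j (\<lambda>v. [:a v:])"
    unfolding x mac_det_scale ..
  also have "mac_det n d j (\<lambda>v. [:a v:]) = [:mac_det n d j a:]" by (rule mac_det_hom[OF comm_ring_hom_const_poly, symmetric])
  finally have "ieval x P * ieval x Q = monom (mac_det n d j a) (mac_size n d j)"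
    by (simp add: Q hom_mult monom_altdef)
  moreover have "mac_det n d j a \<noteq> 0"
  proof -
    have "ieval (power_form n d) (mac_det n d j mvar :: (fcoeff, int) mpoly) = (1 :: complex)"
      by (subst mac_det_hom[OF comm_ring_hom_ieval]) (simp add: msubst_mvar mac_det_power_form[OF j])
    then have "(mac_det n d j mvar :: (fcoeff, int) mpoly) \<noteq> 0" by auto
    from a[OF this] show ?thesis by (subst (asm) mac_det_hom[OF comm_ring_hom_ieval]) (simp add: msubst_mvar)
  qed
  ultimately obtain b k where bk: "ieval x P = monom b k" "k \<le> mac_size n d j" using factor_of_monom by blast
  have "mweight (block_weight j) t = k" if t: "t \<in> keys P" for t
  proof (rule ccontr)
    assume ne: "mweight (block_weight j) t \<noteq> k"
    define S where "S = {u\<in>keys P. mweight (block_weight j) u = mweight (block_weight j) t}"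
    define R where "R = (\<Sum>u\<in>S. single u (lookup P u))"
    have fin: "finite S" by (simp add: S_def)
    have "lookup R t = (\<Sum>u\<in>S. if u = t then lookup P t else 0)" unfolding R_def lookup_sum lookup_single when_def by (intro sum.cong) auto
    also have "\<dots> = lookup P t" using fin t by (simp add: S_def)
    finally have "R \<noteq> 0" using t by (auto simp: in_keys_iff)
    from a[OF this] have "ieval a R \<noteq> 0" .
    moreover have "ieval a R = coeff (ieval x P) (mweight (block_weight j) t)"
    proof -
      have "coeff (ieval x P) (mweight (block_weight j) t)
        = (\<Sum>u\<in>keys P. if mweight (block_weight j) u = mweight (block_weight j) t then of_int (lookup P u) * mval a u else 0)"
        unfolding msubst_mval coeff_sum unfolding x_def mval_monom by (intro sum.cong) (auto simp: of_int_poly)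
      also have "\<dots> = (\<Sum>u\<in>S. of_int (lookup P u) * mval a u)" unfolding S_def by (simp add: sum.inter_filter)
      finally show ?thesis unfolding R_def by (simp add: msubst_sum msubst_single)
    qed
    ultimately show False using ne bk(1) by simp
  qed
  then show ?thesis using bk(2) by blast
qed

text \<open>The system \<open>X_i^d = X_j^d\<close>, \<open>i \<noteq> j\<close>, has \<open>d^n\<close> zeros; the remaining form
  \<open>t X_j^d + X_j^(d-1) \<Sum>\<^sub>i T^i X_i\<close> vanishes at one of them for \<open>d^n\<close> values of \<open>t\<close>.\<close>

definition pencil :: "nat => nat => nat => 'b => 'b => fcoeff => 'b::comm_ring_1" where
  "pencil n d j T t v = (if fst v = j
     then (if snd v = single j d then t else 0) + (\<Sum>i\<in>{..n} - {j}. if snd v = single j (d - 1) + single i 1 then T ^ i else 0)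
     else power_form n d v - (if snd v = single j d then 1 else 0))"

lemma fval_monomial: "m \<in> monomials n d ==> (\<Sum>m'\<in>monomials n d. (if m' = m then c else 0) * mval x m') = c * mval x m"
proof -
  assume m: "m \<in> monomials n d"
  have "(\<Sum>m'\<in>monomials n d. (if m' = m then c else 0) * mval x m') = (\<Sum>m'\<in>monomials n d. if m' = m then c * mval x m else 0)"
    by (intro sum.cong) auto
  then show ?thesis using m by simp
qed

lemma fval_pencil:
  assumes j: "j \<le> n" and i: "i \<le> n" and d: "d \<ge> 1"
  shows "fval n d (pencil n d j T t) i x = (if i = j
    then t * x j ^ d + (\<Sum>l\<in>{..n} - {j}. T ^ l * (x j ^ (d - 1) * x l)) else x i ^ d - x j ^ d)"
proof (cases "i = j")
  case True
  have mem: "single j (d - 1) + single l 1 \<in> monomials n d" if "l \<le> n" for l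
    using add_in_monomials[OF single_in_monomials[OF j, of "d - 1"] single_in_monomials[OF that, of 1]] d by simp
  have "fval n d (pencil n d j T t) i x = (\<Sum>m\<in>monomials n d. (if m = single j d then t else 0) * mval x m)
     + (\<Sum>m\<in>monomials n d. \<Sum>l\<in>{..n} - {j}. (if m = single j (d - 1) + single l 1 then T ^ l else 0) * mval x m)"
    unfolding fval_def sum.distrib[symmetric] using True
    by (intro sum.cong) (simp_all add: pencil_def distrib_right sum_distrib_right)
  also have "\<dots> = t * x j ^ d + (\<Sum>l\<in>{..n} - {j}. T ^ l * (x j ^ (d - 1) * x l))"
    using j mem by (subst sum.swap) (simp add: fval_monomial mval_add)
  finally show ?thesis using True by simp
next
  case False
  have "fval n d (pencil n d j T t) i x = fval n d (power_form n d) i x - (\<Sum>m\<in>monomials n d. (if m = single j d then 1 else 0) * mval x m)"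
    unfolding fval_def sum_subtractf[symmetric] using False by (intro sum.cong) (simp_all add: pencil_def left_diff_distrib)
  then show ?thesis using False i j by (simp add: fval_power_form fval_monomial)
qed

lemma ex_separating_scalar:
  fixes \<Xi> :: "(nat => complex) set"
  assumes fin: "finite \<Xi>" "finite I" and ext: "\<And>\<xi> \<xi>'. \<xi> \<in> \<Xi> ==> \<xi>' \<in> \<Xi> ==> (\<And>i. i \<in> I ==> \<xi> i = \<xi>' i) ==> \<xi> = \<xi>'"
  shows "\<exists>T. inj_on (\<lambda>\<xi>. \<Sum>i\<in>I. T ^ i * \<xi> i) \<Xi>"
proof -
  define p where "p = (\<lambda>\<xi> :: nat => complex. \<Sum>i\<in>I. monom (\<xi> i) i)"
  have cp: "coeff (p \<xi>) i = \<xi> i" if "i \<in> I" for \<xi> i using that fin by (simp add: p_def coeff_sum)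
  have pinj: "\<xi> = \<xi>'" if "p \<xi> = p \<xi>'" "\<xi> \<in> \<Xi>" "\<xi>' \<in> \<Xi>" for \<xi> \<xi>' using ext that cp by metis
  define B where "B = (\<Union>q\<in>{(\<xi>, \<xi>')\<in>\<Xi> \<times> \<Xi>. p \<xi> \<noteq> p \<xi>'}. {z. poly (p (fst q) - p (snd q)) z = 0})"
  have "finite B" unfolding B_def
  proof (rule finite_UN_I)
    show "finite {(\<xi>, \<xi>')\<in>\<Xi> \<times> \<Xi>. p \<xi> \<noteq> p \<xi>'}" by (rule finite_subset[of _ "\<Xi> \<times> \<Xi>"]) (use fin in auto)
  qed (auto simp del: poly_diff intro!: poly_roots_finite)
  then obtain T where T: "T \<notin> B" using ex_new_if_finite[OF infinite_UNIV_char_0] by blast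
  have ev: "poly (p \<xi>) T = (\<Sum>i\<in>I. T ^ i * \<xi> i)" for \<xi> by (simp add: p_def poly_sum poly_monom mult.commute)
  have "inj_on (\<lambda>\<xi>. \<Sum>i\<in>I. T ^ i * \<xi> i) \<Xi>"
  proof (rule inj_onI)
    fix \<xi> \<xi>' assume m: "\<xi> \<in> \<Xi>" "\<xi>' \<in> \<Xi>" and "(\<Sum>i\<in>I. T ^ i * \<xi> i) = (\<Sum>i\<in>I. T ^ i * \<xi>' i)"
    then have r: "poly (p \<xi> - p \<xi>') T = 0" by (simp add: ev)
    have "p \<xi> = p \<xi>'"
    proof (rule ccontr)
      assume "p \<xi> \<noteq> p \<xi>'"
      then have "T \<in> B" unfolding B_def using m r by (intro UN_I[of "(\<xi>, \<xi>')"]) auto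
      then show False using T by simp
    qed
    then show "\<xi> = \<xi>'" by (rule pinj) (fact m)+
  qed
  then show ?thesis by blast
qed

text \<open>On the pencil \<open>\<rho>\<close> is a polynomial in \<open>t\<close>. It has
  \<open>d ^ n\<close> distinct roots, because \<open>T\<close> separates the zeros of the other
  forms, and its degree is at most \<open>k\<close>, because \<open>t\<close> occurs in only one
  coefficient, which belongs to the form \<open>j\<close>.\<close>

lemma block_degree_lower:
  fixes \<rho> :: "(fcoeff, int) mpoly"
  assumes j: "j \<le> n" and d: "d \<ge> 1" and \<rho>: "\<And>a. ieval a \<rho> = 0 \<longleftrightarrow> a \<in> zero_locus n d"
    and k: "\<And>t. t \<in> keys \<rho> ==> mweight (block_weight j) t = k"
  shows "d ^ n \<le> k"
proof -
  define I where "I = {..n} - {j}"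
  define \<mu> where "\<mu> = {z :: complex. z ^ d = 1}"
  have \<mu>: "finite \<mu>" "card \<mu> = d" using d finite_roots_unity[of d] card_roots_unity_eq[of d] by (auto simp: \<mu>_def)
  define \<Xi> where "\<Xi> = (\<Pi>\<^sub>E i\<in>I. \<mu>)"
  have fin: "finite \<Xi>" "finite I" using \<mu> by (auto simp: \<Xi>_def I_def intro: finite_PiE)
  have "\<exists>T. inj_on (\<lambda>\<xi>. \<Sum>i\<in>I. T ^ i * \<xi> i) \<Xi>"
  proof (rule ex_separating_scalar[OF fin])
    fix \<xi> \<xi>' assume "\<xi> \<in> \<Xi>" "\<xi>' \<in> \<Xi>" "\<And>i. i \<in> I ==> \<xi> i = \<xi>' i"
    then show "\<xi> = \<xi>'" unfolding \<Xi>_def by (intro PiE_ext)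
  qed
  then obtain T where T: "inj_on (\<lambda>\<xi>. \<Sum>i\<in>I. T ^ i * \<xi> i) \<Xi>" by blast
  define val where "val = (\<lambda>\<xi>. - (\<Sum>i\<in>I. T ^ i * \<xi> i))"
  have "inj_on val \<Xi>" using T by (auto simp: val_def inj_on_def)
  then have card: "card (val ` \<Xi>) = d ^ n" using j \<mu> by (simp add: card_image \<Xi>_def card_PiE I_def)
  define f where "f = ieval (\<lambda>v. [:pencil n d j T 0 v, if v = (j, single j d) then 1 else 0:]) \<rho>"
  have pen: "pencil n d j T 0 v + t * (if v = (j, single j d) then 1 else 0) = pencil n d j T t v" for v t
    by (auto simp: pencil_def prod_eq_iff)
  have f: "poly f t = ieval (pencil n d j T t) \<rho>" for t
    unfolding f_def by (subst ieval_hom[OF comm_ring_hom_poly]) (simp add: pen)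
  have root: "poly f t = 0 \<longleftrightarrow> t \<in> val ` \<Xi>" for t
  proof
    assume "poly f t = 0"
    then have "pencil n d j T t \<in> zero_locus n d" using \<rho> by (simp add: f)
    then obtain x l where l: "l \<le> n" "x l \<noteq> 0" and x: "\<And>i. i \<le> n ==> fval n d (pencil n d j T t) i x = 0"
      unfolding zero_locus_def by blast
    have xi: "x i ^ d = x j ^ d" if "i \<le> n" for i using x[OF that] fval_pencil[OF j that d, of T t x] by (cases "i = j") auto
    have xj: "x j \<noteq> 0"
    proof
      assume "x j = 0"
      then have "x l ^ d = 0" using xi[OF l(1)] d by (simp add: power_0_left)
      then show False using l by simp
    qed
    define \<xi> where "\<xi> = restrict (\<lambda>i. x i / x j) I"
    have "\<xi> \<in> \<Xi>" unfolding \<xi>_def \<Xi>_def restrict_PiE_iff using xi xj by (auto simp: \<mu>_def I_def power_divide)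
    moreover have "t = val \<xi>"
    proof -
      have "x j ^ d = x j ^ (d - 1) * x j" using d by (metis power_minus_mult not_one_le_zero not_gr_zero)
      moreover have "t * x j ^ d + (\<Sum>l\<in>I. T ^ l * (x j ^ (d - 1) * x l)) = 0"
        using x[OF j] fval_pencil[OF j j d, of T t x] by (simp add: I_def)
      moreover have "(\<Sum>l\<in>I. T ^ l * (x j ^ (d - 1) * x l)) = x j ^ (d - 1) * x j * (\<Sum>l\<in>I. T ^ l * \<xi> l)"
        unfolding sum_distrib_left using xj by (intro sum.cong) (auto simp: \<xi>_def)
      ultimately have "(x j ^ (d - 1) * x j) * (t + (\<Sum>l\<in>I. T ^ l * \<xi> l)) = 0" by (simp add: algebra_simps)
      then have "t + (\<Sum>l\<in>I. T ^ l * \<xi> l) = 0" using xj by simp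
      then show ?thesis by (simp add: val_def eq_neg_iff_add_eq_0)
    qed
    ultimately show "t \<in> val ` \<Xi>" by blast
  next
    assume "t \<in> val ` \<Xi>"
    then obtain \<xi> where \<xi>: "\<xi> \<in> \<Xi>" "t = val \<xi>" by blast
    define x where "x = (\<lambda>i. if i = j then 1 else \<xi> i)"
    have "x i ^ d = 1" if "i \<le> n" for i using that \<xi>(1) by (auto simp: x_def \<Xi>_def I_def \<mu>_def)
    moreover have "(\<Sum>l\<in>I. T ^ l * x l) = (\<Sum>l\<in>I. T ^ l * \<xi> l)" by (intro sum.cong) (auto simp: x_def I_def)
    ultimately have "fval n d (pencil n d j T t) i x = 0" if "i \<le> n" for i
      using fval_pencil[OF j that d, of T t x] that j \<xi>(2) by (auto simp: x_def[symmetric] val_def I_def, simp add: x_def)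
    then have "pencil n d j T t \<in> zero_locus n d" unfolding zero_locus_def
      using j by (intro CollectI exI[of _ x] conjI exI[of _ j]) (auto simp: x_def)
    then show "poly f t = 0" using \<rho> by (simp add: f)
  qed
  have roots: "{t. poly f t = 0} = val ` \<Xi>" using root by blast
  have "f \<noteq> 0"
  proof
    assume "f = 0"
    then have "val ` \<Xi> = UNIV" using roots by simp
    then have "finite (UNIV :: complex set)" using finite_imageI[OF fin(1), of val] by simp
    then show False using infinite_UNIV_char_0 by blast
  qed
  then have "card {t. poly f t = 0} \<le> degree f" by (rule card_poly_roots_bound)
  then have "d ^ n \<le> degree f" using card roots by simp
  also have "degree f \<le> k" unfolding f_def msubst_mval
  proof (rule degree_sum_le)
    fix t assume t: "t \<in> keys \<rho>"
    let ?x = "\<lambda>v. [:pencil n d j T 0 v, if v = (j, single j d) then 1 else 0:]"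
    have "degree (?x v ^ e) \<le> block_weight j v * e" for v e
      by (rule order_trans[OF degree_power_le]) (auto simp: block_weight_def)
    then have "degree (mval ?x t) \<le> mweight (block_weight j) t"
      unfolding mval_def mweight_def
      by (intro order_trans[OF degree_prod_sum_le]) (auto intro: sum_mono)
    then show "degree (of_int (lookup \<rho> t) * mval ?x t) \<le> k"
      using k[OF t] degree_smult_le[of "of_int (lookup \<rho> t)" "mval ?x t"] by (simp only: of_int_poly) simp
  qed simp
  finally show ?thesis .
qed

lemma mdegree_eq_blocks:
  assumes "keys t \<subseteq> {..n} \<times> M" shows "mdegree t = (\<Sum>j\<le>n. mweight (block_weight j) t)"
proof -
  have "(\<Sum>j\<le>n. mweight (block_weight j) t) = (\<Sum>v\<in>keys t. \<Sum>j\<le>n. block_weight j v * lookup t v)"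
    unfolding mweight_def by (rule sum.swap)
  also have "\<dots> = (\<Sum>v\<in>keys t. lookup t v)"
  proof (rule sum.cong)
    fix v assume "v \<in> keys t"
    then have v: "fst v \<le> n" using assms by auto
    have "(\<Sum>j\<le>n. block_weight j v * lookup t v) = (\<Sum>j\<le>n. if j = fst v then lookup t v else 0)"
      by (intro sum.cong) (auto simp: block_weight_def)
    then show "(\<Sum>j\<le>n. block_weight j v * lookup t v) = lookup t v" using v by simp
  qed simp
  finally show ?thesis by (simp add: mdegree_def)
qed

lemma mvars_ieval:
  fixes x :: "'u => ('v, int) mpoly"
  assumes x: "\<And>v. mvars (x v) \<subseteq> V" shows "mvars (ieval x P) \<subseteq> V"
proof -
  have add: "mvars (p + q) \<subseteq> V" if "mvars p \<subseteq> V" "mvars q \<subseteq> V" for p q :: "('v, int) mpoly"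
    using that keys_add[of p q] unfolding mvars_def by blast
  have mult: "mvars (p * q) \<subseteq> V" if "mvars p \<subseteq> V" "mvars q \<subseteq> V" for p q :: "('v, int) mpoly"
  proof
    fix v assume "v \<in> mvars (p * q)"
    then obtain m where m: "m \<in> keys (p * q)" "v \<in> keys m" by (auto simp: mvars_def)
    then obtain a b where "m = a + b" "a \<in> keys p" "b \<in> keys q" using keys_mult[of p q] by blast
    then show "v \<in> V" using m(2) that keys_add[of a b] unfolding mvars_def by blast
  qed
  have int: "mvars (of_int k :: ('v, int) mpoly) \<subseteq> V" for k by (auto simp: mvars_def simp flip: single_of_int)
  have one: "mvars (1 :: ('v, int) mpoly) \<subseteq> V" using int[of 1] by simp
  have pow: "mvars (x v ^ e) \<subseteq> V" for v e
  proof (induction e)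
    case (Suc e)
    show ?case unfolding power_Suc by (rule mult[OF x Suc.IH])
  qed (simp only: power_0 one)
  have prod: "mvars (\<Prod>v\<in>A. x v ^ f v) \<subseteq> V" for A f
  proof (induction A rule: infinite_finite_induct)
    case (insert v A)
    then show ?case using mult[OF pow insert.IH] by simp
  qed (simp_all add: one)
  have tm: "mvars (of_int (lookup P m) * mval x m) \<subseteq> V" for m unfolding mval_def by (intro mult int prod)
  have "mvars (\<Sum>m\<in>A. of_int (lookup P m) * mval x m) \<subseteq> V" for A
  proof (induction A rule: infinite_finite_induct)
    case (insert m A)
    then show ?case using add[OF tm insert.IH] by simp
  qed (use int[of 0] in simp_all)
  then show ?thesis by (simp add: msubst_mval)
qed

lemma mac_det_cong:
  assumes j: "j \<le> n" and ab: "\<And>i m. i \<le> n ==> m \<in> monomials n d ==> a (i, m) = b (i, m)"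
  shows "mac_det n d j a = mac_det n d j b"
proof -
  have "mac_mat n d j a = mac_mat n d j b"
  proof (rule eq_matI)
    fix r c assume "r < dim_row (mac_mat n d j b)" "c < dim_col (mac_mat n d j b)"
    then have rc: "r < length (mac_list n d)" "c < length (mac_list n d)" by (simp_all add: mac_mat_def Let_def)
    have "mac_list n d ! r \<in> mac_monomials n d" using nth_mem[OF rc(1)] unfolding mac_list(2) .
    from mac_index(1)[OF this j] have "mac_entry n d a (mac_index n d j (mac_list n d ! r)) \<beta> \<gamma>
      = mac_entry n d b (mac_index n d j (mac_list n d ! r)) \<beta> \<gamma>" for \<beta> \<gamma>
      unfolding mac_entry_def using ab by (intro sum.cong) auto
    then show "mac_mat n d j a $$ (r, c) = mac_mat n d j b $$ (r, c)" using rc by (simp add: mac_mat_def Let_def)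
  qed (simp_all add: mac_mat_def Let_def)
  then show ?thesis by (simp add: mac_det_def)
qed

lemma res_step:
  assumes d: "d \<ge> 1" and nz: "forms_have_zero n d" shows "\<exists>\<rho>. is_res n d \<rho>"
proof -
  obtain \<rho>0 :: "(fcoeff, int) mpoly" where
    dv0: "\<And>P. (\<And>a. a \<in> zero_locus n d ==> ieval a P = 0) ==> \<rho>0 dvd P"
    and z0: "\<And>a. ieval a \<rho>0 = 0 \<longleftrightarrow> a \<in> zero_locus n d"
    using generator_of_zero_locus[OF nz] by blast
  \<comment> \<open>The generator may involve variables that are not coefficients of the forms.
    Setting them to 0 affects neither its zero set nor the divisibility of the Macaulay determinants
    by it.\<close>
  define V where "V = {..n} \<times> monomials n d"
  define \<pi> :: "(fcoeff, int) mpoly => (fcoeff, int) mpoly" where "\<pi> = ieval (\<lambda>v. if v \<in> V then mvar v else 0)"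
  interpret \<pi>: comm_ring_hom \<pi> unfolding \<pi>_def by (rule comm_ring_hom_ieval)
  define \<rho>1 where "\<rho>1 = \<pi> \<rho>0"
  have var1: "keys t \<subseteq> V" if "t \<in> keys \<rho>1" for t
  proof -
    have "mvars \<rho>1 \<subseteq> V" unfolding \<rho>1_def \<pi>_def by (rule mvars_ieval) (auto simp: mvars_def mvar_def)
    then show ?thesis using that unfolding mvars_def by blast
  qed
  have z1: "ieval a \<rho>1 = 0 \<longleftrightarrow> a \<in> zero_locus n d" for a
  proof -
    have "ieval a \<rho>1 = ieval (\<lambda>v. if v \<in> V then a v else 0) \<rho>0" unfolding \<rho>1_def \<pi>_def
      by (subst ieval_hom[OF comm_ring_hom_ieval]) (auto intro!: msubst_cong simp: msubst_mvar)
    moreover have "fval n d (\<lambda>v. if v \<in> V then a v else 0) i x = fval n d a i x" if "i \<le> n" for i x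
      by (rule fval_cong) (use that in \<open>auto simp: V_def\<close>)
    then have "(\<lambda>v. if v \<in> V then a v else 0) \<in> zero_locus n d \<longleftrightarrow> a \<in> zero_locus n d" by (simp add: zero_locus_def)
    ultimately show ?thesis using z0 by simp
  qed
  have dv: "\<rho>1 dvd mac_det n d j mvar" if j: "j \<le> n" for j
  proof -
    have "\<rho>0 dvd mac_det n d j mvar"
      by (rule dv0, subst mac_det_hom[OF comm_ring_hom_ieval]) (simp add: msubst_mvar mac_det_zero_locus[OF _ j])
    then have "\<rho>1 dvd \<pi> (mac_det n d j mvar)" unfolding \<rho>1_def by (rule \<pi>.hom_dvd)
    moreover have "\<pi> (mac_det n d j mvar) = mac_det n d j mvar"
      unfolding mac_det_hom[OF \<pi>.comm_ring_hom_axioms] by (rule mac_det_cong[OF j]) (simp add: \<pi>_def msubst_mvar V_def)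
    ultimately show ?thesis by simp
  qed
  have block: "\<forall>t\<in>keys \<rho>1. mweight (block_weight j) t = d ^ n" if j: "j \<le> n" for j
  proof -
    obtain k where k: "k \<le> mac_size n d j" "\<And>t. t \<in> keys \<rho>1 ==> mweight (block_weight j) t = k"
      using block_homogeneous[OF j dv[OF j]] by blast
    have "d ^ n \<le> k" by (rule block_degree_lower[OF j d z1 k(2)])
    then have "k = d ^ n" using k(1) mac_size_le[OF j d] by simp
    then show ?thesis using k(2) by simp
  qed
  \<comment> \<open>\<open>\<rho>1\<close> divides a Macaulay determinant, which is 1 at the power
    forms. So its own value there is a unit of the integers, and only the sign has to be
    adjusted.\<close>
  define u where "u = (ieval (power_form n d) \<rho>1 :: int)"
  obtain q where q: "mac_det n d 0 mvar = \<rho>1 * q" using dv[of 0] by (auto elim: dvdE)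
  interpret h: comm_ring_hom "ieval (power_form n d :: fcoeff => int) :: (fcoeff, int) mpoly => int" by (rule comm_ring_hom_ieval)
  have "u * ieval (power_form n d) q = ieval (power_form n d) (mac_det n d 0 mvar :: (fcoeff, int) mpoly)"
    unfolding q h.hom_mult u_def ..
  also have "\<dots> = 1" by (subst mac_det_hom[OF comm_ring_hom_ieval]) (simp add: msubst_mvar mac_det_power_form)
  finally have "u dvd 1" by (metis dvd_triv_left)
  then have u: "u = 1 \<or> u = - 1" by auto
  have hu: "ieval (power_form n d) \<rho>1 = (of_int u :: complex)"
    unfolding u_def ieval_hom[OF comm_ring_hom_of_int] power_form_of_int ..
  define \<rho> where "\<rho> = (if u = 1 then \<rho>1 else - \<rho>1)"
  have keys: "keys \<rho> = keys \<rho>1" by (simp add: \<rho>_def)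
  have ev: "ieval a \<rho> = of_int u * ieval a \<rho>1" for a :: "fcoeff => complex"
  proof -
    interpret comm_ring_hom "ieval a :: (fcoeff, int) mpoly => complex" by (rule comm_ring_hom_ieval)
    show ?thesis using u by (auto simp: \<rho>_def hom_uminus)
  qed
  have "is_res n d \<rho>" unfolding is_res_def
  proof (intro conjI ballI allI)
    fix t assume "t \<in> keys \<rho>"
    then have t: "t \<in> keys \<rho>1" by (simp add: keys)
    show v: "keys t \<subseteq> {..n} \<times> monomials n d" using var1[OF t] by (simp add: V_def)
    have "(\<Sum>j\<le>n. mweight (block_weight j) t) = (\<Sum>j\<le>n. d ^ n)" using block t by (intro sum.cong) auto
    then show "mdegree t = (n + 1) * d ^ n" using mdegree_eq_blocks[OF v] by simp
  next
    show "ieval (power_form n d) \<rho> = (1 :: complex)" using u by (auto simp: ev hu)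
    show "ieval a \<rho> = 0 \<longleftrightarrow> a \<in> zero_locus n d" for a using u z1[of a] by (auto simp: ev)
  qed
  then show ?thesis by blast
qed

theorem exists_res:
  assumes d: "d \<ge> 1" shows "\<exists>\<rho>. is_res n d \<rho>"
proof -
  have "forms_have_zero n d"
  proof (induction n)
    case (Suc n)
    then obtain \<rho> where "is_res n d \<rho>" using res_step[OF d] by blast
    then show ?case by (intro forms_have_zero_Suc[OF d, of \<rho>]) (simp add: is_res_def)
  qed (rule forms_have_zero_0)
  then show ?thesis by (rule res_step[OF d])
qed

lemma eval_at_forms: "eval_at_forms \<rho> F = ieval (\<lambda>(i, m). lookup (F i) m) \<rho>"
  by (simp add: eval_at_forms_def)

lemma meval_form: "keys P \<subseteq> monomials n d ==> meval x P = (\<Sum>m\<in>monomials n d. lookup P m * mval x m)"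
  by (rule msubst_superset) auto

lemma zero_locus_iff_has_common_zero:
  assumes "\<And>i. i \<le> n ==> keys (F i) \<subseteq> monomials n d"
  shows "(\<lambda>(i, m). lookup (F i) m) \<in> zero_locus n d \<longleftrightarrow> has_common_zero UNIV n F"
proof -
  have "fval n d (\<lambda>(i, m). lookup (F i) m) i x = meval x (F i)" if "i \<le> n" for i x
    using meval_form[OF assms[OF that]] by (simp add: fval_def)
  then show ?thesis by (auto simp: zero_locus_def has_common_zero_def)
qed

text \<open>The resultant is a choice; all later arguments use nothing about it but this
  specification.\<close>

lemma macaulay_resultant:
  assumes d: "d \<ge> 1" shows "is_macaulay_resultant n d (macaulay_resultant n d)"
proof -
  obtain \<rho> where \<rho>: "is_res n d \<rho>" using exists_res[OF d] by blast
  have "is_macaulay_resultant n d \<rho>"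
    unfolding is_macaulay_resultant_def
  proof (intro conjI allI impI)
    show "\<forall>t\<in>keys \<rho>. keys t \<subseteq> {..n} \<times> monomials n d \<and> mdegree t = (n + 1) * d ^ n" using \<rho> by (simp add: is_res_def)
    have pw: "mvar i ^ e = (single (single i e) 1 :: (nat, complex) mpoly)" for i :: nat and e
      using mval_mvar[of "single i e"] by simp
    have "eval_at_forms \<rho> (\<lambda>i. mvar i ^ d) = ieval (power_form n d) \<rho>"
      unfolding eval_at_forms
    proof (rule msubst_cong)
      fix v assume "v \<in> mvars \<rho>"
      then have "fst v \<le> n" using \<rho> unfolding is_res_def mvars_def by force
      then show "(case v of (i, m) => lookup (mvar i ^ d) m) = (power_form n d v :: complex)"
        by (cases v) (simp only: prod.case pw, auto simp: power_form_def lookup_single when_def)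
    qed
    then show "eval_at_forms \<rho> (\<lambda>i. mvar i ^ d) = 1" using \<rho> by (simp add: is_res_def)
    fix F assume F: "\<forall>i\<le>n. form UNIV n d (F i)"
    then have "(\<lambda>(i, m). lookup (F i) m) \<in> zero_locus n d \<longleftrightarrow> has_common_zero UNIV n F"
      by (intro zero_locus_iff_has_common_zero) (simp add: form_def)
    then show "eval_at_forms \<rho> F \<noteq> 0 \<longleftrightarrow> \<not> has_common_zero UNIV n F" using \<rho> by (simp add: is_res_def eval_at_forms)
  qed
  then show ?thesis unfolding macaulay_resultant_def by (rule someI)
qed

section \<open>Rings of algebraic integers\<close>

inductive_set zspan :: "complex set => complex set" for B where
  zspan_0: "0 \<in> zspan B"
| zspan_base: "b \<in> B ==> b \<in> zspan B"
| zspan_add: "x \<in> zspan B ==> y \<in> zspan B ==> x + y \<in> zspan B"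
| zspan_uminus: "x \<in> zspan B ==> - x \<in> zspan B"

lemma zspan_sum: "(\<And>i. i \<in> A ==> f i \<in> zspan B) ==> (\<Sum>i\<in>A. f i) \<in> zspan B"
  by (induction A rule: infinite_finite_induct) (auto intro: zspan_0 zspan_add)

lemma zspan_mult: "x \<in> zspan B ==> (\<And>b. b \<in> B ==> b * y \<in> zspan C) ==> x * y \<in> zspan C"
  by (induction rule: zspan.induct) (auto intro: zspan_0 zspan_add zspan_uminus simp: distrib_right)

lemma zspan_imp_sum: "x \<in> zspan B ==> finite B ==> \<exists>c::complex => int. x = (\<Sum>b\<in>B. of_int (c b) * b)"
proof (induction rule: zspan.induct)
  case zspan_0
  then show ?case by (intro exI[of _ "\<lambda>_. 0"]) simp
next
  case (zspan_base b)
  have "(\<Sum>b'\<in>B. of_int (if b' = b then 1 else 0) * b') = (\<Sum>b'\<in>B. if b' = b then b else 0)" by (intro sum.cong) auto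
  then show ?case using zspan_base by (intro exI[of _ "\<lambda>b'. if b' = b then 1 else 0"]) simp
next
  case (zspan_add x y)
  then obtain c d :: "complex => int" where "x = (\<Sum>b\<in>B. of_int (c b) * b)" "y = (\<Sum>b\<in>B. of_int (d b) * b)" by blast
  then show ?case by (intro exI[of _ "\<lambda>b. c b + d b"]) (simp add: distrib_right sum.distrib)
next
  case (zspan_uminus x)
  then obtain c :: "complex => int" where "x = (\<Sum>b\<in>B. of_int (c b) * b)" by blast
  then show ?case by (intro exI[of _ "\<lambda>b. - c b"]) (simp add: sum_negf)
qed

text \<open>The determinant trick: \<open>x\<close> is an eigenvalue of an integer matrix, hence a
  root of its monic characteristic polynomial.\<close>

lemma algebraic_int_eigen_nat:
  fixes g :: "nat => complex"
  assumes l: "l < m" "g l \<noteq> 0" and st: "\<And>i. i < m ==> \<exists>c::nat => int. x * g i = (\<Sum>j<m. of_int (c j) * g j)"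
  shows "algebraic_int x"
proof -
  have "\<forall>i. \<exists>c::nat => int. i < m --> x * g i = (\<Sum>j<m. of_int (c j) * g j)" using st by blast
  then obtain C :: "nat => nat => int" where C: "\<And>i. i < m ==> x * g i = (\<Sum>j<m. of_int (C i j) * g j)" by metis
  define M where "M = mat m m (\<lambda>(i, j). C i j)"
  define v where "v = vec m g"
  have M: "M \<in> carrier_mat m m" by (simp add: M_def)
  then have M': "(map_mat of_int M :: complex mat) \<in> carrier_mat m m" by simp
  let ?M = "map_mat of_int M :: complex mat"
  have "?M *\<^sub>v v = x \<cdot>\<^sub>v v"
  proof (rule eq_vecI)
    fix i assume "i < dim_vec (x \<cdot>\<^sub>v v)"
    then have i: "i < m" by (simp add: v_def)
    have "(?M *\<^sub>v v) $ i = (\<Sum>j<m. of_int (C i j) * g j)"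
      using i by (simp add: M_def v_def scalar_prod_def lessThan_atLeast0)
    then show "(?M *\<^sub>v v) $ i = (x \<cdot>\<^sub>v v) $ i" using i C[OF i] by (simp add: v_def)
  qed (simp add: M_def v_def)
  moreover have "v \<noteq> 0\<^sub>v m"
  proof
    assume "v = 0\<^sub>v m"
    then have "v $ l = 0" using l by simp
    then show False using l by (simp add: v_def)
  qed
  ultimately have "eigenvector ?M v x" using M by (simp add: eigenvector_def v_def)
  then have "eigenvalue ?M x" unfolding eigenvalue_def by blast
  then have "poly (char_poly ?M) x = 0" using eigenvalue_root_char_poly[OF M'] by simp
  then have "poly (map_poly of_int (char_poly M)) x = 0" unfolding of_int_hom.char_poly_hom[OF M] .
  moreover have "lead_coeff (char_poly M) = 1" using degree_monic_char_poly[OF M] by simp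
  ultimately show ?thesis unfolding algebraic_int_altdef_ipoly by blast
qed

lemma algebraic_int_eigen:
  fixes g :: "'a => complex"
  assumes fin: "finite A" and l: "l \<in> A" "g l \<noteq> 0"
    and st: "\<And>i. i \<in> A ==> x * g i \<in> zspan (g ` A)"
  shows "algebraic_int x"
proof -
  obtain h and m :: nat where h: "bij_betw h {0..<m} (g ` A)" using ex_bij_betw_nat_finite[of "g ` A"] fin by blast
  let ?m = m
  have rng: "h ` {..<?m} = g ` A" and inj: "inj_on h {..<?m}"
    using h by (auto simp: bij_betw_def lessThan_atLeast0)
  have "g l \<in> h ` {..<?m}" unfolding rng using l by blast
  then obtain k where k: "k < ?m" "h k = g l" by force
  show ?thesis
  proof (rule algebraic_int_eigen_nat[of k ?m h])
    show "k < ?m" "h k \<noteq> 0" using k l by auto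
    fix i assume "i < ?m"
    then have "h i \<in> g ` A" using rng by blast
    then have "x * h i \<in> zspan (g ` A)" using st by auto
    then obtain c :: "complex => int" where "x * h i = (\<Sum>b\<in>g ` A. of_int (c b) * b)"
      using zspan_imp_sum fin by blast
    also have "\<dots> = (\<Sum>j<?m. of_int (c (h j)) * h j)" using sum.reindex[OF inj, of "\<lambda>b. of_int (c b) * b"] by (simp add: rng)
    finally show "\<exists>c::nat => int. x * h i = (\<Sum>j<?m. of_int (c j) * h j)" by (rule exI[of _ "\<lambda>j. c (h j)"])
  qed
qed

text \<open>Such rings consist of algebraic integers by the determinant trick, and adjoining a root
  of a monic polynomial stays within the class. Closure of the algebraic integers under sums,
  products and integral equations follows.\<close>

definition fg_ring :: "complex set => bool" where
  "fg_ring R \<longleftrightarrow> 1 \<in> R \<and> (\<forall>x\<in>R. \<forall>y\<in>R. x + y \<in> R \<and> x * y \<in> R) \<and> (\<forall>x\<in>R. - x \<in> R) \<and> (\<exists>B. finite B \<and> B \<subseteq> R \<and> R \<subseteq> zspan B)"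

lemma fg_ring_0: "fg_ring R ==> 0 \<in> R"
  unfolding fg_ring_def by (metis add.right_inverse)

lemma fg_ring_of_int: assumes "fg_ring R" shows "of_int k \<in> R"
proof -
  have nat: "of_nat j \<in> R" for j
    by (induction j) (use assms fg_ring_0[OF assms] in \<open>auto simp: fg_ring_def\<close>)
  show ?thesis by (cases k rule: int_cases2) (use nat assms in \<open>auto simp: fg_ring_def\<close>)
qed

lemma fg_ring_Ints: "fg_ring \<int>"
proof -
  have nat: "of_nat j \<in> zspan {1}" for j by (induction j) (auto intro: zspan.intros)
  have "of_int k \<in> zspan {1}" for k by (cases k rule: int_cases2) (use nat zspan_uminus in auto)
  then have "\<int> \<subseteq> zspan {1}" by (auto elim!: Ints_cases)
  then show ?thesis unfolding fg_ring_def by (intro conjI ballI exI[of _ "{1}"]) auto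
qed

lemma algebraic_int_eigen_over:
  fixes g :: "'a => complex"
  assumes R: "fg_ring R" and fin: "finite A" and l: "l \<in> A" "g l \<noteq> 0"
    and st: "\<And>i. i \<in> A ==> \<exists>c. (\<forall>j\<in>A. c j \<in> R) \<and> x * g i = (\<Sum>j\<in>A. c j * g j)"
  shows "algebraic_int x"
proof -
  obtain B where B: "finite B" "B \<subseteq> R" "R \<subseteq> zspan B" using R by (auto simp: fg_ring_def)
  obtain b where b: "b \<in> B" "b \<noteq> 0"
  proof (rule ccontr)
    assume "\<not> thesis"
    then have z: "B \<subseteq> {0}" using that by blast
    have "y = 0" if "y \<in> zspan B" for y using that by induction (use z in auto)
    then show False using B(3) R unfolding fg_ring_def by (metis one_neq_zero subsetD)
  qed
  let ?g = "\<lambda>(b, i). b * g i"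
  show ?thesis
  proof (rule algebraic_int_eigen[of "B \<times> A" "(b, l)" ?g])
    show "finite (B \<times> A)" "(b, l) \<in> B \<times> A" "?g (b, l) \<noteq> 0" using B fin b l by auto
    fix e assume "e \<in> B \<times> A"
    then obtain b i where e: "e = (b, i)" "b \<in> B" "i \<in> A" by blast
    obtain c where c: "\<And>j. j \<in> A ==> c j \<in> R" "x * g i = (\<Sum>j\<in>A. c j * g j)" using st[OF e(3)] by blast
    have "x * ?g e = (\<Sum>j\<in>A. (b * c j) * g j)" using c(2) by (simp add: e(1) sum_distrib_left mult.assoc mult.left_commute)
    also have "\<dots> \<in> zspan (?g ` (B \<times> A))"
    proof (rule zspan_sum)
      fix j assume j: "j \<in> A"
      have "b * c j \<in> zspan B" using R c(1)[OF j] e(2) B by (auto simp: fg_ring_def)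
      then show "(b * c j) * g j \<in> zspan (?g ` (B \<times> A))"
        by (rule zspan_mult) (use j in \<open>auto intro!: zspan_base\<close>)
    qed
    finally show "x * ?g e \<in> zspan (?g ` (B \<times> A))" .
  qed
qed

lemma fg_ring_algebraic_int:
  assumes R: "fg_ring R" and x: "x \<in> R" shows "algebraic_int x"
  by (rule algebraic_int_eigen_over[OF R, of "{()}" "()" "\<lambda>_. 1"]) (use x in auto)

lemma fg_ring_adjoin:
  assumes R: "fg_ring R" and f: "lead_coeff f = 1" "\<And>i. coeff f i \<in> R" "poly f x = 0"
  shows "fg_ring ((\<lambda>p. poly p x) ` {p. \<forall>i. coeff p i \<in> R})" "R \<subseteq> (\<lambda>p. poly p x) ` {p. \<forall>i. coeff p i \<in> R}"
    "x \<in> (\<lambda>p. poly p x) ` {p. \<forall>i. coeff p i \<in> R}"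
proof -
  have cl: "1 \<in> R" "0 \<in> R" "\<And>a b. a \<in> R ==> b \<in> R ==> a + b \<in> R" "\<And>a b. a \<in> R ==> b \<in> R ==> a * b \<in> R" "\<And>a. a \<in> R ==> - a \<in> R"
    using R fg_ring_0[OF R] by (auto simp: fg_ring_def)
  have sm: "(\<Sum>i\<in>A. h i) \<in> R" if "\<And>i. i \<in> A ==> h i \<in> R" for A :: "nat set" and h
    using that by (induction A rule: infinite_finite_induct) (auto intro: cl)
  obtain B where B: "finite B" "B \<subseteq> R" "R \<subseteq> zspan B" using R by (auto simp: fg_ring_def)
  define S where "S = {p. \<forall>i. coeff p i \<in> R}"
  define R' where "R' = (\<lambda>p. poly p x) ` S"
  have S: "[:a:] \<in> S" "[:0, 1:] \<in> S" if "a \<in> R" for a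
    using that cl by (auto simp: S_def coeff_pCons split: nat.split)
  have S_add: "p + q \<in> S" "p * q \<in> S" "- p \<in> S" "p - q \<in> S" if "p \<in> S" "q \<in> S" for p q
  proof -
    show "p + q \<in> S" "- p \<in> S" using that cl by (auto simp: S_def)
    have "a - b \<in> R" if "a \<in> R" "b \<in> R" for a b using cl(3)[OF that(1) cl(5)[OF that(2)]] by simp
    then show "p - q \<in> S" using that by (auto simp: S_def)
    show "p * q \<in> S" using that by (auto simp: S_def coeff_mult intro!: sm cl)
  qed
  let ?m = "degree f"
  define B' where "B' = (\<lambda>(b, i). b * x ^ i) ` (B \<times> {..<?m})"
  have m: "?m > 0"
  proof (rule ccontr)
    assume "\<not> ?m > 0"
    then obtain c where "f = [:c:]" using degree_eq_zeroE by blast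
    then show False using f by simp
  qed
  have red: "poly p x \<in> zspan B'" if "p \<in> S" for p
    using that
  proof (induction "degree p" arbitrary: p rule: less_induct)
    case less
    show ?case
    proof (cases "degree p < ?m")
      case True
      show ?thesis unfolding poly_altdef
      proof (rule zspan_sum)
        fix i assume "i \<in> {..degree p}"
        then have i: "i < ?m" using True by simp
        have "coeff p i \<in> zspan B" using less.prems B by (auto simp: S_def)
        then show "coeff p i * x ^ i \<in> zspan B'"
          by (rule zspan_mult) (use i in \<open>auto simp: B'_def intro!: zspan_base\<close>)
      qed
    next
      case False
      define q where "q = p - monom (lead_coeff p) (degree p - ?m) * f"
      have mS: "monom (lead_coeff p) (degree p - ?m) \<in> S" using less.prems cl by (auto simp: S_def)
      have "q \<in> S" unfolding q_def using less.prems mS f(2) S_add by (auto simp: S_def)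
      moreover have "degree q < degree p"
      proof -
        have "degree (monom (lead_coeff p) (degree p - ?m) * f) \<le> degree p"
          by (rule order_trans[OF degree_mult_le]) (use degree_monom_le[of "lead_coeff p" "degree p - ?m"] False in linarith)
        then have "degree q \<le> degree p" unfolding q_def by (intro degree_diff_le) auto
        moreover have "coeff q (degree p) = 0" using False f(1) by (simp add: q_def coeff_monom_mult)
        ultimately have "degree q \<le> degree p - 1" by (rule coeff_0_degree_minus_1[rotated])
        then show ?thesis using False m by linarith
      qed
      ultimately have "poly q x \<in> zspan B'" by (intro less.hyps)
      then show ?thesis by (simp add: q_def f(3))
    qed
  qed
  have "fg_ring R'" unfolding fg_ring_def
  proof (intro conjI ballI exI[of _ B'])
    show "1 \<in> R'" unfolding R'_def using S(1)[OF cl(1)] by (intro image_eqI[of _ _ "[:1:]"]) auto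
    show "finite B'" using B by (simp add: B'_def)
    show "R' \<subseteq> zspan B'" using red by (auto simp: R'_def)
    show "B' \<subseteq> R'"
    proof
      fix y assume "y \<in> B'"
      then obtain b i where b: "b \<in> B" "y = b * x ^ i" by (auto simp: B'_def)
      then have "monom b i \<in> S" using B cl by (auto simp: S_def)
      then show "y \<in> R'" unfolding R'_def using b by (intro image_eqI[of _ _ "monom b i"]) (auto simp: poly_monom)
    qed
    fix a assume a: "a \<in> R'"
    then obtain p where p: "p \<in> S" "a = poly p x" by (auto simp: R'_def)
    show "- a \<in> R'" unfolding R'_def using p S_add by (intro image_eqI[of _ _ "- p"]) auto
    fix b assume "b \<in> R'"
    then obtain q where q: "q \<in> S" "b = poly q x" by (auto simp: R'_def)
    show "a + b \<in> R'" "a * b \<in> R'" unfolding R'_def using p q S_add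
      by (auto intro: image_eqI[of _ _ "p + q"] image_eqI[of _ _ "p * q"])
  qed
  then show "fg_ring ((\<lambda>p. poly p x) ` {p. \<forall>i. coeff p i \<in> R})" by (simp add: R'_def S_def)
  have "R \<subseteq> R'"
  proof
    fix a assume "a \<in> R"
    then show "a \<in> R'" unfolding R'_def using S(1) by (intro image_eqI[of _ _ "[:a:]"]) auto
  qed
  then show "R \<subseteq> (\<lambda>p. poly p x) ` {p. \<forall>i. coeff p i \<in> R}" by (simp add: R'_def S_def)
  have "x \<in> R'" unfolding R'_def using S(2)[OF cl(1)] by (intro image_eqI[of _ _ "[:0, 1:]"]) auto
  then show "x \<in> (\<lambda>p. poly p x) ` {p. \<forall>i. coeff p i \<in> R}" by (simp add: R'_def S_def)
qed

lemma fg_ring_adjoin_algebraic_int: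
  assumes R: "fg_ring R" and x: "algebraic_int x"
  shows "\<exists>R'. fg_ring R' \<and> R \<subseteq> R' \<and> x \<in> R'"
proof -
  obtain p where p: "lead_coeff p = 1" "\<forall>i. coeff p i \<in> \<int>" "poly p x = 0" using x by (auto elim: algebraic_int.cases)
  have "coeff p i \<in> R" for i using p(2) fg_ring_of_int[OF R] by (metis Ints_cases)
  from fg_ring_adjoin[OF R p(1) this p(3)] show ?thesis by blast
qed

lemma ex_fg_ring:
  assumes "finite S" "\<And>x. x \<in> S ==> algebraic_int x" shows "\<exists>R. fg_ring R \<and> S \<subseteq> R"
  using assms
proof (induction S rule: finite_induct)
  case empty
  then show ?case using fg_ring_Ints by blast
next
  case (insert x S)
  then obtain R where R: "fg_ring R" "S \<subseteq> R" by auto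
  obtain R' where "fg_ring R'" "R \<subseteq> R'" "x \<in> R'"
    using fg_ring_adjoin_algebraic_int[OF R(1), of x] insert.prems by blast
  then show ?case using R by blast
qed

lemma algebraic_int_add: assumes "algebraic_int x" "algebraic_int y" shows "algebraic_int (x + y :: complex)"
  and algebraic_int_mult: "algebraic_int (x * y)"
proof -
  obtain R where R: "fg_ring R" "{x, y} \<subseteq> R" using ex_fg_ring[of "{x, y}"] assms by blast
  then have "x + y \<in> R" "x * y \<in> R" by (auto simp: fg_ring_def)
  then show "algebraic_int (x + y)" "algebraic_int (x * y)" using fg_ring_algebraic_int[OF R(1)] by auto
qed

lemma algebraic_int_stable:
  fixes g :: "'a => complex"
  assumes fin: "finite A" and l: "l \<in> A" "g l \<noteq> 0"
    and c: "\<And>i j. i \<in> A ==> j \<in> A ==> algebraic_int (c i j)" and st: "\<And>i. i \<in> A ==> x * g i = (\<Sum>j\<in>A. c i j * g j)"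
  shows "algebraic_int x"
proof -
  have "\<exists>R. fg_ring R \<and> (\<lambda>(i, j). c i j) ` (A \<times> A) \<subseteq> R"
    by (rule ex_fg_ring) (use fin c in auto)
  then obtain R where R: "fg_ring R" "(\<lambda>(i, j). c i j) ` (A \<times> A) \<subseteq> R" by blast
  show ?thesis
  proof (rule algebraic_int_eigen_over[of R A l g])
    fix i assume i: "i \<in> A"
    show "\<exists>c. (\<forall>j\<in>A. c j \<in> R) \<and> x * g i = (\<Sum>j\<in>A. c j * g j)"
      using R(2) i st[OF i] by (intro exI[of _ "c i"]) auto
  qed (fact R fin l)+
qed

lemma algebraic_int_monic:
  assumes f: "lead_coeff f = 1" "\<And>i. algebraic_int (coeff f i)" "poly f x = 0"
  shows "algebraic_int (x :: complex)"
proof -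
  obtain R where R: "fg_ring R" "coeff f ` {..degree f} \<subseteq> R"
    using ex_fg_ring[of "coeff f ` {..degree f}"] f(2) by auto
  have "coeff f i \<in> R" for i
    by (cases "i \<le> degree f") (use R(2) fg_ring_0[OF R(1)] in \<open>auto simp: coeff_eq_0\<close>)
  from fg_ring_adjoin(1,3)[OF R(1) f(1) this f(3)] show ?thesis by (rule fg_ring_algebraic_int)
qed

text \<open>All powers of \<open>x\<close> lie in one finitely generated group, so their coordinates
  in a number field have a common denominator.\<close>

lemma algebraic_int_power_span:
  assumes "algebraic_int x"
  shows "\<exists>B. finite B \<and> B \<subseteq> (\<lambda>p. poly p x) ` {p. \<forall>i. coeff p i \<in> \<int>} \<and> (\<forall>j. \<exists>c::complex => int. x ^ j = (\<Sum>b\<in>B. of_int (c b) * b))"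
proof -
  obtain p where p: "lead_coeff p = 1" "\<forall>i. coeff p i \<in> \<int>" "poly p x = 0" using assms by (auto elim: algebraic_int.cases)
  let ?R = "(\<lambda>p. poly p x) ` {p. \<forall>i. coeff p i \<in> \<int>}"
  have "coeff p i \<in> \<int>" for i using p(2) by blast
  note R = fg_ring_adjoin(1,3)[OF fg_ring_Ints p(1) this p(3)]
  then obtain B where B: "finite B" "B \<subseteq> ?R" "?R \<subseteq> zspan B" by (auto simp: fg_ring_def)
  have "x ^ j \<in> ?R" for j
  proof (induction j)
    case 0
    show ?case using R(1) by (simp only: fg_ring_def power_0)
  next
    case (Suc j)
    then show ?case using R unfolding power_Suc fg_ring_def by blast
  qed
  then have "\<exists>c::complex => int. x ^ j = (\<Sum>b\<in>B. of_int (c b) * b)" for j using zspan_imp_sum B(1,3) by blast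
  then show ?thesis using B(1,2) by blast
qed

section \<open>Subrings and subfields of the complex numbers\<close>

locale complex_subring =
  fixes R :: "complex set"
  assumes one_in: "1 \<in> R" and add_in: "x \<in> R ==> y \<in> R ==> x + y \<in> R"
    and uminus_in: "x \<in> R ==> - x \<in> R" and mult_in: "x \<in> R ==> y \<in> R ==> x * y \<in> R"
begin

lemma zero_in: "0 \<in> R" using add_in[OF one_in uminus_in[OF one_in]] by simp

lemma diff_in: "x \<in> R ==> y \<in> R ==> x - y \<in> R" using add_in[of x "- y"] uminus_in[of y] by simp

lemma power_in: "x \<in> R ==> x ^ k \<in> R" by (induction k) (auto intro: one_in mult_in)

lemma sum_in: "(\<And>i. i \<in> A ==> f i \<in> R) ==> (\<Sum>i\<in>A. f i) \<in> R"
  by (induction A rule: infinite_finite_induct) (auto intro: zero_in add_in)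

lemma prod_in: "(\<And>i. i \<in> A ==> f i \<in> R) ==> (\<Prod>i\<in>A. f i) \<in> R"
  by (induction A rule: infinite_finite_induct) (auto intro: one_in mult_in)

lemma of_nat_in: "of_nat k \<in> R" by (induction k) (auto intro: zero_in one_in add_in)

lemma of_int_in: "of_int k \<in> R" by (cases k rule: int_cases2) (auto intro: of_nat_in uminus_in)

end

locale complex_subfield = complex_subring L for L +
  assumes inverse_in: "x \<in> L ==> inverse x \<in> L"
begin

lemma divide_in: "x \<in> L ==> y \<in> L ==> x / y \<in> L" unfolding divide_inverse by (intro mult_in inverse_in)

lemma power_int_in: "x \<in> L ==> x powi k \<in> L" by (auto simp: power_int_def intro: power_in inverse_in)

lemma of_rat_in: "of_rat r \<in> L" by (cases r) (auto simp: of_rat_rat intro: of_int_in divide_in)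

lemma poly_in: "(\<And>i. coeff p i \<in> L) ==> x \<in> L ==> poly p x \<in> L"
  unfolding poly_altdef by (intro sum_in mult_in power_in)

lemmas field_in = zero_in one_in add_in uminus_in mult_in inverse_in diff_in divide_in power_in power_int_in of_nat_in of_int_in

abbreviation "OL \<equiv> integers_of L"

lemma O_sub: "x \<in> OL ==> x \<in> L" by (simp add: integers_of_def)

sublocale O: complex_subring OL
  by unfold_locales (auto simp: integers_of_def intro: one_in add_in mult_in uminus_in algebraic_int_add algebraic_int_mult)

lemmas O_add = O.add_in and O_mult = O.mult_in and O_uminus = O.uminus_in and O_diff = O.diff_in and O_0 = O.zero_in and O_1 = O.one_in
  and O_power = O.power_in and O_sum = O.sum_in and O_prod = O.prod_in and O_of_nat = O.of_nat_in and O_of_int = O.of_int_in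

lemmas O_in = O_0 O_1 O_add O_uminus O_mult O_diff O_power O_of_nat O_of_int

end

lemma CC_field: "field CC" by (rule field_from_type_algebra)

lemma CC_simps: "carrier CC = UNIV" "x \<otimes>\<^bsub>CC\<^esub> y = x * y" "x \<oplus>\<^bsub>CC\<^esub> y = x + y" "\<zero>\<^bsub>CC\<^esub> = 0" "\<one>\<^bsub>CC\<^esub> = 1"
  by (auto simp: ring_of_type_algebra_def)

lemma CC_uminus: "a_inv CC x = - x"
proof -
  interpret field CC by (rule CC_field)
  show ?thesis using minus_equality[of "- x" x] by (simp add: CC_simps)
qed

lemma CC_inv: "x \<noteq> 0 ==> m_inv CC x = inverse x"
proof -
  interpret field CC by (rule CC_field)
  show "x \<noteq> 0 ==> m_inv CC x = inverse x" using comm_inv_char[of x "inverse x"] by (simp add: CC_simps)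
qed

lemma subring_CC: assumes "complex_subring R" shows "subring R CC"
proof -
  interpret field CC by (rule CC_field)
  interpret R: complex_subring R by (rule assms)
  show ?thesis by (rule subringI) (auto simp: CC_simps CC_uminus intro: R.one_in R.add_in R.uminus_in R.mult_in)
qed

lemma subfield_CC_iff: "subfield L CC \<longleftrightarrow> complex_subfield L"
proof
  interpret field CC by (rule CC_field)
  assume L: "subfield L CC"
  show "complex_subfield L"
  proof
    fix x y assume x: "x \<in> L" and y: "y \<in> L"
    show "x + y \<in> L" "x * y \<in> L" using subringE(6,7)[OF subfieldE(1)[OF L] x y] by (auto simp: CC_simps)
  next
    fix x assume x: "x \<in> L"
    show "- x \<in> L" using subringE(5)[OF subfieldE(1)[OF L] x] by (simp add: CC_uminus)
    show "inverse x \<in> L" using subfield_m_inv(1)[OF L, of x] x by (cases "x = 0") (auto simp: CC_simps CC_inv)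
  qed (use subringE(3)[OF subfieldE(1)[OF L]] in \<open>simp add: CC_simps\<close>)
next
  interpret field CC by (rule CC_field)
  assume "complex_subfield L"
  then interpret L: complex_subfield L .
  show "subfield L CC"
  proof (rule subfieldI')
    show "subring L CC" by (rule subring_CC) unfold_locales
    show "m_inv CC k \<in> L" if "k \<in> L - {\<zero>\<^bsub>CC\<^esub>}" for k using that by (auto simp: CC_simps CC_inv intro: L.field_in)
  qed
qed

lemma complex_subfield_Rats: "complex_subfield \<rat>" by standard auto

lemma CC_combine: "length Ks = length Us ==> ring.combine CC Ks Us = (\<Sum>i<length Us. Ks ! i * Us ! i)"
proof (induction Us arbitrary: Ks)
  case Nil
  interpret field CC by (rule CC_field)
  show ?case using Nil by (simp add: CC_simps)
next
  case (Cons u Us)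
  interpret field CC by (rule CC_field)
  obtain k Ks' where "Ks = k # Ks'" using Cons.prems by (cases Ks) auto
  then show ?case using Cons by (simp add: CC_simps sum.lessThan_Suc_shift del: sum.lessThan_Suc)
qed

lemma common_denominator: "finite S ==> \<exists>D::int. D > 0 \<and> (\<forall>r\<in>S. \<exists>k. of_int D * r = (of_int k :: rat))"
proof (induction S rule: finite_induct)
  case empty
  then show ?case by (intro exI[of _ 1]) simp
next
  case (insert r S)
  then obtain D :: int where D: "D > 0" "\<forall>r\<in>S. \<exists>k. of_int D * r = (of_int k :: rat)" by blast
  obtain a b where ab: "quotient_of r = (a, b)" by (cases "quotient_of r")
  then have r: "r = of_int a / of_int b" "b > 0" by (rule quotient_of_div, rule quotient_of_denom_pos)
  have rk: "of_int (D * b) * r = (of_int (D * a) :: rat)" using r by simp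
  have "\<exists>k. of_int (D * b) * s = (of_int k :: rat)" if s: "s \<in> S" for s
  proof -
    obtain k where "of_int D * s = (of_int k :: rat)" using D s by blast
    then have "of_int (D * b) * s = (of_int (b * k) :: rat)" by (simp add: mult_ac)
    then show ?thesis by blast
  qed
  with rk have "\<forall>s\<in>insert r S. \<exists>k. of_int (D * b) * s = (of_int k :: rat)" by blast
  moreover have "D * b > 0" using D(1) r(2) by simp
  ultimately show ?case by blast
qed

section \<open>Size of the elements of a number field\<close>

locale number_basis = complex_subfield +
  fixes n :: nat and \<omega> :: "nat => complex" and q :: "complex => nat => rat"
  assumes \<omega>_in: "i < n ==> \<omega> i \<in> L" and expand: "x \<in> L ==> x = (\<Sum>i<n. of_rat (q x i) * \<omega> i)"
    and q_unique: "x \<in> L ==> x = (\<Sum>i<n. of_rat (c i) * \<omega> i) ==> i < n ==> q x i = c i"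
begin

lemma ex_integral_multiple:
  assumes x: "x \<in> L" shows "\<exists>D::int. D > 0 \<and> algebraic_int (of_int D * x)"
proof -
  obtain D :: int where D: "D > 0" "\<forall>r\<in>(\<lambda>(i, j). q (x * \<omega> i) j) ` ({..<n} \<times> {..<n}). \<exists>k. of_int D * r = (of_int k :: rat)"
    using common_denominator[of "(\<lambda>(i, j). q (x * \<omega> i) j) ` ({..<n} \<times> {..<n})"] by auto
  obtain l where l: "l < n" "\<omega> l \<noteq> 0"
  proof (rule ccontr)
    assume "\<not> thesis"
    then have "\<omega> i = 0" if "i < n" for i using that \<open>\<And>l. l < n ==> \<omega> l \<noteq> 0 ==> thesis\<close> by blast
    then show False using expand[OF one_in] by simp
  qed
  have "algebraic_int (of_int D * x)"
  proof (rule algebraic_int_eigen_nat[where g = \<omega>, OF l])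
    fix i assume i: "i < n"
    have "\<forall>j. \<exists>k. j < n --> of_int D * q (x * \<omega> i) j = (of_int k :: rat)" using D(2) i by auto
    then obtain k where k: "\<And>j. j < n ==> of_int D * q (x * \<omega> i) j = (of_int (k j) :: rat)" by metis
    have "of_int D * x * \<omega> i = of_int D * (\<Sum>j<n. of_rat (q (x * \<omega> i) j) * \<omega> j)"
      using expand[OF mult_in[OF x \<omega>_in[OF i]]] by simp
    also have "\<dots> = (\<Sum>j<n. of_rat (of_int D * q (x * \<omega> i) j) * \<omega> j)" by (simp add: sum_distrib_left of_rat_mult mult.assoc)
    also have "\<dots> = (\<Sum>j<n. of_int (k j) * \<omega> j)" by (intro sum.cong) (simp_all add: k)
    finally show "\<exists>c::nat => int. of_int D * x * \<omega> i = (\<Sum>j<n. of_int (c j) * \<omega> j)" by (rule exI[of _ k])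
  qed
  then show ?thesis using D by blast
qed

lemma integral_basis: "\<exists>\<omega>' q'. number_basis L n \<omega>' q' \<and> (\<forall>i<n. algebraic_int (\<omega>' i))"
proof -
  have "\<forall>i. \<exists>D::int. D > 0 \<and> (i < n --> algebraic_int (of_int D * \<omega> i))" 
  proof
    fix i
    show "\<exists>D::int. D > 0 \<and> (i < n --> algebraic_int (of_int D * \<omega> i))"
    proof (cases "i < n")
      case True
      then show ?thesis using ex_integral_multiple[OF \<omega>_in[OF True]] by blast
    qed (auto intro: exI[of _ 1])
  qed
  then obtain D :: "nat => int" where D: "\<And>i. D i > 0" "\<And>i. i < n ==> algebraic_int (of_int (D i) * \<omega> i)" by metis
  have "number_basis L n (\<lambda>i. of_int (D i) * \<omega> i) (\<lambda>x i. q x i / of_int (D i))"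
  proof unfold_locales
    show "of_int (D i) * \<omega> i \<in> L" if "i < n" for i using \<omega>_in[OF that] by (intro mult_in of_int_in)
    have D0: "of_int (D i) \<noteq> (0 :: rat)" "of_int (D i) \<noteq> (0 :: complex)" for i using D(1)[of i] by auto
    show "x = (\<Sum>i<n. of_rat (q x i / of_int (D i)) * (of_int (D i) * \<omega> i))" if "x \<in> L" for x
      using expand[OF that] D0 by (simp add: of_rat_divide)
    fix x c i assume x: "x \<in> L" "x = (\<Sum>i<n. of_rat (c i) * (of_int (D i) * \<omega> i))" and i: "i < n"
    have "q x i = c i * of_int (D i)" by (rule q_unique[OF x(1) _ i]) (use x(2) in \<open>simp add: of_rat_mult mult.assoc\<close>)
    then show "q x i / of_int (D i) = c i" using D0 by simp
  qed
  then show ?thesis using D(2) by blast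
qed

lemma q_add: "x \<in> L ==> y \<in> L ==> i < n ==> q (x + y) i = q x i + q y i"
  by (rule q_unique) (auto intro: add_in simp: of_rat_add distrib_right sum.distrib expand[symmetric])

lemma q_scale: "x \<in> L ==> i < n ==> q (of_rat c * x) i = c * q x i"
  by (rule q_unique) (auto intro: mult_in of_rat_in simp: of_rat_mult mult.assoc expand[symmetric] simp flip: sum_distrib_left)

lemma q_diff: "x \<in> L ==> y \<in> L ==> i < n ==> q (x - y) i = q x i - q y i"
  using q_add[of x "- y" i] q_scale[of y i "- 1"] uminus_in[of y] by (simp add: of_rat_minus)

lemma q_0: "i < n ==> q 0 i = 0" by (rule q_unique) (auto intro: zero_in)

lemma q_sum: "(\<And>a. a \<in> A ==> f a \<in> L) ==> i < n ==> q (\<Sum>a\<in>A. f a) i = (\<Sum>a\<in>A. q (f a) i)"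
  by (induction A rule: infinite_finite_induct) (auto simp: q_0 q_add sum_in)

lemma q_comb: "i < n ==> q (\<Sum>j<n. of_rat (c j) * \<omega> j) i = c i"
  by (rule q_unique) (auto intro: sum_in mult_in of_rat_in \<omega>_in)

definition s0 :: "complex => real" where "s0 x = (\<Sum>i<n. real_of_rat \<bar>q x i\<bar>)"

lemma s0_nonneg: "s0 x \<ge> 0" unfolding s0_def by (intro sum_nonneg) simp

lemma s0_add: "x \<in> L ==> y \<in> L ==> s0 (x + y) \<le> s0 x + s0 y"
  unfolding s0_def sum.distrib[symmetric] by (intro sum_mono) (simp add: q_add of_rat_less_eq flip: of_rat_add)

lemma s0_scale: "x \<in> L ==> s0 (of_rat c * x) = real_of_rat \<bar>c\<bar> * s0 x"
  unfolding s0_def sum_distrib_left by (intro sum.cong) (simp_all add: q_scale abs_mult of_rat_mult)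

lemma s0_0: "s0 0 = 0" by (simp add: s0_def q_0)

lemma s0_sum: "(\<And>a. a \<in> A ==> f a \<in> L) ==> s0 (\<Sum>a\<in>A. f a) \<le> (\<Sum>a\<in>A. s0 (f a))"
proof (induction A rule: infinite_finite_induct)
  case (insert a A)
  then have "s0 (f a + sum f A) \<le> s0 (f a) + s0 (sum f A)" by (intro s0_add sum_in) auto
  then show ?case using insert by fastforce
qed (simp_all add: s0_0)

text \<open>\<open>C0\<close> bounds the products of basis elements, that is, the structure
  constants. Multiplying the sum of the absolute coordinates by it yields a submultiplicative size,
  which takes the place of the absolute values at the embeddings.\<close>

definition C0 :: real where "C0 = 1 + (\<Sum>i<n. \<Sum>j<n. s0 (\<omega> i * \<omega> j))"

definition sz :: "complex => real" where "sz x = C0 * s0 x"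

lemma C0: "C0 \<ge> 1" "i < n ==> j < n ==> s0 (\<omega> i * \<omega> j) \<le> C0"
proof -
  have nn: "0 \<le> (\<Sum>j<n. s0 (\<omega> i * \<omega> j))" for i by (intro sum_nonneg s0_nonneg)
  then show "C0 \<ge> 1" unfolding C0_def by (simp add: sum_nonneg)
  assume ij: "i < n" "j < n"
  have "s0 (\<omega> i * \<omega> j) \<le> (\<Sum>j<n. s0 (\<omega> i * \<omega> j))" by (rule member_le_sum) (use ij s0_nonneg in auto)
  also have "\<dots> \<le> (\<Sum>i<n. \<Sum>j<n. s0 (\<omega> i * \<omega> j))" by (rule member_le_sum) (use ij nn in auto)
  finally show "s0 (\<omega> i * \<omega> j) \<le> C0" by (simp add: C0_def)
qed

lemma s0_mult: assumes x: "x \<in> L" and y: "y \<in> L" shows "s0 (x * y) \<le> C0 * (s0 x * s0 y)"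
proof -
  let ?t = "\<lambda>i j. of_rat (q x i * q y j) * (\<omega> i * \<omega> j)"
  have tin: "?t i j \<in> L" if "i < n" "j < n" for i j using that by (intro mult_in of_rat_in \<omega>_in)
  have "x * y = (\<Sum>i<n. of_rat (q x i) * \<omega> i) * (\<Sum>j<n. of_rat (q y j) * \<omega> j)" using expand[OF x] expand[OF y] by simp
  also have "\<dots> = (\<Sum>i<n. \<Sum>j<n. ?t i j)" unfolding sum_product by (intro sum.cong) (simp_all add: of_rat_mult mult_ac)
  finally have "s0 (x * y) = s0 (\<Sum>i<n. \<Sum>j<n. ?t i j)" by simp
  also have "\<dots> \<le> (\<Sum>i<n. \<Sum>j<n. s0 (?t i j))"
    using tin by (intro order_trans[OF s0_sum] sum_mono s0_sum sum_in) auto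
  also have "\<dots> \<le> (\<Sum>i<n. \<Sum>j<n. C0 * (real_of_rat \<bar>q x i\<bar> * real_of_rat \<bar>q y j\<bar>))"
  proof (intro sum_mono)
    fix i j assume ij: "i \<in> {..<n}" "j \<in> {..<n}"
    have "s0 (?t i j) = real_of_rat \<bar>q x i * q y j\<bar> * s0 (\<omega> i * \<omega> j)" using ij by (intro s0_scale mult_in \<omega>_in) auto
    also have "\<dots> \<le> real_of_rat \<bar>q x i * q y j\<bar> * C0" using ij C0(2) by (intro mult_left_mono) auto
    finally show "s0 (?t i j) \<le> C0 * (real_of_rat \<bar>q x i\<bar> * real_of_rat \<bar>q y j\<bar>)" by (simp add: abs_mult of_rat_mult mult_ac)
  qed
  also have "\<dots> = C0 * (s0 x * s0 y)" unfolding s0_def sum_product by (simp add: sum_distrib_left)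
  finally show ?thesis .
qed

lemma sz_mult: assumes "x \<in> L" "y \<in> L" shows "sz (x * y) \<le> sz x * sz y"
  using mult_left_mono[OF s0_mult[OF assms], of C0] C0 by (simp add: sz_def mult_ac)

lemma sz_nonneg: "sz x \<ge> 0" using C0 s0_nonneg[of x] by (simp add: sz_def)

lemma sz_bound: assumes "\<And>i. i < n ==> real_of_rat \<bar>q x i\<bar> \<le> e" shows "sz x \<le> C0 * (of_nat n * e)"
proof -
  have "s0 x \<le> (\<Sum>i<n. e)" unfolding s0_def by (intro sum_mono) (use assms in auto)
  then show ?thesis unfolding sz_def using C0 by (intro mult_left_mono) auto
qed

lemma le_sz: assumes "i < n" shows "real_of_rat \<bar>q x i\<bar> \<le> sz x"
proof -
  have "real_of_rat \<bar>q x i\<bar> \<le> s0 x" unfolding s0_def by (rule member_le_sum[of i "{..<n}"]) (use assms in auto)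
  also have "\<dots> \<le> sz x" unfolding sz_def using C0(1) s0_nonneg[of x] mult_right_mono[of 1 C0 "s0 x"] by simp
  finally show ?thesis .
qed

text \<open>If \<open>sz z < 1\<close>, the sizes of the powers of \<open>z\<close> tend to 0. But
  all powers have coordinates with one common denominator \<open>D\<close>, so the size of a nonzero
  power is at least \<open>1 / D\<close>.\<close>

lemma sz_discrete:
  assumes z: "z \<in> OL" and small: "sz z < 1" shows "z = 0"
proof (rule ccontr)
  assume z0: "z \<noteq> 0"
  have zL: "z ^ j \<in> L" for j by (rule power_in[OF O_sub[OF z]])
  have "algebraic_int z" using z by (simp add: integers_of_def)
  from algebraic_int_power_span[OF this] obtain B where B: "finite B" "B \<subseteq> (\<lambda>p. poly p z) ` {p. \<forall>i. coeff p i \<in> \<int>}"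
    and m: "\<And>j. \<exists>c::complex => int. z ^ j = (\<Sum>b\<in>B. of_int (c b) * b)" by blast
  have "poly p z \<in> L" if "\<forall>i. coeff p i \<in> \<int>" for p
  proof (rule poly_in)
    show "coeff p i \<in> L" for i using that of_int_in by (metis Ints_cases)
  qed (use zL[of 1] in simp)
  then have BL: "b \<in> L" if "b \<in> B" for b using B(2) that by blast
  obtain D :: int where D: "D > 0" "\<forall>r\<in>(\<lambda>(b, i). q b i) ` (B \<times> {..<n}). \<exists>k. of_int D * r = (of_int k :: rat)"
    using common_denominator[of "(\<lambda>(b, i). q b i) ` (B \<times> {..<n})"] B(1) by auto
  have lower: "1 / of_int D \<le> sz (z ^ j)" for j
  proof -
    obtain c :: "complex => int" where c: "z ^ j = (\<Sum>b\<in>B. of_int (c b) * b)" using m by blast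
    obtain i where i: "i < n" "q (z ^ j) i \<noteq> 0"
    proof (rule ccontr)
      assume "\<not> thesis"
      then have "q (z ^ j) i = 0" if "i < n" for i using that \<open>\<And>i. i < n ==> q (z ^ j) i \<noteq> 0 ==> thesis\<close> by blast
      then show False using expand[OF zL[of j]] z0 by simp
    qed
    have "q (z ^ j) i = (\<Sum>b\<in>B. of_int (c b) * q b i)"
    proof -
      have "q (z ^ j) i = (\<Sum>b\<in>B. q (of_rat (of_int (c b)) * b) i)"
        unfolding c using i BL by (subst q_sum) (auto intro: mult_in of_int_in)
      also have "\<dots> = (\<Sum>b\<in>B. of_int (c b) * q b i)" using i BL by (intro sum.cong refl q_scale) auto
      finally show ?thesis .
    qed
    then have "of_int D * q (z ^ j) i = (\<Sum>b\<in>B. of_int (c b) * (of_int D * q b i))" by (simp add: sum_distrib_left mult_ac)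
    also have "\<dots> \<in> \<int>"
    proof (rule Ints_sum)
      fix b assume "b \<in> B"
      then obtain l where "of_int D * q b i = of_int l" using D(2) i by force
      then show "of_int (c b) * (of_int D * q b i) \<in> \<int>" by simp
    qed
    finally obtain l where l: "of_int D * q (z ^ j) i = of_int l" by (auto elim: Ints_cases)
    then have "l \<noteq> 0" using D(1) i(2) by auto
    then have "1 \<le> \<bar>of_int D * q (z ^ j) i\<bar>" unfolding l by linarith
    then have "1 / of_int D \<le> \<bar>q (z ^ j) i\<bar>" using D(1) by (simp add: abs_mult field_simps)
    then have "real_of_rat (1 / of_int D) \<le> real_of_rat \<bar>q (z ^ j) i\<bar>" by (simp only: of_rat_less_eq)
    then show ?thesis using le_sz[OF i(1), of "z ^ j"] by (simp add: of_rat_divide)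
  qed
  have upper: "sz (z ^ j) \<le> sz 1 * sz z ^ j" for j
  proof (induction j)
    case (Suc j)
    have "sz (z ^ Suc j) \<le> sz z * sz (z ^ j)" unfolding power_Suc by (rule sz_mult) (use zL zL[of 1] in auto)
    also have "\<dots> \<le> sz z * (sz 1 * sz z ^ j)" by (intro mult_left_mono Suc sz_nonneg)
    finally show ?case by (simp add: mult_ac)
  qed simp
  define e where "e = 1 / of_int D / (sz 1 + 1)"
  have e: "e > 0" using D(1) sz_nonneg[of 1] by (simp add: e_def)
  obtain j where j: "sz z ^ j < e" using real_arch_pow_inv[OF e small] by blast
  have "1 / of_int D \<le> sz 1 * sz z ^ j" using lower upper by (rule order_trans)
  also have "\<dots> \<le> sz 1 * e" using j sz_nonneg by (intro mult_left_mono) auto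
  also have "\<dots> < (sz 1 + 1) * e" using e by simp
  also have "\<dots> = 1 / of_int D" using sz_nonneg[of 1] by (simp add: e_def)
  finally show False by simp
qed

lemma floor_close: "\<lfloor>x\<rfloor> = \<lfloor>y :: rat\<rfloor> ==> \<bar>x - y\<bar> < 1" by linarith

lemma ex_grid: "\<exists>M::nat. M \<ge> 1 \<and> (\<forall>x. (\<forall>i<n. \<bar>q x i\<bar> \<le> 1 / of_nat M) --> sz x < 1)"
proof -
  obtain M :: nat where M: "of_nat M > C0 * of_nat n" using reals_Archimedean2 by blast
  have M1: "M \<ge> 1"
  proof (rule ccontr)
    assume "\<not> M \<ge> 1"
    then have "C0 * of_nat n < 0" using M by simp
    then show False using C0(1) by (simp add: mult_less_0_iff)
  qed
  have "sz x < 1" if x: "\<forall>i<n. \<bar>q x i\<bar> \<le> 1 / of_nat M" for x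
  proof -
    have "real_of_rat \<bar>q x i\<bar> \<le> 1 / of_nat M" if "i < n" for i
    proof -
      have "real_of_rat \<bar>q x i\<bar> \<le> real_of_rat (1 / of_nat M)" using x that by (simp only: of_rat_less_eq)
      then show ?thesis by (simp add: of_rat_divide)
    qed
    then have "sz x \<le> C0 * (of_nat n * (1 / of_nat M))" by (rule sz_bound)
    also have "\<dots> < 1" using M M1 by (simp add: field_simps)
    finally show ?thesis .
  qed
  then show ?thesis using M1 by blast
qed

text \<open>Cut the coordinates into boxes of width \<open>1 / M\<close>. Two integers of
  \<open>L\<close> in the same box differ by one of size below 1, that is, by 0; and a bounded
  region meets only finitely many boxes.\<close>

lemma finite_ball: "finite {z \<in> OL. sz z \<le> b}"
proof -
  obtain M :: nat where M: "M \<ge> 1" "\<And>x. (\<forall>i<n. \<bar>q x i\<bar> \<le> 1 / of_nat M) ==> sz x < 1" using ex_grid by blast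
  define F where "F = (\<lambda>z. restrict (\<lambda>i. \<lfloor>of_nat M * q z i\<rfloor>) {..<n})"
  define R where "R = \<lceil>of_nat M * b\<rceil> + 1"
  have "F ` {z \<in> OL. sz z \<le> b} \<subseteq> {..<n} \<rightarrow>\<^sub>E {- R..R}"
  proof (intro image_subsetI)
    fix z assume z: "z \<in> {z \<in> OL. sz z \<le> b}"
    have "\<lfloor>of_nat M * q z i\<rfloor> \<in> {- R..R}" if i: "i < n" for i
    proof -
      have "real_of_rat \<bar>of_nat M * q z i\<bar> = of_nat M * real_of_rat \<bar>q z i\<bar>" by (simp add: abs_mult of_rat_mult)
      also have "\<dots> \<le> of_nat M * b" using le_sz[OF i, of z] z by (intro mult_left_mono) auto
      also have "\<dots> \<le> of_int \<lceil>of_nat M * b\<rceil>" by simp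
      finally have "real_of_rat \<bar>of_nat M * q z i\<bar> \<le> real_of_rat (of_int \<lceil>of_nat M * b\<rceil>)" by simp
      then have "\<bar>of_nat M * q z i\<bar> \<le> of_int \<lceil>of_nat M * b\<rceil>" by (simp only: of_rat_less_eq)
      then show ?thesis unfolding R_def atLeastAtMost_iff by linarith
    qed
    then show "F z \<in> {..<n} \<rightarrow>\<^sub>E {- R..R}" by (simp add: F_def)
  qed
  then have "finite (F ` {z \<in> OL. sz z \<le> b})" by (rule finite_subset) (auto intro: finite_PiE)
  moreover have "inj_on F {z \<in> OL. sz z \<le> b}"
  proof (rule inj_onI)
    fix z z' assume z: "z \<in> {z \<in> OL. sz z \<le> b}" "z' \<in> {z \<in> OL. sz z \<le> b}" and eq: "F z = F z'"
    have "sz (z - z') < 1"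
    proof (rule M(2), intro allI impI)
      fix i assume i: "i < n"
      have "\<lfloor>of_nat M * q z i\<rfloor> = \<lfloor>of_nat M * q z' i\<rfloor>" using fun_cong[OF eq, of i] i by (simp add: F_def)
      then have "\<bar>of_nat M * q z i - of_nat M * q z' i\<bar> < 1" by (rule floor_close)
      then have "of_nat M * \<bar>q z i - q z' i\<bar> < 1" by (simp add: abs_mult flip: right_diff_distrib)
      then show "\<bar>q (z - z') i\<bar> \<le> 1 / of_nat M" using M(1) i z O_sub by (simp add: q_diff field_simps)
    qed
    then have "z - z' = 0" using z by (intro sz_discrete O_diff) auto
    then show "z = z'" by simp
  qed
  ultimately show ?thesis by (rule finite_imageD)
qed

end

locale integral_number_basis = number_basis +
  assumes \<omega>_int: "i < n ==> algebraic_int (\<omega> i)"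
begin

lemma \<omega>_O: "i < n ==> \<omega> i \<in> OL" by (simp add: integers_of_def \<omega>_in \<omega>_int)

definition near :: "complex => complex" where "near x = (\<Sum>i<n. of_int \<lfloor>q x i\<rfloor> * \<omega> i)"

lemma near_O: "near x \<in> OL" unfolding near_def by (intro O_sum O_mult O_of_int \<omega>_O) auto

lemma q_near: "i < n ==> q (near x) i = of_int \<lfloor>q x i\<rfloor>"
  using q_comb[of i "\<lambda>i. of_int \<lfloor>q x i\<rfloor>"] by (simp add: near_def)

lemma sz_diff_near: assumes x: "x \<in> L" shows "sz (x - near x) \<le> C0 * of_nat n"
proof -
  have "sz (x - near x) \<le> C0 * (of_nat n * 1)"
  proof (rule sz_bound)
    fix i assume i: "i < n"
    have "\<bar>q (x - near x) i\<bar> \<le> 1" using q_diff[OF x O_sub[OF near_O] i] q_near[OF i] by (simp, linarith)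
    then have "real_of_rat \<bar>q (x - near x) i\<bar> \<le> real_of_rat 1" by (simp only: of_rat_less_eq)
    then show "real_of_rat \<bar>q (x - near x) i\<bar> \<le> 1" by simp
  qed
  then show ?thesis by simp
qed

text \<open>Rounding down the coordinates of \<open>x / N\<close> leaves a remainder of bounded
  size, and there are only finitely many integers of bounded size. This is finiteness of the ring of
  integers modulo \<open>N\<close>.\<close>

lemma finite_reps:
  assumes N: "N \<ge> 1"
  shows "\<exists>Rep. finite Rep \<and> Rep \<subseteq> OL \<and> (\<forall>x\<in>OL. \<exists>r\<in>Rep. \<exists>y\<in>OL. x = r + of_nat N * y)"
proof (intro exI conjI ballI)
  let ?R = "{z \<in> OL. sz z \<le> sz (of_nat N) * (C0 * of_nat n)}"
  show "finite ?R" by (rule finite_ball)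
  show "?R \<subseteq> OL" by blast
  fix x assume x: "x \<in> OL"
  define w where "w = x / of_nat N"
  have w: "w \<in> L" "x = of_nat N * w" using N O_sub[OF x] by (auto simp: w_def intro: divide_in of_nat_in)
  let ?r = "of_nat N * (w - near w)"
  have "sz ?r \<le> sz (of_nat N) * sz (w - near w)" using w near_O by (intro sz_mult of_nat_in diff_in) (auto intro: O_sub)
  also have "\<dots> \<le> sz (of_nat N) * (C0 * of_nat n)" using sz_diff_near[OF w(1)] by (intro mult_left_mono sz_nonneg)
  finally have "sz ?r \<le> sz (of_nat N) * (C0 * of_nat n)" .
  moreover have "?r \<in> OL"
    using O_diff[OF x O_mult[OF O_of_nat near_O], of N w] by (simp add: w(2) right_diff_distrib)
  ultimately have "?r \<in> ?R" by blast
  moreover have "x = ?r + of_nat N * near w" by (simp add: w(2) right_diff_distrib)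
  ultimately show "\<exists>r\<in>?R. \<exists>y\<in>OL. x = r + of_nat N * y" using near_O by blast
qed

lemma floor_mult_close:
  assumes "M \<ge> 1" "\<lfloor>of_nat M * x\<rfloor> = \<lfloor>of_nat M * (y :: rat)\<rfloor>" shows "\<bar>x - y\<bar> \<le> 1 / of_nat M"
proof -
  have "\<bar>of_nat M * x - of_nat M * y\<bar> < 1" using assms(2) by (rule floor_close)
  then have "of_nat M * \<bar>x - y\<bar> < 1" by (simp add: abs_mult flip: right_diff_distrib)
  then show ?thesis using assms(1) by (simp add: field_simps)
qed

text \<open>Dirichlet's argument. The fractional coordinates of \<open>M ^ n + 1\<close> multiples
  of \<open>w\<close> fall into \<open>M ^ n\<close> boxes of width \<open>1 / M\<close>; the
  difference of two multiples in one box is close to an integer of \<open>L\<close>. This serves as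
  division with remainder up to a bounded multiplier.\<close>

lemma box_principle: "\<exists>H::nat. \<forall>w\<in>L. \<exists>t z. 1 \<le> t \<and> t \<le> H \<and> z \<in> OL \<and> sz (of_nat t * w - z) < 1"
proof -
  obtain M :: nat where M: "M \<ge> 1" "\<And>x. (\<forall>i<n. \<bar>q x i\<bar> \<le> 1 / of_nat M) ==> sz x < 1" using ex_grid by blast
  have "\<exists>t z. 1 \<le> t \<and> t \<le> M ^ n \<and> z \<in> OL \<and> sz (of_nat t * w - z) < 1" if w: "w \<in> L" for w
  proof -
    define F where "F = (\<lambda>t. restrict (\<lambda>i. \<lfloor>of_nat M * frac (q (of_nat t * w) i)\<rfloor>) {..<n})"
    have sub: "F ` {0..M ^ n} \<subseteq> {..<n} \<rightarrow>\<^sub>E {0..<int M}"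
    proof (intro image_subsetI)
      fix t
      have "\<lfloor>of_nat M * frac x\<rfloor> \<in> {0..<int M}" for x :: rat
      proof -
        have "of_nat M * frac x < of_nat M * 1" using M(1) frac_lt_1[of x] by (intro mult_strict_left_mono) auto
        then show ?thesis using frac_ge_0[of x] by (auto simp: floor_less_iff)
      qed
      then show "F t \<in> {..<n} \<rightarrow>\<^sub>E {0..<int M}" by (simp add: F_def)
    qed
    have card: "card ({..<n} \<rightarrow>\<^sub>E {0..<int M}) = M ^ n" by (simp add: card_PiE)
    have fin: "finite ({..<n} \<rightarrow>\<^sub>E {0..<int M})" by (simp add: finite_PiE)
    have "\<not> inj_on F {0..M ^ n}"
    proof
      assume "inj_on F {0..M ^ n}"
      from card_inj_on_le[OF this sub fin] show False by (simp add: card)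
    qed
    then obtain a' b' where a'b': "a' \<in> {0..M ^ n}" "b' \<in> {0..M ^ n}" "F a' = F b'" "a' \<noteq> b'" unfolding inj_on_def by blast
    have "\<exists>a b. a < b \<and> b \<le> M ^ n \<and> F a = F b"
    proof (cases "a' < b'")
      case True
      then show ?thesis using a'b' by (intro exI[of _ a'] exI[of _ b']) auto
    next
      case False
      then show ?thesis using a'b' by (intro exI[of _ b'] exI[of _ a']) auto
    qed
    then obtain a b where ab: "a < b" "b \<le> M ^ n" "F a = F b" by blast
    define z where "z = near (of_nat b * w) - near (of_nat a * w)"
    have "sz (of_nat (b - a) * w - z) < 1"
    proof (rule M(2), intro allI impI)
      fix i assume i: "i < n"
      have inL: "of_nat k * w \<in> L" "near (of_nat k * w) \<in> L" for k using w near_O by (auto intro: mult_in of_nat_in O_sub)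
      have "of_nat (b - a) * w - z = (of_nat b * w - near (of_nat b * w)) - (of_nat a * w - near (of_nat a * w))"
        using ab(1) by (simp add: z_def of_nat_diff algebra_simps)
      then have "q (of_nat (b - a) * w - z) i = frac (q (of_nat b * w) i) - frac (q (of_nat a * w) i)"
        using i inL by (simp add: q_diff diff_in q_near frac_def)
      moreover have "\<lfloor>of_nat M * frac (q (of_nat b * w) i)\<rfloor> = \<lfloor>of_nat M * frac (q (of_nat a * w) i)\<rfloor>"
        using fun_cong[OF ab(3), of i] i by (simp add: F_def)
      ultimately show "\<bar>q (of_nat (b - a) * w - z) i\<bar> \<le> 1 / of_nat M" using floor_mult_close[OF M(1)] by simp
    qed
    moreover have "z \<in> OL" unfolding z_def by (intro O_diff near_O)
    moreover have "1 \<le> b - a" "b - a \<le> M ^ n" using ab by auto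
    ultimately show ?thesis by blast
  qed
  then show ?thesis by blast
qed

end

lemma number_field_basis:
  assumes "number_field L" shows "\<exists>n \<omega> q. integral_number_basis L n \<omega> q"
proof -
  interpret CC: field CC by (rule CC_field)
  have L: "complex_subfield L" and fd: "CC.finite_dimension \<rat> L"
    using assms by (auto simp: number_field_def subfield_CC_iff)
  have Q: "subfield \<rat> CC" using complex_subfield_Rats by (simp add: subfield_CC_iff)
  obtain Us where Us: "CC.independent \<rat> Us" "CC.Span \<rat> Us = L"
    using CC.exists_base[OF Q CC.finite_dimensionE[OF Q fd]] by blast
  interpret L: complex_subfield L by (rule L)
  define n where "n = length Us"
  have car: "set Us \<subseteq> carrier CC" by (simp add: CC_simps)
  have ex: "\<exists>c::nat => rat. x = (\<Sum>i<n. of_rat (c i) * Us ! i)" if xL: "x \<in> L" for x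
  proof -
    obtain Ks where Ks: "set Ks \<subseteq> \<rat>" "length Ks = n" "x = CC.combine Ks Us"
      using ex1_implies_ex[OF CC.unique_decomposition[OF Q Us(1), of x]] xL Us(2) unfolding n_def by blast
    have "\<forall>i. \<exists>r. i < n --> Ks ! i = of_rat r"
      using Ks(1,2) by (meson Rats_cases nth_mem subsetD)
    then obtain c where "\<And>i. i < n ==> Ks ! i = of_rat (c i)" by metis
    then have "x = (\<Sum>i<n. of_rat (c i) * Us ! i)" using Ks(2,3) CC_combine[of Ks Us] by (simp add: n_def)
    then show ?thesis by blast
  qed
  have un: "c i = c' i" if "(\<Sum>i<n. of_rat (c i) * Us ! i) = (\<Sum>i<n. of_rat (c' i) * Us ! i)"
    "(\<Sum>i<n. of_rat (c i) * Us ! i) \<in> L" "i < n" for c c' :: "nat => rat" and i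
  proof -
    let ?K = "\<lambda>c :: nat => rat. map (\<lambda>i. of_rat (c i) :: complex) [0..<n]"
    have cb: "CC.combine (?K c) Us = (\<Sum>i<n. of_rat (c i) * Us ! i)" for c
      using CC_combine[of "?K c" Us] by (simp add: n_def)
    have "set (?K c) \<subseteq> \<rat>" "length (?K c) = length Us" for c by (auto simp: n_def)
    then have "?K c = ?K c'"
      using CC.unique_decomposition[OF Q Us(1), of "CC.combine (?K c) Us"] that(1,2) Us(2) cb by metis
    then show ?thesis using that(3) by (auto simp: map_eq_conv)
  qed
  have "\<forall>x. \<exists>c::nat => rat. x \<in> L --> x = (\<Sum>i<n. of_rat (c i) * Us ! i)" using ex by blast
  then obtain q :: "complex => nat => rat" where q: "\<And>x. x \<in> L ==> x = (\<Sum>i<n. of_rat (q x i) * Us ! i)" by metis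
  have "number_basis L n ((!) Us) q"
  proof (intro number_basis.intro number_basis_axioms.intro L)
    fix i assume "i < n"
    then show "Us ! i \<in> L" using CC.Span_base_incl[OF Q car] Us(2) by (auto simp: n_def)
  next
    fix x c i assume x: "x \<in> L" "x = (\<Sum>i<n. of_rat (c i) * Us ! i)" "i < n"
    show "q x i = c i" by (rule un) (use q[OF x(1)] x in auto)
  qed (rule q)
  then obtain \<omega>' q' where "number_basis L n \<omega>' q'" "\<forall>i<n. algebraic_int (\<omega>' i)"
    using number_basis.integral_basis by blast
  then show ?thesis unfolding integral_number_basis_def integral_number_basis_axioms_def by blast
qed

locale number_field_loc =
  fixes L :: "complex set" assumes number_field: "number_field L"

sublocale number_field_loc \<subseteq> complex_subfield L
  using number_field by (simp add: number_field_def subfield_CC_iff)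

context number_field_loc
begin

lemma ex_integral_multiple:
  assumes x: "x \<in> L" shows "\<exists>D::nat. D \<ge> 1 \<and> of_nat D * x \<in> OL"
proof -
  obtain n \<omega> q where "integral_number_basis L n \<omega> q" using number_field_basis[OF number_field] by blast
  then interpret integral_number_basis L n \<omega> q .
  obtain D :: int where D: "D > 0" "algebraic_int (of_int D * x)" using ex_integral_multiple[OF x] by blast
  have "of_int D * x \<in> OL" unfolding integers_of_def using D(2) x by (auto intro: mult_in of_int_in)
  then show ?thesis using D(1) by (intro exI[of _ "nat D"]) auto
qed

lemma finite_reps: "N \<ge> 1 ==> \<exists>Rep. finite Rep \<and> Rep \<subseteq> OL \<and> (\<forall>x\<in>OL. \<exists>r\<in>Rep. \<exists>y\<in>OL. x = r + of_nat N * y)"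
proof -
  assume N: "N \<ge> 1"
  obtain n \<omega> q where "integral_number_basis L n \<omega> q" using number_field_basis[OF number_field] by blast
  from this N show ?thesis by (rule integral_number_basis.finite_reps)
qed

lemma ex_size:
  "\<exists>(s :: complex => real) (H :: nat). (\<forall>x. s x \<ge> 0) \<and> (\<forall>x\<in>L. \<forall>y\<in>L. s (x * y) \<le> s x * s y) \<and> (\<forall>b. finite {z \<in> OL. s z \<le> b})
    \<and> (\<forall>w\<in>L. \<exists>t z. 1 \<le> t \<and> t \<le> H \<and> z \<in> OL \<and> s (of_nat t * w - z) < 1) \<and> (\<forall>z\<in>OL. s z < 1 --> z = 0)"
proof -
  obtain n \<omega> q where "integral_number_basis L n \<omega> q" using number_field_basis[OF number_field] by blast
  then interpret integral_number_basis L n \<omega> q .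
  obtain H where H: "\<forall>w\<in>L. \<exists>t z. 1 \<le> t \<and> t \<le> H \<and> z \<in> OL \<and> sz (of_nat t * w - z) < 1" using box_principle by blast
  show ?thesis
    by (intro exI[of _ sz] exI[of _ H] conjI H) (auto intro: sz_nonneg sz_mult finite_ball sz_discrete)
qed

end

section \<open>Discrete valuations\<close>

context complex_subfield
begin

lemma ring_O: "ring (CC\<lparr>carrier := OL\<rparr>)"
proof -
  interpret field CC by (rule CC_field)
  show ?thesis by (rule subring_is_ring, rule subring_CC) unfold_locales
qed

lemma ideal_iff:
  "ideal J (CC\<lparr>carrier := OL\<rparr>) \<longleftrightarrow> J \<subseteq> OL \<and> 0 \<in> J \<and> (\<forall>x\<in>J. \<forall>y\<in>J. x + y \<in> J) \<and> (\<forall>a\<in>OL. \<forall>x\<in>J. a * x \<in> J)"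
    (is "_ \<longleftrightarrow> ?P J")
proof
  interpret R: ring "CC\<lparr>carrier := OL\<rparr>" by (rule ring_O)
  show "?P J" if "ideal J (CC\<lparr>carrier := OL\<rparr>)"
  proof -
    interpret ideal J "CC\<lparr>carrier := OL\<rparr>" by (rule that)
    show ?thesis using a_Hcarr zero_closed a_closed I_l_closed by (auto simp: CC_simps)
  qed
  assume J: "?P J"
  have neg: "- x \<in> J" if "x \<in> J" for x using J O_uminus[OF O_1] that by (metis mult_minus1)
  have inv: "\<ominus>\<^bsub>CC\<lparr>carrier := OL\<rparr>\<^esub> x = - x" if "x \<in> J" for x
    using R.minus_equality[of "- x" x] that J O_uminus by (auto simp: CC_simps)
  show "ideal J (CC\<lparr>carrier := OL\<rparr>)"
  proof (rule idealI[OF R.ring_axioms R.add.subgroupI])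
    show "J \<subseteq> carrier (CC\<lparr>carrier := OL\<rparr>)" "J \<noteq> {}" using J by auto
    show "\<ominus>\<^bsub>CC\<lparr>carrier := OL\<rparr>\<^esub> x \<in> J" if "x \<in> J" for x using that inv neg by simp
    fix a x assume a: "a \<in> J" and "x \<in> carrier (CC\<lparr>carrier := OL\<rparr>)"
    then have x: "x \<in> OL" by simp
    show "x \<otimes>\<^bsub>CC\<lparr>carrier := OL\<rparr>\<^esub> a \<in> J" using a x J by (simp add: CC_simps)
    show "a \<otimes>\<^bsub>CC\<lparr>carrier := OL\<rparr>\<^esub> x \<in> J" using a x J by (simp add: CC_simps mult.commute[of a])
  qed (use J in \<open>simp add: CC_simps\<close>)
qed

lemma closed_point_iff:
  "closed_point L p \<longleftrightarrow> p \<subseteq> OL \<and> 0 \<in> p \<and> (\<forall>x\<in>p. \<forall>y\<in>p. x + y \<in> p) \<and> (\<forall>a\<in>OL. \<forall>x\<in>p. a * x \<in> p) \<and> 1 \<notin> p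
     \<and> (\<forall>a\<in>OL - p. \<exists>b\<in>OL. a * b - 1 \<in> p)" (is "_ \<longleftrightarrow> ?P")
proof
  assume "closed_point L p"
  then have m: "maximalideal p (CC\<lparr>carrier := OL\<rparr>)" by (simp add: closed_point_def)
  interpret maximalideal p "CC\<lparr>carrier := OL\<rparr>" by (rule m)
  have p: "p \<subseteq> OL" "0 \<in> p" "\<And>x y. x \<in> p ==> y \<in> p ==> x + y \<in> p" "\<And>a x. a \<in> OL ==> x \<in> p ==> a * x \<in> p"
    using ideal_axioms unfolding ideal_iff by auto
  have np: "p \<noteq> OL" using I_notcarr by simp
  have one: "1 \<notin> p"
  proof
    assume "1 \<in> p"
    then have "OL \<subseteq> p" using p(4)[of _ 1] by auto
    then show False using p(1) np by blast
  qed
  moreover have "\<exists>b\<in>OL. a * b - 1 \<in> p" if a: "a \<in> OL - p" for a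
  proof -
    define J where "J = {x + a * b | x b. x \<in> p \<and> b \<in> OL}"
    have "ideal J (CC\<lparr>carrier := OL\<rparr>)" unfolding ideal_iff
    proof (intro conjI ballI)
      show "J \<subseteq> OL" using p(1) a by (auto simp: J_def intro!: O_add O_mult)
      show "0 \<in> J" unfolding J_def using p(2) O_0 by (intro CollectI exI[of _ 0]) auto
      fix y assume "y \<in> J"
      then obtain x b where y: "y = x + a * b" "x \<in> p" "b \<in> OL" by (auto simp: J_def)
      show "c * y \<in> J" if "c \<in> OL" for c unfolding J_def using y that p(4)
        by (intro CollectI exI[of _ "c * x"] exI[of _ "c * b"]) (auto simp: algebra_simps intro: O_mult)
      fix z assume "z \<in> J"
      then obtain x' b' where z: "z = x' + a * b'" "x' \<in> p" "b' \<in> OL" by (auto simp: J_def)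
      show "y + z \<in> J" unfolding J_def using y z p(3)
        by (intro CollectI exI[of _ "x + x'"] exI[of _ "b + b'"]) (auto simp: algebra_simps intro: O_add)
    qed
    moreover have "p \<subseteq> J"
    proof
      fix x assume "x \<in> p"
      then show "x \<in> J" unfolding J_def using O_0 by (intro CollectI exI[of _ x] exI[of _ 0]) auto
    qed
    moreover have "J \<subseteq> carrier (CC\<lparr>carrier := OL\<rparr>)" using p(1) a by (auto simp: J_def intro!: O_add O_mult)
    ultimately have "J = p \<or> J = OL" using I_maximal by auto
    moreover have "a \<in> J" unfolding J_def using p(2) O_1 by (intro CollectI exI[of _ 0] exI[of _ 1]) auto
    ultimately have "1 \<in> J" using a O_1 by auto
    then obtain x b where b: "1 = x + a * b" "x \<in> p" "b \<in> OL" by (auto simp: J_def)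
    then have "a * b - 1 = - 1 * x" by (simp add: algebra_simps)
    then show ?thesis using p(4)[OF O_uminus[OF O_1], of x] b by (intro bexI[of _ b]) auto
  qed
  ultimately show ?P by (intro conjI ballI) (use p(1) in \<open>blast intro: p(2-4)\<close>)+
next
  assume P: ?P
  have "maximalideal p (CC\<lparr>carrier := OL\<rparr>)"
  proof (rule maximalidealI)
    show "ideal p (CC\<lparr>carrier := OL\<rparr>)" using P by (auto simp: ideal_iff)
    show "carrier (CC\<lparr>carrier := OL\<rparr>) \<noteq> p" using P O_1 by auto
    fix J assume J: "ideal J (CC\<lparr>carrier := OL\<rparr>)" "p \<subseteq> J" "J \<subseteq> carrier (CC\<lparr>carrier := OL\<rparr>)"
    show "J = p \<or> J = carrier (CC\<lparr>carrier := OL\<rparr>)"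
    proof (cases "J \<subseteq> p")
      case False
      then obtain a where a: "a \<in> J" "a \<notin> p" by blast
      have j: "\<And>x y. x \<in> J ==> y \<in> J ==> x + y \<in> J" "\<And>c x. c \<in> OL ==> x \<in> J ==> c * x \<in> J"
        using J(1) unfolding ideal_iff by auto
      have "a \<in> OL - p" using a J(3) by auto
      then obtain b where b: "b \<in> OL" "a * b - 1 \<in> p" using P by blast
      have "b * a + (- 1) * (a * b - 1) \<in> J" using a b J(2) by (intro j O_uminus O_1) auto
      then have "1 \<in> J" by (simp add: algebra_simps)
      then have "OL \<subseteq> J" using j(2)[of _ 1] by auto
      then show ?thesis using J(3) by auto
    qed (use J in auto)
  qed
  then show "closed_point L p" by (simp add: closed_point_def)
qed

end

section \<open>Valued fields and their balls\<close>

locale valued_field = complex_subfield +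
  fixes v :: "complex => int"
  assumes v_mult: "x \<in> L ==> x \<noteq> 0 ==> y \<in> L ==> y \<noteq> 0 ==> v (x * y) = v x + v y"
    and v_add: "x \<in> L ==> x \<noteq> 0 ==> y \<in> L ==> y \<noteq> 0 ==> x + y \<noteq> 0 ==> min (v x) (v y) \<le> v (x + y)"
begin

text \<open>The value of \<open>v\<close> at 0 is arbitrary, so 0 is put in by hand.
  \<open>B 0\<close> is the valuation ring and \<open>B 1\<close> its maximal ideal.\<close>

definition B :: "int => complex set" where "B k = {x \<in> L. x = 0 \<or> k \<le> v x}"

lemma v_1: "v 1 = 0" using v_mult[of 1 1] one_in by simp

lemma v_minus_1: "v (- 1) = 0" using v_mult[of "- 1" "- 1"] uminus_in[OF one_in] by (simp add: v_1)

lemma v_uminus: "x \<in> L ==> x \<noteq> 0 ==> v (- x) = v x" using v_mult[of "- 1" x] uminus_in[OF one_in] by (simp add: v_minus_1)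

lemma v_inverse: "x \<in> L ==> x \<noteq> 0 ==> v (inverse x) = - v x" using v_mult[of x "inverse x"] inverse_in by (simp add: v_1)

lemma v_divide: "x \<in> L ==> x \<noteq> 0 ==> y \<in> L ==> y \<noteq> 0 ==> v (x / y) = v x - v y"
  by (simp add: divide_inverse v_mult v_inverse inverse_in)

lemma v_power: "x \<in> L ==> x \<noteq> 0 ==> v (x ^ k) = int k * v x"
  by (induction k) (auto simp: v_1 v_mult power_in algebra_simps)

lemma v_power_int: "x \<in> L ==> x \<noteq> 0 ==> v (x powi k) = k * v x"
  by (auto simp: power_int_def v_power v_inverse inverse_in)

lemma v_prod: "(\<And>i. i \<in> A ==> f i \<in> L \<and> f i \<noteq> 0) ==> v (\<Prod>i\<in>A. f i) = (\<Sum>i\<in>A. v (f i))"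
proof (induction A rule: infinite_finite_induct)
  case (insert i A)
  then have "v (f i * (\<Prod>i\<in>A. f i)) = v (f i) + v (\<Prod>i\<in>A. f i)" by (intro v_mult prod_in) auto
  then show ?case using insert by simp
qed (auto simp: v_1)

lemma B_sub: "x \<in> B k ==> x \<in> L" by (simp add: B_def)
lemma B_0: "0 \<in> B k" by (simp add: B_def zero_in)
lemma B_1: "1 \<in> B 0" by (simp add: B_def one_in v_1)
lemma B_mono: "x \<in> B k ==> l \<le> k ==> x \<in> B l" by (auto simp: B_def)
lemma B_add: "x \<in> B k ==> y \<in> B k ==> x + y \<in> B k"
  by (cases "x = 0"; cases "y = 0"; cases "x + y = 0") (use v_add[of x y] in \<open>auto simp: B_def intro: add_in zero_in\<close>)
lemma B_uminus: "x \<in> B k ==> - x \<in> B k" by (cases "x = 0") (auto simp: B_def uminus_in v_uminus)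
lemma B_diff: "x \<in> B k ==> y \<in> B k ==> x - y \<in> B k" using B_add[of x k "- y"] B_uminus[of y k] by simp
lemma B_mult: "x \<in> B k ==> y \<in> B l ==> x * y \<in> B (k + l)"
  by (cases "x = 0"; cases "y = 0") (auto simp: B_def mult_in v_mult zero_in)
lemma B_mult0: "x \<in> B 0 ==> y \<in> B k ==> x * y \<in> B k" using B_mult[of x 0 y k] by simp

sublocale B0: complex_subring "B 0" by unfold_locales (auto intro: B_1 B_add B_uminus B_mult0)

lemmas B_power = B0.power_in and B_prod = B0.prod_in and B_of_int = B0.of_int_in

lemma B_sum: "(\<And>i. i \<in> A ==> f i \<in> B k) ==> (\<Sum>i\<in>A. f i) \<in> B k"
  by (induction A rule: infinite_finite_induct) (auto intro: B_0 B_add)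
lemma B_v: "x \<in> L ==> x \<in> B (v x)" by (simp add: B_def)
lemma vB: "x \<in> B k ==> x \<noteq> 0 ==> k \<le> v x" by (simp add: B_def)

lemma v_add_eq:
  assumes x: "x \<in> L" "x \<noteq> 0" and y: "y \<in> B (v x + 1)" shows "x + y \<noteq> 0" "v (x + y) = v x"
proof -
  have yv: "y = 0 \<or> v x + 1 \<le> v y" "y \<in> L" using y by (auto simp: B_def)
  show nz: "x + y \<noteq> 0"
  proof
    assume "x + y = 0"
    then have "y = - x" by (simp add: eq_neg_iff_add_eq_0 add.commute)
    then show False using yv x by (simp add: v_uminus)
  qed
  show "v (x + y) = v x"
  proof (cases "y = 0")
    case False
    have "min (v x) (v y) \<le> v (x + y)" using x yv False nz by (intro v_add) auto
    moreover have "min (v (x + y)) (v (- y)) \<le> v x"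
      using v_add[of "x + y" "- y"] x yv False nz add_in uminus_in by simp
    ultimately show ?thesis using yv False v_uminus[of y] by simp
  qed simp
qed

end

locale discrete_valued_field = valued_field +
  assumes ex_uniformizer: "\<exists>\<pi>\<in>L. \<pi> \<noteq> 0 \<and> v \<pi> = 1"

context number_field_loc
begin

lemma finite_generators:
  assumes N: "N \<ge> (1::nat)" "of_nat N \<in> J" and J: "J \<subseteq> OL"
    and cl: "\<And>x y. x \<in> J ==> y \<in> J ==> x - y \<in> J" "\<And>a x. a \<in> OL ==> x \<in> J ==> a * x \<in> J"
  shows "\<exists>A. finite A \<and> A \<subseteq> J \<and> of_nat N \<in> A \<and> (\<forall>x\<in>J. \<exists>c. (\<forall>j\<in>A. c j \<in> OL) \<and> x = (\<Sum>j\<in>A. c j * j))"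
proof -
  obtain Rep where R: "finite Rep" "Rep \<subseteq> OL" "\<forall>x\<in>OL. \<exists>r\<in>Rep. \<exists>y\<in>OL. x = r + of_nat N * y" using finite_reps[OF N(1)] by blast
  define A where "A = insert (of_nat N) (Rep \<inter> J)"
  have A: "finite A" "A \<subseteq> J" "of_nat N \<in> A" using R N by (auto simp: A_def)
  have "\<exists>c. (\<forall>j\<in>A. c j \<in> OL) \<and> x = (\<Sum>j\<in>A. c j * j)" if x: "x \<in> J" for x
  proof -
    obtain r y where ry: "r \<in> Rep" "y \<in> OL" "x = r + of_nat N * y" using R(3) J x by blast
    have "x - y * of_nat N \<in> J" using x N ry by (intro cl)
    then have rp: "r \<in> J" using ry by (simp add: mult.commute)
    let ?c = "\<lambda>j. (if j = r then 1 else 0) + (if j = of_nat N then y else 0)"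
    have "(\<Sum>j\<in>A. ?c j * j) = (\<Sum>j\<in>A. if j = r then r else 0) + (\<Sum>j\<in>A. if j = of_nat N then y * of_nat N else 0)"
      unfolding sum.distrib[symmetric] by (intro sum.cong) (auto simp: distrib_right)
    also have "\<dots> = x" using A(1) rp ry by (simp add: A_def mult.commute)
    finally show ?thesis using ry by (intro exI[of _ ?c]) (auto intro: O_in)
  qed
  then show ?thesis using A by blast
qed

text \<open>There are finitely many residues modulo \<open>N\<close>, so the powers of
  \<open>a\<close> repeat. If \<open>a\<close> lies in a prime, \<open>1 - a ^ Suc d\<close> is a
  unit locally, and a power of \<open>a\<close> is divisible by \<open>N\<close>; if it does not, a
  power of \<open>a\<close> is its inverse modulo a prime containing \<open>N\<close>.\<close>

lemma power_cycle:
  assumes N: "N \<ge> (1::nat)" and a: "a \<in> OL" shows "\<exists>i d. \<exists>y\<in>OL. a ^ i * (1 - a ^ Suc d) = of_nat N * y"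
proof -
  obtain Rep where R: "finite Rep" "\<forall>x\<in>OL. \<exists>r\<in>Rep. \<exists>y\<in>OL. x = r + of_nat N * y" using finite_reps[OF N] by blast
  have "\<forall>i. \<exists>r. r \<in> Rep \<and> (\<exists>y\<in>OL. a ^ i = r + of_nat N * y)" using R(2) O_power[OF a] by blast
  then obtain r where r: "\<And>i. r i \<in> Rep" "\<And>i. \<exists>y\<in>OL. a ^ i = r i + of_nat N * y" by metis
  have "\<not> inj r"
  proof
    assume "inj r"
    then have "finite (UNIV :: nat set)" by (rule finite_imageD[rotated]) (use r(1) R(1) in \<open>auto intro: finite_subset[of _ Rep]\<close>)
    then show False by simp
  qed
  then obtain i j where ij: "i < j" "r i = r j" unfolding inj_def by (metis linorder_neqE_nat)
  then obtain d where d: "j = Suc (i + d)" using less_imp_Suc_add by blast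
  obtain y y' where y: "y \<in> OL" "a ^ i = r i + of_nat N * y" "y' \<in> OL" "a ^ j = r j + of_nat N * y'" using r(2) by meson
  have "a ^ i * (1 - a ^ Suc d) = a ^ i - a ^ j" unfolding d by (simp add: right_diff_distrib power_add)
  also have "\<dots> = of_nat N * (y - y')" unfolding y(2,4) ij(2) by (simp add: right_diff_distrib)
  finally show ?thesis using y by (blast intro: O_diff)
qed

end

section \<open>The discrete valuation ring at a closed point\<close>

locale closed_point_loc = number_field_loc +
  fixes p :: "complex set" assumes closed_point: "closed_point L p"
begin

abbreviation "Op \<equiv> local_ring L p"
abbreviation "mp \<equiv> local_max_ideal L p"

lemma p_sub: "x \<in> p ==> x \<in> OL" and p_0: "0 \<in> p" and p_add: "x \<in> p ==> y \<in> p ==> x + y \<in> p"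
  and p_mult: "a \<in> OL ==> x \<in> p ==> a * x \<in> p" and p_1: "1 \<notin> p"
  and p_max: "a \<in> OL ==> a \<notin> p ==> \<exists>b\<in>OL. a * b - 1 \<in> p"
  using closed_point unfolding closed_point_iff by auto

lemma p_uminus: "x \<in> p ==> - x \<in> p" using p_mult[of "- 1" x] O_uminus[OF O_1] by simp
lemma p_diff: "x \<in> p ==> y \<in> p ==> x - y \<in> p" using p_add[of x "- y"] p_uminus[of y] by simp

lemma p_prime: assumes "a \<in> OL" "b \<in> OL" "a * b \<in> p" shows "a \<in> p \<or> b \<in> p"
proof (rule disjCI)
  assume "b \<notin> p"
  then obtain c where c: "c \<in> OL" "b * c - 1 \<in> p" using p_max assms by blast
  have "c * (a * b) - a * (b * c - 1) \<in> p" by (rule p_diff[OF p_mult[OF c(1) assms(3)] p_mult[OF assms(1) c(2)]])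
  then show "a \<in> p" by (simp add: algebra_simps)
qed

lemma p_power: "a \<in> OL ==> a ^ k \<in> p ==> a \<in> p"
proof (induction k)
  case (Suc k)
  then show ?case using p_prime[of a "a ^ k"] O_power by auto
qed (simp add: p_1)

lemma p_prod: "(\<And>i. i \<in> A ==> f i \<in> OL) ==> finite A ==> (\<Prod>i\<in>A. f i) \<in> p ==> \<exists>i\<in>A. f i \<in> p"
proof (induction A rule: infinite_finite_induct)
  case (insert i A)
  then show ?case using p_prime[of "f i" "\<Prod>i\<in>A. f i"] O_prod[of A f] by auto
qed (simp_all add: p_1)

text \<open>A closed point is not the zero ideal, since otherwise 2 would have an inverse among the
  algebraic integers. For nonzero \<open>a\<close> in \<open>p\<close> some positive multiple of
  \<open>1 / a\<close> is integral, and multiplying it by \<open>a\<close> gives the number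
  sought.\<close>

lemma ex_nat_in_p: "\<exists>N::nat. N \<ge> 1 \<and> of_nat N \<in> p"
proof -
  obtain a where a: "a \<in> p" "a \<noteq> 0"
  proof (rule ccontr)
    assume "\<not> thesis"
    then have p0: "p \<subseteq> {0}" using that by blast
    have "(2 :: complex) \<in> OL" using O_of_nat[of 2] by simp
    moreover have "(2 :: complex) \<notin> p" using p0 by auto
    ultimately obtain b where b: "b \<in> OL" "2 * b - 1 \<in> p" using p_max by blast
    then have "2 * b - 1 = 0" using p0 by blast
    then have b2: "b = 1 / 2" by (simp add: field_simps)
    have "b \<in> \<int>" by (rule rational_algebraic_int_is_int) (use b in \<open>auto simp: integers_of_def b2\<close>)
    then obtain k :: int where "b = of_int k" by (auto elim: Ints_cases)
    then have "of_int (2 * k) = (of_int 1 :: complex)" using b2 by (simp add: field_simps)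
    then have "2 * k = 1" by (simp only: of_int_eq_iff)
    then show False by presburger
  qed
  obtain D :: nat where D: "D \<ge> 1" "of_nat D * inverse a \<in> OL"
    using ex_integral_multiple[OF inverse_in[OF O_sub[OF p_sub[OF a(1)]]]] by blast
  have "of_nat D * inverse a * a \<in> p" using D a by (intro p_mult)
  then have "of_nat D \<in> p" using a(2) by (simp add: mult.assoc)
  then show ?thesis using D(1) by blast
qed

lemma Op_I: "a \<in> OL ==> s \<in> OL ==> s \<notin> p ==> a / s \<in> Op" by (auto simp: local_ring_def)
lemma mp_I: "a \<in> p ==> s \<in> OL ==> s \<notin> p ==> a / s \<in> mp" by (auto simp: local_max_ideal_def)
lemma Op_E: assumes "x \<in> Op" obtains a s where "a \<in> OL" "s \<in> OL" "s \<notin> p" "s \<noteq> 0" "x = a / s"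
  using assms p_0 unfolding local_ring_def by blast
lemma mp_E: assumes "x \<in> mp" obtains a s where "a \<in> p" "s \<in> OL" "s \<notin> p" "s \<noteq> 0" "x = a / s"
  using assms p_0 unfolding local_max_ideal_def by blast

lemma O_Op: "a \<in> OL ==> a \<in> Op" using Op_I[of a 1] O_1 p_1 by simp
lemma p_mp: "a \<in> p ==> a \<in> mp" using mp_I[of a 1] O_1 p_1 by simp

lemma Op_sub: "x \<in> Op ==> x \<in> L" by (erule Op_E) (auto intro: divide_in O_sub)
lemma mp_sub: "x \<in> mp ==> x \<in> Op" by (erule mp_E) (auto intro: Op_I p_sub)

lemma s_mult: "s \<in> OL ==> t \<in> OL ==> s \<notin> p ==> t \<notin> p ==> s * t \<in> OL \<and> s * t \<notin> p"
  using p_prime[of s t] O_mult by blast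

lemma Op_mult: assumes "x \<in> Op" "y \<in> Op" shows "x * y \<in> Op"
proof -
  obtain a s where x: "a \<in> OL" "s \<in> OL" "s \<notin> p" "s \<noteq> 0" "x = a / s" using assms(1) by (rule Op_E)
  obtain b t where y: "b \<in> OL" "t \<in> OL" "t \<notin> p" "t \<noteq> 0" "y = b / t" using assms(2) by (rule Op_E)
  have "a * b / (s * t) \<in> Op" using s_mult[of s t] x y by (intro Op_I O_mult) auto
  then show ?thesis by (simp add: x y)
qed

lemma Op_add: assumes "x \<in> Op" "y \<in> Op" shows "x + y \<in> Op"
proof -
  obtain a s where x: "a \<in> OL" "s \<in> OL" "s \<notin> p" "s \<noteq> 0" "x = a / s" using assms(1) by (rule Op_E)
  obtain b t where y: "b \<in> OL" "t \<in> OL" "t \<notin> p" "t \<noteq> 0" "y = b / t" using assms(2) by (rule Op_E)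
  have "(a * t + b * s) / (s * t) \<in> Op" using s_mult[of s t] x y by (intro Op_I O_add O_mult) auto
  then show ?thesis using x y by (simp add: add_frac_eq)
qed

lemma mp_mult: assumes "x \<in> Op" "y \<in> mp" shows "x * y \<in> mp"
proof -
  obtain a s where x: "a \<in> OL" "s \<in> OL" "s \<notin> p" "s \<noteq> 0" "x = a / s" using assms(1) by (rule Op_E)
  obtain b t where y: "b \<in> p" "t \<in> OL" "t \<notin> p" "t \<noteq> 0" "y = b / t" using assms(2) by (rule mp_E)
  have "a * b / (s * t) \<in> mp" using s_mult[of s t] x y by (intro mp_I p_mult) auto
  then show ?thesis by (simp add: x y)
qed

lemma mp_iff: assumes "a \<in> OL" shows "a \<in> mp \<longleftrightarrow> a \<in> p"
proof
  assume "a \<in> mp"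
  then obtain b t where y: "b \<in> p" "t \<in> OL" "t \<notin> p" "t \<noteq> 0" "a = b / t" by (rule mp_E)
  then have "a * t = b" by simp
  then show "a \<in> p" using p_prime[of a t] y assms by auto
qed (rule p_mp)

lemma mp_1: "1 \<notin> mp" using mp_iff[OF O_1] p_1 by simp

lemma unit_iff: assumes "x \<in> Op" shows "x \<notin> mp \<longleftrightarrow> x \<noteq> 0 \<and> inverse x \<in> Op"
proof
  obtain a s where x: "a \<in> OL" "s \<in> OL" "s \<notin> p" "s \<noteq> 0" "x = a / s" using assms by (rule Op_E)
  assume "x \<notin> mp"
  then have "a \<notin> p" using mp_I[of a s] x by auto
  then show "x \<noteq> 0 \<and> inverse x \<in> Op" using Op_I[of s a] x p_0 by auto
next
  assume "x \<noteq> 0 \<and> inverse x \<in> Op"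
  then show "x \<notin> mp" using mp_mult[of "inverse x" x] mp_1 by auto
qed

lemma one_minus_unit:
  assumes y: "y \<in> p" and z: "z \<in> OL" shows "z / (1 - y) \<in> Op"
proof (rule Op_I[OF z])
  show "1 - y \<in> OL" using O_diff[OF O_1 p_sub[OF y]] .
  show "1 - y \<notin> p" using p_add[of "1 - y" y] y p_1 by auto
qed

lemma power_divisible:
  assumes N: "N \<ge> (1::nat)" and a: "a \<in> p" shows "\<exists>k. a ^ k / of_nat N \<in> Op"
proof -
  obtain i d y where y: "y \<in> OL" "a ^ i * (1 - a ^ Suc d) = of_nat N * y" using power_cycle[OF N p_sub[OF a]] by blast
  have ap: "a ^ Suc d \<in> p" using p_mult[OF O_power[OF p_sub[OF a], of d] a] by (simp add: mult.commute)
  have "1 - a ^ Suc d \<noteq> 0" using ap p_1 by auto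
  then have "a ^ i / of_nat N = y / (1 - a ^ Suc d)" using y(2) N by (simp add: frac_eq_eq mult.commute)
  then show ?thesis using one_minus_unit[OF ap y(1)] by (intro exI[of _ i]) simp
qed

text \<open>The element \<open>b\<close> is built up one member of \<open>S\<close> at a time,
  starting from 1. For a new \<open>a\<close>, multiply by the last power of \<open>a\<close> that
  keeps the quotient by \<open>N\<close> outside the local ring; one more factor \<open>a\<close>
  brings it inside. There is a last one because some power of \<open>a\<close> is divisible by
  \<open>N\<close> locally.\<close>

lemma annihilator:
  assumes N: "N \<ge> (1::nat)" "of_nat N \<in> p" and "finite S" "S \<subseteq> p"
  shows "\<exists>b\<in>OL. b / of_nat N \<notin> Op \<and> (\<forall>a\<in>S. a * b / of_nat N \<in> Op)"
  using assms(3,4)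
proof (induction S rule: finite_induct)
  case empty
  have "1 / of_nat N \<notin> Op"
  proof
    assume "1 / of_nat N \<in> Op"
    from mp_mult[OF this p_mp[OF N(2)]] show False using N(1) mp_1 by simp
  qed
  then show ?case using O_1 by auto
next
  case (insert a S)
  then obtain b where b: "b \<in> OL" "b / of_nat N \<notin> Op" "\<forall>a\<in>S. a * b / of_nat N \<in> Op" by auto
  have a: "a \<in> p" using insert by auto
  define P where "P = (\<lambda>k. a ^ k * b / of_nat N \<in> Op)"
  obtain k where "a ^ k / of_nat N \<in> Op" using power_divisible[OF N(1) a] by blast
  from Op_mult[OF this O_Op[OF b(1)]] have "P k" by (simp add: P_def)
  define l where "l = (LEAST k. P k)"
  have l: "P l" "\<And>j. j < l ==> \<not> P j" unfolding l_def using \<open>P k\<close> by (auto intro: LeastI dest: not_less_Least)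
  have "\<not> P 0" using b(2) by (simp add: P_def)
  then have "l \<noteq> 0" using l(1) by metis
  then obtain j where j: "l = Suc j" by (cases l) auto
  have aj: "a ^ j \<in> OL" by (rule O_power[OF p_sub[OF a]])
  have "c * (a ^ j * b) / of_nat N \<in> Op" if "c \<in> S" for c
  proof -
    have "a ^ j * (c * b / of_nat N) \<in> Op" using b(3) that by (intro Op_mult[OF O_Op[OF aj]]) auto
    then show ?thesis by (simp add: mult_ac)
  qed
  moreover have "a * (a ^ j * b) / of_nat N \<in> Op" using l(1) by (simp add: P_def j mult_ac)
  moreover have "a ^ j * b / of_nat N \<notin> Op" using l(2)[of j] by (simp add: P_def j)
  moreover have "a ^ j * b \<in> OL" using aj b by (intro O_mult)
  ultimately show ?case by auto
qed

text \<open>\<open>\<tau> = b / N\<close> carries \<open>p\<close> into the local ring without lying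
  in it. If it carried \<open>p\<close> into the maximal ideal, its product with some element
  outside \<open>p\<close> would map the finitely generated ideal \<open>p\<close> to itself and so
  be integral, which would put \<open>\<tau>\<close> into the local ring. Hence
  \<open>\<tau> * \<pi>\<close> is a unit for some \<open>\<pi>\<close> in \<open>p\<close>, and
  this \<open>\<pi>\<close> generates the maximal ideal.\<close>

lemma ex_\<pi>: "\<exists>\<pi>\<in>p. \<pi> \<noteq> 0 \<and> uniformizer L p \<pi>"
proof -
  obtain N :: nat where N: "N \<ge> 1" "of_nat N \<in> p" using ex_nat_in_p by blast
  obtain A where A: "finite A" "A \<subseteq> p" and NA: "of_nat N \<in> A"
    and gen': "\<forall>x\<in>p. \<exists>c. (\<forall>j\<in>A. c j \<in> OL) \<and> x = (\<Sum>j\<in>A. c j * j)"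
  proof -
    have "\<exists>A. finite A \<and> A \<subseteq> p \<and> of_nat N \<in> A \<and> (\<forall>x\<in>p. \<exists>c. (\<forall>j\<in>A. c j \<in> OL) \<and> x = (\<Sum>j\<in>A. c j * j))"
      by (rule finite_generators[OF N]) (auto intro: p_sub p_diff p_mult)
    then show thesis using that by blast
  qed
  then have gen: "\<exists>c. (\<forall>j\<in>A. c j \<in> OL) \<and> x = (\<Sum>j\<in>A. c j * j)" if "x \<in> p" for x using that by blast
  obtain b where b: "b \<in> OL" "b / of_nat N \<notin> Op" "\<forall>a\<in>A. a * b / of_nat N \<in> Op"
    using annihilator[OF N A] by blast
  define \<tau> where "\<tau> = b / of_nat N"
  have \<tau>L: "\<tau> \<in> L" unfolding \<tau>_def using b by (intro divide_in O_sub O_of_nat)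
  have \<tau>p: "\<tau> * x \<in> Op" if xp: "x \<in> p" for x
  proof -
    obtain c where c: "\<forall>j\<in>A. c j \<in> OL" "x = (\<Sum>j\<in>A. c j * j)" using gen[OF xp] by blast
    have "(\<Sum>j\<in>S. c j * (j * b / of_nat N)) \<in> Op" if "S \<subseteq> A" for S
      using finite_subset[OF that A(1)] that
    proof (induction S rule: finite_induct)
      case empty
      then show ?case using O_Op[OF O_0] by simp
    next
      case (insert j S)
      have "c j * (j * b / of_nat N) \<in> Op" using insert.prems b(3) c(1) by (intro Op_mult[OF O_Op]) auto
      moreover have "(\<Sum>j\<in>S. c j * (j * b / of_nat N)) \<in> Op" using insert by simp
      ultimately show ?case unfolding sum.insert[OF insert.hyps(1,2)] by (rule Op_add)
    qed
    then show ?thesis by (simp add: c \<tau>_def sum_distrib_left mult_ac)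
  qed
  have "\<exists>x\<in>p. \<tau> * x \<notin> mp"
  proof (rule ccontr)
    assume "\<not> ?thesis"
    then have "\<forall>x. \<exists>a s. x \<in> A --> a \<in> p \<and> s \<in> OL \<and> s \<notin> p \<and> s \<noteq> 0 \<and> \<tau> * x = a / s"
      using A by (meson mp_E subsetD)
    then obtain f s where fs: "\<And>x. x \<in> A ==> f x \<in> p \<and> s x \<in> OL \<and> s x \<notin> p \<and> s x \<noteq> 0 \<and> \<tau> * x = f x / s x" by metis
    define S where "S = (\<Prod>x\<in>A. s x)"
    have S: "S \<in> OL" "S \<notin> p" unfolding S_def using fs A p_prod[of A s] by (auto intro: O_prod)
    have st: "\<exists>c. (\<forall>j\<in>A. c j \<in> OL) \<and> S * \<tau> * x = (\<Sum>j\<in>A. c j * j)" if x: "x \<in> A" for x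
    proof -
      have "S = s x * (\<Prod>x\<in>A - {x}. s x)" unfolding S_def using A x by (intro prod.remove)
      then have "S * \<tau> * x = (\<Prod>x\<in>A - {x}. s x) * f x" using fs[OF x] by (simp add: mult.assoc)
      moreover have "(\<Prod>x\<in>A - {x}. s x) * f x \<in> p" using fs x by (intro p_mult O_prod) auto
      ultimately show ?thesis using gen by simp
    qed
    then obtain c where c: "\<And>x. x \<in> A ==> (\<forall>j\<in>A. c x j \<in> OL) \<and> S * \<tau> * x = (\<Sum>j\<in>A. c x j * j)" by metis
    have "algebraic_int (S * \<tau>)"
      by (rule algebraic_int_stable[OF A(1), of "of_nat N" "\<lambda>x. x" c]) (use c N NA in \<open>auto simp: integers_of_def\<close>)
    then have "S * \<tau> \<in> OL" using S \<tau>L by (auto simp: integers_of_def intro: mult_in)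
    then have "S * \<tau> / S \<in> Op" using S by (intro Op_I)
    moreover have "S \<noteq> 0" using S p_0 by auto
    ultimately show False using b(2) by (simp add: \<tau>_def)
  qed
  then obtain \<pi> where \<pi>: "\<pi> \<in> p" "\<tau> * \<pi> \<notin> mp" by blast
  have u: "\<tau> * \<pi> \<noteq> 0" "inverse (\<tau> * \<pi>) \<in> Op" using unit_iff[OF \<tau>p[OF \<pi>(1)]] \<pi>(2) by auto
  have "mp = {\<pi> * a |a. a \<in> Op}"
  proof (intro equalityI subsetI)
    fix y assume "y \<in> mp"
    then obtain a s where a: "a \<in> p" "s \<in> OL" "s \<notin> p" "s \<noteq> 0" "y = a / s" by (rule mp_E)
    have "inverse (\<tau> * \<pi>) * (\<tau> * a) * (1 / s) \<in> Op" 
      by (rule Op_mult[OF Op_mult[OF u(2) \<tau>p[OF a(1)]] Op_I[OF O_1 a(2,3)]])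
    moreover have "y = \<pi> * (inverse (\<tau> * \<pi>) * (\<tau> * a) * (1 / s))" using u(1) a by (simp add: field_simps)
    ultimately show "y \<in> {\<pi> * a |a. a \<in> Op}" by blast
  next
    fix y assume "y \<in> {\<pi> * a |a. a \<in> Op}"
    then show "y \<in> mp" using mp_mult p_mp[OF \<pi>(1)] by (auto simp: mult.commute)
  qed
  then show ?thesis using \<pi> u by (auto simp: uniformizer_def)
qed

definition \<pi> where "\<pi> = (SOME \<pi>. \<pi> \<in> p \<and> \<pi> \<noteq> 0 \<and> uniformizer L p \<pi>)"

lemma \<pi>: "\<pi> \<in> p" "\<pi> \<noteq> 0" "uniformizer L p \<pi>"
  using someI_ex[of "\<lambda>\<pi>. \<pi> \<in> p \<and> \<pi> \<noteq> 0 \<and> uniformizer L p \<pi>"] ex_\<pi> unfolding \<pi>_def by blast+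

lemma mp_\<pi>: "uniformizer L p \<theta> ==> \<theta> \<noteq> 0 ==> x \<in> mp \<longleftrightarrow> x / \<theta> \<in> Op"
  unfolding uniformizer_def by (auto intro: exI[of _ "x / \<theta>"])

abbreviation "Up \<equiv> Op - mp"

lemma U_mult: "u \<in> Up ==> w \<in> Up ==> u * w \<in> Up"
  using unit_iff[of u] unit_iff[of w] unit_iff[of "u * w"] Op_mult[of u w] Op_mult[of "inverse u" "inverse w"] by simp

lemma U_inverse: "u \<in> Up ==> inverse u \<in> Up" using unit_iff[of u] unit_iff[of "inverse u"] by simp

lemma U_1: "1 \<in> Up" using O_Op[OF O_1] mp_1 by simp

lemma U_power_int: "u \<in> Up ==> u powi k \<in> Up"
proof -
  assume u: "u \<in> Up"
  have "w ^ j \<in> Up" if "w \<in> Up" for w j by (induction j) (simp_all add: U_1 U_mult that del: Diff_iff)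
  then show ?thesis using u U_inverse by (simp add: power_int_def del: Diff_iff)
qed

text \<open>If every power of \<open>\<pi>\<close> divided \<open>a\<close>, then
  \<open>1 / \<pi>\<close> would be in the local ring: some multiple \<open>D / a\<close> is
  integral, and some power of \<open>\<pi>\<close> is divisible by \<open>D\<close>.\<close>

lemma decompose_O:
  assumes a: "a \<in> OL" "a \<noteq> 0" shows "\<exists>(k::nat) u. u \<in> Up \<and> a = u * \<pi> ^ k"
proof -
  have "\<exists>k. a / \<pi> ^ k \<notin> Op"
  proof (rule ccontr)
    assume "\<not> ?thesis"
    then have all: "a / \<pi> ^ k \<in> Op" for k by blast
    obtain D :: nat where D: "D \<ge> 1" "of_nat D * inverse a \<in> OL" using ex_integral_multiple[OF inverse_in[OF O_sub[OF a(1)]]] by blast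
    obtain k where k: "\<pi> ^ k / of_nat D \<in> Op" using power_divisible[OF D(1) \<pi>(1)] by blast
    have "\<pi> ^ k / of_nat D * (of_nat D * inverse a) * (a / \<pi> ^ Suc k) \<in> Op" by (intro Op_mult k O_Op D(2) all)
    then have "1 / \<pi> \<in> Op" using a(2) D(1) \<pi>(2) by (simp add: field_simps)
    then show False using mp_\<pi>[OF \<pi>(3,2)] mp_1 by blast
  qed
  then obtain k where k: "a / \<pi> ^ k \<notin> Op" "\<And>j. j < k ==> a / \<pi> ^ j \<in> Op" using exists_least_iff[of "\<lambda>k. a / \<pi> ^ k \<notin> Op"] by auto
  then have "k \<noteq> 0" using O_Op[OF a(1)] by (metis div_by_1 power_0)
  then obtain j where j: "k = Suc j" by (cases k) auto
  have "a / \<pi> ^ j \<in> Up" using k(1) k(2)[of j] mp_\<pi>[OF \<pi>(3,2), of "a / \<pi> ^ j"] by (simp add: j mult.commute)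
  then show ?thesis using \<pi>(2) by (intro exI[of _ j] exI[of _ "a / \<pi> ^ j"]) auto
qed

lemma decompose:
  assumes x: "x \<in> L" "x \<noteq> 0" shows "\<exists>k u. u \<in> Up \<and> x = u * \<pi> powi k"
proof -
  obtain D :: nat where D: "D \<ge> 1" "of_nat D * x \<in> OL" using ex_integral_multiple[OF x(1)] by blast
  obtain k u where u: "u \<in> Up" "of_nat D * x = u * \<pi> ^ k" using decompose_O[OF D(2)] D(1) x by auto
  obtain l w where w: "w \<in> Up" "of_nat D = w * \<pi> ^ l" using decompose_O[OF O_of_nat[of D]] D(1) by auto
  have w0: "w \<noteq> 0" using w(2) D(1) by auto
  have "x = (of_nat D * x) / of_nat D" using D(1) by simp
  also have "\<dots> = (u * \<pi> ^ k) / (w * \<pi> ^ l)" by (simp only: u(2) w(2)[symmetric])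
  also have "\<dots> = (u * inverse w) * \<pi> powi (int k - int l)" using \<pi>(2) w0 by (simp add: power_int_diff field_simps)
  finally show ?thesis using U_mult[OF u(1) U_inverse[OF w(1)]] by blast
qed

lemma power_int_unit_imp:
  assumes \<theta>: "uniformizer L p \<theta>" "\<theta> \<noteq> 0" and k: "\<theta> powi k \<in> Up" shows "k = 0"
proof -
  have m: "\<theta> ^ j \<in> mp" if "j > 0" for j
  proof -
    have \<theta>m: "\<theta> \<in> mp" using mp_\<pi>[OF \<theta>, of \<theta>] \<theta>(2) O_Op[OF O_1] by simp
    show ?thesis using that
    proof (induction j)
      case (Suc j)
      then show ?case using \<theta>m mp_mult[OF mp_sub[OF \<theta>m]] by (cases "j = 0") auto
    qed simp
  qed
  show ?thesis
  proof (rule ccontr)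
    assume "k \<noteq> 0"
    then consider "k > 0" | "k < 0" by linarith
    then show False
    proof cases
      case 1
      then have "\<theta> powi k = \<theta> ^ nat k" by (simp add: power_int_def)
      then show False using m[of "nat k"] 1 k by simp
    next
      case 2
      then have "inverse (\<theta> powi k) = \<theta> ^ nat (- k)" by (simp add: power_int_def power_inverse)
      then show False using m[of "nat (- k)"] 2 U_inverse[OF k] by simp
    qed
  qed
qed

lemma uniformizer_nonzero: assumes "uniformizer L p \<theta>" shows "\<theta> \<noteq> 0"
proof
  assume "\<theta> = 0"
  then have "\<pi> = 0" using assms p_mp[OF \<pi>(1)] by (auto simp: uniformizer_def)
  then show False using \<pi> by simp
qed

lemma ord_at_eq:
  assumes \<theta>: "uniformizer L p \<theta>" and u: "u \<in> Up" and x: "x = u * \<theta> powi k"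
  shows "ord_at L p x = k"
  unfolding ord_at_def
proof (rule the_equality)
  show "\<exists>\<pi> u. uniformizer L p \<pi> \<and> u \<in> Up \<and> x = u * \<pi> powi k" using assms by blast
  have w0: "\<theta> \<noteq> 0" using \<theta> by (rule uniformizer_nonzero)
  fix l assume "\<exists>\<pi> u. uniformizer L p \<pi> \<and> u \<in> Up \<and> x = u * \<pi> powi l"
  then obtain \<rho> t where \<rho>: "uniformizer L p \<rho>" "t \<in> Up" "x = t * \<rho> powi l" by blast
  have r0: "\<rho> \<noteq> 0" using \<rho>(1) by (rule uniformizer_nonzero)
  have one: "1 \<in> Op" using O_Op[OF O_1] .
  have "\<rho> \<in> mp" "\<theta> \<in> mp" using mp_\<pi>[OF \<rho>(1) r0, of \<rho>] mp_\<pi>[OF \<theta> w0, of \<theta>] one r0 w0 by auto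
  then have "\<rho> / \<theta> \<in> Op" "\<theta> / \<rho> \<in> Op" using mp_\<pi>[OF \<rho>(1) r0, of \<theta>] mp_\<pi>[OF \<theta> w0, of \<rho>] by auto
  then have w: "\<rho> / \<theta> \<in> Up" using unit_iff[of "\<rho> / \<theta>"] r0 w0 by simp
  define w where "w = \<rho> / \<theta>"
  have wU: "w \<in> Up" "w \<noteq> 0" and rw: "\<rho> = w * \<theta>" using w w0 r0 by (auto simp: w_def)
  have u0: "u \<noteq> 0" "t \<noteq> 0" using u \<rho>(2) unit_iff by auto
  have "u * \<theta> powi k = t * (w powi l * \<theta> powi l)" using x \<rho>(3) by (simp add: rw power_int_mult_distrib)
  then have "\<theta> powi (k - l) = inverse u * (t * w powi l)" using u0 w0 wU by (simp add: power_int_diff field_simps)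
  also have "\<dots> \<in> Up" by (intro U_mult U_inverse u \<rho>(2) U_power_int wU)
  finally have "k - l = 0" by (rule power_int_unit_imp[OF \<theta> w0])
  then show "l = k" by simp
qed

abbreviation "vp \<equiv> ord_at L p"

lemma vp_decompose: assumes "x \<in> L" "x \<noteq> 0" shows "\<exists>u\<in>Up. x = u * \<pi> powi vp x"
  using decompose[OF assms] ord_at_eq[OF \<pi>(3)] by metis

lemma \<pi>_powi_Op: assumes "k \<ge> 0" shows "\<pi> powi k \<in> Op"
  using O_Op[OF O_power[OF p_sub[OF \<pi>(1)]]] assms by (simp add: power_int_def)

lemma \<pi>_powi_mp: assumes "k \<ge> 1" shows "\<pi> powi k \<in> mp"
proof -
  have "\<pi> powi k = \<pi> powi (k - 1) * \<pi>" using \<pi>(2) by (simp add: power_int_diff)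
  then show ?thesis using mp_mult[OF \<pi>_powi_Op p_mp[OF \<pi>(1)], of "k - 1"] assms by simp
qed

lemma Op_iff: assumes "x \<in> L" "x \<noteq> 0" shows "x \<in> Op \<longleftrightarrow> 0 \<le> vp x" "x \<in> mp \<longleftrightarrow> 1 \<le> vp x"
proof -
  obtain u where u: "u \<in> Up" "x = u * \<pi> powi vp x" using vp_decompose[OF assms] by blast
  have ge: "x \<in> Op" if "0 \<le> vp x" using Op_mult[OF _ \<pi>_powi_Op[OF that], of u] u by simp
  have m: "x \<in> mp" if "1 \<le> vp x" using mp_mult[OF _ \<pi>_powi_mp[OF that], of u] u by simp
  have lt: "x \<notin> Op" if "vp x < 0"
  proof
    assume x: "x \<in> Op"
    have "inverse x = inverse u * \<pi> powi (- vp x)" by (subst u(2)) (simp add: power_int_minus)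
    also have "\<dots> \<in> mp" using U_inverse[OF u(1)] that by (intro mp_mult \<pi>_powi_mp) auto
    finally have "x * inverse x \<in> mp" using x by (intro mp_mult)
    then show False using assms mp_1 by simp
  qed
  have z: "x \<notin> mp" if "vp x = 0" using u that by simp
  show "x \<in> Op \<longleftrightarrow> 0 \<le> vp x" using ge lt by force
  show "x \<in> mp \<longleftrightarrow> 1 \<le> vp x" using m lt z mp_sub[of x] by (cases "vp x < 0"; cases "vp x = 0") auto
qed

lemma vp_mult: assumes "x \<in> L" "x \<noteq> 0" "y \<in> L" "y \<noteq> 0" shows "vp (x * y) = vp x + vp y"
proof -
  obtain u where u: "u \<in> Up" "x = u * \<pi> powi vp x" using vp_decompose[OF assms(1,2)] by blast
  obtain w where w: "w \<in> Up" "y = w * \<pi> powi vp y" using vp_decompose[OF assms(3,4)] by blast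
  have "x * y = (u * \<pi> powi vp x) * (w * \<pi> powi vp y)" using u(2) w(2) by simp
  also have "\<dots> = (u * w) * \<pi> powi (vp x + vp y)" using \<pi>(2) by (simp add: power_int_add mult_ac)
  finally show ?thesis by (rule ord_at_eq[OF \<pi>(3) U_mult[OF u(1) w(1)]])
qed

lemma vp_add:
  assumes "x \<in> L" "x \<noteq> 0" "y \<in> L" "y \<noteq> 0" "x + y \<noteq> 0" shows "min (vp x) (vp y) \<le> vp (x + y)"
proof -
  have main: "vp x \<le> vp (x + y)" if xy: "x \<in> L" "x \<noteq> 0" "y \<in> L" "y \<noteq> 0" "x + y \<noteq> 0" "vp x \<le> vp y" for x y
  proof -
    have iv: "vp (inverse x) = - vp x"
      using vp_mult[of x "inverse x"] inverse_in xy ord_at_eq[OF \<pi>(3) U_1, of 1 0] by simp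
    have "vp (inverse x * y) = vp y - vp x" using vp_mult[of "inverse x" y] xy iv inverse_in by simp
    then have "inverse x * y \<in> Op" using Op_iff(1)[of "inverse x * y"] xy inverse_in mult_in by simp
    then have "1 + inverse x * y \<in> Op" using O_Op[OF O_1] by (rule Op_add[rotated])
    moreover have e: "1 + inverse x * y = inverse x * (x + y)" using xy by (simp add: distrib_left)
    moreover have inL: "inverse x * (x + y) \<in> L" using xy by (intro mult_in inverse_in add_in)
    ultimately have "0 \<le> vp (inverse x * (x + y))" using Op_iff(1)[OF inL] xy by simp
    also have "\<dots> = vp (x + y) - vp x" using vp_mult[of "inverse x" "x + y"] xy iv inverse_in add_in by simp
    finally show ?thesis by simp
  qed
  show ?thesis using main[of x y] main[of y x] assms by (cases "vp x \<le> vp y") (auto simp: add.commute)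
qed

lemma vp_\<pi>: "vp \<pi> = 1" using ord_at_eq[OF \<pi>(3) U_1, of \<pi> 1] by simp

end

sublocale closed_point_loc \<subseteq> discrete_valued_field L "ord_at L p"
proof unfold_locales
  show "\<exists>\<pi>\<in>L. \<pi> \<noteq> 0 \<and> vp \<pi> = 1" using \<pi> vp_\<pi> p_sub O_sub by blast
qed (fact vp_mult vp_add)+

context closed_point_loc
begin

lemma Op_eq: "Op = B 0"
  using Op_iff(1) Op_sub O_Op[OF O_0] by (auto simp: B_def)

lemma mp_eq: "mp = B 1"
  using Op_iff(2) Op_sub[OF mp_sub] p_mp[OF p_0] by (auto simp: B_def)

lemma O_B: "x \<in> OL ==> x \<in> B 0" using O_Op Op_eq by blast

lemma p_B: "x \<in> OL ==> x \<in> p \<longleftrightarrow> x \<in> B 1" using mp_iff mp_eq by simp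

end

section \<open>Approximation and torsion of the class group\<close>

abbreviation val_ball :: "complex set => complex set => int => complex set" where
  "val_ball L p \<equiv> valued_field.B L (ord_at L p)"

context valued_field
begin

lemma B_power_mult: "x \<in> B 1 ==> x ^ k \<in> B (int k)"
proof (induction k)
  case (Suc k)
  then show ?case using B_mult[of x 1 "x ^ k" "int k"] by (simp add: add.commute)
qed (simp add: B_1)

end

context number_field_loc
begin

text \<open>A group of integers of \<open>L\<close> that contains all multiples of \<open>N\<close>
  is determined by the representatives modulo \<open>N\<close> in it. So there are only finitely
  many such groups; this yields finiteness of the primes above \<open>N\<close> and torsion of the
  class group.\<close>

lemma rep_determines:
  assumes R: "\<forall>x\<in>OL. \<exists>r\<in>Rep. \<exists>y\<in>OL. x = r + of_nat N * y" and J: "J \<subseteq> OL"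
    and cl: "\<And>x y. x \<in> J ==> y \<in> J ==> x - y \<in> J" "\<And>y. y \<in> OL ==> of_nat N * y \<in> J"
    and cl': "\<And>x y. x \<in> J' ==> y \<in> J' ==> x + y \<in> J'" "\<And>y. y \<in> OL ==> of_nat N * y \<in> J'"
    and eq: "J \<inter> Rep \<subseteq> J'"
  shows "J \<subseteq> J'"
proof
  fix x assume x: "x \<in> J"
  then obtain r y where ry: "r \<in> Rep" "y \<in> OL" "x = r + of_nat N * y" using R J by blast
  have "x - of_nat N * y \<in> J" using x ry by (intro cl)
  then have "r \<in> J'" using ry eq by auto
  then show "x \<in> J'" using ry cl' by simp
qed

lemma finite_closed_points:
  assumes a: "a \<in> OL" "a \<noteq> 0" shows "finite {p. closed_point L p \<and> a \<in> p}"
proof -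
  obtain N :: nat where N: "N \<ge> 1" "of_nat N * inverse a \<in> OL" using ex_integral_multiple[OF inverse_in[OF O_sub[OF a(1)]]] by blast
  obtain Rep where R: "finite Rep" "\<forall>x\<in>OL. \<exists>r\<in>Rep. \<exists>y\<in>OL. x = r + of_nat N * y" using finite_reps[OF N(1)] by blast
  let ?P = "{p. closed_point L p \<and> a \<in> p}"
  have sub: "p \<subseteq> p'" if p: "p \<in> ?P" "p' \<in> ?P" "p \<inter> Rep = p' \<inter> Rep" for p p'
  proof -
    interpret p: closed_point_loc L p by unfold_locales (use p in simp)
    interpret p': closed_point_loc L p' by unfold_locales (use p in simp)
    have "of_nat N * inverse a * a \<in> p" "of_nat N * inverse a * a \<in> p'" using p N by (auto intro: p.p_mult p'.p_mult)
    then have "of_nat N \<in> p" "of_nat N \<in> p'" using a by (simp_all add: mult.assoc)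
    then have N: "y \<in> OL ==> of_nat N * y \<in> p" "y \<in> OL ==> of_nat N * y \<in> p'" for y
      using p.p_mult[of y "of_nat N"] p'.p_mult[of y "of_nat N"] by (simp_all add: mult.commute)
    show ?thesis
    proof (rule rep_determines[OF R(2)])
      show "p \<subseteq> OL" using p.p_sub by blast
      show "p \<inter> Rep \<subseteq> p'" using p(3) by blast
    qed (fact p.p_diff p'.p_add N)+
  qed
  have "inj_on (\<lambda>p. p \<inter> Rep) ?P"
  proof (rule inj_onI)
    fix p p' assume p: "p \<in> ?P" "p' \<in> ?P" "p \<inter> Rep = p' \<inter> Rep"
    show "p = p'" using sub[OF p] sub[OF p(2,1) p(3)[symmetric]] by (rule equalityI)
  qed
  moreover have "finite ((\<lambda>p. p \<inter> Rep) ` ?P)" by (rule finite_subset[of _ "Pow Rep"]) (use R(1) in auto)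
  ultimately show ?thesis by (rule finite_imageD[rotated])
qed

lemma closed_point_not_subset:
  assumes p: "closed_point L p" and q: "closed_point L q" and ne: "p \<noteq> q" shows "\<exists>t\<in>p. t \<notin> q"
proof (rule ccontr)
  interpret p: closed_point_loc L p by unfold_locales (rule p)
  interpret q: closed_point_loc L q by unfold_locales (rule q)
  assume "\<not> ?thesis"
  then have sub: "p \<subseteq> q" by blast
  then obtain a where a: "a \<in> q" "a \<notin> p" using ne by blast
  then obtain b where b: "b \<in> OL" "a * b - 1 \<in> p" using p.p_max q.p_sub by blast
  have "b * a - (a * b - 1) \<in> q" by (rule q.p_diff[OF q.p_mult[OF b(1) a(1)] subsetD[OF sub b(2)]])
  then show False using q.p_1 by (simp add: mult.commute)
qed

lemma ex_idempotent:
  assumes S: "finite S" "\<And>q. q \<in> S ==> closed_point L q" and p: "p \<in> S"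
  shows "\<exists>e\<in>OL. e - 1 \<in> val_ball L p (int M) \<and> (\<forall>l\<in>S - {p}. e \<in> val_ball L l (int M))"
proof -
  interpret p: closed_point_loc L p by unfold_locales (use S p in simp)
  have "\<exists>t\<in>OL. t \<in> l \<and> t - 1 \<in> p" if l: "l \<in> S - {p}" for l
  proof -
    interpret l: closed_point_loc L l by unfold_locales (use S l in simp)
    obtain a where a: "a \<in> l" "a \<notin> p" using closed_point_not_subset[of l p] S p l by auto
    then obtain b where b: "b \<in> OL" "a * b - 1 \<in> p" using p.p_max l.p_sub by blast
    have "b * a \<in> l" using a b by (intro l.p_mult)
    then show ?thesis using b l.p_sub[of "a * b"] by (intro bexI[of _ "a * b"]) (auto simp: mult.commute)
  qed
  then obtain t where t: "\<And>l. l \<in> S - {p} ==> t l \<in> OL \<and> t l \<in> l \<and> t l - 1 \<in> p" by metis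
  define T where "T = (\<Prod>l\<in>S - {p}. t l)"
  have T: "T \<in> OL" unfolding T_def using t by (intro O_prod) auto
  have Tp: "(\<Prod>l\<in>A. t l) - 1 \<in> p" if "A \<subseteq> S - {p}" for A
    using finite_subset[OF that] S(1) that
  proof (induction A rule: infinite_finite_induct)
    case (insert l A)
    have lin: "l \<in> S - {p}" "A \<subseteq> S - {p}" using insert.prems by auto
    have "(\<Prod>l\<in>A. t l) - 1 \<in> p" using insert lin by auto
    then have "t l * ((\<Prod>l\<in>A. t l) - 1) + (t l - 1) \<in> p" using t[OF lin(1)] by (intro p.p_add p.p_mult) auto
    moreover have "t l * ((\<Prod>l\<in>A. t l) - 1) + (t l - 1) = (\<Prod>l\<in>insert l A. t l) - 1"
      using insert.hyps by (simp add: algebra_simps)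
    ultimately show ?case by simp
  qed (simp_all add: p.p_0)
  \<comment> \<open>\<open>T\<close> is 1 modulo \<open>p\<close> and 0 modulo the other points. The
    inner power makes \<open>T ^ M\<close> small at these, and \<open>e\<close> is a multiple of it;
    at \<open>p\<close> the number \<open>1 - T ^ M\<close> still has positive valuation, and the
    outer power makes it small.\<close>
  define e where "e = 1 - (1 - T ^ M) ^ M"
  have fac: "1 - x ^ M = (\<Sum>i<M. x ^ i) * (1 - x)" for x :: complex using one_diff_power_eq[of x M] by simp
  have "1 - T \<in> p" using p.p_uminus[OF Tp[of "S - {p}"]] by (simp add: T_def)
  then have "1 - T ^ M \<in> p" unfolding fac by (intro p.p_mult O_sum O_power T)
  then have "1 - T ^ M \<in> p.B 1" using p.p_B p.p_sub by blast
  then have "- ((1 - T ^ M) ^ M) \<in> p.B (int M)" by (intro p.B_uminus p.B_power_mult)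
  then have ep: "e - 1 \<in> p.B (int M)" by (simp add: e_def)
  have el: "e \<in> val_ball L l (int M)" if l: "l \<in> S - {p}" for l
  proof -
    interpret l: closed_point_loc L l by unfold_locales (use S l in simp)
    have "T = (\<Prod>l\<in>S - {p} - {l}. t l) * t l" unfolding T_def using S l by (subst prod.remove[of _ l]) (auto simp: mult.commute)
    also have "\<dots> \<in> l" using t l by (intro l.p_mult O_prod) auto
    finally have "T \<in> l.B 1" using l.p_B T by blast
    then have TM: "T ^ M \<in> l.B (int M)" by (rule l.B_power_mult)
    have "e = (\<Sum>i<M. (1 - T ^ M) ^ i) * T ^ M" using fac[of "1 - T ^ M"] by (simp add: e_def)
    also have "\<dots> \<in> l.B (int M)"
      using TM T by (intro l.B_mult0 l.O_B O_sum O_power O_diff O_1)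
    finally show ?thesis .
  qed
  have "e \<in> OL" unfolding e_def using T by (intro O_diff O_1 O_power)
  then show ?thesis using ep el by blast
qed

end

text \<open>Write \<open>x = a / s\<close> and \<open>s * b = 1 - y\<close> with \<open>y\<close> in
  \<open>p\<close>. The truncated geometric series inverts \<open>1 - y\<close> up to
  \<open>y ^ M\<close>.\<close>

lemma (in closed_point_loc) approx_integral:
  assumes x: "x \<in> B 0" shows "\<exists>a\<in>OL. a - x \<in> B (int M)"
proof -
  have "x \<in> Op" using x by (simp add: Op_eq)
  then obtain a s where as: "a \<in> OL" "s \<in> OL" "s \<notin> p" "s \<noteq> 0" "x = a / s" by (rule Op_E)
  obtain b where b: "b \<in> OL" "s * b - 1 \<in> p" using p_max as by blast
  define y where "y = 1 - s * b"
  have y: "y \<in> p" using p_uminus[OF b(2)] by (simp add: y_def)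
  then have "y \<in> B 1" using p_B p_sub by blast
  then have "- (y ^ M) * x \<in> B (int M + 0)" by (intro B_mult B_uminus B_power_mult x)
  moreover have "a * b * (\<Sum>i<M. y ^ i) - x = - (y ^ M) * x"
  proof -
    have "s * b * (\<Sum>i<M. y ^ i) = 1 - y ^ M" unfolding one_diff_power_eq by (simp add: y_def)
    moreover have "a * b * (\<Sum>i<M. y ^ i) = x * (s * b * (\<Sum>i<M. y ^ i))" using as by simp
    ultimately have "a * b * (\<Sum>i<M. y ^ i) = x * (1 - y ^ M)" by simp
    then show ?thesis by (simp add: algebra_simps)
  qed
  moreover have "a * b * (\<Sum>i<M. y ^ i) \<in> OL" using as b p_sub[OF y] by (intro O_mult O_sum O_power)
  ultimately show ?thesis by (intro bexI[of _ "a * b * (\<Sum>i<M. y ^ i)"]) auto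
qed

context number_field_loc
begin

lemma chinese_remainder:
  assumes S: "finite S" "\<And>q. q \<in> S ==> closed_point L q" and x: "\<And>q. q \<in> S ==> x q \<in> val_ball L q 0"
  shows "\<exists>a\<in>OL. \<forall>q\<in>S. a - x q \<in> val_ball L q (int M)"
proof -
  have "\<exists>a\<in>OL. a - x q \<in> val_ball L q (int M)" if q: "q \<in> S" for q
  proof -
    interpret q: closed_point_loc L q by unfold_locales (use S q in simp)
    show ?thesis using q.approx_integral[OF x[OF q]] .
  qed
  then obtain a where a: "\<And>q. q \<in> S ==> a q \<in> OL \<and> a q - x q \<in> val_ball L q (int M)" by metis
  have "\<forall>q\<in>S. \<exists>e\<in>OL. e - 1 \<in> val_ball L q (int M) \<and> (\<forall>l\<in>S - {q}. e \<in> val_ball L l (int M))"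
    using ex_idempotent[OF S] by blast
  then obtain e where e: "\<And>q. q \<in> S ==> e q \<in> OL \<and> e q - 1 \<in> val_ball L q (int M) \<and> (\<forall>l\<in>S - {q}. e q \<in> val_ball L l (int M))"
    by metis
  have "(\<Sum>q\<in>S. e q * a q) - x l \<in> val_ball L l (int M)" if l: "l \<in> S" for l
  proof -
    interpret l: closed_point_loc L l by unfold_locales (use S l in simp)
    have "(\<Sum>q\<in>S. e q * a q) = e l * a l + (\<Sum>q\<in>S - {l}. e q * a q)" using S l by (intro sum.remove)
    then have "(\<Sum>q\<in>S. e q * a q) - x l = a l * (e l - 1) + (a l - x l) + (\<Sum>q\<in>S - {l}. a q * e q)"
      by (simp add: algebra_simps)
    also have "\<dots> \<in> l.B (int M)"
      using a e l by (intro l.B_add l.B_mult0 l.B_sum l.O_B) auto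
    finally show ?thesis .
  qed
  moreover have "(\<Sum>q\<in>S. e q * a q) \<in> OL" using a e by (intro O_sum O_mult) auto
  ultimately show ?thesis by blast
qed

end

text \<open>\<open>I i\<close> consists of the integers of \<open>L\<close> of valuation at least
  \<open>i\<close>. With \<open>x i\<close> of least size in it, the box principle shows that
  \<open>W * y / x i\<close> is integral for all \<open>y\<close> in \<open>I i\<close>, with one
  \<open>W\<close> for all \<open>i\<close>. The groups \<open>J i\<close> of these quotients
  contain all multiples of \<open>W\<close>, so two of them agree; then \<open>c = x j / x i\<close>
  carries \<open>I i\<close> onto \<open>I j\<close>. This is the classical proof that the class
  number is finite.\<close>

lemma (in closed_point_loc) class_torsion:
  "\<exists>c\<in>OL. c \<noteq> 0 \<and> vp c \<ge> 1 \<and> (\<forall>q. closed_point L q --> q \<noteq> p --> ord_at L q c = 0)"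
proof -
  obtain s :: "complex => real" and H :: nat where s0: "\<And>x. s x \<ge> 0" and sm: "\<And>x y. x \<in> L ==> y \<in> L ==> s (x * y) \<le> s x * s y"
    and sf: "\<And>b. finite {z \<in> OL. s z \<le> b}" and bx: "\<And>w. w \<in> L ==> \<exists>t z. 1 \<le> t \<and> t \<le> H \<and> z \<in> OL \<and> s (of_nat t * w - z) < 1"
    and sd: "\<And>z. z \<in> OL ==> s z < 1 ==> z = 0"
    using ex_size by blast
  obtain N :: nat where N: "N \<ge> 1" "of_nat N \<in> p" using ex_nat_in_p by blast
  define I where "I = (\<lambda>i::nat. {x \<in> OL. x \<in> B (int i)})"
  have I_cl: "x + y \<in> I i" "x - y \<in> I i" if "x \<in> I i" "y \<in> I i" for x y i
    using that by (auto simp: I_def intro: O_in B_add B_diff)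
  have I_mult: "a * x \<in> I i" if "a \<in> OL" "x \<in> I i" for a x i
    using that O_B by (auto simp: I_def intro: O_in B_mult0)
  have I_pow: "t ^ i \<in> I i" if "t \<in> p" for t i
    using that p_B p_sub by (auto simp: I_def intro: O_power B_power_mult)
  have "\<exists>x\<in>I i - {0}. \<forall>y\<in>I i - {0}. s x \<le> s y" for i
  proof -
    have ne: "of_nat N ^ i \<in> I i - {0}" using I_pow[OF N(2)] N(1) by simp
    let ?F = "{z \<in> I i - {0}. s z \<le> s (of_nat N ^ i)}"
    have fin: "finite ?F" by (rule finite_subset[OF _ sf[of "s (of_nat N ^ i)"]]) (auto simp: I_def)
    have nF: "?F \<noteq> {}" using ne by blast
    obtain x where "is_arg_min s (\<lambda>x. x \<in> ?F) x" using ex_is_arg_min_if_finite[OF fin nF] by blast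
    then have x: "x \<in> ?F" "\<And>y. y \<in> ?F ==> s x \<le> s y" unfolding is_arg_min_linorder by blast+
    have "s x \<le> s y" if "y \<in> I i - {0}" for y
      using x that by (cases "s y \<le> s (of_nat N ^ i)") auto
    then show ?thesis using x(1) by blast
  qed
  then obtain x where x: "\<And>i. x i \<in> I i - {0}" "\<And>i y. y \<in> I i - {0} ==> s (x i) \<le> s y" by metis
  have xL: "x i \<in> L" "x i \<noteq> 0" for i using x(1)[of i] O_sub by (auto simp: I_def)
  \<comment> \<open>The multiplier \<open>t\<close> of the box principle varies with the element but
    is at most \<open>H\<close>; the factorial is a multiple of all possible values.\<close>
  define W :: nat where "W = fact H"
  have W: "W \<ge> 1" using fact_ge_1[of H] by (simp add: W_def)
  have div: "of_nat W * (y / x i) \<in> OL" if y: "y \<in> I i" for y i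
  proof -
    have yL: "y \<in> L" using y by (auto simp: I_def O_sub)
    obtain t z where tz: "1 \<le> t" "t \<le> H" "z \<in> OL" "s (of_nat t * (y / x i) - z) < 1"
      using bx[OF divide_in[OF yL xL(1)]] by blast
    let ?d = "of_nat t * y - z * x i"
    have dI: "?d \<in> I i" using y x(1) tz(3) by (intro I_cl I_mult O_of_nat) auto
    have "?d = 0"
    proof (rule ccontr)
      assume d0: "?d \<noteq> 0"
      then have le: "s (x i) \<le> s ?d" using dI by (intro x) auto
      have sx: "s (x i) > 0"
      proof (rule ccontr)
        assume "\<not> s (x i) > 0"
        then have "x i = 0" using x(1)[of i] by (intro sd) (auto simp: I_def)
        then show False using xL by simp
      qed
      have "?d = x i * (of_nat t * (y / x i) - z)" using xL by (simp add: field_simps)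
      then have "s ?d \<le> s (x i) * s (of_nat t * (y / x i) - z)"
        using sm[OF xL(1), of "of_nat t * (y / x i) - z"] yL xL tz(3) by (simp add: diff_in mult_in of_nat_in divide_in O_sub)
      also have "\<dots> < s (x i) * 1" using tz(4) sx by (intro mult_strict_left_mono)
      finally show False using le by simp
    qed
    then have e: "of_nat t * (y / x i) = z" using xL by (simp add: field_simps)
    have "t dvd W" using tz unfolding W_def by (intro dvd_fact) auto
    then obtain k where "W = t * k" by (rule dvdE)
    then have "of_nat W * (y / x i) = of_nat k * z" using e by (simp add: mult_ac)
    then show ?thesis using tz(3) by (auto intro: O_mult O_of_nat)
  qed
  obtain Rep where R: "finite Rep" "\<forall>x\<in>OL. \<exists>r\<in>Rep. \<exists>y\<in>OL. x = r + of_nat W * y" using finite_reps[OF W] by blast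
  define J where "J = (\<lambda>i. (\<lambda>y. of_nat W * (y / x i)) ` I i)"
  have JO: "J i \<subseteq> OL" for i using div by (auto simp: J_def)
  have Jm: "of_nat W * y \<in> J i" if "y \<in> OL" for y i
    unfolding J_def using I_mult[OF that, of "x i"] x(1)[of i] xL[of i] by (intro image_eqI[of _ _ "y * x i"]) auto
  have Jadd: "a + b \<in> J i" "a - b \<in> J i" if ab: "a \<in> J i" "b \<in> J i" for a b i
  proof -
    obtain y z where y: "a = of_nat W * (y / x i)" "y \<in> I i" "b = of_nat W * (z / x i)" "z \<in> I i" using ab by (auto simp: J_def)
    have "a + b = of_nat W * ((y + z) / x i)" "a - b = of_nat W * ((y - z) / x i)"
      unfolding y by (simp_all add: add_divide_distrib diff_divide_distrib distrib_left right_diff_distrib)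
    then show "a + b \<in> J i" "a - b \<in> J i" unfolding J_def using I_cl[OF y(2,4)] by blast+
  qed
  have "\<not> inj (\<lambda>i. J i \<inter> Rep)"
  proof
    assume "inj (\<lambda>i. J i \<inter> Rep)"
    then have "finite (UNIV :: nat set)"
      by (rule finite_imageD[rotated]) (use R(1) in \<open>auto intro: finite_subset[of _ "Pow Rep"]\<close>)
    then show False by simp
  qed
  then obtain i j where ij: "i < j" "J i \<inter> Rep = J j \<inter> Rep" unfolding inj_def by (metis linorder_neqE_nat)
  have Jsub: "J k \<subseteq> J l" if "J k \<inter> Rep = J l \<inter> Rep" for k l
    using that by (intro rep_determines[OF R(2) JO]) (auto intro: Jadd Jm)
  have Jij: "J i = J j" using Jsub[of i j] Jsub[of j i] ij(2) by auto
  define c where "c = x j / x i"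
  have c: "c \<in> L" "c \<noteq> 0" using xL by (auto simp: c_def intro: divide_in)
  have cI: "c * y \<in> I j" if "y \<in> I i" for y
  proof -
    have "of_nat W * (y / x i) \<in> J j" using that Jij by (auto simp: J_def)
    then obtain z where "z \<in> I j" "of_nat W * (y / x i) = of_nat W * (z / x j)" by (auto simp: J_def)
    moreover from this have "c * y = z" using W xL by (simp add: c_def field_simps)
    ultimately show ?thesis by simp
  qed
  have cI': "y / c \<in> I i" if "y \<in> I j" for y
  proof -
    have "of_nat W * (y / x j) \<in> J i" using that Jij by (auto simp: J_def)
    then obtain z where "z \<in> I i" "of_nat W * (y / x j) = of_nat W * (z / x i)" by (auto simp: J_def)
    moreover from this have "y / c = z" using W xL by (simp add: c_def field_simps)
    ultimately show ?thesis by simp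
  qed
  \<comment> \<open>Multiplication by \<open>c\<close> maps the finitely generated ideal
    \<open>I i\<close> into \<open>I j\<close>, hence into itself, so \<open>c\<close> is integral
    by the determinant trick.\<close>
  have "c \<in> OL"
  proof -
    have Ni: "N ^ i \<ge> 1" "of_nat (N ^ i) \<in> I i" using I_pow[OF N(2), of i] N(1) by simp_all
    have "\<exists>A. finite A \<and> A \<subseteq> I i \<and> of_nat (N ^ i) \<in> A \<and> (\<forall>x\<in>I i. \<exists>d. (\<forall>j\<in>A. d j \<in> OL) \<and> x = (\<Sum>j\<in>A. d j * j))"
    proof (rule finite_generators[OF Ni])
      show "I i \<subseteq> OL" by (auto simp: I_def)
    qed (fact I_cl(2) I_mult)+
    then obtain A where A: "finite A" "A \<subseteq> I i" "of_nat (N ^ i) \<in> A" "\<forall>x\<in>I i. \<exists>d. (\<forall>j\<in>A. d j \<in> OL) \<and> x = (\<Sum>j\<in>A. d j * j)"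
      by blast
    have "I j \<subseteq> I i" using ij(1) by (auto simp: I_def intro: B_mono)
    then have "\<forall>y\<in>A. \<exists>d. (\<forall>j\<in>A. d j \<in> OL) \<and> c * y = (\<Sum>j\<in>A. d j * j)" using A(2,4) cI by blast
    then obtain d where d: "\<And>y. y \<in> A ==> (\<forall>j\<in>A. d y j \<in> OL) \<and> c * y = (\<Sum>j\<in>A. d y j * j)" by metis
    have "algebraic_int c"
      by (rule algebraic_int_stable[OF A(1), of "of_nat (N ^ i)" "\<lambda>x. x" d]) (use d A N in \<open>auto simp: integers_of_def\<close>)
    then show ?thesis using c by (simp add: integers_of_def)
  qed
  moreover have "vp c \<ge> 1"
  proof -
    have \<pi>i: "\<pi> ^ i \<in> I i" by (rule I_pow[OF \<pi>(1)])
    have \<pi>L: "\<pi> ^ i \<in> L" "\<pi> ^ i \<noteq> 0" using \<pi> p_sub O_sub by (auto intro: power_in)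
    have "c * \<pi> ^ i \<in> B (int j)" using cI[OF \<pi>i] by (simp add: I_def)
    then have "int j \<le> vp (c * \<pi> ^ i)" using c \<pi>L by (intro vB) auto
    also have "\<dots> = vp c + int i" using v_mult[OF c \<pi>L] v_power[of \<pi> i] \<pi> p_sub O_sub vp_\<pi> by simp
    finally show ?thesis using ij(1) by simp
  qed
  moreover have "ord_at L q c = 0" if q: "closed_point L q" "q \<noteq> p" for q
  proof -
    interpret q: closed_point_loc L q by unfold_locales (rule q)
    \<comment> \<open>Powers of \<open>t\<close> are units at \<open>q\<close>, and
      \<open>t ^ k\<close> lies in \<open>I k\<close>. Multiplying and dividing such powers by
      \<open>c\<close> gives the two inequalities for the valuation of \<open>c\<close> at
      \<open>q\<close>.\<close>
    obtain t where t: "t \<in> p" "t \<notin> q" using closed_point_not_subset[OF closed_point q(1)] q(2) by auto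
    have v0: "q.vp (t ^ k) = 0" "t ^ k \<noteq> 0" "t ^ k \<in> L" for k
    proof -
      have tO: "t \<in> OL" "t ^ k \<in> OL" using p_sub[OF t(1)] by (auto intro: O_power)
      have "t ^ k \<notin> q" using q.p_power[OF tO(1)] t(2) by blast
      then show z: "t ^ k \<noteq> 0" using q.p_0 by metis
      show tL: "t ^ k \<in> L" using tO O_sub by blast
      show "q.vp (t ^ k) = 0" using \<open>t ^ k \<notin> q\<close> q.p_B[OF tO(2)] q.O_B[OF tO(2)] z tL by (auto simp: q.B_def)
    qed
    have "c * t ^ i \<in> q.B 0" using cI[OF I_pow[OF t(1), of i]] q.O_B by (simp add: I_def)
    then have "0 \<le> q.vp (c * t ^ i)" using c v0 by (intro q.vB) auto
    then have 1: "0 \<le> q.vp c" using q.v_mult[OF c v0(3,2)] v0(1) by simp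
    have "t ^ j / c \<in> q.B 0" using cI'[OF I_pow[OF t(1), of j]] q.O_B by (simp add: I_def)
    then have "0 \<le> q.vp (t ^ j / c)" using c v0 by (intro q.vB) auto
    then show ?thesis using 1 q.v_divide[OF v0(3,2) c] v0(1) by simp
  qed
  ultimately show ?thesis using c by blast
qed

context number_field_loc
begin

text \<open>Additive approximation with integrality away from \<open>S\<close>. By torsion of the
  class group there is an integer \<open>c\<close> of positive valuation at the points of
  \<open>S\<close> and a unit elsewhere. A power of it clears the denominators of all
  \<open>x q\<close> at once; the integral case applies with a precision raised accordingly, and
  division by the power of \<open>c\<close> does no harm outside \<open>S\<close>.\<close>

lemma chinese_remainder_away:
  assumes S: "finite S" "\<And>q. q \<in> S ==> closed_point L q" and x: "\<And>q. q \<in> S ==> x q \<in> L"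
  shows "\<exists>u\<in>L. (\<forall>q\<in>S. u - x q \<in> val_ball L q (int M)) \<and> (\<forall>q. closed_point L q --> q \<notin> S --> u \<in> val_ball L q 0)"
proof -
  have "\<exists>c\<in>OL. c \<noteq> 0 \<and> ord_at L p c \<ge> 1 \<and> (\<forall>q. closed_point L q --> q \<noteq> p --> ord_at L q c = 0)" if "p \<in> S" for p
  proof -
    interpret p: closed_point_loc L p by unfold_locales (use S that in simp)
    show ?thesis by (rule p.class_torsion)
  qed
  then obtain c0 where c0: "\<And>p. p \<in> S ==> c0 p \<in> OL \<and> c0 p \<noteq> 0 \<and> ord_at L p (c0 p) \<ge> 1
      \<and> (\<forall>q. closed_point L q --> q \<noteq> p --> ord_at L q (c0 p) = 0)" by metis
  define c where "c = (\<Prod>p\<in>S. c0 p)"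
  have cO: "c \<in> OL" unfolding c_def using c0 by (intro O_prod) auto
  have cn: "c \<in> L" "c \<noteq> 0" using O_sub[OF cO] S c0 by (auto simp: c_def)
  have cv: "ord_at L q c = (\<Sum>p\<in>S. ord_at L q (c0 p))" if q: "closed_point L q" for q
  proof -
    interpret q: closed_point_loc L q by unfold_locales (rule q)
    show ?thesis unfolding c_def using c0 O_sub by (intro q.v_prod) auto
  qed
  have cS: "ord_at L q c \<ge> 1" if q: "q \<in> S" for q
  proof -
    have "(\<Sum>p\<in>S. ord_at L q (c0 p)) = ord_at L q (c0 q) + (\<Sum>p\<in>S - {q}. ord_at L q (c0 p))" using S q by (intro sum.remove)
    also have "(\<Sum>p\<in>S - {q}. ord_at L q (c0 p)) = 0" using c0 S q by (intro sum.neutral) auto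
    finally show ?thesis using cv[OF S(2)[OF q]] c0[OF q] by simp
  qed
  have cnS: "ord_at L q c = 0" if "closed_point L q" "q \<notin> S" for q
    unfolding cv[OF that(1)] by (intro sum.neutral) (use c0 that in auto)
  define k where "k = (\<Sum>q\<in>S. nat \<bar>ord_at L q (x q)\<bar>)"
  define Q where "Q = (\<Sum>q\<in>S. nat (int k * ord_at L q c))"
  define M' where "M' = M + Q"
  have ck: "c ^ k \<in> L" "c ^ k \<noteq> 0" using cn by (auto intro: power_in)
  have ckO: "c ^ k * x q \<in> val_ball L q 0" if q: "q \<in> S" for q
  proof -
    interpret q: closed_point_loc L q by unfold_locales (use S q in simp)
    show ?thesis
    proof (cases "x q = 0")
      case False
      have "nat \<bar>q.vp (x q)\<bar> \<le> k" unfolding k_def using S q by (intro member_le_sum) auto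
      moreover have "int k * 1 \<le> int k * q.vp c" using cS[OF q] by (intro mult_left_mono) auto
      moreover have "q.vp (c ^ k * x q) = int k * q.vp c + q.vp (x q)"
        using q.v_mult[OF ck x[OF q] False] q.v_power[OF cn] by simp
      ultimately show ?thesis using ck x[OF q] by (auto simp: q.B_def intro: mult_in)
    qed (simp add: q.B_0)
  qed
  obtain a where a: "a \<in> OL" "\<forall>q\<in>S. a - c ^ k * x q \<in> val_ball L q (int M')"
    using chinese_remainder[of S "\<lambda>q. c ^ k * x q" M', OF S ckO] by blast
  have "a / c ^ k - x q \<in> val_ball L q (int M)" if q: "q \<in> S" for q
  proof -
    interpret q: closed_point_loc L q by unfold_locales (use S q in simp)
    have "nat (int k * ord_at L q c) \<le> Q" unfolding Q_def using S q by (intro member_le_sum) auto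
    then have "int k * q.vp c \<le> int Q" by linarith
    then have le: "int M \<le> int M' + q.vp (inverse (c ^ k))"
      unfolding M'_def using q.v_inverse[OF ck] q.v_power[OF cn] by simp
    have "(a - c ^ k * x q) * inverse (c ^ k) \<in> q.B (int M' + q.vp (inverse (c ^ k)))"
      using a q ck by (intro q.B_mult q.B_v inverse_in) auto
    moreover have "(a - c ^ k * x q) * inverse (c ^ k) = a / c ^ k - x q" using ck by (simp add: field_simps)
    ultimately show ?thesis using le by (auto intro: q.B_mono)
  qed
  moreover have "a / c ^ k \<in> val_ball L q 0" if q: "closed_point L q" "q \<notin> S" for q
  proof -
    interpret q: closed_point_loc L q by unfold_locales (rule q)
    have "q.vp (inverse (c ^ k)) = 0" using q.v_inverse[OF ck] q.v_power[OF cn] cnS[OF q] by simp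
    then have "inverse (c ^ k) \<in> q.B 0" using ck by (auto simp: q.B_def intro: inverse_in)
    from q.B_mult0[OF this q.O_B[OF a(1)]] show ?thesis by (simp add: divide_inverse mult.commute)
  qed
  moreover have "a / c ^ k \<in> L" using O_sub[OF a(1)] ck by (intro divide_in)
  ultimately show ?thesis by blast
qed

end

section \<open>Completely split extensions\<close>

text \<open>Only maximality has to be argued. The powers of \<open>a\<close> repeat modulo an
  integer in \<open>P\<close>, so for \<open>a\<close> outside \<open>P\<close> some
  \<open>1 - a ^ Suc d\<close> lies in \<open>P\<close>; the inverse of \<open>a\<close> is then a
  power of \<open>a\<close>, which is in \<open>K\<close>.\<close>

lemma closed_point_contract:
  assumes K: "number_field K" and L: "number_field L" and KL: "K \<subseteq> L" and P: "closed_point L P"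
  shows "closed_point K (P \<inter> K)"
proof -
  interpret K: number_field_loc K by unfold_locales (rule K)
  interpret P: closed_point_loc L P using L P by unfold_locales
  have OK: "x \<in> integers_of K" if "x \<in> P" "x \<in> K" for x using P.p_sub[OF that(1)] that(2) by (simp add: integers_of_def)
  have OL: "x \<in> integers_of L" if "x \<in> integers_of K" for x using that KL by (auto simp: integers_of_def)
  have "\<exists>b\<in>integers_of K. a * b - 1 \<in> P \<inter> K" if a: "a \<in> integers_of K - P \<inter> K" for a
  proof -
    have aK: "a \<in> integers_of K" "a \<notin> P" using a K.O_sub by auto
    obtain N :: nat where N: "N \<ge> 1" "of_nat N \<in> P" using P.ex_nat_in_p by blast
    obtain i d y where y: "y \<in> integers_of K" "a ^ i * (1 - a ^ Suc d) = of_nat N * y" using K.power_cycle[OF N(1) aK(1)] by blast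
    have "a ^ i * (1 - a ^ Suc d) \<in> P" unfolding y(2) using P.p_mult[OF OL[OF y(1)] N(2)] by (simp add: mult.commute)
    then have "a ^ i \<in> P \<or> 1 - a ^ Suc d \<in> P" using aK OL by (intro P.p_prime P.O_power P.O_diff P.O_1) auto
    then have "1 - a ^ Suc d \<in> P" using P.p_power[OF OL[OF aK(1)]] aK(2) by blast
    from P.p_uminus[OF this] have "a * a ^ d - 1 \<in> P" by simp
    moreover have "a * a ^ d - 1 \<in> K" using K.O_sub[OF aK(1)] by (intro K.diff_in K.mult_in K.power_in K.one_in)
    ultimately show ?thesis using K.O_power[OF aK(1)] by blast
  qed
  then show ?thesis unfolding K.closed_point_iff
    using OK OL P.p_0 P.p_1 by (auto intro: K.zero_in K.add_in K.mult_in P.p_add P.p_mult K.O_sub)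
qed

locale point_above = P: closed_point_loc L P + K: number_field_loc K for L P K +
  assumes KL: "K \<subseteq> L"
begin

abbreviation "q \<equiv> P \<inter> K"

sublocale q: closed_point_loc K "P \<inter> K"
  using closed_point_contract[OF K.number_field P.number_field KL P.closed_point] by unfold_locales

lemma OK_OL: "x \<in> integers_of K ==> x \<in> integers_of L" using KL by (auto simp: integers_of_def)

lemma B0_above: assumes "x \<in> q.B 0" shows "x \<in> P.B 0"
proof -
  have "x \<in> local_ring K q" using assms by (simp add: q.Op_eq)
  then obtain a s where "a \<in> integers_of K" "s \<in> integers_of K" "s \<notin> q" "x = a / s" by (rule q.Op_E)
  then have "x \<in> local_ring L P" using OK_OL K.O_sub by (auto intro: P.Op_I)
  then show ?thesis by (simp add: P.Op_eq)
qed

text \<open>The ramification index of \<open>P\<close> over \<open>q\<close>.\<close>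

definition e where "e = ord_at L P q.\<pi>"

lemma \<pi>_in: "q.\<pi> \<in> K" "q.\<pi> \<in> L" using q.\<pi>(1) KL by auto

lemma e_pos: "e \<ge> 1"
proof -
  have "q.\<pi> \<in> P" using q.\<pi>(1) by simp
  then have "q.\<pi> \<in> P.B 1" using P.p_B P.p_sub by blast
  then show ?thesis using q.\<pi>(2) unfolding e_def by (intro P.vB)
qed

lemma ord_above: assumes x: "x \<in> K" "x \<noteq> 0" shows "ord_at L P x = ord_at K q x * e"
proof -
  obtain u where u: "u \<in> local_ring K q - local_max_ideal K q" "x = u * q.\<pi> powi ord_at K q x" using q.vp_decompose[OF x] by blast
  have u0: "u \<noteq> 0" "inverse u \<in> local_ring K q" using q.unit_iff u(1) by auto
  have "u \<in> P.B 0" "inverse u \<in> P.B 0" using u(1) u0(2) by (auto simp: q.Op_eq intro: B0_above)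
  then have "0 \<le> ord_at L P u" "0 \<le> ord_at L P (inverse u)" and uL: "u \<in> L" using u0 by (auto intro: P.vB P.B_sub)
  then have "ord_at L P u = 0" using P.v_inverse[OF uL u0(1)] by simp
  moreover have "ord_at L P (u * q.\<pi> powi ord_at K q x) = ord_at L P u + ord_at K q x * e"
    using P.v_mult[OF uL u0(1)] P.v_power_int[OF \<pi>_in(2) q.\<pi>(2)] \<pi>_in(2) q.\<pi>(2) P.power_int_in by (simp add: e_def)
  ultimately show ?thesis using u(2) by simp
qed

lemma B_above: assumes "x \<in> q.B k" shows "x \<in> P.B (k * e)"
  using assms e_pos KL P.B_0 by (cases "x = 0") (auto simp: q.B_def P.B_def ord_above intro: mult_right_mono)

end

section \<open>Newton's iteration and closures of subfields\<close>

context valued_field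
begin

lemma poly_diff_B:
  assumes "\<And>i. coeff p i \<in> B k" "x \<in> B 0" "y \<in> B 0" shows "\<exists>w\<in>B k. poly p x - poly p y = (x - y) * w"
  using assms(1)
proof (induction p)
  case 0
  then show ?case using B_0 by auto
next
  case (pCons a p)
  have c: "coeff p i \<in> B k" for i using pCons.prems[of "Suc i"] by simp
  then obtain w where w: "w \<in> B k" "poly p x - poly p y = (x - y) * w" using pCons.IH by blast
  have "poly p x \<in> B k" unfolding poly_altdef using B_mult0[OF B_power[OF assms(2)] c] by (intro B_sum) (simp add: mult.commute)
  then have "poly p x + y * w \<in> B k" using w assms by (intro B_add B_mult0)
  moreover have "poly (pCons a p) x - poly (pCons a p) y = (x - y) * poly p x + y * (poly p x - poly p y)"
    by (simp add: algebra_simps)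
  then have "poly (pCons a p) x - poly (pCons a p) y = (x - y) * (poly p x + y * w)" unfolding w(2) by (simp add: algebra_simps)
  ultimately show ?case by blast
qed

lemma poly_B: "(\<And>i. coeff p i \<in> B k) ==> x \<in> B 0 ==> poly p x \<in> B k"
  unfolding poly_altdef using B_mult0[OF B_power] by (intro B_sum) (simp add: mult.commute)

lemma coeff_prod_B:
  assumes "\<And>k i. k \<in> A ==> coeff (f k) i \<in> B 0" shows "coeff (\<Prod>k\<in>A. f k) i \<in> B 0"
  using assms
proof (induction A arbitrary: i rule: infinite_finite_induct)
  case (insert a A)
  then show ?case by (auto simp: coeff_mult intro!: B_sum B_mult0)
qed (auto simp: coeff_1 B_0 B_1)

lemma prod_in_B_imp:
  assumes h: "h > 0" and x: "\<And>k. k < h ==> x k \<in> L" and pr: "(\<Prod>k<h. x k) \<in> B (int h * t)"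
  shows "\<exists>k<h. x k \<in> B t"
proof (rule ccontr)
  assume n: "\<not> ?thesis"
  have lt: "x k \<noteq> 0" "v (x k) < t" if "k < h" for k
  proof -
    have "x k \<notin> B t" using n that by blast
    then show "x k \<noteq> 0" "v (x k) < t" using x[OF that] by (auto simp: B_def)
  qed
  have "v (\<Prod>k<h. x k) = (\<Sum>k<h. v (x k))" using x lt by (intro v_prod) auto
  also have "\<dots> < (\<Sum>k<h. t)" using lt h by (intro sum_strict_mono) auto
  finally show False using pr lt by (auto simp: B_def)
qed

text \<open>Newton's iteration with the fixed slope \<open>\<Prod>\<^sub>l\<^sub>\<noteq>\<^sub>k (r\<^sub>k - r\<^sub>l)\<close>.\<close>

lemma approx_root:
  fixes r :: "nat => complex"
  assumes K: "complex_subfield K" and h: "h > 0" and \<alpha>: "\<alpha> \<in> B 0" and r: "\<And>k. k < h ==> r k \<in> K \<inter> B 0"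
    and inj: "inj_on r {..<h}" and fK: "\<And>i. coeff f i \<in> K"
    and fG: "\<And>i. coeff (f - (\<Prod>k<h. [:- r k, 1:])) i \<in> B (int h * t)" and f0: "poly f \<alpha> = 0" and t: "t \<ge> 1"
    and slope: "\<And>k. k < h ==> v (\<Prod>l\<in>{..<h} - {k}. r k - r l) + 1 \<le> t"
  shows "\<exists>k<h. \<alpha> - r k \<in> B t \<and> (\<forall>M. \<exists>y\<in>K. \<alpha> - y \<in> B M)"
proof -
  interpret K: complex_subfield K by (rule K)
  define G where "G = (\<Prod>k<h. [:- r k, 1:])"
  define E where "E = f - G"
  have E: "coeff E i \<in> B (int h * t)" for i using fG by (simp add: E_def G_def)
  have Gev: "poly G x = (\<Prod>k<h. x - r k)" for x by (simp add: G_def poly_prod)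
  have "poly G \<alpha> = - poly E \<alpha>" using f0 by (simp add: E_def)
  \<comment> \<open>The precision \<open>h * t\<close> of the approximation of \<open>f\<close> is
    made for this step: among \<open>h\<close> factors with product in \<open>B (h * t)\<close> one
    lies in \<open>B t\<close>.\<close>
  then have "(\<Prod>k<h. \<alpha> - r k) \<in> B (int h * t)" using B_uminus[OF poly_B[OF E \<alpha>]] by (simp add: Gev)
  then have "\<exists>k<h. \<alpha> - r k \<in> B t"
    by (rule prod_in_B_imp[OF h, rotated]) (use \<alpha> r B_sub in \<open>blast intro: diff_in\<close>)
  then obtain k where k: "k < h" "\<alpha> - r k \<in> B t" by blast
  define H where "H = (\<Prod>l\<in>{..<h} - {k}. [:- r l, 1:])"
  have H: "coeff H i \<in> B 0" for i unfolding H_def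
    using r B_uminus B_0 B_1 by (intro coeff_prod_B) (auto simp: coeff_pCons split: nat.split)
  have GH: "poly G x = (x - r k) * poly H x" for x using k(1) unfolding Gev H_def by (subst prod.remove[of _ k]) (auto simp: poly_prod)
  define s where "s = poly H (r k)"
  have s_alt: "s = (\<Prod>l\<in>{..<h} - {k}. r k - r l)" by (simp add: s_def H_def poly_prod)
  have rr: "r k - r l \<in> K" if "l < h" for l using r[OF k(1)] r[OF that] by (auto intro: K.diff_in)
  have s: "s \<in> K" "s \<noteq> 0" "s \<in> L" "v s + 1 \<le> t"
    using rr inj k(1) slope[OF k(1)] poly_B[OF H, of "r k"] r[OF k(1)] B_sub
    unfolding s_alt[symmetric] by (auto simp: s_alt inj_on_def intro!: K.prod_in) (simp add: s_def[symmetric] s_alt[symmetric])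
  have "\<exists>y\<in>K. \<alpha> - y \<in> B (t + int j)" for j
  proof (induction j)
    case 0
    then show ?case using k r by auto
  next
    case (Suc j)
    then obtain y where y: "y \<in> K" "\<alpha> - y \<in> B (t + int j)" by blast
    have ty: "\<alpha> - y \<in> B t" using y(2) by (rule B_mono) simp
    have "\<alpha> - (\<alpha> - y) \<in> B 0" by (rule B_diff[OF \<alpha> B_mono[OF ty]]) (use t in simp)
    then have yB: "y \<in> B 0" by simp
    obtain w where w: "w \<in> B (int h * t)" "poly E y - poly E \<alpha> = (y - \<alpha>) * w" using poly_diff_B[OF E yB \<alpha>] by blast
    obtain w1 where w1: "w1 \<in> B 0" "poly H y - poly H \<alpha> = (y - \<alpha>) * w1" using poly_diff_B[OF H yB \<alpha>] by blast
    obtain w2 where w2: "w2 \<in> B 0" "poly H y - poly H (r k) = (y - r k) * w2" using poly_diff_B[OF H yB] r[OF k(1)] by blast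
    have wt: "w \<in> B t" using w(1) h t by (rule_tac B_mono) (auto simp: mult_le_cancel_right1)
    have yr: "y - r k \<in> B t" using B_diff[OF k(2) ty] by simp
    \<comment> \<open>The value of \<open>f\<close> at the approximation \<open>y\<close> is
      \<open>(y - \<alpha>) * (s + g)\<close>, where \<open>g\<close> is smaller than the slope
      \<open>s\<close>. Replacing \<open>y\<close> by \<open>y - poly f y / s\<close> multiplies the
      error by \<open>g / s\<close> up to sign, a gain of at least one in valuation.\<close>
    define g where "g = (y - r k) * w2 + (\<alpha> - r k) * w1 + w"
    have g: "g \<in> B t" unfolding g_def using B_mult[OF yr w2(1)] B_mult[OF k(2) w1(1)] wt by (intro B_add) auto
    have "poly f y = poly f y - poly f \<alpha>" using f0 by simp
    also have "\<dots> = (poly G y - poly G \<alpha>) + (poly E y - poly E \<alpha>)" by (simp add: E_def)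
    also have "poly G y - poly G \<alpha> = (y - \<alpha>) * (s + (poly H y - poly H (r k))) + (\<alpha> - r k) * (poly H y - poly H \<alpha>)"
      unfolding GH s_def by (simp add: algebra_simps)
    finally have fy: "poly f y = (y - \<alpha>) * (s + g)" unfolding w(2) w1(2) w2(2) g_def by (simp add: algebra_simps)
    have "\<alpha> - (y - poly f y / s) = (\<alpha> - y) * - (g * inverse s)" unfolding fy using s(2) by (simp add: field_simps)
    also have "\<dots> \<in> B (t + int j + 1)"
    proof (rule B_mult[OF y(2)])
      have "g * inverse s \<in> B (t + - v s)" using B_mult[OF g B_v[OF inverse_in[OF s(3)]]] v_inverse[OF s(3,2)] by simp
      from B_mono[OF this, of 1] s(4) show "- (g * inverse s) \<in> B 1" by (intro B_uminus) simp
    qed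
    finally have "\<alpha> - (y - poly f y / s) \<in> B (t + int (Suc j))" by (simp add: ac_simps)
    moreover have "y - poly f y / s \<in> K" using y s fK by (intro K.diff_in K.divide_in K.poly_in)
    ultimately show ?case by blast
  qed
  then have "\<exists>y\<in>K. \<alpha> - y \<in> B M" for M
  proof -
    obtain y where "y \<in> K" "\<alpha> - y \<in> B (t + int (nat (M - t)))" using \<open>\<And>j. \<exists>y\<in>K. \<alpha> - y \<in> B (t + int j)\<close> by blast
    moreover from this(2) have "\<alpha> - y \<in> B M" by (rule B_mono) simp
    ultimately show ?thesis by blast
  qed
  then show ?thesis using k by blast
qed

text \<open>The closure of \<open>K\<close> in \<open>L\<close>. Since it is a ring, it is all of
  \<open>L\<close> as soon as it contains \<open>K\<close> and ring generators of \<open>L\<close>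
  over \<open>K\<close>.\<close>

definition approx :: "complex set => complex set" where "approx K = {x \<in> L. \<forall>M. \<exists>y\<in>K. x - y \<in> B M}"

lemma approx_subring:
  assumes K: "complex_subfield K" shows "complex_subring (approx K)"
proof -
  interpret K: complex_subfield K by (rule K)
  have low: "\<exists>b\<le>0. x \<in> B b" if "x \<in> L" for x
  proof -
    have "x \<in> B (min 0 (v x))" using B_v[OF that] by (rule B_mono) simp
    then show ?thesis by (intro exI[of _ "min 0 (v x)"]) simp
  qed
  show ?thesis
  proof
    fix x y assume "x \<in> approx K" "y \<in> approx K"
    then have xL: "x \<in> L" "y \<in> L" and ax: "\<And>M. \<exists>a\<in>K. x - a \<in> B M" "\<And>M. \<exists>b\<in>K. y - b \<in> B M" by (auto simp: approx_def)
    have "\<exists>c\<in>K. x + y - c \<in> B M" for M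
    proof -
      obtain a b where "a \<in> K" "x - a \<in> B M" "b \<in> K" "y - b \<in> B M" using ax by meson
      then show ?thesis using B_add[of "x - a" M "y - b"] by (intro bexI[of _ "a + b"]) (auto simp: algebra_simps intro: K.add_in)
    qed
    then show "x + y \<in> approx K" using xL by (simp add: approx_def add_in)
    have "\<exists>c\<in>K. x * y - c \<in> B M" for M
    proof -
      obtain b c where b: "b \<le> 0" "x \<in> B b" "c \<le> 0" "y \<in> B c" using low xL by meson
      define N where "N = max 0 (max (M - b) (M - c))"
      obtain x' y' where *: "x' \<in> K" "x - x' \<in> B N" "y' \<in> K" "y - y' \<in> B N" using ax by meson
      have "y - (y - y') \<in> B c" by (rule B_diff[OF b(4) B_mono[OF *(4)]]) (use b(3) in \<open>simp add: N_def\<close>)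
      then have "(x - x') * y' \<in> B (N + c)" using * by (intro B_mult) auto
      moreover have "x * (y - y') \<in> B (b + N)" using b * by (intro B_mult) auto
      ultimately have "x * (y - y') + (x - x') * y' \<in> B M" by (intro B_add) (auto intro: B_mono simp: N_def)
      then show ?thesis using * by (intro bexI[of _ "x' * y'"]) (auto simp: algebra_simps intro: K.mult_in)
    qed
    then show "x * y \<in> approx K" using xL by (simp add: approx_def mult_in)
  next
    fix x assume "x \<in> approx K"
    then have xL: "x \<in> L" and ax: "\<And>M. \<exists>a\<in>K. x - a \<in> B M" by (auto simp: approx_def)
    have "\<exists>c\<in>K. - x - c \<in> B M" for M
    proof -
      obtain a where "a \<in> K" "x - a \<in> B M" using ax by blast
      then show ?thesis using B_uminus[of "x - a" M] by (intro bexI[of _ "- a"]) (auto simp: algebra_simps intro: K.uminus_in)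
    qed
    then show "- x \<in> approx K" using xL by (simp add: approx_def uminus_in)
  next
    show "1 \<in> approx K" using K.one_in B_0 one_in by (auto simp: approx_def intro: bexI[of _ 1])
  qed
qed

end

lemma CC_eval: "ring.eval CC (rev (map f [0..<n])) x = (\<Sum>i<n. f i * x ^ i)"
proof -
  interpret field CC by (rule CC_field)
  have pw: "x [^]\<^bsub>CC\<^esub> k = x ^ k" for k :: nat by (induction k) (simp_all add: nat_pow_def CC_simps)
  show ?thesis by (induction n) (simp_all add: CC_simps pw add.commute)
qed

lemma CC_algebraic_over:
  assumes K: "complex_subfield K" and x: "algebraic_int x" shows "(ring.algebraic CC over K) x"
proof -
  interpret CC: field CC by (rule CC_field)
  interpret K: complex_subfield K by (rule K)
  obtain p where p: "lead_coeff p = 1" "\<forall>i. coeff p i \<in> \<int>" "poly p x = 0" using x by (auto elim: algebraic_int.cases)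
  let ?l = "rev (map (coeff p) [0..<Suc (degree p)])"
  have "coeff p i \<in> K" for i using p(2) K.of_int_in by (metis Ints_cases)
  then have "polynomial\<^bsub>CC\<^esub> K ?l" using p(1) K.one_in by (auto simp: polynomial_def CC_simps)
  then have "?l \<in> carrier (K [X]\<^bsub>CC\<^esub>)" by (simp only: univ_poly_carrier)
  moreover have "CC.eval ?l x = \<zero>\<^bsub>CC\<^esub>"
    unfolding CC_eval using p(3) by (simp only: CC_simps poly_altdef lessThan_Suc_atMost)
  ultimately show ?thesis by (intro CC.algebraicI[of ?l]) auto
qed

text \<open>Minimality is stated for subrings because it will be applied to the closure of
  \<open>K\<close>, which is known to be a ring only.\<close>

lemma ex_adjoin:
  assumes K: "number_field K" and A: "finite A" "\<And>x. x \<in> A ==> algebraic_int x"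
  shows "\<exists>L. finite_extension K L \<and> number_field L \<and> K \<subseteq> L \<and> A \<subseteq> L \<and> (\<forall>M. complex_subring M --> K \<subseteq> M --> A \<subseteq> M --> L \<subseteq> M)"
proof -
  interpret CC: field CC by (rule CC_field)
  have sK: "subfield K CC" and cK: "complex_subfield K" and dK: "CC.finite_dimension \<rat> K"
    using K by (auto simp: number_field_def subfield_CC_iff)
  have sQ: "subfield \<rat> CC" using complex_subfield_Rats by (simp add: subfield_CC_iff)
  obtain xs where xs: "set xs = A" using finite_list[OF A(1)] by blast
  have car: "set xs \<subseteq> carrier CC" by (simp add: CC_simps)
  define L where "L = CC.finite_extension K xs"
  have alg: "(CC.algebraic over K) x" if "x \<in> set xs" for x using CC_algebraic_over[OF cK] A(2) that xs by blast
  have sL: "subfield L CC" unfolding L_def by (rule CC.finite_extension_is_subfield[OF sK car alg])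
  have dL: "CC.finite_dimension K L" unfolding L_def by (rule CC.finite_extension_finite_dimension(1)[OF sK car alg])
  have KL: "K \<subseteq> L" unfolding L_def by (rule CC.finite_extension_incl[OF subfieldE(3)[OF sK] car])
  have "number_field L" unfolding number_field_def using sL CC.telescopic_base_dim(1)[OF sQ sK dK dL] by blast
  moreover have "A \<subseteq> L" unfolding L_def using CC.finite_extension_mem[OF subfieldE(1)[OF sK] car] xs by simp
  moreover have "L \<subseteq> M" if "complex_subring M" "K \<subseteq> M" "A \<subseteq> M" for M
    unfolding L_def using that xs by (intro CC.finite_extension_subring_incl subring_CC) auto
  ultimately show ?thesis using sL dL KL unfolding finite_extension_def by blast
qed

text \<open>The last root is forced by the product; the others are units times \<open>\<pi>\<^sup>w\<close>, so large in absolute value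
  that the last one differs from them.\<close>

lemma (in closed_point_loc) ex_local_roots:
  assumes c: "c \<in> L" "c \<noteq> 0" and h: "h > 0" and vc: "vp c = int h * w"
  shows "\<exists>r. inj_on r {..<h} \<and> (\<forall>k<h. r k \<in> L \<and> r k \<noteq> 0 \<and> vp (r k) = w) \<and> (\<Prod>k<h. r k) = c"
proof -
  obtain m where m: "h = Suc m" using h by (cases h) auto
  define a where "a = \<pi> powi w"
  have \<pi>L: "\<pi> \<in> L" using \<pi>(1) p_sub O_sub by blast
  have a: "a \<in> L" "a \<noteq> 0" "vp a = w" using \<pi>L \<pi>(2) by (simp_all add: a_def power_int_in v_power_int vp_\<pi>)
  obtain N :: nat where N: "N \<ge> 1" "of_nat N \<in> p" using ex_nat_in_p by blast
  \<comment> \<open>The numbers \<open>u k\<close> below are 1 modulo \<open>N\<close>, hence units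
    at \<open>p\<close>. The bound \<open>s\<close> makes them so large that, if there is more than
    one root, the last one, \<open>c / P\<close>, is smaller than \<open>a\<close> in complex
    absolute value, while the others are at least as large as \<open>a\<close>.\<close>
  obtain s :: nat where s: "norm c / norm a ^ Suc m < of_nat s" using reals_Archimedean2 by blast
  define u where "u = (\<lambda>k. 1 + N * (k + s))"
  define P where "P = (\<Prod>k<m. a * of_nat (u k))"
  define r where "r = (\<lambda>k. if k < m then a * of_nat (u k) else c / P)"
  have u: "vp (of_nat (u k)) = 0" "(of_nat (u k) :: complex) \<in> L" "of_nat (u k) \<noteq> (0 :: complex)" "u k \<ge> 1" for k
  proof -
    have "of_nat (k + s) * of_nat N \<in> p" using N by (intro p_mult O_of_nat)
    then have "of_nat (k + s) * of_nat N \<in> B 1" using p_B p_sub by blast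
    with v_add_eq(2)[OF one_in, of "of_nat (k + s) * of_nat N"] show "vp (of_nat (u k)) = 0"
      by (simp add: u_def v_1 mult.commute)
    show "of_nat (u k) \<noteq> (0 :: complex)" "u k \<ge> 1" by (simp_all add: u_def del: of_nat_Suc of_nat_add)
  qed (rule of_nat_in)
  have au: "a * of_nat (u k) \<in> L" "a * of_nat (u k) \<noteq> 0" "vp (a * of_nat (u k)) = w" for k
    using v_mult[OF a(1,2) u(2,3), of k] a u by (auto intro: mult_in)
  have P: "P \<in> L" "P \<noteq> 0" "vp P = int m * w"
    unfolding P_def using au v_prod[of "{..<m}" "\<lambda>k. a * of_nat (u k)"] by (auto intro: prod_in)
  have r: "r k \<in> L \<and> r k \<noteq> 0 \<and> vp (r k) = w" if "k < h" for k
    using au v_divide[OF c P(1,2)] c P vc by (auto simp: r_def m algebra_simps intro: divide_in)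
  have pr: "(\<Prod>k<h. r k) = c" unfolding m using P(2) by (simp add: r_def P_def)
  have neq: "r m \<noteq> r k" if k: "k < m" for k
  proof -
    have "1 * norm a \<le> of_nat (u k) * norm a" using u(4)[of k] by (intro mult_right_mono) auto
    then have rk: "norm a \<le> norm (r k)" using k by (simp add: r_def norm_mult mult.commute)
    have "u k * 1 \<le> u k * (\<Prod>l\<in>{..<m} - {k}. u l)" using u(4) by (intro mult_left_mono prod_ge_1) auto
    also have "\<dots> = (\<Prod>l<m. u l)" using k by (intro prod.remove[symmetric]) auto
    finally have "u k \<le> (\<Prod>l<m. u l)" by simp
    moreover have "s \<le> u k"
    proof -
      have "s \<le> 1 * (k + s)" by simp
      also have "\<dots> \<le> N * (k + s)" using N(1) by (rule mult_right_mono) simp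
      also have "\<dots> \<le> u k" by (simp add: u_def)
      finally show ?thesis .
    qed
    ultimately have "real s \<le> real (\<Prod>l<m. u l)" by linarith
    then have "norm a ^ m * s \<le> norm a ^ m * of_nat (\<Prod>l<m. u l)" by (intro mult_left_mono) auto
    also have "\<dots> = norm P" by (simp add: P_def prod.distrib norm_mult norm_power prod_norm[symmetric])
    finally have "norm a ^ m * s \<le> norm P" .
    then have "norm a * (norm a ^ m * s) \<le> norm a * norm P" by (intro mult_left_mono) auto
    moreover have "norm c < norm a * (norm a ^ m * s)" using s a(2) by (simp add: field_simps)
    ultimately have "norm c < norm a * norm P" by linarith
    then have "norm (r m) < norm a" using P(2) by (simp add: r_def norm_divide field_simps)
    then show ?thesis using rk by auto
  qed
  have uinj: "r k \<noteq> r l" if "k < m" "l < m" "k \<noteq> l" for k l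
  proof -
    have "u k \<noteq> u l" using that N(1) by (simp add: u_def)
    then show ?thesis using that a(2) by (simp add: r_def)
  qed
  have "inj_on r {..<h}"
    unfolding inj_on_def m using neq uinj by (metis less_antisym lessThan_iff)
  then show ?thesis using r pr by blast
qed

text \<open>Only the middle coefficients are approximated. The leading one stays 1 for integrality
  of the roots, and the constant one stays exactly \<open>b\<close>, because its valuation at every
  prime matters.\<close>

lemma (in number_field_loc) ex_poly_approx:
  assumes S: "finite S" "\<And>j. j \<in> S ==> closed_point L j" and h: "h > 0" and b: "b \<in> OL"
    and G: "\<And>j. j \<in> S ==> degree (G j) = h \<and> coeff (G j) h = 1 \<and> coeff (G j) 0 = b \<and> (\<forall>i. coeff (G j) i \<in> val_ball L j 0)"
  shows "\<exists>f. degree f = h \<and> lead_coeff f = 1 \<and> coeff f 0 = b \<and> (\<forall>i. coeff f i \<in> OL) \<and> (\<forall>j\<in>S. \<forall>i. coeff (f - G j) i \<in> val_ball L j (int M))"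
proof -
  have "\<forall>i. \<exists>a. a \<in> OL \<and> (\<forall>j\<in>S. a - coeff (G j) i \<in> val_ball L j (int M))"
    using chinese_remainder[OF S, of "\<lambda>j. coeff (G j) i" M for i] G by blast
  then obtain a where a: "\<And>i. a i \<in> OL" "\<And>i j. j \<in> S ==> a i - coeff (G j) i \<in> val_ball L j (int M)" by metis
  define g where "g = (\<lambda>i. if i = 0 then b else if i = h then 1 else a i)"
  define f where "f = (\<Sum>i\<le>h. monom (g i) i)"
  have cf: "coeff f i = (if i \<le> h then g i else 0)" for i by (simp add: f_def coeff_sum)
  have deg: "degree f = h"
    by (rule antisym[OF degree_le le_degree]) (use h in \<open>auto simp: cf g_def\<close>)
  have "coeff (f - G j) i \<in> val_ball L j (int M)" if j: "j \<in> S" for j i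
  proof -
    interpret j: closed_point_loc L j by unfold_locales (use S j in simp)
    show ?thesis using G[OF j] a(2)[OF j, of i] by (cases "i \<le> h") (auto simp: cf g_def j.B_0 coeff_eq_0)
  qed
  moreover have "coeff f i \<in> OL" for i using a(1) b by (auto simp: cf g_def intro: O_in)
  ultimately show ?thesis using deg h by (intro exI[of _ f]) (auto simp: cf g_def)
qed

text \<open>The numbers \<open>r j k\<close> are the approximate roots of \<open>f\<close> at the
  point \<open>j\<close>. The precision \<open>h * t\<close> and the bound on the slopes are what
  Newton's iteration asks for; \<open>t \<ge> 2\<close> lets a root of \<open>f\<close> inherit the
  valuation 1 from the \<open>r j k\<close> next to it.\<close>

definition (in number_field_loc) splitting_poly where
  "splitting_poly S p f c r (h :: nat) (t :: nat) \<longleftrightarrow> h > 0 \<and> lead_coeff f = 1 \<and> degree f = h \<and> coeff f 0 = c \<and> (\<forall>i. coeff f i \<in> OL) \<and> c \<in> OL \<and> c \<noteq> 0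
    \<and> (\<forall>q. closed_point L q --> q \<noteq> p --> ord_at L q c = 0) \<and> t \<ge> 2
    \<and> (\<forall>j\<in>S. inj_on (r j) {..<h} \<and> (\<forall>k<h. r j k \<in> L \<and> r j k \<noteq> 0 \<and> ord_at L j (r j k) = (if j = p then 1 else 0)
        \<and> ord_at L j (\<Prod>l\<in>{..<h} - {k}. r j k - r j l) + 1 \<le> int t)
      \<and> (\<forall>i. coeff (f - (\<Prod>k<h. [:- r j k, 1:])) i \<in> val_ball L j (int h * int t)))"

lemma (in number_field_loc) ex_splitting_poly:
  assumes S: "finite S" "\<And>j. j \<in> S ==> closed_point L j" and p: "p \<in> S"
  shows "\<exists>f c r h t. splitting_poly S p f c r h t"
proof -
  interpret p: closed_point_loc L p by unfold_locales (use S p in simp)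
  obtain c where c: "c \<in> OL" "c \<noteq> 0" "p.vp c \<ge> 1" "\<forall>q. closed_point L q --> q \<noteq> p --> ord_at L q c = 0" using p.class_torsion by blast
  \<comment> \<open>The degree is the valuation of \<open>c\<close> at \<open>p\<close>, so that
    \<open>h\<close> numbers of valuation 1 at \<open>p\<close> can have the product
    \<open>c\<close>; at the other points of \<open>S\<close> they are units, like
    \<open>c\<close>.\<close>
  define h where "h = nat (p.vp c)"
  have h: "h > 0" "p.vp c = int h" using c(3) by (simp_all add: h_def)
  have "\<exists>r. inj_on r {..<h} \<and> (\<forall>k<h. r k \<in> L \<and> r k \<noteq> 0 \<and> ord_at L j (r k) = (if j = p then 1 else 0)) \<and> (\<Prod>k<h. r k) = c" if j: "j \<in> S" for j
  proof -
    interpret j: closed_point_loc L j by unfold_locales (use S j in simp)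
    have "j.vp c = int h * (if j = p then 1 else 0)" using h(2) c(4) S(2)[OF j] by auto
    then show ?thesis by (rule j.ex_local_roots[OF O_sub[OF c(1)] c(2) h(1)])
  qed
  then obtain r where r: "\<And>j. j \<in> S ==> inj_on (r j) {..<h} \<and> (\<forall>k<h. r j k \<in> L \<and> r j k \<noteq> 0 \<and> ord_at L j (r j k) = (if j = p then 1 else 0)) \<and> (\<Prod>k<h. r j k) = c"
    by metis
  define t where "t = 2 + (\<Sum>j\<in>S. \<Sum>k<h. nat \<bar>ord_at L j (\<Prod>l\<in>{..<h} - {k}. r j k - r j l)\<bar>)"
  have t: "ord_at L j (\<Prod>l\<in>{..<h} - {k}. r j k - r j l) + 1 \<le> int t" if "j \<in> S" "k < h" for j k
  proof -
    have "nat \<bar>ord_at L j (\<Prod>l\<in>{..<h} - {k}. r j k - r j l)\<bar> \<le> (\<Sum>k<h. nat \<bar>ord_at L j (\<Prod>l\<in>{..<h} - {k}. r j k - r j l)\<bar>)"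
      using that by (intro member_le_sum) auto
    also have "\<dots> \<le> (\<Sum>j\<in>S. \<Sum>k<h. nat \<bar>ord_at L j (\<Prod>l\<in>{..<h} - {k}. r j k - r j l)\<bar>)" using that S by (intro member_le_sum) auto
    finally have "2 + nat \<bar>ord_at L j (\<Prod>l\<in>{..<h} - {k}. r j k - r j l)\<bar> \<le> t" unfolding t_def by (rule add_left_mono)
    then show ?thesis by linarith
  qed
  have "\<exists>f. degree f = h \<and> lead_coeff f = 1 \<and> coeff f 0 = (- 1) ^ h * c \<and> (\<forall>i. coeff f i \<in> OL)
      \<and> (\<forall>j\<in>S. \<forall>i. coeff (f - (\<Prod>k<h. [:- r j k, 1:])) i \<in> val_ball L j (int (h * t)))"
  proof (rule ex_poly_approx[OF S h(1)])
    show "(- 1) ^ h * c \<in> OL" using c by (intro O_mult O_power O_uminus O_1)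
    fix j assume j: "j \<in> S"
    interpret j: closed_point_loc L j by unfold_locales (use S j in simp)
    let ?G = "\<Prod>k<h. [:- r j k, 1:]"
    have deg: "degree ?G = h" by (subst degree_prod_eq_sum_degree) auto
    moreover have "lead_coeff ?G = 1" by (simp add: lead_coeff_prod)
    moreover have "coeff ?G 0 = (- 1) ^ h * c" using r[OF j] by (simp add: poly_prod prod.distrib prod_uminus flip: poly_0_coeff_0)
    moreover have "coeff ?G i \<in> j.B 0" for i
    proof (rule j.coeff_prod_B)
      fix k i assume "k \<in> {..<h}"
      then have "r j k \<in> j.B 0" using r[OF j] by (auto simp: j.B_def)
      then show "coeff [:- r j k, 1:] i \<in> j.B 0" using j.B_uminus j.B_0 j.B_1 by (auto simp: coeff_pCons split: nat.split)
    qed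
    ultimately show "degree ?G = h \<and> coeff ?G h = 1 \<and> coeff ?G 0 = (- 1) ^ h * c \<and> (\<forall>i. coeff ?G i \<in> j.B 0)" by simp
  qed
  then obtain f where f: "degree f = h" "lead_coeff f = 1" "coeff f 0 = (- 1) ^ h * c" "\<forall>i. coeff f i \<in> OL"
    "\<forall>j\<in>S. \<forall>i. coeff (f - (\<Prod>k<h. [:- r j k, 1:])) i \<in> val_ball L j (int h * int t)" by auto
  have c': "ord_at L q ((- 1) ^ h * c) = 0" if q: "closed_point L q" "q \<noteq> p" for q
  proof -
    interpret q: closed_point_loc L q by unfold_locales (rule q)
    show ?thesis using c(4) q q.v_uminus[OF O_sub[OF c(1)] c(2)] by (cases "even h") auto
  qed
  show ?thesis unfolding splitting_poly_def
    by (rule exI[of _ f], rule exI[of _ "(- 1) ^ h * c"], rule exI[of _ r], rule exI[of _ h], rule exI[of _ t])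
      (use f c c' h r t in \<open>auto simp: t_def intro: O_mult O_power O_uminus O_1\<close>)
qed

text \<open>At a point above \<open>S\<close> each \<open>\<alpha> p\<close> is a limit of elements
  of \<open>K\<close>; limits form a ring, so all of \<open>L\<close> lies in the closure of
  \<open>K\<close>. This forces ramification index 1. At points not above \<open>p\<close> the
  number \<open>\<alpha> p\<close> is a unit because it divides the constant term
  \<open>c p\<close>, which is a unit there.\<close>

theorem ex_splitting_extension:
  assumes K: "number_field K" and S: "finite S" "\<And>j. j \<in> S ==> closed_point K j"
  shows "\<exists>L \<alpha>. finite_extension K L \<and> number_field L \<and> K \<subseteq> L \<and> (\<forall>p\<in>S. \<alpha> p \<in> L \<and> \<alpha> p \<noteq> 0) \<and> (\<forall>P. closed_point L P -->
    (P \<inter> K \<in> S --> L \<subseteq> valued_field.approx L (ord_at L P) K \<and> (\<forall>x\<in>K - {0}. ord_at L P x = ord_at K (P \<inter> K) x)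
      \<and> ord_at L P (\<alpha> (P \<inter> K)) = 1) \<and> (\<forall>p\<in>S. p \<noteq> P \<inter> K --> ord_at L P (\<alpha> p) = 0))"
proof -
  interpret K: number_field_loc K by unfold_locales (rule K)
  have "\<forall>p. \<exists>f c r h t. p \<in> S --> K.splitting_poly S p f c r h t" using K.ex_splitting_poly[OF S] by blast
  then obtain f c r h t where sp: "\<And>p. p \<in> S ==> K.splitting_poly S p (f p) (c p) (r p) (h p) (t p)" by metis
  have
    h: "\<And>p. p \<in> S ==> h p > (0::nat)" and f: "\<And>p. p \<in> S ==> lead_coeff (f p) = 1" "\<And>p. p \<in> S ==> degree (f p) = h p"
      "\<And>p. p \<in> S ==> coeff (f p) 0 = c p" "\<And>p i. p \<in> S ==> coeff (f p) i \<in> integers_of K"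
    and c: "\<And>p. p \<in> S ==> c p \<in> integers_of K" "\<And>p. p \<in> S ==> c p \<noteq> 0" "\<And>p q. p \<in> S ==> closed_point K q ==> q \<noteq> p ==> ord_at K q (c p) = 0"
    and t: "\<And>p. p \<in> S ==> t p \<ge> (2::nat)"
    and r: "\<And>p j. p \<in> S ==> j \<in> S ==> inj_on (r p j) {..<h p}"
      "\<And>p j k. p \<in> S ==> j \<in> S ==> k < h p ==> r p j k \<in> K \<and> r p j k \<noteq> 0 \<and> ord_at K j (r p j k) = (if j = p then 1 else 0)"
      "\<And>p j k. p \<in> S ==> j \<in> S ==> k < h p ==> ord_at K j (\<Prod>l\<in>{..<h p} - {k}. r p j k - r p j l) + 1 \<le> int (t p)"
      "\<And>p j i. p \<in> S ==> j \<in> S ==> coeff (f p - (\<Prod>k<h p. [:- r p j k, 1:])) i \<in> val_ball K j (int (h p) * int (t p))"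
    using sp unfolding K.splitting_poly_def by blast+
  have "\<exists>x. poly (f p) x = 0" if "p \<in> S" for p using ex_root_complex[of "f p"] f h that by simp
  then obtain \<alpha> where \<alpha>: "\<And>p. p \<in> S ==> poly (f p) (\<alpha> p) = 0" by metis
  have \<alpha>int: "algebraic_int (\<alpha> p)" if "p \<in> S" for p
    by (rule algebraic_int_monic[OF f(1)[OF that] _ \<alpha>[OF that]]) (use f(4)[OF that] in \<open>auto simp: integers_of_def\<close>)
  have \<alpha>0: "\<alpha> p \<noteq> 0" if "p \<in> S" for p
  proof
    assume "\<alpha> p = 0"
    then show False using \<alpha>[OF that] f(3)[OF that] c(2)[OF that] by (simp add: poly_0_coeff_0)
  qed
  have "\<exists>L. finite_extension K L \<and> number_field L \<and> K \<subseteq> L \<and> \<alpha> ` S \<subseteq> L \<and> (\<forall>M. complex_subring M --> K \<subseteq> M --> \<alpha> ` S \<subseteq> M --> L \<subseteq> M)"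
    by (rule ex_adjoin[OF K]) (use S(1) \<alpha>int in auto)
  then obtain L where L: "finite_extension K L" "number_field L" "K \<subseteq> L" "\<alpha> ` S \<subseteq> L"
    and Lmin: "\<And>M. complex_subring M ==> K \<subseteq> M ==> \<alpha> ` S \<subseteq> M ==> L \<subseteq> M"
    by blast
  have main: "(P \<inter> K \<in> S --> L \<subseteq> valued_field.approx L (ord_at L P) K \<and> (\<forall>x\<in>K - {0}. ord_at L P x = ord_at K (P \<inter> K) x)
      \<and> ord_at L P (\<alpha> (P \<inter> K)) = 1) \<and> (\<forall>p\<in>S. p \<noteq> P \<inter> K --> ord_at L P (\<alpha> p) = 0)" if P: "closed_point L P" for P
  proof -
    interpret point_above L P K
      by (intro point_above.intro closed_point_loc.intro number_field_loc.intro closed_point_loc_axioms.intro point_above_axioms.intro L K P)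
    have \<alpha>O: "\<alpha> p \<in> integers_of L" if "p \<in> S" for p using \<alpha>int[OF that] L(4) that by (auto simp: integers_of_def)
    have ap: "\<exists>k<h p. \<alpha> p - r p q k \<in> P.B (int (t p) * e) \<and> (\<forall>M. \<exists>y\<in>K. \<alpha> p - y \<in> P.B M)" if p: "p \<in> S" and qS: "q \<in> S" for p
    proof (rule P.approx_root[OF K.complex_subfield_axioms h[OF p] P.O_B[OF \<alpha>O[OF p]]])
      show "r p q k \<in> K \<inter> P.B 0" if "k < h p" for k
      proof -
        have "r p q k \<in> q.B 0" using r(2)[OF p qS that] by (auto simp: q.B_def)
        then show ?thesis using B0_above r(2)[OF p qS that] by blast
      qed
      show "inj_on (r p q) {..<h p}" by (rule r(1)[OF p qS])
      show "coeff (f p) i \<in> K" for i using K.O_sub[OF f(4)[OF p]] .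
      show "coeff (f p - (\<Prod>k<h p. [:- r p q k, 1:])) i \<in> P.B (int (h p) * (int (t p) * e))" for i
        using B_above[OF r(4)[OF p qS]] by (simp add: mult.assoc)
      show "1 \<le> int (t p) * e" using mult_mono[of 1 "int (t p)" 1 e] t[OF p] e_pos by simp
      fix k assume k: "k < h p"
      let ?x = "\<Prod>l\<in>{..<h p} - {k}. r p q k - r p q l"
      have x: "?x \<in> K" "?x \<noteq> 0" using r(2)[OF p qS] r(1)[OF p qS] k by (auto simp: inj_on_def intro!: K.prod_in K.diff_in)
      have "(ord_at K q ?x + 1) * e \<le> int (t p) * e" using r(3)[OF p qS k] e_pos by (intro mult_right_mono) auto
      then show "ord_at L P ?x + 1 \<le> int (t p) * e" using ord_above[OF x] e_pos by (simp add: distrib_right)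
    qed (rule \<alpha>[OF p])
    have near: "L \<subseteq> P.approx K" if qS: "q \<in> S"
    proof (rule Lmin[OF P.approx_subring[OF K.complex_subfield_axioms]])
      show "K \<subseteq> P.approx K"
      proof
        fix x assume "x \<in> K"
        then show "x \<in> P.approx K" unfolding P.approx_def using KL P.B_0 by (auto intro!: bexI[of _ x])
      qed
      show "\<alpha> ` S \<subseteq> P.approx K" using ap[OF _ qS] L(4) by (auto simp: P.approx_def)
    qed
    \<comment> \<open>A uniformizer of \<open>P\<close> agrees to precision 2 with an element of
      \<open>K\<close>, which then has valuation 1 at \<open>P\<close>. But on \<open>K\<close> this
      valuation takes multiples of \<open>e\<close> only.\<close>
    have e1: "e = 1" if qS: "q \<in> S"
    proof -
      have \<pi>P: "P.\<pi> \<in> L" "P.\<pi> \<noteq> 0" using P.\<pi> P.p_sub P.O_sub by auto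
      then obtain y where y: "y \<in> K" "P.\<pi> - y \<in> P.B 2" using near[OF qS] by (auto simp: P.approx_def)
      have "- (P.\<pi> - y) \<in> P.B (P.vp P.\<pi> + 1)" using P.B_uminus[OF y(2)] P.vp_\<pi> by simp
      from P.v_add_eq[OF \<pi>P this] have "y \<noteq> 0" "P.vp y = 1" using P.vp_\<pi> by auto
      then have "1 = q.vp y * e" using ord_above y by simp
      then show ?thesis using pos_zmult_eq_1_iff[of e "q.vp y"] e_pos by (simp add: mult.commute)
    qed
    have "P.vp (\<alpha> q) = 1" if qS: "q \<in> S"
    proof -
      obtain k where k: "k < h q" "\<alpha> q - r q q k \<in> P.B (int (t q))" using ap[OF qS qS] e1[OF qS] by auto
      have rk: "r q q k \<in> L" "r q q k \<noteq> 0" "P.vp (r q q k) = 1"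
        using r(2)[OF qS qS k(1)] ord_above e1[OF qS] KL by auto
      have "\<alpha> q - r q q k \<in> P.B (P.vp (r q q k) + 1)" using k(2) t[OF qS] by (rule_tac P.B_mono) (auto simp: rk)
      from P.v_add_eq(2)[OF rk(1,2) this] show ?thesis using rk by simp
    qed
    moreover have "P.vp (\<alpha> p) = 0" if p: "p \<in> S" "p \<noteq> q" for p
    proof -
      have "\<alpha> p \<notin> P"
      proof
        assume \<alpha>P: "\<alpha> p \<in> P"
        have "poly (f p) (\<alpha> p) = coeff (f p) 0 + (\<Sum>i<degree (f p). coeff (f p) (Suc i) * \<alpha> p ^ i * \<alpha> p)"
          unfolding poly_altdef lessThan_Suc_atMost[symmetric] sum.lessThan_Suc_shift by (simp add: mult_ac)
        then have "c p = - (\<Sum>i<degree (f p). coeff (f p) (Suc i) * \<alpha> p ^ i * \<alpha> p)"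
          using \<alpha>[OF p(1)] f(3)[OF p(1)] by (simp add: eq_neg_iff_add_eq_0)
        also have "\<dots> \<in> P"
        proof -
          have "(\<Sum>i\<in>A. coeff (f p) (Suc i) * \<alpha> p ^ i * \<alpha> p) \<in> P" for A
            by (induction A rule: infinite_finite_induct)
              (use \<alpha>P f(4)[OF p(1)] OK_OL \<alpha>O[OF p(1)] in \<open>auto simp: P.p_0 intro!: P.p_add P.p_mult P.O_mult P.O_power\<close>)
          then show ?thesis by (rule P.p_uminus)
        qed
        finally have "c p \<in> q" using c(1)[OF p(1)] K.O_sub by blast
        then have "c p \<in> q.B 1" using q.p_B q.p_sub by blast
        then have "1 \<le> q.vp (c p)" using c(2)[OF p(1)] by (intro q.vB)
        then show False using c(3)[OF p(1) q.closed_point] p(2) by simp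
      qed
      then show ?thesis using P.p_B[OF \<alpha>O[OF p(1)]] P.O_B[OF \<alpha>O[OF p(1)]] \<alpha>0[OF p(1)] by (auto simp: P.B_def)
    qed
    ultimately show ?thesis using near e1 ord_above by auto
  qed
  show ?thesis using L \<alpha>0 main by (intro exI[of _ L] exI[of _ \<alpha>]) blast
qed

section \<open>Changes of coordinates\<close>

definition subst_form :: "nat => 'c mat => (nat, 'c) mpoly => (nat, 'c::comm_ring_1) mpoly" where
  "subst_form n \<Gamma> = msubst mconst (\<lambda>k. \<Sum>l\<le>n. mconst (\<Gamma> $$ (k, l)) * mvar l)"

text \<open>\<open>change_coords\<close> over an arbitrary coefficient ring; used over \<open>\<complex>[t]\<close> for paths of matrices.\<close>

definition chcoords :: "nat => 'c mat => (nat => (nat, 'c) mpoly) => nat => (nat, 'c::comm_ring_1) mpoly" where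
  "chcoords n \<Gamma> F i = (\<Sum>j\<le>n. mconst (adj_mat \<Gamma> $$ (i, j)) * subst_form n \<Gamma> (F j))"

lemma change_coords_eq: "change_coords = chcoords"
  by (intro ext) (simp add: change_coords_def chcoords_def subst_form_def)

lemma mconst_0 [simp]: "mconst 0 = 0" and mconst_1 [simp]: "mconst 1 = 1" by (simp_all add: mconst_def)

definition cmap :: "('a::comm_ring_1 => 'b) => (nat, 'a) mpoly => (nat, 'b::comm_ring_1) mpoly" where
  "cmap g = msubst (\<lambda>c. mconst (g c)) mvar"

lemma lookup_cmap: assumes "comm_ring_hom g" shows "lookup (cmap g P) m = g (lookup P m)"
proof -
  interpret comm_ring_hom g by fact
  have "cmap g P = (\<Sum>m\<in>keys P. single m (g (lookup P m)))"
    by (simp add: cmap_def msubst_mval mval_mvar mconst_def mult_single)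
  then show ?thesis by (simp add: lookup_sum lookup_single when_def in_keys_iff)
qed

lemma comm_ring_hom_mconst_comp: "comm_ring_hom g ==> comm_ring_hom (\<lambda>c. mconst (g c) :: (nat, 'b::comm_ring_1) mpoly)"
  by (rule comm_ring_hom_comp[OF comm_ring_hom_mconst])

lemma comm_ring_hom_cmap: "comm_ring_hom g ==> comm_ring_hom (cmap g)"
  unfolding cmap_def by (rule comm_ring_hom_msubst[OF comm_ring_hom_mconst_comp])

lemma cmap_subst_form:
  assumes g: "comm_ring_hom g" and \<Gamma>: "\<Gamma> \<in> carrier_mat (n + 1) (n + 1)" and P: "\<And>m. m \<in> keys P ==> keys m \<subseteq> {..n}"
  shows "cmap g (subst_form n \<Gamma> P) = subst_form n (map_mat g \<Gamma>) (cmap g P)"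
proof -
  interpret g: comm_ring_hom g by (rule g)
  interpret c: comm_ring_hom "cmap g" by (rule comm_ring_hom_cmap[OF g])
  interpret s: comm_ring_hom "subst_form n (map_mat g \<Gamma>)" unfolding subst_form_def by (rule comm_ring_hom_msubst[OF comm_ring_hom_mconst])
  have cc: "cmap g (mconst a) = mconst (g a)" for a by (simp add: cmap_def msubst_mconst)
  have cv: "cmap g (mvar v) = mvar v" for v by (simp add: cmap_def msubst_mvar)
  have sc: "subst_form n (map_mat g \<Gamma>) (mconst a) = mconst a" for a by (simp add: subst_form_def msubst_mconst)
  have sv: "subst_form n (map_mat g \<Gamma>) (mvar k) = (\<Sum>l\<le>n. mconst (map_mat g \<Gamma> $$ (k, l)) * mvar l)" for k
    by (simp add: subst_form_def msubst_mvar)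
  have "cmap g (subst_form n \<Gamma> P) = msubst (\<lambda>a. cmap g (mconst a)) (\<lambda>k. cmap g (\<Sum>l\<le>n. mconst (\<Gamma> $$ (k, l)) * mvar l)) P"
    unfolding subst_form_def by (rule msubst_hom[OF comm_ring_hom_cmap[OF g]])
  also have "\<dots> = msubst (\<lambda>a. subst_form n (map_mat g \<Gamma>) (mconst (g a))) (\<lambda>k. subst_form n (map_mat g \<Gamma>) (mvar k)) P"
    unfolding cc sc sv
  proof (rule msubst_cong)
    fix k assume "k \<in> mvars P"
    then have "k \<le> n" using P by (auto simp: mvars_def)
    then show "cmap g (\<Sum>l\<le>n. mconst (\<Gamma> $$ (k, l)) * mvar l) = (\<Sum>l\<le>n. mconst (map_mat g \<Gamma> $$ (k, l)) * mvar l)"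
      using \<Gamma> by (simp add: c.hom_sum c.hom_mult cc cv)
  qed
  also have "\<dots> = subst_form n (map_mat g \<Gamma>) (cmap g P)"
    unfolding cmap_def by (rule msubst_hom[OF s.comm_ring_hom_axioms, symmetric])
  finally show ?thesis .
qed

lemma adj_mat_hom:
  assumes "comm_ring_hom g" "\<Gamma> \<in> carrier_mat m m" "i < m" "j < m" shows "adj_mat (map_mat g \<Gamma>) $$ (i, j) = g (adj_mat \<Gamma> $$ (i, j))"
proof -
  interpret comm_ring_hom g by fact
  have "mat_delete (map_mat g \<Gamma>) j i = map_mat g (mat_delete \<Gamma> j i)"
    using assms by (intro eq_matI) (auto simp: mat_delete_def)
  then have "cofactor (map_mat g \<Gamma>) j i = g (cofactor \<Gamma> j i)" by (simp add: cofactor_def hom_mult hom_power hom_uminus)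
  then show ?thesis using assms by (simp add: adj_mat_def)
qed

lemma cmap_chcoords:
  assumes g: "comm_ring_hom g" and \<Gamma>: "\<Gamma> \<in> carrier_mat (n + 1) (n + 1)" and P: "\<And>j m. j \<le> n ==> m \<in> keys (F j) ==> keys m \<subseteq> {..n}" and i: "i \<le> n"
  shows "cmap g (chcoords n \<Gamma> F i) = chcoords n (map_mat g \<Gamma>) (\<lambda>j. cmap g (F j)) i"
proof -
  interpret g: comm_ring_hom g by (rule g)
  interpret c: comm_ring_hom "cmap g" by (rule comm_ring_hom_cmap[OF g])
  have "cmap g (mconst a) = mconst (g a)" for a by (simp add: cmap_def msubst_mconst)
  then show ?thesis
    using i adj_mat_hom[OF g \<Gamma>] cmap_subst_form[OF g \<Gamma> P]
    by (simp add: chcoords_def c.hom_sum c.hom_mult)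
qed

lemma subst_form_comp:
  fixes U V :: "'c::comm_ring_1 mat"
  assumes U: "U \<in> carrier_mat (n + 1) (n + 1)" and V: "V \<in> carrier_mat (n + 1) (n + 1)" and P: "\<And>m. m \<in> keys P ==> keys m \<subseteq> {..n}"
  shows "subst_form n V (subst_form n U P) = subst_form n (U * V) P"
proof -
  interpret s: comm_ring_hom "subst_form n V" unfolding subst_form_def by (rule comm_ring_hom_msubst[OF comm_ring_hom_mconst])
  have sc: "subst_form n V (mconst a) = mconst a" for a by (simp add: subst_form_def msubst_mconst)
  have sv: "subst_form n V (mvar k) = (\<Sum>l\<le>n. mconst (V $$ (k, l)) * mvar l)" for k
    by (simp add: subst_form_def msubst_mvar)
  interpret mc: comm_ring_hom "mconst :: 'c => (nat, 'c) mpoly" by (rule comm_ring_hom_mconst)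
  have "subst_form n V (subst_form n U P) = msubst (\<lambda>a. subst_form n V (mconst a)) (\<lambda>k. subst_form n V (\<Sum>l\<le>n. mconst (U $$ (k, l)) * mvar l)) P"
    unfolding subst_form_def[of n U] by (rule msubst_hom[OF s.comm_ring_hom_axioms])
  also have "\<dots> = subst_form n (U * V) P"
    unfolding sc subst_form_def[of n "U * V"]
  proof (rule msubst_cong)
    fix k assume "k \<in> mvars P"
    then have k: "k \<le> n" using P by (auto simp: mvars_def)
    have "subst_form n V (\<Sum>l\<le>n. mconst (U $$ (k, l)) * mvar l) = (\<Sum>l\<le>n. \<Sum>j\<le>n. mconst (U $$ (k, l) * V $$ (l, j)) * mvar j)"
      by (simp add: s.hom_sum s.hom_mult sc sv sum_distrib_left mc.hom_mult mult.assoc)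
    also have "\<dots> = (\<Sum>j\<le>n. mconst (\<Sum>l\<le>n. U $$ (k, l) * V $$ (l, j)) * mvar j)"
      by (subst sum.swap) (simp add: mc.hom_sum sum_distrib_right)
    also have "\<dots> = (\<Sum>j\<le>n. mconst ((U * V) $$ (k, j)) * mvar j)"
      using U V k by (intro sum.cong) (auto simp: scalar_prod_def atMost_atLeast0 atLeastLessThanSuc_atLeastAtMost)
    finally show "subst_form n V (\<Sum>l\<le>n. mconst (U $$ (k, l)) * mvar l) = (\<Sum>j\<le>n. mconst ((U * V) $$ (k, j)) * mvar j)" .
  qed
  finally show ?thesis .
qed

context complex_subring
begin

lemma det_in: assumes "A \<in> carrier_mat m m" "\<And>i j. i < m ==> j < m ==> A $$ (i, j) \<in> R" shows "det A \<in> R"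
  unfolding det_def'[OF assms(1)] using assms(2) by (auto intro!: sum_in mult_in prod_in simp: of_int_in permutes_in_image)

lemma adj_mat_in:
  assumes A: "A \<in> carrier_mat (Suc m) (Suc m)" "\<And>i j. i < Suc m ==> j < Suc m ==> A $$ (i, j) \<in> R" and ij: "i < Suc m" "j < Suc m"
  shows "adj_mat A $$ (i, j) \<in> R"
proof -
  have "det (mat_delete A j i) \<in> R"
    by (rule det_in[of _ m]) (use A ij in \<open>auto simp: mat_delete_def\<close>)
  then show ?thesis using A ij by (auto simp: adj_mat_def cofactor_def intro!: mult_in power_in uminus_in one_in)
qed

lemma form_0: "form R n d 0" by (simp add: form_def zero_in)

lemma form_add: "form R n d P ==> form R n d Q ==> form R n d (P + Q)"
  using keys_add[of P Q] unfolding form_def by (auto simp: lookup_add intro: add_in)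

lemma form_sum: "(\<And>i. i \<in> A ==> form R n d (f i)) ==> form R n d (\<Sum>i\<in>A. f i)"
  by (induction A rule: infinite_finite_induct) (auto intro: form_0 form_add)

lemma form_mult: assumes P: "form R n d P" and Q: "form R n e Q" shows "form R n (d + e) (P * Q)"
proof -
  have "P * Q = (\<Sum>a\<in>keys P. \<Sum>b\<in>keys Q. single (a + b) (lookup P a * lookup Q b))"
    by (subst (1 2) mpoly_as_sum) (simp add: sum_product mult_single)
  moreover have "form R n (d + e) (single (a + b) (lookup P a * lookup Q b))" if "a \<in> keys P" "b \<in> keys Q" for a b
    using P Q that add_in_monomials[of a n d b e] by (auto simp: form_def lookup_single when_def zero_in intro: mult_in)
  ultimately show ?thesis by (auto intro!: form_sum)
qed

lemma form_mconst: "c \<in> R ==> form R n 0 (mconst c)"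
  by (auto simp: form_def mconst_def lookup_single when_def zero_in monomials_def mdegree_def)

lemma form_mvar: "i \<le> n ==> form R n 1 (mvar i)"
  using single_in_monomials[of i n 1] by (auto simp: form_def mvar_def lookup_single when_def zero_in one_in)

lemma form_power: "form R n e P ==> form R n (k * e) (P ^ k)"
  by (induction k) (use form_mconst[OF one_in] form_mult in \<open>auto simp: mconst_def\<close>)

lemma form_prod: "(\<And>i. i \<in> A ==> form R n (e i) (f i)) ==> form R n (\<Sum>i\<in>A. e i) (\<Prod>i\<in>A. f i)"
  by (induction A rule: infinite_finite_induct) (use form_mconst[OF one_in] form_mult in \<open>auto simp: mconst_def\<close>)

lemma form_subst:
  assumes \<Gamma>: "\<And>i j. i \<le> n ==> j \<le> n ==> \<Gamma> $$ (i, j) \<in> R" and P: "form R n d P" shows "form R n d (subst_form n \<Gamma> P)"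
  unfolding subst_form_def msubst_mval
proof (rule form_sum)
  fix m assume m: "m \<in> keys P"
  then have mm: "keys m \<subseteq> {..n}" "mdegree m = d" using P by (auto simp: form_def monomials_def)
  let ?l = "\<lambda>k. \<Sum>l\<le>n. mconst (\<Gamma> $$ (k, l)) * mvar l"
  have "form R n (0 + 1) (mconst (\<Gamma> $$ (k, l)) * mvar l)" if "k \<le> n" "l \<le> n" for k l
    by (intro form_mult form_mconst form_mvar \<Gamma> that)
  then have "form R n 1 (?l k)" if "k \<le> n" for k using that by (intro form_sum) auto
  then have "form R n (lookup m k * 1) (?l k ^ lookup m k)" if "k \<in> keys m" for k using that mm by (intro form_power) auto
  then have "form R n (\<Sum>k\<in>keys m. lookup m k) (mval ?l m)" unfolding mval_def by (intro form_prod) auto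
  then have "form R n d (mval ?l m)" using mm by (simp add: mdegree_def)
  from form_mult[OF form_mconst this, of "lookup P m"] show "form R n d (mconst (lookup P m) * mval ?l m)"
    using P by (simp add: form_def)
qed

lemma form_scale: "c \<in> R ==> form R n d P ==> form R n d (mconst c * P)"
  using form_mult[OF form_mconst, of c n d P] by simp

lemma form_change:
  assumes \<Gamma>: "\<Gamma> \<in> carrier_mat (n + 1) (n + 1)" "\<And>i j. i \<le> n ==> j \<le> n ==> \<Gamma> $$ (i, j) \<in> R" and F: "\<And>j. j \<le> n ==> form R n d (F j)" and i: "i \<le> n"
  shows "form R n d (change_coords n \<Gamma> F i)"
  unfolding change_coords_eq chcoords_def
proof (intro form_sum form_scale form_subst)
  fix j assume "j \<in> {..n}"
  then show "adj_mat \<Gamma> $$ (i, j) \<in> R" using adj_mat_in[of \<Gamma> n i j] \<Gamma> i by auto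
qed (use \<Gamma> F in auto)

lemma eval_in: assumes "\<And>i m. i \<le> n ==> lookup (F i) m \<in> R" "d \<ge> 1" shows "eval_at_forms (macaulay_resultant n d) F \<in> R"
proof -
  have k: "t \<in> keys (macaulay_resultant n d) ==> keys t \<subseteq> {..n} \<times> monomials n d" for t
    using macaulay_resultant[OF assms(2)] by (auto simp: is_macaulay_resultant_def)
  show ?thesis unfolding eval_at_forms msubst_mval mval_def
    by (intro sum_in mult_in of_int_in prod_in power_in) (use k assms(1) in fastforce)
qed

end

lemma subring_UNIV: "complex_subring UNIV" by unfold_locales auto

lemma form_mono: "form R n d P ==> R \<subseteq> R' ==> form R' n d P" by (auto simp: form_def)

lemma form_keys: "form R n d P ==> m \<in> keys P ==> keys m \<subseteq> {..n}" by (auto simp: form_def monomials_def)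

lemma mconst_mult_lookup: "lookup (mconst c * P) m = c * lookup P m" for c :: complex
proof -
  have "mconst c * P = (\<Sum>a\<in>keys P. single a (c * lookup P a))"
    by (subst (2) mpoly_as_sum) (simp add: sum_distrib_left mconst_def mult_single)
  then show ?thesis by (simp add: lookup_sum lookup_single when_def in_keys_iff)
qed

abbreviation resultant :: "nat => nat => (nat => (nat, complex) mpoly) => complex" where
  "resultant n d \<equiv> eval_at_forms (macaulay_resultant n d)"

context
  fixes n d :: nat assumes d: "d \<ge> 1"
begin

lemma res_vars: "v \<in> mvars (macaulay_resultant n d) ==> fst v \<le> n"
  using macaulay_resultant[OF d, of n] unfolding is_macaulay_resultant_def mvars_def by force

lemma res_cong: "(\<And>i. i \<le> n ==> F i = G i) ==> resultant n d F = resultant n d G"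
  unfolding eval_at_forms by (rule msubst_cong) (use res_vars in auto)

lemma res_scale: "resultant n d (\<lambda>i. mconst c * F i) = c ^ ((n + 1) * d ^ n) * resultant n d F"
proof -
  have t: "mdegree t = (n + 1) * d ^ n" if "t \<in> keys (macaulay_resultant n d)" for t
    using macaulay_resultant[OF d, of n] that unfolding is_macaulay_resultant_def by blast
  have "(\<lambda>(i, m). lookup (mconst c * F i) m) = (\<lambda>v. c * (case v of (i, m) => lookup (F i) m))"
    by (auto simp: mconst_mult_lookup)
  then show ?thesis unfolding eval_at_forms msubst_mval
    by (simp add: mval_mult mval_const t sum_distrib_left mult_ac)
qed

lemma res_nonzero_iff: "(\<And>i. i \<le> n ==> form UNIV n d (F i)) ==> resultant n d F \<noteq> 0 \<longleftrightarrow> \<not> has_common_zero UNIV n F"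
  using macaulay_resultant[OF d, of n] unfolding is_macaulay_resultant_def by blast

end

lemma smult_smult_mat: "a \<cdot>\<^sub>m (b \<cdot>\<^sub>m A) = (a * b) \<cdot>\<^sub>m (A :: complex mat)" by (rule eq_matI) (auto simp: mult.assoc)

abbreviation GLC :: "nat => complex mat set" where "GLC n \<equiv> GL n UNIV"

lemma GLC_iff: "A \<in> GLC n \<longleftrightarrow> A \<in> carrier_mat (n + 1) (n + 1) \<and> det A \<noteq> 0" by (auto simp: GL_def)

lemma GLC_mult: "A \<in> GLC n ==> B \<in> GLC n ==> A * B \<in> GLC n" by (auto simp: GLC_iff det_mult[of A "n + 1" B])

lemma GLC_cancel:
  assumes A: "A \<in> GLC n" and B: "B \<in> carrier_mat (n + 1) (n + 1)" "C \<in> carrier_mat (n + 1) (n + 1)" and e: "A * B = A * C" shows "B = C"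
proof -
  have cA: "A \<in> carrier_mat (n + 1) (n + 1)" "det A \<noteq> 0" using A by (auto simp: GLC_iff)
  have adj: "adj_mat A * (A * Y) = det A \<cdot>\<^sub>m Y" if X: "Y \<in> carrier_mat (n + 1) (n + 1)" for Y
    using assoc_mult_mat[OF adj_mat(1)[OF cA(1)] cA(1) X] adj_mat(3)[OF cA(1)]
      mult_smult_assoc_mat[OF one_carrier_mat X, of "det A"] left_mult_one_mat[OF X] by simp
  have e': "det A \<cdot>\<^sub>m B = det A \<cdot>\<^sub>m C" using adj[OF B(1)] adj[OF B(2)] e by simp
  show ?thesis
  proof (rule eq_matI)
    fix i j assume "i < dim_row C" "j < dim_col C"
    then show "B $$ (i, j) = C $$ (i, j)" using arg_cong[OF e', of "\<lambda>M. M $$ (i, j)"] B cA(2) by simp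
  qed (use B in auto)
qed

lemma adj_mat_mult: assumes U: "U \<in> GLC n" and V: "V \<in> GLC n" shows "adj_mat (U * V) = adj_mat V * adj_mat U"
proof (rule GLC_cancel[OF GLC_mult[OF U V]])
  let ?m = "n + 1"
  have c: "U \<in> carrier_mat ?m ?m" "V \<in> carrier_mat ?m ?m" using U V by (auto simp: GLC_iff)
  note a = adj_mat[OF c(1)] adj_mat[OF c(2)] adj_mat[OF mult_carrier_mat[OF c]]
  show "adj_mat (U * V) \<in> carrier_mat ?m ?m" "adj_mat V * adj_mat U \<in> carrier_mat ?m ?m" using a by auto
  have "V * (adj_mat V * adj_mat U) = det V \<cdot>\<^sub>m adj_mat U"
    using assoc_mult_mat[OF c(2) a(4,1)] a(5) mult_smult_assoc_mat[OF one_carrier_mat a(1), of "det V"] left_mult_one_mat[OF a(1)] by simp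
  then have "(U * V) * (adj_mat V * adj_mat U) = det V \<cdot>\<^sub>m (U * adj_mat U)"
    using assoc_mult_mat[OF c mult_carrier_mat[OF a(4,1)]] mult_smult_distrib[OF c(1) a(1), of "det V"] by simp
  then show "U * V * adj_mat (U * V) = U * V * (adj_mat V * adj_mat U)"
    unfolding a(8) a(2) det_mult[OF c] by (simp add: smult_smult_mat mult.commute)
qed

lemma change_coords_comp:
  assumes U: "U \<in> GLC n" and V: "V \<in> GLC n" and F: "\<And>j m. j \<le> n ==> m \<in> keys (F j) ==> keys m \<subseteq> {..n}" and i: "i \<le> n"
  shows "change_coords n V (change_coords n U F) i = change_coords n (U * V) F i"
proof -
  have c: "U \<in> carrier_mat (n + 1) (n + 1)" "V \<in> carrier_mat (n + 1) (n + 1)" using U V by (auto simp: GLC_iff)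
  interpret s: comm_ring_hom "subst_form n V" unfolding subst_form_def by (rule comm_ring_hom_msubst[OF comm_ring_hom_mconst])
  interpret mc: comm_ring_hom "mconst :: complex => (nat, complex) mpoly" by (rule comm_ring_hom_mconst)
  have sc: "subst_form n V (mconst a) = mconst a" for a by (simp add: subst_form_def msubst_mconst)
  have "change_coords n V (change_coords n U F) i
    = (\<Sum>j\<le>n. \<Sum>k\<le>n. mconst (adj_mat V $$ (i, j) * adj_mat U $$ (j, k)) * subst_form n (U * V) (F k))"
    unfolding change_coords_eq chcoords_def
    by (simp add: s.hom_sum s.hom_mult sc subst_form_comp[OF c F] sum_distrib_left mc.hom_mult mult.assoc)
  also have "\<dots> = (\<Sum>k\<le>n. mconst (\<Sum>j\<le>n. adj_mat V $$ (i, j) * adj_mat U $$ (j, k)) * subst_form n (U * V) (F k))"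
    by (subst sum.swap) (simp add: mc.hom_sum sum_distrib_right)
  also have "\<dots> = change_coords n (U * V) F i"
    unfolding change_coords_eq chcoords_def adj_mat_mult[OF U V]
    using adj_mat(1)[OF c(1)] adj_mat(1)[OF c(2)] i
    by (intro sum.cong) (auto simp: scalar_prod_def atMost_atLeast0 atLeastLessThanSuc_atLeastAtMost)
  finally show ?thesis .
qed

lemma subst_form_scalar:
  assumes P: "keys P \<subseteq> monomials n d" shows "subst_form n (c \<cdot>\<^sub>m 1\<^sub>m (n + 1)) P = mconst (c ^ d) * (P :: (nat, complex) mpoly)"
proof -
  have "subst_form n (c \<cdot>\<^sub>m 1\<^sub>m (n + 1)) P = msubst mconst (\<lambda>k. mconst c * mvar k) P"
    unfolding subst_form_def
  proof (rule msubst_cong)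
    fix k assume "k \<in> mvars P"
    then have k: "k \<le> n" using P by (auto simp: mvars_def monomials_def)
    have "(\<Sum>l\<le>n. mconst ((c \<cdot>\<^sub>m 1\<^sub>m (n + 1)) $$ (k, l)) * mvar l) = (\<Sum>l\<le>n. if l = k then mconst c * mvar l else 0 :: (nat, complex) mpoly)"
      using k by (intro sum.cong) (auto simp: mconst_def)
    then show "(\<Sum>l\<le>n. mconst ((c \<cdot>\<^sub>m 1\<^sub>m (n + 1)) $$ (k, l)) * mvar l) = mconst c * (mvar k :: (nat, complex) mpoly)" using k by simp
  qed
  also have "\<dots> = mconst (c ^ d) * msubst mconst mvar P"
  proof -
    interpret mc: comm_ring_hom "mconst :: complex => (nat, complex) mpoly" by (rule comm_ring_hom_mconst)
    have "mdegree m = d" if "m \<in> keys P" for m using P that by (auto simp: monomials_def)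
    then show ?thesis by (simp add: msubst_mval mval_mult mval_const sum_distrib_left mult_ac mc.hom_power)
  qed
  finally show ?thesis by (simp add: msubst_mvar_id)
qed

lemma change_coords_scalar:
  assumes F: "\<And>j. j \<le> n ==> keys (F j) \<subseteq> monomials n d" and c: "c \<noteq> 0" and i: "i \<le> n"
  shows "change_coords n (c \<cdot>\<^sub>m 1\<^sub>m (n + 1)) F i = mconst (c ^ (n + d)) * F i"
proof -
  let ?m = "n + 1"
  interpret mc: comm_ring_hom "mconst :: complex => (nat, complex) mpoly" by (rule comm_ring_hom_mconst)
  have D: "c \<cdot>\<^sub>m 1\<^sub>m ?m \<in> GLC n" using c by (simp add: GLC_iff)
  then have cD: "c \<cdot>\<^sub>m 1\<^sub>m ?m \<in> carrier_mat ?m ?m" by (simp add: GLC_iff)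
  have "adj_mat (c \<cdot>\<^sub>m 1\<^sub>m ?m) = c ^ n \<cdot>\<^sub>m 1\<^sub>m ?m"
  proof (rule GLC_cancel[OF D])
    show "c \<cdot>\<^sub>m 1\<^sub>m ?m * adj_mat (c \<cdot>\<^sub>m 1\<^sub>m ?m) = c \<cdot>\<^sub>m 1\<^sub>m ?m * (c ^ n \<cdot>\<^sub>m 1\<^sub>m ?m)"
      unfolding adj_mat(2)[OF cD] mult_smult_assoc_mat[OF one_carrier_mat smult_carrier_mat[OF one_carrier_mat]]
      using left_mult_one_mat[of "c ^ n \<cdot>\<^sub>m 1\<^sub>m ?m" ?m ?m] by (simp add: smult_smult_mat)
  qed (use adj_mat(1)[OF cD] in auto)
  then have "change_coords n (c \<cdot>\<^sub>m 1\<^sub>m ?m) F i = (\<Sum>j\<le>n. if j = i then mconst (c ^ n) * (mconst (c ^ d) * F j) else 0)"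
    unfolding change_coords_eq chcoords_def using i F by (intro sum.cong) (auto simp: subst_form_scalar[simplified])
  then show ?thesis using i by (simp add: power_add mc.hom_mult mult.assoc)
qed

lemma meval_subst: "meval x (subst_form n \<Gamma> P) = meval (\<lambda>k. \<Sum>l\<le>n. \<Gamma> $$ (k, l) * x l) (P :: (nat, complex) mpoly)"
proof -
  interpret ev: comm_ring_hom "meval x :: (nat, complex) mpoly => complex" by (rule comm_ring_hom_meval)
  show ?thesis unfolding subst_form_def msubst_hom[OF ev.comm_ring_hom_axioms]
    by (simp add: ev.hom_sum ev.hom_mult msubst_mconst msubst_mvar)
qed

text \<open>If \<open>x\<close> is a zero of the conjugate of \<open>F\<close> by \<open>\<Gamma>\<close>, then \<open>\<Gamma> x\<close> is a zero of its conjugate back by \<open>adj \<Gamma>\<close>,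
  which is a multiple of \<open>F\<close>.\<close>

lemma change_coords_no_zero:
  assumes \<Gamma>: "\<Gamma> \<in> GLC n" and F: "\<not> has_common_zero UNIV n F" and form: "\<And>j. j \<le> n ==> form UNIV n d (F j)"
  shows "\<not> has_common_zero UNIV n (change_coords n \<Gamma> F)"
proof
  let ?m = "n + 1" and ?G = "change_coords n \<Gamma> F" and ?V = "adj_mat \<Gamma>"
  assume "has_common_zero UNIV n ?G"
  then obtain x where x: "\<exists>j\<le>n. x j \<noteq> 0" "\<And>i. i \<le> n ==> meval x (?G i) = 0" by (auto simp: has_common_zero_def)
  have c: "\<Gamma> \<in> carrier_mat ?m ?m" "det \<Gamma> \<noteq> 0" using \<Gamma> by (auto simp: GLC_iff)
  note a = adj_mat[OF c(1)]
  have "det \<Gamma> * det ?V = det (det \<Gamma> \<cdot>\<^sub>m 1\<^sub>m ?m)" by (rule det_mult[OF c(1) a(1), unfolded a(2), symmetric])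
  moreover have "det (det \<Gamma> \<cdot>\<^sub>m 1\<^sub>m ?m) \<noteq> 0" using c(2) by simp
  ultimately have V: "?V \<in> GLC n" using a(1) by (metis GLC_iff mult_zero_right)
  define y where "y = (\<lambda>k. \<Sum>l\<le>n. \<Gamma> $$ (k, l) * x l)"
  have Vy: "(\<Sum>l\<le>n. ?V $$ (k, l) * y l) = det \<Gamma> * x k" if k: "k \<le> n" for k
  proof -
    have "(\<Sum>l\<le>n. ?V $$ (k, l) * y l) = (\<Sum>j\<le>n. (\<Sum>l\<le>n. ?V $$ (k, l) * \<Gamma> $$ (l, j)) * x j)"
      by (simp add: y_def sum_distrib_left sum_distrib_right mult.assoc) (rule sum.swap)
    also have "\<dots> = (\<Sum>j\<le>n. (?V * \<Gamma>) $$ (k, j) * x j)"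
      using a(1) c(1) k by (intro sum.cong) (auto simp: scalar_prod_def atMost_atLeast0 atLeastLessThanSuc_atLeastAtMost)
    also have "\<dots> = (\<Sum>j\<le>n. if j = k then det \<Gamma> * x j else 0)" unfolding a(3) using k by (intro sum.cong) auto
    finally show ?thesis using k by simp
  qed
  have G: "form UNIV n d (?G j)" if "j \<le> n" for j
    by (rule complex_subring.form_change[OF subring_UNIV c(1)]) (use form that in auto)
  have hom: "meval (\<lambda>k. \<Sum>l\<le>n. ?V $$ (k, l) * y l) (?G j) = 0" if j: "j \<le> n" for j
  proof -
    have "meval (\<lambda>k. \<Sum>l\<le>n. ?V $$ (k, l) * y l) (?G j) = meval (\<lambda>k. det \<Gamma> * x k) (?G j)"
      by (rule msubst_cong) (use Vy form_keys[OF G[OF j]] in \<open>auto simp: mvars_def\<close>)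
    also have "\<dots> = det \<Gamma> ^ d * meval x (?G j)"
    proof -
      have "mdegree m = d" if "m \<in> keys (?G j)" for m using G[OF j] that by (auto simp: form_def monomials_def)
      then show ?thesis by (simp add: msubst_mval mval_mult mval_const sum_distrib_left mult_ac)
    qed
    finally show ?thesis using x(2)[OF j] by simp
  qed
  interpret ev: comm_ring_hom "meval y :: (nat, complex) mpoly => complex" by (rule comm_ring_hom_meval)
  have "meval y (F i) = 0" if i: "i \<le> n" for i
  proof -
    have z: "meval y (change_coords n ?V g i) = 0" if "\<And>j. j \<le> n ==> meval (\<lambda>k. \<Sum>l\<le>n. ?V $$ (k, l) * y l) (g j) = 0" for g
      using that by (simp add: change_coords_eq chcoords_def ev.hom_sum ev.hom_mult meval_subst)
    have "mconst (det \<Gamma> ^ (n + d)) * F i = change_coords n (det \<Gamma> \<cdot>\<^sub>m 1\<^sub>m ?m) F i"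
      by (rule change_coords_scalar[symmetric, OF _ c(2) i]) (use form in \<open>simp add: form_def\<close>)
    also have "\<dots> = change_coords n ?V ?G i"
      using change_coords_comp[OF \<Gamma> V _ i, of F] form_keys[OF form] a(2) by simp
    finally have "meval y (mconst (det \<Gamma> ^ (n + d)) * F i) = 0" using z[of ?G] hom by simp
    then show ?thesis using c(2) by (simp add: ev.hom_mult msubst_mconst)
  qed
  moreover have "\<exists>j\<le>n. y j \<noteq> 0"
  proof (rule ccontr)
    assume "\<not> ?thesis"
    then have "(\<Sum>l\<le>n. ?V $$ (k, l) * y l) = 0" for k by simp
    then show False using Vy x(1) c(2) by auto
  qed
  ultimately show False using F by (auto simp: has_common_zero_def)
qed

lemma change_coords_resultant:
  assumes "d \<ge> 1" "\<Gamma> \<in> GLC n" "resultant n d F \<noteq> 0" "\<And>j. j \<le> n ==> form UNIV n d (F j)"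
  shows "resultant n d (change_coords n \<Gamma> F) \<noteq> 0"
proof -
  have "\<Gamma> \<in> carrier_mat (n + 1) (n + 1)" using assms by (simp add: GLC_iff)
  then have "form UNIV n d (change_coords n \<Gamma> F i)" if "i \<le> n" for i
    using complex_subring.form_change[OF subring_UNIV] assms(4) that by auto
  then show ?thesis using assms change_coords_no_zero[of \<Gamma> n F d] res_nonzero_iff[OF assms(1)] by blast
qed

text \<open>Along the line \<open>A + t N\<close> the resultant is a polynomial in \<open>t\<close>, without roots where the matrix is invertible.\<close>

lemma resultant_along_line:
  assumes d: "d \<ge> 1" and A: "A \<in> carrier_mat (n + 1) (n + 1)" and N: "N \<in> carrier_mat (n + 1) (n + 1)"
    and F: "\<And>j. j \<le> n ==> form UNIV n d (F j)"
  shows "\<exists>p. \<forall>t. resultant n d (change_coords n (A + t \<cdot>\<^sub>m N) F) = poly p t"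
proof -
  let ?m = "n + 1"
  define M where "M = mat ?m ?m (\<lambda>ij. [:A $$ ij, N $$ ij:])"
  define H where "H = (\<lambda>j. cmap (\<lambda>c. [:c:]) (F j))"
  have cM: "M \<in> carrier_mat ?m ?m" by (simp add: M_def)
  have kH: "keys m \<subseteq> {..n}" if "j \<le> n" "m \<in> keys (H j)" for j m
    using that form_keys[OF F[OF that(1)]] by (auto simp: H_def in_keys_iff lookup_cmap[OF comm_ring_hom_const_poly])
  have ev: "lookup (change_coords n (A + t \<cdot>\<^sub>m N) F i) m = poly (lookup (chcoords n M H i) m) t" if i: "i \<le> n" for i m t
  proof -
    let ?e = "\<lambda>p. poly p t"
    have "map_mat ?e M = A + t \<cdot>\<^sub>m N" using A N by (intro eq_matI) (auto simp: M_def)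
    moreover have "cmap ?e (H j) = F j" for j
      by (rule poly_mapping_eqI) (simp add: H_def lookup_cmap[OF comm_ring_hom_poly] lookup_cmap[OF comm_ring_hom_const_poly])
    ultimately have "cmap ?e (chcoords n M H i) = change_coords n (A + t \<cdot>\<^sub>m N) F i"
      unfolding change_coords_eq by (subst cmap_chcoords[OF comm_ring_hom_poly cM kH i]) auto
    then show ?thesis using lookup_cmap[OF comm_ring_hom_poly, of t "chcoords n M H i" m] by simp
  qed
  have "resultant n d (change_coords n (A + t \<cdot>\<^sub>m N) F) = poly (ieval (\<lambda>(i, m). lookup (chcoords n M H i) m) (macaulay_resultant n d)) t" for t
    unfolding eval_at_forms ieval_hom[OF comm_ring_hom_poly]
    by (rule msubst_cong) (use ev res_vars[OF d] in \<open>auto split: prod.splits\<close>)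
  then show ?thesis by blast
qed

text \<open>Invertibility along the whole line leaves a complex polynomial without roots, hence a
  constant. This stands in for the transformation formula of the resultant under linear
  substitutions.\<close>

lemma resultant_line_const:
  assumes "d \<ge> 1" "A \<in> carrier_mat (n + 1) (n + 1)" "N \<in> carrier_mat (n + 1) (n + 1)"
    and "\<And>j. j \<le> n ==> form UNIV n d (F j)" "resultant n d F \<noteq> 0" and det: "\<And>t. det (A + t \<cdot>\<^sub>m N) \<noteq> 0"
  shows "resultant n d (change_coords n (A + N) F) = resultant n d (change_coords n A F)"
proof -
  obtain p where p: "\<And>t. resultant n d (change_coords n (A + t \<cdot>\<^sub>m N) F) = poly p t"
    using resultant_along_line[OF assms(1-3), of F] assms(4) by blast
  have "poly p t \<noteq> 0" for t
    unfolding p[symmetric] using assms by (intro change_coords_resultant) (auto simp: GLC_iff)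
  then have "poly p 1 = poly p 0" by (rule const_if_no_root)
  moreover have "A + 1 \<cdot>\<^sub>m N = A + N" "A + 0 \<cdot>\<^sub>m N = A" using assms(2,3) by (auto intro!: eq_matI)
  ultimately show ?thesis using p[of 1] p[of 0] by simp
qed

lemma poly_nonzero_off_0:
  assumes "\<And>t. t \<noteq> 0 ==> poly p t \<noteq> (0 :: complex)" shows "\<exists>s. \<forall>t. poly p t = t ^ s * poly p 1"
proof -
  have "p \<noteq> 0" using assms[of 1] by auto
  then obtain q where q: "p = [:- 0, 1:] ^ order 0 p * q" "\<not> [:- 0, 1:] dvd q" using order_decomp[of p 0] by blast
  have ev: "poly p t = t ^ order 0 p * poly q t" for t by (subst q(1)) simp
  have "poly q t \<noteq> 0" for t
    using q(2) assms[of t] ev[of t] by (cases "t = 0") (auto simp: poly_eq_0_iff_dvd)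
  then have "poly q t = poly q 1" for t by (rule const_if_no_root)
  then show ?thesis using ev[of 1] ev by (intro exI[of _ "order 0 p"]) simp
qed

lemma det_upper: "(A :: complex mat) \<in> carrier_mat m m ==> (\<And>i j. j < i ==> i < m ==> A $$ (i, j) = 0) ==> det A = (\<Prod>i<m. A $$ (i, i))"
  by (subst det_upper_triangular) (auto simp: prod_list_diag_prod lessThan_atLeast0)

lemma det_lower: "(A :: complex mat) \<in> carrier_mat m m ==> (\<And>i j. i < j ==> j < m ==> A $$ (i, j) = 0) ==> det A = (\<Prod>i<m. A $$ (i, i))"
  by (subst det_lower_triangular) (auto simp: prod_list_diag_prod lessThan_atLeast0)

lemma mat_mult_index:
  assumes "V \<in> carrier_mat (n + 1) (n + 1)" "W \<in> carrier_mat (n + 1) (n + 1)" "i \<le> n" "j \<le> n"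
  shows "(V * W) $$ (i, j) = (\<Sum>k\<le>n. V $$ (i, k) * W $$ (k, j))"
  using assms by (auto simp: scalar_prod_def atMost_atLeast0 atLeastLessThanSuc_atLeastAtMost)

lemma one_smult_mat: "1 \<cdot>\<^sub>m N = (N :: complex mat)" by (intro eq_matI) auto

definition strictly_triangular :: "complex mat => bool" where
  "strictly_triangular N \<longleftrightarrow> (\<forall>i j. i < dim_row N --> j < dim_row N --> j \<le> i --> N $$ (i, j) = 0)
     \<or> (\<forall>i j. i < dim_row N --> j < dim_row N --> i \<le> j --> N $$ (i, j) = 0)"

lemma det_unipotent:
  assumes "N \<in> carrier_mat m m" "strictly_triangular N" shows "det (1\<^sub>m m + t \<cdot>\<^sub>m N) = 1"
  using assms(2) unfolding strictly_triangular_def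
proof (elim disjE)
  assume "\<forall>i j. i < dim_row N --> j < dim_row N --> j \<le> i --> N $$ (i, j) = 0"
  then show ?thesis using assms(1) by (subst det_upper[of _ m]) auto
next
  assume "\<forall>i j. i < dim_row N --> j < dim_row N --> i \<le> j --> N $$ (i, j) = 0"
  then show ?thesis using assms(1) by (subst det_lower[of _ m]) auto
qed

section \<open>Matrices over a valuation ring\<close>

context valued_field
begin

definition GLO :: "nat => complex mat set" where
  "GLO n = {V \<in> carrier_mat (n + 1) (n + 1). (\<forall>i\<le>n. \<forall>j\<le>n. V $$ (i, j) \<in> B 0) \<and> det V \<noteq> 0 \<and> v (det V) = 0}"

text \<open>Each factor is a unipotent triangular matrix, joined to 1 by a line of matrices of
  determinant 1. Multiplication by it therefore preserves the resultant itself, not only its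
  valuation.\<close>

inductive_set elem :: "nat => complex mat set" for n where
  elem_1: "1\<^sub>m (n + 1) \<in> elem n"
| elem_step: "W \<in> elem n ==> N \<in> carrier_mat (n + 1) (n + 1) ==> (\<And>i j. i \<le> n ==> j \<le> n ==> N $$ (i, j) \<in> B 0)
    ==> strictly_triangular N ==> W * (1\<^sub>m (n + 1) + N) \<in> elem n"

lemma GLO_GLC: "V \<in> GLO n ==> V \<in> GLC n" by (auto simp: GLO_def GLC_iff)

lemma mat_mult_B:
  assumes "V \<in> carrier_mat (n + 1) (n + 1)" "W \<in> carrier_mat (n + 1) (n + 1)" "\<And>i j. i \<le> n ==> j \<le> n ==> V $$ (i, j) \<in> B k"
    "\<And>i j. i \<le> n ==> j \<le> n ==> W $$ (i, j) \<in> B l" "i \<le> n" "j \<le> n"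
  shows "(V * W) $$ (i, j) \<in> B (k + l)"
  unfolding mat_mult_index[OF assms(1,2,5,6)] using assms by (intro B_sum B_mult) auto

lemma GLO_mult: "V \<in> GLO n ==> W \<in> GLO n ==> V * W \<in> GLO n"
  using mat_mult_B[of V n W 0 0] B0.det_in[of V "n + 1"] B0.det_in[of W "n + 1"]
  by (auto simp: GLO_def det_mult[of V "n + 1" W] v_mult B_sub)

lemma elem_GLO: "W \<in> elem n ==> W \<in> GLO n"
proof (induction rule: elem.induct)
  case elem_1
  then show ?case by (simp add: GLO_def B_0 B_1 v_1)
next
  case (elem_step W N)
  have "det (1\<^sub>m (n + 1) + N) = 1" using det_unipotent[OF elem_step(2,4), of 1] by (simp add: one_smult_mat)
  moreover have "(1\<^sub>m (n + 1) + N) $$ (i, j) \<in> B 0" if "i \<le> n" "j \<le> n" for i j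
    using elem_step(2,3) that B_0 B_1 by (auto intro: B_add)
  ultimately have "1\<^sub>m (n + 1) + N \<in> GLO n" using elem_step(2) by (simp add: GLO_def v_1)
  then show ?case using elem_step.IH by (rule GLO_mult[rotated])
qed

lemma resultant_elem:
  assumes d: "d \<ge> 1" and F: "\<And>j. j \<le> n ==> form UNIV n d (F j)" "resultant n d F \<noteq> 0" and A: "A \<in> GLC n" and W: "W \<in> elem n"
  shows "resultant n d (change_coords n (A * W) F) = resultant n d (change_coords n A F)"
  using W
proof (induction rule: elem.induct)
  case elem_1
  then show ?case using A right_mult_one_mat[of A "n + 1" "n + 1"] by (simp add: GLC_iff)
next
  case (elem_step W N)
  let ?m = "n + 1"
  have W: "W \<in> GLC n" using elem_GLO[OF elem_step(1)] by (rule GLO_GLC)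
  then have AW: "A * W \<in> GLC n" using A by (rule GLC_mult[rotated])
  have c: "A \<in> carrier_mat ?m ?m" "W \<in> carrier_mat ?m ?m" "A * W \<in> carrier_mat ?m ?m" "A * W * N \<in> carrier_mat ?m ?m"
    using A W elem_step(2) by (auto simp: GLC_iff)
  have line: "A * W + t \<cdot>\<^sub>m (A * W * N) = A * W * (1\<^sub>m ?m + t \<cdot>\<^sub>m N)" for t
    using mult_add_distrib_mat[OF c(3) one_carrier_mat smult_carrier_mat[OF elem_step(2)], of t] mult_smult_distrib[OF c(3) elem_step(2), of t]
      right_mult_one_mat[OF c(3)] by simp
  have "det (A * W + t \<cdot>\<^sub>m (A * W * N)) \<noteq> 0" for t
    unfolding line using det_mult[OF c(3), of "1\<^sub>m ?m + t \<cdot>\<^sub>m N"] det_unipotent[OF elem_step(2,4), of t] elem_step(2) AW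
    by (simp add: GLC_iff)
  then have "resultant n d (change_coords n (A * W + A * W * N) F) = resultant n d (change_coords n (A * W) F)"
    by (intro resultant_line_const[OF d c(3,4)] F)
  moreover have "A * (W * (1\<^sub>m ?m + N)) = A * W + A * W * N"
    using mult_add_distrib_mat[OF c(3) one_carrier_mat elem_step(2)] assoc_mult_mat[OF c(1,2), of "1\<^sub>m ?m + N" ?m] elem_step(2)
      right_mult_one_mat[OF c(3)] by simp
  ultimately show ?case using elem_step.IH by simp
qed

lemma row_op:
  fixes C :: "complex mat"
  assumes "C \<in> carrier_mat m m" "r < m" "i < m" "b < m"
  shows "(C * (1\<^sub>m m + mat m m (\<lambda>(k, b). if k = r then f b else 0))) $$ (i, b) = C $$ (i, b) + C $$ (i, r) * f b"
proof -
  have "(C * (1\<^sub>m m + mat m m (\<lambda>(k, b). if k = r then f b else 0))) $$ (i, b)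
    = (\<Sum>k = 0..<m. C $$ (i, k) * (if k = b then 1 else 0) + C $$ (i, k) * (if k = r then f b else 0))"
    using assms by (auto simp: scalar_prod_def distrib_left intro!: sum.cong)
  also have "\<dots> = (\<Sum>k = 0..<m. if k = b then C $$ (i, k) else 0) + (\<Sum>k = 0..<m. if k = r then C $$ (i, k) * f b else 0)"
    unfolding sum.distrib by (intro arg_cong2[of _ _ _ _ "(+)"] sum.cong) auto
  finally show ?thesis using assms by simp
qed

text \<open>Rows are cleared from the bottom up; the column operations for row \<open>a\<close>
  involve columns up to \<open>a\<close> only, where the finished rows are 0. The pivot is an entry
  of least valuation. It is brought to the diagonal by adding a column instead of a permutation, so
  that all factors are unipotent.\<close>

lemma triangularize:
  assumes A: "A \<in> carrier_mat (n + 1) (n + 1)" "\<And>i j. i \<le> n ==> j \<le> n ==> A $$ (i, j) \<in> L"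
  shows "\<exists>W\<in>elem n. \<forall>i j. i \<le> n --> j < i --> (A * W) $$ (i, j) = 0"
proof -
  let ?m = "n + 1"
  have "k \<le> ?m ==> \<exists>W\<in>elem n. \<forall>i j. ?m - k \<le> i --> i \<le> n --> j < i --> (A * W) $$ (i, j) = 0" for k
  proof (induction k)
    case 0
    then show ?case using elem_1 by auto
  next
    case (Suc k)
    then obtain W where W: "W \<in> elem n" "\<And>i j. ?m - k \<le> i ==> i \<le> n ==> j < i ==> (A * W) $$ (i, j) = 0" by auto
    define a where "a = n - k"
    have a: "a \<le> n" "?m - Suc k = a" "?m - k = Suc a" using Suc.prems by (auto simp: a_def)
    have cW: "W \<in> carrier_mat ?m ?m" and WB: "W $$ (i, j) \<in> B 0" if "i \<le> n" "j \<le> n" for i j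
      using elem_GLO[OF W(1)] that by (auto simp: GLO_def)
    then have cW: "W \<in> carrier_mat ?m ?m" by blast
    define C where "C = A * W"
    have cC: "C \<in> carrier_mat ?m ?m" using A cW by (simp add: C_def)
    have CL: "C $$ (i, j) \<in> L" if "i \<le> n" "j \<le> n" for i j
      unfolding C_def mat_mult_index[OF A(1) cW that] using that A(2) B_sub[OF WB] by (intro sum_in mult_in) auto
    have C0: "C $$ (i, j) = 0" if "a < i" "i \<le> n" "j < i" for i j using W(2) that a by (simp add: C_def)
    show ?case
    proof (cases "\<forall>j<a. C $$ (a, j) = 0")
      case True
      then show ?thesis using W(1) C0 a(2) by (intro bexI[of _ W]) (auto simp: C_def[symmetric] le_less)
    next
      case False
      define J where "J = {j. j \<le> a \<and> C $$ (a, j) \<noteq> 0}"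
      obtain b where "b < a" "C $$ (a, b) \<noteq> 0" using False by blast
      then have "finite J" "J \<noteq> {}" by (auto simp: J_def intro: less_imp_le)
      then obtain j where "is_arg_min (\<lambda>j. v (C $$ (a, j))) (\<lambda>j. j \<in> J) j" using ex_is_arg_min_if_finite by blast
      then have j: "j \<in> J" "\<And>b. b \<in> J ==> v (C $$ (a, j)) \<le> v (C $$ (a, b))" unfolding is_arg_min_linorder by blast+
      \<comment> \<open>Column \<open>j\<close> is added to column \<open>a\<close> only if the
        diagonal entry has larger valuation or is 0. In that case the sum has exactly the least
        valuation, so it can serve as pivot.\<close>
      define \<epsilon> :: complex where "\<epsilon> = (if a \<in> J \<and> v (C $$ (a, a)) \<le> v (C $$ (a, j)) then 0 else 1)"
      define N1 where "N1 = mat ?m ?m (\<lambda>(k, b). if k = j then (if b = a then \<epsilon> else 0) else 0)"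
      define C1 where "C1 = C * (1\<^sub>m ?m + N1)"
      have jn: "j \<le> a" "j < ?m" using j(1) a by (auto simp: J_def)
      have C1: "C1 $$ (i, b) = C $$ (i, b) + (if b = a then C $$ (i, j) * \<epsilon> else 0)" if "i \<le> n" "b \<le> n" for i b
        unfolding C1_def N1_def using row_op[OF cC jn(2), of i b "\<lambda>b. if b = a then \<epsilon> else 0"] that by auto
      have \<epsilon>: "\<epsilon> = 0 \<or> \<epsilon> = 1" by (simp add: \<epsilon>_def)
      have ja: "j = a ==> \<epsilon> = 0" using j(1) by (auto simp: \<epsilon>_def)
      have N1: "N1 \<in> carrier_mat ?m ?m" "strictly_triangular N1" "\<And>i j. i \<le> n ==> j \<le> n ==> N1 $$ (i, j) \<in> B 0"
        using jn ja \<epsilon> B_0 B_1 by (auto simp: N1_def strictly_triangular_def le_less)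
      have pivot: "C1 $$ (a, a) \<noteq> 0 \<and> (\<forall>b<a. C1 $$ (a, b) = 0 \<or> v (C1 $$ (a, a)) \<le> v (C1 $$ (a, b)))"
      proof -
        have jL: "C $$ (a, j) \<in> L" "C $$ (a, j) \<noteq> 0" using j(1) CL[OF a(1)] a(1) by (auto simp: J_def)
        have "C1 $$ (a, a) \<noteq> 0 \<and> v (C1 $$ (a, a)) = v (C $$ (a, j))"
        proof (cases "\<epsilon> = 0")
          case True
          then have "a \<in> J" "v (C $$ (a, a)) \<le> v (C $$ (a, j))" by (auto simp: \<epsilon>_def split: if_splits)
          then show ?thesis using j(2)[of a] C1[OF a(1) a(1)] True by (auto simp: J_def)
        next
          case False
          then have "a \<notin> J \<or> v (C $$ (a, j)) < v (C $$ (a, a))" by (auto simp: \<epsilon>_def split: if_splits)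
          then have "C $$ (a, a) \<in> B (v (C $$ (a, j)) + 1)" using CL[OF a(1) a(1)] by (auto simp: B_def J_def)
          from v_add_eq[OF jL this] show ?thesis using C1[OF a(1) a(1)] False \<epsilon> by (simp add: add.commute)
        qed
        moreover have "C1 $$ (a, b) = 0 \<or> v (C $$ (a, j)) \<le> v (C1 $$ (a, b))" if "b < a" for b
          using j(2)[of b] C1[OF a(1), of b] a(1) that by (auto simp: J_def)
        ultimately show ?thesis by simp
      qed
      have C1_0: "C1 $$ (i, b) = 0" if "a < i" "i \<le> n" "b < i" for i b using C1[OF that(2), of b] C0[of i] that jn by simp
      have cC1: "C1 \<in> carrier_mat ?m ?m" using cC N1 by (simp add: C1_def)
      define f where "f = (\<lambda>b. if b < a then - (C1 $$ (a, b) / C1 $$ (a, a)) else 0)"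
      define N2 where "N2 = mat ?m ?m (\<lambda>(k, b). if k = a then f b else 0)"
      have C1L: "C1 $$ (a, b) \<in> L" if "b \<le> n" for b
        using C1[OF a(1) that] CL[OF a(1)] that jn \<epsilon> by (auto intro: add_in)
      have "f b \<in> B 0" if "b \<le> n" for b
      proof (cases "b < a \<and> C1 $$ (a, b) \<noteq> 0")
        case True
        then have "v (C1 $$ (a, b) / C1 $$ (a, a)) \<ge> 0"
          using pivot v_divide[OF C1L[OF that] _ C1L[OF a(1)]] by auto
        then have "C1 $$ (a, b) / C1 $$ (a, a) \<in> B 0" using C1L that a by (auto simp: B_def intro: divide_in)
        then show ?thesis using B_uminus True by (simp add: f_def)
      qed (auto simp: f_def B_0)
      then have N2: "N2 \<in> carrier_mat ?m ?m" "strictly_triangular N2" "\<And>i j. i \<le> n ==> j \<le> n ==> N2 $$ (i, j) \<in> B 0"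
        using B_0 by (auto simp: N2_def strictly_triangular_def f_def)
      have C2: "(C1 * (1\<^sub>m ?m + N2)) $$ (i, b) = C1 $$ (i, b) + C1 $$ (i, a) * f b" if "i \<le> n" "b \<le> n" for i b
        unfolding N2_def using row_op[OF cC1, of a i b f] that a by auto
      let ?W = "W * (1\<^sub>m ?m + N1) * (1\<^sub>m ?m + N2)"
      have "?W \<in> elem n" using elem_step[OF elem_step[OF W(1) N1(1,3,2)] N2(1,3,2)] by simp
      moreover have "A * ?W = C1 * (1\<^sub>m ?m + N2)"
        unfolding C1_def C_def using A(1) cW N1(1) N2(1) by (simp add: assoc_mult_mat[of _ ?m ?m _ ?m _ ?m])
      moreover have "(C1 * (1\<^sub>m ?m + N2)) $$ (i, b) = 0" if "a \<le> i" "i \<le> n" "b < i" for i b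
        using C2[OF that(2), of b] C1_0[of i] that pivot by (cases "i = a") (auto simp: f_def)
      ultimately show ?thesis using a(2) by (intro bexI[of _ ?W]) simp_all
    qed
  qed
  from this[of ?m] show ?thesis by auto
qed

text \<open>The diagonal entries are changed one at a time. As a function of one entry
  \<open>t\<close> the resultant is a polynomial without roots other than 0, hence a constant times
  \<open>t ^ s\<close>; a unit \<open>t\<close> does not affect the valuation, whatever the exponent
  \<open>s\<close>.\<close>

lemma v_resultant_diag:
  assumes d: "d \<ge> 1" and F: "\<And>j. j \<le> n ==> form L n d (F j)" "resultant n d F \<noteq> 0"
    and u: "\<And>i. i \<le> n ==> u i \<in> L \<and> u i \<noteq> 0 \<and> v (u i) = 0"
  shows "v (resultant n d (change_coords n (mat (n + 1) (n + 1) (\<lambda>(i, j). if i = j then u i else 0)) F)) = v (resultant n d F)"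
proof -
  let ?m = "n + 1"
    have FU: "form UNIV n d (F j)" if "j \<le> n" for j using form_mono[OF F(1)[OF that]] by simp
  define D where "D = (\<lambda>k. mat ?m ?m (\<lambda>(i, j). if i = j then if i < k then u i else 1 else 0))"
  have inL: "resultant n d (change_coords n A F) \<in> L \<and> resultant n d (change_coords n A F) \<noteq> 0"
    if "A \<in> GLC n" "\<And>i j. i \<le> n ==> j \<le> n ==> A $$ (i, j) \<in> L" for A
  proof
    have "form L n d (change_coords n A F i)" if "i \<le> n" for i
      using form_change[OF _ _ F(1) that, of A] \<open>A \<in> GLC n\<close> \<open>\<And>i j. i \<le> n ==> j \<le> n ==> A $$ (i, j) \<in> L\<close> by (auto simp: GLC_iff)
    then show "resultant n d (change_coords n A F) \<in> L" by (intro eval_in[OF _ d]) (auto simp: form_def)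
  qed (rule change_coords_resultant[OF d that(1) F(2) FU])
  have D: "D k \<in> GLC n" "\<And>i j. i \<le> n ==> j \<le> n ==> D k $$ (i, j) \<in> L" for k
    using u by (auto simp: GLC_iff D_def det_upper[of _ ?m] zero_in one_in)
  have "k \<le> ?m ==> v (resultant n d (change_coords n (D k) F)) = v (resultant n d F)" for k
  proof (induction k)
    case 0
    have "D 0 = 1 \<cdot>\<^sub>m 1\<^sub>m ?m" by (intro eq_matI) (auto simp: D_def)
    then have "change_coords n (D 0) F i = F i" if "i \<le> n" for i
      using change_coords_scalar[of n F d 1 i] F(1) that by (auto simp: form_def)
    then show ?case using res_cong[OF d, of n "change_coords n (D 0) F" F] by simp
  next
    case (Suc k)
    define A where "A = mat ?m ?m (\<lambda>(i, j). if i = j \<and> i \<noteq> k then if i < k then u i else 1 else 0)"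
    define N :: "complex mat" where "N = mat ?m ?m (\<lambda>(i, j). if i = j \<and> i = k then 1 else 0)"
    have e: "A + t \<cdot>\<^sub>m N = mat ?m ?m (\<lambda>(i, j). if i = j then if i = k then t else if i < k then u i else 1 else 0)" for t
      by (intro eq_matI) (auto simp: A_def N_def)
    have DA: "D k = A + 1 \<cdot>\<^sub>m N" "D (Suc k) = A + u k \<cdot>\<^sub>m N" unfolding e by (intro eq_matI; auto simp: D_def)+
    obtain p where p: "\<And>t. resultant n d (change_coords n (A + t \<cdot>\<^sub>m N) F) = poly p t"
      using resultant_along_line[OF d, of A n N F] FU by (auto simp: A_def N_def)
    have "poly p t \<noteq> 0" if "t \<noteq> 0" for t
    proof -
      have "A + t \<cdot>\<^sub>m N \<in> GLC n" unfolding e using u that by (auto simp: GLC_iff det_upper[of _ ?m])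
      then show ?thesis unfolding p[symmetric] by (rule change_coords_resultant[OF d _ F(2) FU])
    qed
    then obtain s where "\<And>t. poly p t = t ^ s * poly p 1" using poly_nonzero_off_0 by blast
    then have ps: "resultant n d (change_coords n (D (Suc k)) F) = u k ^ s * resultant n d (change_coords n (D k) F)"
      unfolding DA p .
    have "v (u k ^ s * resultant n d (change_coords n (D k) F)) = v (u k ^ s) + v (resultant n d (change_coords n (D k) F))"
      using inL[OF D] u[of k] Suc.prems by (intro v_mult) (auto intro: power_in)
    then show ?case unfolding ps using Suc u[of k] v_power[of "u k" s] by simp
  qed
  moreover have "D ?m = mat ?m ?m (\<lambda>(i, j). if i = j then u i else 0)" by (intro eq_matI) (auto simp: D_def)
  ultimately show ?thesis by fastforce
qed

text \<open>Unipotent factors turn \<open>V\<close> into an upper triangular \<open>T\<close>. The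
  diagonal entries of \<open>T\<close> are integral with a unit as product, hence units. On the line
  from the diagonal part to \<open>T\<close> the determinant is constant, which leaves the diagonal
  case.\<close>

lemma v_resultant_GLO:
  assumes d: "d \<ge> 1" and F: "\<And>j. j \<le> n ==> form L n d (F j)" "resultant n d F \<noteq> 0" and V: "V \<in> GLO n"
  shows "v (resultant n d (change_coords n V F)) = v (resultant n d F)"
proof -
  let ?m = "n + 1"
  have FU: "form UNIV n d (F j)" if "j \<le> n" for j using form_mono[OF F(1)[OF that]] by simp
  have "\<exists>W\<in>elem n. \<forall>i j. i \<le> n --> j < i --> (V * W) $$ (i, j) = 0"
    by (rule triangularize) (use V B_sub in \<open>auto simp: GLO_def\<close>)
  then obtain W where W: "W \<in> elem n" "\<And>i j. i \<le> n ==> j < i ==> (V * W) $$ (i, j) = 0" by blast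
  define T where "T = V * W"
  have T: "T \<in> GLO n" unfolding T_def by (rule GLO_mult[OF V elem_GLO[OF W(1)]])
  then have cT: "T \<in> carrier_mat ?m ?m" "det T \<noteq> 0" "v (det T) = 0" and TB: "\<And>i. i \<le> n ==> T $$ (i, i) \<in> B 0" by (auto simp: GLO_def)
  have dT: "det T = (\<Prod>i<?m. T $$ (i, i))" using W(2) by (intro det_upper cT) (auto simp: T_def)
  have "\<not> (\<exists>i\<in>{..<?m}. T $$ (i, i) = 0)" using cT(2) unfolding dT by (simp only: prod_zero_iff finite_lessThan not_False_eq_True)
  then have nz: "T $$ (i, i) \<noteq> 0" if "i \<le> n" for i using that by auto
  have "v (\<Prod>i<?m. T $$ (i, i)) = (\<Sum>i<?m. v (T $$ (i, i)))" by (rule v_prod) (use nz B_sub[OF TB] in auto)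
  then have "(\<Sum>i<?m. v (T $$ (i, i))) = 0" using cT(3) unfolding dT by simp
  moreover have ge: "0 \<le> v (T $$ (i, i))" if "i \<in> {..<?m}" for i using nz TB that by (intro vB) auto
  ultimately have v0: "v (T $$ (i, i)) = 0" if "i < ?m" for i using sum_nonneg_eq_0_iff[of "{..<?m}" "\<lambda>i. v (T $$ (i, i))"] that by blast
  define D where "D = mat ?m ?m (\<lambda>(i, j). if i = j then T $$ (i, i) else 0)"
  have c: "D \<in> carrier_mat ?m ?m" "T - D \<in> carrier_mat ?m ?m" by (auto simp: D_def)
  have "det (D + t \<cdot>\<^sub>m (T - D)) = (\<Prod>i<?m. T $$ (i, i))" for t
    using W(2) cT by (subst det_upper[of _ ?m]) (auto simp: D_def T_def[symmetric])
  then have "det (D + t \<cdot>\<^sub>m (T - D)) \<noteq> 0" for t using cT(2) dT by simp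
  then have "resultant n d (change_coords n (D + (T - D)) F) = resultant n d (change_coords n D F)"
    by (intro resultant_line_const[OF d c] FU F(2))
  moreover have "D + (T - D) = T" using cT(1) by (intro eq_matI) (auto simp: D_def)
  moreover have "v (resultant n d (change_coords n D F)) = v (resultant n d F)"
    unfolding D_def using nz v0 B_sub[OF TB] by (intro v_resultant_diag[OF d F]) auto
  ultimately show ?thesis using resultant_elem[OF d FU F(2) GLO_GLC[OF V] W(1)] by (simp add: T_def)
qed

lemma prod_cong_B:
  assumes "\<And>i. i \<in> A ==> f i \<in> B 0" "\<And>i. i \<in> A ==> g i \<in> B 0" "\<And>i. i \<in> A ==> f i - g i \<in> B 1"
  shows "(\<Prod>i\<in>A. f i) - (\<Prod>i\<in>A. g i) \<in> B 1"
  using assms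
proof (induction A rule: infinite_finite_induct)
  case (insert a A)
  have "f a * (prod f A - prod g A) + prod g A * (f a - g a) \<in> B 1" using insert by (intro B_add B_mult0 B_prod) auto
  then show ?case using insert.hyps by (simp add: algebra_simps)
qed (simp_all add: B_0)

lemma GLO_if_near_1:
  assumes V: "V \<in> carrier_mat (n + 1) (n + 1)" and near: "\<And>i j. i \<le> n ==> j \<le> n ==> V $$ (i, j) - (if i = j then 1 else 0) \<in> B 1"
  shows "V \<in> GLO n"
proof -
  have VB: "V $$ (i, j) \<in> B 0" if "i \<le> n" "j \<le> n" for i j
  proof -
    have "(V $$ (i, j) - (if i = j then 1 else 0)) + (if i = j then 1 else 0) \<in> B 0"
      by (rule B_add) (use B_mono[OF near[OF that]] B_0 B_1 in auto)
    then show ?thesis by simp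
  qed
  have "det V - det (1\<^sub>m (n + 1)) \<in> B 1"
    unfolding det_def'[OF V] det_def'[OF one_carrier_mat] sum_subtractf[symmetric] right_diff_distrib[symmetric]
  proof (intro B_sum B_mult0)
    fix p assume "p \<in> {p. p permutes {0..<n + 1}}"
    then have pp: "p permutes {0..<n + 1}" by simp
    have p: "p i \<le> n" if "i \<le> n" for i using that permutes_in_image[OF pp, of i] by simp
    show "signof p \<in> B 0" by (rule B_of_int)
    show "(\<Prod>i = 0..<n + 1. V $$ (i, p i)) - (\<Prod>i = 0..<n + 1. 1\<^sub>m (n + 1) $$ (i, p i)) \<in> B 1"
      by (rule prod_cong_B) (use p VB near B_0 B_1 in \<open>auto simp: less_Suc_eq_le\<close>)
  qed
  then have "det V - 1 \<in> B (v 1 + 1)" by (simp add: v_1)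
  from v_add_eq[OF one_in one_neq_zero this] show ?thesis using V VB by (simp add: GLO_def v_1)
qed

text \<open>\<open>C = A * (1 + I * (C - A))\<close> for the inverse \<open>I\<close> of
  \<open>A\<close>, and \<open>m0\<close> bounds the denominators of \<open>I\<close>. So matrices
  near \<open>A\<close> differ from it by a right factor near 1, which for \<open>M \<ge> 1\<close>
  is invertible over the valuation ring.\<close>

lemma ex_right_factor:
  assumes A: "A \<in> GL n L"
  shows "\<exists>m0. \<forall>M C. C \<in> carrier_mat (n + 1) (n + 1) --> (\<forall>i\<le>n. \<forall>j\<le>n. C $$ (i, j) - A $$ (i, j) \<in> B (m0 + M)) -->
    (\<exists>V\<in>carrier_mat (n + 1) (n + 1). C = A * V \<and> (\<forall>i\<le>n. \<forall>j\<le>n. V $$ (i, j) - (if i = j then 1 else 0) \<in> B M))"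
proof -
  let ?m = "n + 1"
  have cA: "A \<in> carrier_mat ?m ?m" "det A \<noteq> 0" and AL: "\<And>i j. i \<le> n ==> j \<le> n ==> A $$ (i, j) \<in> L"
    using A elements_matI[of A "n + 1" "n + 1"] by (auto simp: GL_def)
  note a = adj_mat[OF cA(1)]
    define I where "I = inverse (det A) \<cdot>\<^sub>m adj_mat A"
  have cI: "I \<in> carrier_mat ?m ?m" using a by (simp add: I_def)
  have AI: "A * I = 1\<^sub>m ?m" unfolding I_def mult_smult_distrib[OF cA(1) a(1)] a(2) using cA(2) by (simp add: smult_smult_mat) (intro eq_matI; auto)
  have IL: "I $$ (i, j) \<in> L" if "i \<le> n" "j \<le> n" for i j
  proof -
    have "det A \<in> L" using det_in[OF cA(1)] AL by auto
    moreover have "adj_mat A $$ (i, j) \<in> L" using adj_mat_in[of A n i j] cA(1) AL that by auto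
    ultimately show ?thesis using a(1) that by (auto simp: I_def intro: mult_in inverse_in)
  qed
  define m0 where "m0 = (\<Sum>i\<le>n. \<Sum>j\<le>n. \<bar>v (I $$ (i, j))\<bar>)"
  have IB: "I $$ (i, j) \<in> B (- m0)" if ij: "i \<le> n" "j \<le> n" for i j
  proof -
    have "\<bar>v (I $$ (i, j))\<bar> \<le> (\<Sum>j\<le>n. \<bar>v (I $$ (i, j))\<bar>)" using ij by (intro member_le_sum) auto
    also have "\<dots> \<le> m0" unfolding m0_def using ij by (intro member_le_sum) (auto intro: sum_nonneg)
    finally show ?thesis using IL[OF ij] by (auto simp: B_def)
  qed
  have "\<exists>V\<in>carrier_mat ?m ?m. C = A * V \<and> (\<forall>i\<le>n. \<forall>j\<le>n. V $$ (i, j) - (if i = j then 1 else 0) \<in> B M)"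
    if C: "C \<in> carrier_mat ?m ?m" "\<forall>i\<le>n. \<forall>j\<le>n. C $$ (i, j) - A $$ (i, j) \<in> B (m0 + M)" for M C
  proof (intro bexI[of _ "1\<^sub>m ?m + I * (C - A)"] conjI allI impI)
    have cD: "C - A \<in> carrier_mat ?m ?m" using cA by auto
    have "A * (1\<^sub>m ?m + I * (C - A)) = A + (A * I) * (C - A)"
      using mult_add_distrib_mat[OF cA(1) one_carrier_mat mult_carrier_mat[OF cI cD]] right_mult_one_mat[OF cA(1)] assoc_mult_mat[OF cA(1) cI cD] by simp
    also have "\<dots> = C" unfolding AI left_mult_one_mat[OF cD] using C cA by (intro eq_matI) auto
    finally show "C = A * (1\<^sub>m ?m + I * (C - A))" by simp
    fix i j assume ij: "i \<le> n" "j \<le> n"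
    have "(I * (C - A)) $$ (i, j) \<in> B (- m0 + (m0 + M))"
      by (rule mat_mult_B[OF cI cD IB _ ij]) (use C cA in auto)
    then show "(1\<^sub>m ?m + I * (C - A)) $$ (i, j) - (if i = j then 1 else 0) \<in> B M" using ij cI cD by auto
  qed (use cI cA in auto)
  then show ?thesis by blast
qed

end

section \<open>Minimal presentations\<close>

lemma resultant_order_cong:
  assumes "d \<ge> 1" "\<And>i. i \<le> n ==> F i = G i" shows "resultant_order L p n d F = resultant_order L p n d G"
proof -
  have "normalized_at L p n (\<lambda>i. mconst c * F i) = normalized_at L p n (\<lambda>i. mconst c * G i)" for c
    using assms(2) by (simp add: normalized_at_def cong: conj_cong)
  moreover have "resultant n d (\<lambda>i. mconst c * F i) = resultant n d (\<lambda>i. mconst c * G i)" for c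
    by (rule res_cong[OF assms(1)]) (simp add: assms(2))
  ultimately show ?thesis by (simp add: resultant_order_def)
qed

lemma change_coords_scale: "change_coords n V (\<lambda>i. mconst c * F i) i = mconst c * change_coords n V F i"
proof -
  interpret s: comm_ring_hom "subst_form n V" unfolding subst_form_def by (rule comm_ring_hom_msubst[OF comm_ring_hom_mconst])
  have "subst_form n V (mconst a) = mconst a" for a by (simp add: subst_form_def msubst_mconst)
  then show ?thesis by (simp add: change_coords_eq chcoords_def s.hom_mult sum_distrib_left mult_ac)
qed

context closed_point_loc
begin

text \<open>The scalars that make \<open>G\<close> integral, primitive or not. The order is the
  least valuation of the resultant over all of them, so an upper bound requires only one such scalar
  and no normalisation.\<close>

definition integral_coeffs :: "nat => (nat => (nat, complex) mpoly) => complex => bool" where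
  "integral_coeffs n G c \<longleftrightarrow> c \<in> L - {0} \<and> (\<forall>i\<le>n. \<forall>m. c * lookup (G i) m \<in> B 0)"

context
  fixes n d :: nat and G :: "nat => (nat, complex) mpoly"
  assumes d: "d \<ge> 1" and G: "\<And>i. i \<le> n ==> form L n d (G i)" and res: "resultant n d G \<noteq> 0"
begin

lemma res_L: "resultant n d G \<in> L"
  using eval_in[OF _ d] G by (auto simp: form_def)

lemma v_res_scale: "c \<in> L - {0} ==> vp (resultant n d (\<lambda>i. mconst c * G i)) = int ((n + 1) * d ^ n) * vp c + vp (resultant n d G)"
  unfolding res_scale[OF d] using v_mult[OF power_in _ res_L res, of c] v_power[of c] by simp

lemma ex_normalizer: "\<exists>c. c \<in> L - {0} \<and> normalized_at L p n (\<lambda>i. mconst c * G i)"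
proof -
  define S where "S = (SIGMA i:{..n}. keys (G i))"
  have "S \<noteq> {}"
  proof
    assume "S = {}"
    then have "keys (G i) = {}" if "i \<le> n" for i using that unfolding S_def by blast
    then have "resultant n d G = resultant n d (\<lambda>i. mconst 0 * G i)" by (intro res_cong[OF d]) simp
    then show False using res d unfolding res_scale[OF d] by (simp add: power_0_left)
  qed
  moreover have "finite S" by (simp add: S_def)
  ultimately obtain s where "is_arg_min (\<lambda>(i, m). vp (lookup (G i) m)) (\<lambda>s. s \<in> S) s" using ex_is_arg_min_if_finite by blast
  then obtain i m where im: "i \<le> n" "m \<in> keys (G i)" "\<And>j l. j \<le> n ==> l \<in> keys (G j) ==> vp (lookup (G i) m) \<le> vp (lookup (G j) l)"
    unfolding is_arg_min_linorder by (cases s) (force simp: S_def)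
  define c where "c = inverse (lookup (G i) m)"
  have g: "lookup (G j) l \<in> L" if "j \<le> n" for j l using G[OF that] by (simp add: form_def)
  have nz: "lookup (G i) m \<noteq> 0" using im(2) by (simp add: in_keys_iff)
  have c: "c \<in> L" "c \<noteq> 0" using g[OF im(1)] nz by (auto simp: c_def intro: inverse_in)
  have "c * lookup (G j) l \<in> B 0" if "j \<le> n" for j l
  proof (cases "lookup (G j) l = 0")
    case False
    then have "vp (c * lookup (G j) l) \<ge> 0"
      using im(3)[OF that, of l] v_mult[OF c g[OF that] False] v_inverse[OF g[OF im(1)] nz] by (simp add: c_def in_keys_iff)
    then show ?thesis using c g[OF that] by (auto simp: B_def intro: mult_in)
  qed (simp add: B_0)
  moreover have "c * lookup (G i) m \<notin> B 1" using nz v_1 by (simp add: c_def B_def)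
  ultimately have "normalized_at L p n (\<lambda>i. mconst c * G i)"
    using im(1) unfolding normalized_at_def Op_eq mp_eq mconst_mult_lookup by blast
  then show ?thesis using c by blast
qed

lemma order_attained: "\<exists>c. integral_coeffs n G c \<and> resultant_order L p n d G = vp (resultant n d (\<lambda>i. mconst c * G i))"
  using someI_ex[OF ex_normalizer] unfolding resultant_order_def Let_def integral_coeffs_def normalized_at_def Op_eq mconst_mult_lookup by blast

lemma order_le: assumes c: "integral_coeffs n G c" shows "resultant_order L p n d G \<le> vp (resultant n d (\<lambda>i. mconst c * G i))"
proof -
  define c' where "c' = (SOME c. c \<in> L - {0} \<and> normalized_at L p n (\<lambda>i. mconst c * G i))"
  have c': "c' \<in> L - {0}" "normalized_at L p n (\<lambda>i. mconst c' * G i)" using someI_ex[OF ex_normalizer] unfolding c'_def by auto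
  then obtain i m where im: "i \<le> n" "c' * lookup (G i) m \<notin> B 1" unfolding normalized_at_def mp_eq mconst_mult_lookup by blast
  have g: "lookup (G i) m \<in> L" "lookup (G i) m \<noteq> 0" using G[OF im(1)] im(2) B_0 by (auto simp: form_def)
  have cL: "c \<in> L" "c \<noteq> 0" "c' \<in> L" "c' \<noteq> 0" and "c * lookup (G i) m \<in> B 0" using c c' im(1) by (auto simp: integral_coeffs_def)
  then have "0 \<le> vp c + vp (lookup (G i) m)" using vB[of "c * lookup (G i) m" 0] g v_mult[OF cL(1,2) g] by auto
  moreover have "vp c' + vp (lookup (G i) m) < 1" using im(2) v_mult[OF cL(3,4) g] mult_in[OF cL(3) g(1)] by (auto simp: B_def)
  ultimately have "vp c' \<le> vp c" by linarith
  then have "int ((n + 1) * d ^ n) * vp c' \<le> int ((n + 1) * d ^ n) * vp c" by (rule mult_left_mono) simp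
  then have "vp (resultant n d (\<lambda>i. mconst c' * G i)) \<le> vp (resultant n d (\<lambda>i. mconst c * G i))"
    using v_res_scale[of c] v_res_scale[of c'] cL by simp
  then show ?thesis unfolding resultant_order_def Let_def c'_def[symmetric] .
qed

lemma v_res_nonneg: assumes c: "integral_coeffs n G c" shows "0 \<le> vp (resultant n d (\<lambda>i. mconst c * G i))"
proof -
  have "resultant n d (\<lambda>i. mconst c * G i) \<in> B 0"
    by (rule B0.eval_in[OF _ d]) (use c in \<open>auto simp: integral_coeffs_def mconst_mult_lookup\<close>)
  moreover have "resultant n d (\<lambda>i. mconst c * G i) \<noteq> 0" unfolding res_scale[OF d] using c res by (simp add: integral_coeffs_def)
  ultimately show ?thesis by (rule vB)
qed

lemma order_nonneg: "0 \<le> resultant_order L p n d G"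
  using order_attained v_res_nonneg by auto

lemma order_eq_0: "integral_coeffs n G c ==> vp (resultant n d (\<lambda>i. mconst c * G i)) = 0 ==> resultant_order L p n d G = 0"
  using order_le order_nonneg by fastforce

end

lemma change_L:
  assumes d: "d \<ge> 1" and G: "\<And>i. i \<le> n ==> form L n d (G i)" "resultant n d G \<noteq> 0" and V: "V \<in> GL n L"
  shows "i \<le> n ==> form L n d (change_coords n V G i)" "resultant n d (change_coords n V G) \<noteq> 0"
proof -
  have c: "V \<in> carrier_mat (n + 1) (n + 1)" "V \<in> GLC n" and VL: "\<And>i j. i \<le> n ==> j \<le> n ==> V $$ (i, j) \<in> L"
    using V elements_matI[of V "n + 1" "n + 1"] by (auto simp: GL_def)
  show "i \<le> n ==> form L n d (change_coords n V G i)" by (rule form_change[OF c(1) VL G(1)])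
  show "resultant n d (change_coords n V G) \<noteq> 0"
    by (rule change_coords_resultant[OF d c(2) G(2)]) (use form_mono[OF G(1)] in auto)
qed

lemma GLO_GL: "V \<in> GLO n ==> V \<in> GL n L"
  by (auto simp: GLO_def GL_def dest!: elements_matD intro: B_sub[of _ 0])

lemma order_GLO_le:
  assumes d: "d \<ge> 1" and G: "\<And>i. i \<le> n ==> form L n d (G i)" "resultant n d G \<noteq> 0" and V: "V \<in> GLO n"
  shows "resultant_order L p n d (change_coords n V G) \<le> resultant_order L p n d G"
proof -
  obtain c where c: "integral_coeffs n G c" "resultant_order L p n d G = vp (resultant n d (\<lambda>i. mconst c * G i))"
    using order_attained[OF d G] by blast
  let ?H = "\<lambda>i. mconst c * G i"
  have cL: "c \<in> L" "c \<noteq> 0" using c(1) by (auto simp: integral_coeffs_def)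
  have H: "form L n d (?H i)" "form (B 0) n d (?H i)" if "i \<le> n" for i
    using form_scale[OF cL(1) G(1)[OF that]] c(1) that
    by (auto simp: form_def integral_coeffs_def mconst_mult_lookup)
  have Hr: "resultant n d ?H \<noteq> 0" unfolding res_scale[OF d] using G(2) cL by simp
  have "integral_coeffs n (change_coords n V G) c"
    unfolding integral_coeffs_def mconst_mult_lookup[symmetric] change_coords_scale[symmetric]
    using B0.form_change[OF _ _ H(2), of V] V cL by (auto simp: GLO_def form_def)
  from order_le[OF d change_L[OF d G GLO_GL[OF V]] this] v_resultant_GLO[OF d H(1) Hr V] c(2)
  show ?thesis by (simp add: change_coords_scale[abs_def])
qed

lemma order_scale:
  assumes d: "d \<ge> 1" and G: "\<And>i. i \<le> n ==> form L n d (G i)" "resultant n d G \<noteq> 0" and a: "a \<in> L" "a \<noteq> 0"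
  shows "resultant_order L p n d G \<le> resultant_order L p n d (\<lambda>i. mconst a * G i)"
proof -
  interpret mc: comm_ring_hom "mconst :: complex => (nat, complex) mpoly" by (rule comm_ring_hom_mconst)
  have G': "form L n d (mconst a * G i)" if "i \<le> n" for i by (rule form_scale[OF a(1) G(1)[OF that]])
  have r': "resultant n d (\<lambda>i. mconst a * G i) \<noteq> 0" unfolding res_scale[OF d] using G(2) a by simp
  obtain c where c: "integral_coeffs n (\<lambda>i. mconst a * G i) c"
    "resultant_order L p n d (\<lambda>i. mconst a * G i) = vp (resultant n d (\<lambda>i. mconst c * (mconst a * G i)))"
    using order_attained[OF d G' r'] by blast
  have "integral_coeffs n G (c * a)" using c(1) a by (auto simp: integral_coeffs_def mconst_mult_lookup mult.assoc intro: mult_in)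
  from order_le[OF d G this] c(2) show ?thesis by (simp add: mc.hom_mult mult.assoc)
qed

text \<open>The adjugate of \<open>V\<close> is again in \<open>GLO n\<close>, and a change of
  coordinates by \<open>V\<close> followed by one by the adjugate is a scalar one, which merely
  rescales \<open>G\<close>. So the inequality for \<open>GLO\<close> applies in both
  directions.\<close>

lemma order_GLO:
  assumes d: "d \<ge> 1" and G: "\<And>i. i \<le> n ==> form L n d (G i)" "resultant n d G \<noteq> 0" and V: "V \<in> GLO n"
  shows "resultant_order L p n d (change_coords n V G) = resultant_order L p n d G"
proof (rule antisym[OF order_GLO_le[OF assms]])
  let ?m = "n + 1" and ?W = "adj_mat V" and ?G = "change_coords n V G" and ?a = "det V ^ (n + d)"
  have cV: "V \<in> carrier_mat ?m ?m" "det V \<noteq> 0" "vp (det V) = 0" and VB: "\<And>i j. i \<le> n ==> j \<le> n ==> V $$ (i, j) \<in> B 0"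
    using V by (auto simp: GLO_def)
  note a = adj_mat[OF cV(1)]
  have dL: "det V \<in> L" using B0.det_in[OF cV(1)] VB B_sub by auto
  have WB: "?W $$ (i, j) \<in> B 0" if "i \<le> n" "j \<le> n" for i j
    using B0.adj_mat_in[of V n i j] cV(1) VB that by auto
  have "det V * det ?W = det (det V \<cdot>\<^sub>m 1\<^sub>m ?m)" by (rule det_mult[OF cV(1) a(1), unfolded a(2), symmetric])
  also have "\<dots> = det V * det V ^ n" by simp
  finally have dW': "det ?W = det V ^ n" using cV(2) by simp
  then have W: "?W \<in> GLO n" using a(1) WB cV(2,3) v_power[OF dL cV(2)] by (simp add: GLO_def)
  have keys: "keys m \<subseteq> {..n}" if "j \<le> n" "m \<in> keys (G j)" for j m using form_keys[OF G(1)] that by blast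
  have "change_coords n ?W ?G i = mconst ?a * G i" if i: "i \<le> n" for i
  proof -
    have "change_coords n ?W ?G i = change_coords n (V * ?W) G i"
      by (rule change_coords_comp[OF GLO_GLC[OF V] GLO_GLC[OF W] keys i])
    then show ?thesis unfolding a(2) using change_coords_scalar[OF _ cV(2) i, of G d] G(1) by (auto simp: form_def)
  qed
  then have "resultant_order L p n d (change_coords n ?W ?G) = resultant_order L p n d (\<lambda>i. mconst ?a * G i)"
    by (rule resultant_order_cong[OF d])
  moreover have "resultant_order L p n d G \<le> resultant_order L p n d (\<lambda>i. mconst ?a * G i)"
    using dL cV(2) by (intro order_scale[OF d G]) (auto intro: power_in)
  moreover have "resultant_order L p n d (change_coords n ?W ?G) \<le> resultant_order L p n d ?G"
    by (rule order_GLO_le[OF d change_L[OF d G GLO_GL[OF V]] W])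
  ultimately show "resultant_order L p n d G \<le> resultant_order L p n d ?G" by simp
qed

lemma order_mult_GLO:
  assumes d: "d \<ge> 1" and F: "\<And>i. i \<le> n ==> form L n d (F i)" "resultant n d F \<noteq> 0" and A: "A \<in> GL n L" and V: "V \<in> GLO n"
  shows "resultant_order L p n d (change_coords n (A * V) F) = resultant_order L p n d (change_coords n A F)"
proof -
  have A': "A \<in> GLC n" using A by (auto simp: GL_def)
  have "change_coords n (A * V) F i = change_coords n V (change_coords n A F) i" if "i \<le> n" for i
    using change_coords_comp[OF A' GLO_GLC[OF V] _ that, of F] form_keys[OF F(1)] by simp
  then have "resultant_order L p n d (change_coords n (A * V) F) = resultant_order L p n d (change_coords n V (change_coords n A F))"
    by (rule resultant_order_cong[OF d])
  then show ?thesis using order_GLO[OF d change_L[OF d F A] V] by simp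
qed

lemma ex_minimal:
  assumes d: "d \<ge> 1" and F: "\<And>i. i \<le> n ==> form L n d (F i)" "resultant n d F \<noteq> 0"
  shows "\<exists>A\<in>GL n L. minimal_at L p n d F A"
proof -
  let ?f = "\<lambda>A. nat (resultant_order L p n d (change_coords n A F))"
  have "1\<^sub>m (n + 1) \<in> GL n L" by (auto simp: GL_def zero_in one_in elim!: elements_matD)
  then obtain A where A: "A \<in> GL n L" "\<And>C. C \<in> GL n L ==> ?f A \<le> ?f C"
    using ex_has_least_nat[of "\<lambda>A. A \<in> GL n L" _ ?f] by blast
  have "0 \<le> resultant_order L p n d (change_coords n C F)" if "C \<in> GL n L" for C
    by (rule order_nonneg[OF d change_L[OF d F that]])
  then show ?thesis unfolding minimal_at_def using A by (intro bexI[of _ A] ballI) (simp_all add: nat_le_eq_zle)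
qed

end

context point_above
begin

lemma order_above:
  assumes e1: "e = 1" and d: "d \<ge> 1" and G: "\<And>i. i \<le> n ==> form K n d (G i)" "resultant n d G \<noteq> 0"
  shows "resultant_order L P n d G = resultant_order K q n d G"
proof (rule antisym)
  have v: "x \<in> K ==> x \<noteq> 0 ==> P.vp x = q.vp x" for x using ord_above e1 by simp
  have GL: "form L n d (G i)" if "i \<le> n" for i using form_mono[OF G(1)[OF that] KL] .
  have vr: "P.vp (resultant n d G) = q.vp (resultant n d G)" by (rule v[OF q.res_L[OF d G] G(2)])
  obtain c where c: "q.integral_coeffs n G c" "resultant_order K q n d G = q.vp (resultant n d (\<lambda>i. mconst c * G i))"
    using q.order_attained[OF d G] by blast
  have cK: "c \<in> K" "c \<noteq> 0" using c(1) by (auto simp: q.integral_coeffs_def)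
  have "P.integral_coeffs n G c" using c(1) KL B0_above by (auto simp: q.integral_coeffs_def P.integral_coeffs_def)
  from P.order_le[OF d GL G(2) this] show "resultant_order L P n d G \<le> resultant_order K q n d G"
    unfolding c(2) using P.v_res_scale[OF d GL G(2), of c] q.v_res_scale[OF d G, of c] vr v[OF cK] cK KL by auto
  obtain b where b: "P.integral_coeffs n G b" "resultant_order L P n d G = P.vp (resultant n d (\<lambda>i. mconst b * G i))"
    using P.order_attained[OF d GL G(2)] by blast
  have bL: "b \<in> L" "b \<noteq> 0" using b(1) by (auto simp: P.integral_coeffs_def)
  \<comment> \<open>The scalar \<open>b\<close> is in \<open>L\<close>, but only its valuation
    matters. Since \<open>e = 1\<close>, a power of the uniformizer of \<open>K\<close> has the same
    valuation.\<close>
  define y where "y = q.\<pi> powi P.vp b"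
  have y: "y \<in> K" "y \<noteq> 0" "q.vp y = P.vp b"
    using \<pi>_in(1) q.\<pi>(2) by (simp_all add: y_def K.power_int_in q.v_power_int q.vp_\<pi>)
  have "q.integral_coeffs n G y"
    unfolding q.integral_coeffs_def
  proof (intro conjI allI impI)
    fix i m assume i: "i \<le> n"
    have g: "lookup (G i) m \<in> K" using G(1)[OF i] by (simp add: form_def)
    show "y * lookup (G i) m \<in> q.B 0"
    proof (cases "lookup (G i) m = 0")
      case False
      have "b * lookup (G i) m \<in> P.B 0" using b(1) i by (simp add: P.integral_coeffs_def)
      then have "0 \<le> P.vp (b * lookup (G i) m)" using bL False by (intro P.vB) auto
      then have "0 \<le> q.vp (y * lookup (G i) m)"
        using P.v_mult[OF bL _ False] q.v_mult[OF y(1,2) g False] v[OF g False] g KL y(3) by auto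
      then show ?thesis using y g by (auto simp: q.B_def intro: K.mult_in)
    qed (simp add: q.B_0)
  qed (use y in auto)
  from q.order_le[OF d G this] show "resultant_order K q n d G \<le> resultant_order L P n d G"
    unfolding b(2) using P.v_res_scale[OF d GL G(2), of b] q.v_res_scale[OF d G, of y] vr y bL by auto
qed

text \<open>A competitor \<open>C\<close> over \<open>L\<close> is approximated entrywise by
  \<open>D\<close> over \<open>K\<close>. Near enough, \<open>D = C * V\<close> with
  \<open>V\<close> in \<open>GL\<close> over the local ring of \<open>P\<close>, so both have the
  same order; and over \<open>K\<close> the order for \<open>D\<close> is at least that for
  \<open>A\<close>.\<close>

lemma minimal_above:
  assumes e1: "e = 1" and dense: "L \<subseteq> P.approx K" and d: "d \<ge> 1" and F: "\<And>i. i \<le> n ==> form K n d (F i)" "resultant n d F \<noteq> 0"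
    and A: "A \<in> GL n K" "minimal_at K q n d F A"
  shows "minimal_at L P n d F A"
  unfolding minimal_at_def
proof
  let ?m = "n + 1"
  fix C assume C: "C \<in> GL n L"
  have FL: "form L n d (F i)" if "i \<le> n" for i using form_mono[OF F(1)[OF that] KL] .
  obtain m0 where m0: "\<And>M D. D \<in> carrier_mat ?m ?m ==> (\<forall>i\<le>n. \<forall>j\<le>n. D $$ (i, j) - C $$ (i, j) \<in> P.B (m0 + M)) ==>
    (\<exists>V\<in>carrier_mat ?m ?m. D = C * V \<and> (\<forall>i\<le>n. \<forall>j\<le>n. V $$ (i, j) - (if i = j then 1 else 0) \<in> P.B M))"
    using P.ex_right_factor[OF C] by blast
  have CL: "C $$ (i, j) \<in> L" if "i \<le> n" "j \<le> n" for i j using C that elements_matI[of C ?m ?m i j] by (auto simp: GL_def)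
  have "\<forall>i j. \<exists>y. i \<le> n --> j \<le> n --> y \<in> K \<and> C $$ (i, j) - y \<in> P.B (m0 + 1)"
    using dense CL unfolding P.approx_def by blast
  then obtain y where y: "\<And>i j. i \<le> n ==> j \<le> n ==> y i j \<in> K \<and> C $$ (i, j) - y i j \<in> P.B (m0 + 1)" by metis
  define D where "D = mat ?m ?m (\<lambda>(i, j). y i j)"
  have "\<forall>i\<le>n. \<forall>j\<le>n. D $$ (i, j) - C $$ (i, j) \<in> P.B (m0 + 1)"
    using P.B_uminus[OF conjunct2[OF y]] by (simp add: D_def)
  then obtain V where V: "V \<in> carrier_mat ?m ?m" "D = C * V" "\<forall>i\<le>n. \<forall>j\<le>n. V $$ (i, j) - (if i = j then 1 else 0) \<in> P.B 1"
    using m0[of D 1] by (auto simp: D_def)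
  have VO: "V \<in> P.GLO n" using V(1,3) by (intro P.GLO_if_near_1) auto
  have "det D \<noteq> 0" using C VO V(2) det_mult[of C ?m V] by (auto simp: GL_def P.GLO_def)
  then have DK: "D \<in> GL n K" using y by (auto simp: GL_def D_def elim!: elements_matD)
  have "resultant_order L P n d (change_coords n A F) = resultant_order K q n d (change_coords n A F)"
    by (rule order_above[OF e1 d q.change_L[OF d F A(1)]])
  also have "\<dots> \<le> resultant_order K q n d (change_coords n D F)" using A(2) DK by (simp add: minimal_at_def)
  also have "\<dots> = resultant_order L P n d (change_coords n D F)" by (rule order_above[symmetric, OF e1 d q.change_L[OF d F DK]])
  also have "\<dots> = resultant_order L P n d (change_coords n C F)" unfolding V(2) by (rule P.order_mult_GLO[OF d FL F(2) C VO])
  finally show "resultant_order L P n d (change_coords n A F) \<le> resultant_order L P n d (change_coords n C F)" .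
qed

end

section \<open>Algebraic numbers and complex zeros\<close>

lemma (in number_field_loc) common_integral_multiple:
  "finite A ==> A \<subseteq> L ==> \<exists>D::nat. D \<ge> 1 \<and> (\<forall>a\<in>A. of_nat D * a \<in> OL)"
proof (induction A rule: finite_induct)
  case (insert a A)
  then obtain D E :: nat where D: "D \<ge> 1" "\<forall>a\<in>A. of_nat D * a \<in> OL" "E \<ge> 1" "of_nat E * a \<in> OL"
    using ex_integral_multiple[of a] by blast
  have "of_nat (D * E) * b = of_nat E * (of_nat D * b)" "of_nat (D * E) * b = of_nat D * (of_nat E * b)" for b :: complex by simp_all
  then have "\<forall>b\<in>insert a A. of_nat (D * E) * b \<in> OL" using D by (metis O_mult O_of_nat insert_iff)
  then show ?case using D by (intro exI[of _ "D * E"]) simp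
qed auto

text \<open>Stated through integral multiples, so that field operations and roots reduce to number
  fields and algebraic integers.\<close>

definition alg_numbers :: "complex set" where "alg_numbers = {z. \<exists>D::nat. D \<ge> 1 \<and> algebraic_int (of_nat D * z)}"

lemma algebraic_alg_numbers: assumes "z \<in> alg_numbers" shows "algebraic z"
proof -
  obtain D :: nat where D: "D \<ge> 1" "algebraic_int (of_nat D * z)" using assms by (auto simp: alg_numbers_def)
  then obtain p where p: "lead_coeff p = 1" "\<forall>i. coeff p i \<in> \<int>" "poly p (of_nat D * z) = 0" by (auto elim: algebraic_int.cases)
  let ?q = "pcompose p [:0, of_nat D:]"
  have c: "coeff ?q i = of_nat D ^ i * coeff p i" for i by (rule coeff_pcompose_linear)
  show ?thesis
  proof (rule algebraicI[of ?q])
    show "coeff ?q i \<in> \<int>" for i unfolding c using p(2) by (intro Ints_mult Ints_power) auto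
    have "coeff ?q (degree p) \<noteq> 0" unfolding c using p(1) D(1) by simp
    then show "?q \<noteq> 0" by auto
    show "poly ?q z = 0" using p(3) by (simp add: poly_pcompose mult.commute)
  qed
qed

lemma number_field_alg_numbers: assumes "number_field L" shows "L \<subseteq> alg_numbers"
proof -
  interpret number_field_loc L by unfold_locales (rule assms)
  show ?thesis using ex_integral_multiple by (auto simp: alg_numbers_def integers_of_def)
qed

lemma alg_numbers_number_field:
  assumes A: "finite A" "A \<subseteq> alg_numbers" shows "\<exists>L. number_field L \<and> A \<subseteq> L"
proof -
  interpret CC: field CC by (rule CC_field)
  have Q: "subfield \<rat> CC" using complex_subfield_Rats by (simp add: subfield_CC_iff)
  then have nQ: "number_field \<rat>" unfolding number_field_def using CC.finite_dimensionI[OF CC.dimension_one[OF Q]] by blast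
  have "\<forall>a. \<exists>D::nat. a \<in> A --> D \<ge> 1 \<and> algebraic_int (of_nat D * a)" using A(2) by (auto simp: alg_numbers_def)
  then obtain D :: "complex => nat" where D: "\<And>a. a \<in> A ==> D a \<ge> 1 \<and> algebraic_int (of_nat (D a) * a)" by metis
  have "\<exists>L. finite_extension \<rat> L \<and> number_field L \<and> \<rat> \<subseteq> L \<and> (\<lambda>a. of_nat (D a) * a) ` A \<subseteq> L
      \<and> (\<forall>M. complex_subring M --> \<rat> \<subseteq> M --> (\<lambda>a. of_nat (D a) * a) ` A \<subseteq> M --> L \<subseteq> M)"
    by (rule ex_adjoin[OF nQ]) (use A D in auto)
  then obtain L where L: "number_field L" "(\<lambda>a. of_nat (D a) * a) ` A \<subseteq> L" by blast
  interpret number_field_loc L by unfold_locales (rule L)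
  have "a \<in> L" if "a \<in> A" for a
    using divide_in[of "of_nat (D a) * a" "of_nat (D a)"] L(2) D[OF that] that of_nat_in by auto
  then show ?thesis using L(1) by blast
qed

lemma alg_numbers_root:
  assumes p: "\<And>i. coeff p i \<in> alg_numbers" "p \<noteq> 0" "poly p x = 0" shows "x \<in> alg_numbers"
proof -
  obtain L where L: "number_field L" "coeff p ` {..degree p} \<subseteq> L"
    using alg_numbers_number_field[of "coeff p ` {..degree p}"] p(1) by auto
  interpret number_field_loc L by unfold_locales (rule L)
  let ?n = "degree p" and ?b = "\<lambda>i. coeff p i / lead_coeff p"
  have "?b ` {..?n} \<subseteq> L" using L(2) by (auto intro: divide_in)
  then obtain D :: nat where D: "D \<ge> 1" "\<forall>a\<in>?b ` {..?n}. of_nat D * a \<in> OL" using common_integral_multiple by blast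
  \<comment> \<open>The roots of \<open>f\<close> are those of \<open>p\<close> multiplied by
    \<open>D\<close>. The powers of \<open>D\<close> clear the denominators that arise when
    \<open>p\<close> is made monic.\<close>
  define f where "f = (\<Sum>i\<le>?n. monom (of_nat D ^ (?n - i) * ?b i) i)"
  have cf: "coeff f i = (if i \<le> ?n then of_nat D ^ (?n - i) * ?b i else 0)" for i by (simp add: f_def coeff_sum)
  have deg: "degree f = ?n" by (rule antisym[OF degree_le le_degree]) (use p(2) in \<open>auto simp: cf\<close>)
  have "algebraic_int (of_nat D * x)"
  proof (rule algebraic_int_monic)
    show "lead_coeff f = 1" using p(2) by (simp add: deg cf)
    show "algebraic_int (coeff f i)" for i
    proof (cases "i < ?n")
      case True
      then have "coeff f i = of_nat D ^ (?n - i - 1) * (of_nat D * ?b i)"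
        using power_minus_mult[of "?n - i" "of_nat D :: complex"] by (simp add: cf mult.assoc[symmetric] del: times_divide_eq_right)
      also have "of_nat D * ?b i \<in> OL" using D(2) True by auto
      then have "of_nat D ^ (?n - i - 1) * (of_nat D * ?b i) \<in> OL" by (intro O_mult[OF O_power[OF O_of_nat]])
      finally show ?thesis by (simp add: integers_of_def)
    qed (use p(2) in \<open>auto simp: cf\<close>)
    have "poly f (of_nat D * x) = (\<Sum>i\<le>?n. of_nat D ^ ?n / lead_coeff p * (coeff p i * x ^ i))"
      unfolding f_def poly_sum poly_monom power_mult_distrib
    proof (rule sum.cong)
      fix i assume "i \<in> {..?n}"
      then have "(of_nat D :: complex) ^ ?n = of_nat D ^ (?n - i) * of_nat D ^ i" by (simp flip: power_add)
      then show "of_nat D ^ (?n - i) * ?b i * (of_nat D ^ i * x ^ i) = of_nat D ^ ?n / lead_coeff p * (coeff p i * x ^ i)" by simp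
    qed simp
    also have "\<dots> = of_nat D ^ ?n / lead_coeff p * poly p x" by (simp only: poly_altdef sum_distrib_left)
    finally show "poly f (of_nat D * x) = 0" using p(3) by simp
  qed
  then show ?thesis using D(1) by (auto simp: alg_numbers_def)
qed

text \<open>The assumption concerns zeros with algebraic coordinates, the resultant detects complex
  ones. The identity on the algebraic numbers extends to a place of the complex numbers with
  algebraic values; it fixes the coefficients and carries a complex zero to an algebraic
  one.\<close>

lemma no_complex_zero:
  assumes form: "\<And>i. i \<le> n ==> form K n d (F i)" and K: "K \<subseteq> alg_numbers" and nz: "\<not> has_common_zero {z. algebraic z} n F"
  shows "\<not> has_common_zero UNIV n F"
proof
  assume "has_common_zero UNIV n F"
  then obtain x where x: "\<exists>k\<le>n. x k \<noteq> 0" "\<And>i. i \<le> n ==> meval x (F i) = 0" by (auto simp: has_common_zero_def)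
  let ?k = alg_numbers
  have fld: "x - y \<in> ?k" "x * y \<in> ?k" "inverse x \<in> ?k" if xy: "x \<in> ?k" "y \<in> ?k" for x y
  proof -
    obtain L where L: "number_field L" "{x, y} \<subseteq> L" using alg_numbers_number_field[of "{x, y}"] xy by auto
    interpret number_field_loc L by unfold_locales (rule L)
    show "x - y \<in> ?k" "x * y \<in> ?k" "inverse x \<in> ?k"
      using number_field_alg_numbers[OF L(1)] L(2) diff_in mult_in inverse_in by auto
  qed
  have one: "1 \<in> ?k" by (auto simp: alg_numbers_def intro: exI[of _ 1])
  have pg: "place_graph ?k ((\<lambda>x. (x, x)) ` ?k)" unfolding place_graph_def using one fld by auto
  obtain G where G: "(\<lambda>x. (x, x)) ` ?k \<subseteq> G" "place_graph ?k G" "\<And>z. z \<noteq> 0 ==> z \<in> fst ` G \<or> inverse z \<in> fst ` G"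
  proof (rule place_extension[OF pg one fld(1,2,3)])
    fix p assume p: "\<And>i. coeff p i \<in> ?k" "degree p > 0"
    obtain z where z: "poly p z = 0" using ex_root_complex[OF p(2)] by blast
    have "p \<noteq> 0" using p(2) by auto
    from alg_numbers_root[OF p(1) this z] z show "\<exists>z\<in>?k. poly p z = 0" by blast
  qed (use that in auto)
  define a where "a = (\<lambda>(i, m). lookup (F i) m)"
  have fv: "fval n d a i x = meval x (F i)" if "i \<le> n" for i x
    using meval_form[of "F i" n d] form[OF that] by (simp add: fval_def a_def form_def)
  have "(a (i, m), a (i, m)) \<in> G" if "i \<le> n" for i m
  proof -
    have "a (i, m) \<in> ?k" using form[OF that] K by (auto simp: a_def form_def)
    then show ?thesis using G(1) by blast
  qed
  moreover have "fval n d a i x = 0" if "i \<le> n" for i unfolding fv[OF that] by (rule x(2)[OF that])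
  ultimately obtain y where y: "\<exists>k\<le>n. y k \<noteq> 0" "\<forall>i\<le>n. y i \<in> ?k" "\<forall>i\<le>n. fval n d a i y = 0"
    using specialize_zero[OF G(2,3) _ x(1)] by blast
  then have "has_common_zero {z. algebraic z} n F"
    unfolding has_common_zero_def using fv algebraic_alg_numbers by (intro exI[of _ y]) auto
  then show False using nz by simp
qed

section \<open>Gluing the local matrices\<close>

theorem ex_globally_minimal:
  assumes K: "number_field K" and d: "d \<ge> 1" and F: "\<And>i. i \<le> n ==> form K n d (F i)" and res: "resultant n d F \<noteq> 0"
  shows "\<exists>L. finite_extension K L \<and> has_globally_minimal_presentation L n d F"
proof -
  let ?m = "n + 1"
  interpret K: number_field_loc K by unfold_locales (rule K)
    have "finite ((\<lambda>(i, m). lookup (F i) m) ` (SIGMA i:{..n}. keys (F i)))" by auto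
  moreover have "(\<lambda>(i, m). lookup (F i) m) ` (SIGMA i:{..n}. keys (F i)) \<subseteq> K" using F by (auto simp: form_def)
  ultimately obtain D :: nat where D: "D \<ge> 1" "\<forall>a\<in>(\<lambda>(i, m). lookup (F i) m) ` (SIGMA i:{..n}. keys (F i)). of_nat D * a \<in> integers_of K"
    using K.common_integral_multiple by blast
  have DF: "of_nat D * lookup (F i) m \<in> integers_of K" if i: "i \<le> n" for i m
  proof (cases "lookup (F i) m = 0")
    case False
    then have "m \<in> keys (F i)" by (simp add: in_keys_iff)
    then show ?thesis using D(2) i by force
  qed (simp add: K.O_0)
  define \<rho> where "\<rho> = resultant n d (\<lambda>i. mconst (of_nat D) * F i)"
  have \<rho>: "\<rho> \<in> integers_of K" "\<rho> \<noteq> 0"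
  proof -
    show "\<rho> \<in> integers_of K" unfolding \<rho>_def by (rule K.O.eval_in[OF _ d]) (simp add: mconst_mult_lookup DF)
    show "\<rho> \<noteq> 0" unfolding \<rho>_def res_scale[OF d] using res D(1) by simp
  qed
  define S where "S = {q. closed_point K q \<and> \<rho> \<in> q}"
  have S: "finite S" "\<And>q. q \<in> S ==> closed_point K q" using K.finite_closed_points[OF \<rho>] by (auto simp: S_def)
  have "\<exists>A W. A \<in> GL n K \<and> minimal_at K q n d F A \<and> W \<in> valued_field.GLO K (ord_at K q) n \<and> (\<forall>i j. i \<le> n --> j < i --> (A * W) $$ (i, j) = 0)"
    if "q \<in> S" for q
  proof -
    interpret q: closed_point_loc K q by unfold_locales (rule S(2)[OF that])
    obtain A where A: "A \<in> GL n K" "minimal_at K q n d F A" using q.ex_minimal[OF d F res] by blast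
    have "\<exists>W\<in>q.elem n. \<forall>i j. i \<le> n --> j < i --> (A * W) $$ (i, j) = 0"
      by (rule q.triangularize) (use A(1) elements_matI[of A ?m ?m] in \<open>auto simp: GL_def\<close>)
    then show ?thesis using A q.elem_GLO by blast
  qed
  then obtain A W where A: "\<And>q. q \<in> S ==> A q \<in> GL n K" "\<And>q. q \<in> S ==> minimal_at K q n d F (A q)"
    and W: "\<And>q. q \<in> S ==> W q \<in> valued_field.GLO K (ord_at K q) n"
    and AW: "\<And>q i j. q \<in> S ==> i \<le> n ==> j < i ==> (A q * W q) $$ (i, j) = 0" by metis
  define T where "T = (\<lambda>q. A q * W q)"
  have T: "T q \<in> GL n K" "\<And>i j. i \<le> n ==> j \<le> n ==> T q $$ (i, j) \<in> K" "\<And>i. i \<le> n ==> T q $$ (i, i) \<noteq> 0"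
    "det (T q) = (\<Prod>i<?m. T q $$ (i, i))" if q: "q \<in> S" for q
  proof -
    interpret q: closed_point_loc K q by unfold_locales (rule S(2)[OF q])
    have c: "A q \<in> carrier_mat ?m ?m" "W q \<in> carrier_mat ?m ?m" "T q \<in> carrier_mat ?m ?m" "det (T q) \<noteq> 0"
      using A(1)[OF q] W[OF q] by (auto simp: GL_def q.GLO_def T_def det_mult[of _ ?m])
    have "A q $$ (i, j) \<in> K" "W q $$ (i, j) \<in> K" if "i \<le> n" "j \<le> n" for i j
      using A(1)[OF q] W[OF q] that elements_matI[of "A q" ?m ?m i j] q.B_sub[of _ 0] by (auto simp: GL_def q.GLO_def)
    then show TK: "T q $$ (i, j) \<in> K" if "i \<le> n" "j \<le> n" for i j
      unfolding T_def mat_mult_index[OF c(1,2) that] using that by (intro K.sum_in K.mult_in) auto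
    show dT: "det (T q) = (\<Prod>i<?m. T q $$ (i, i))" using AW[OF q] by (intro det_upper c) (auto simp: T_def)
    have "\<not> (\<exists>i\<in>{..<?m}. T q $$ (i, i) = 0)" using c(4) unfolding dT by (simp only: prod_zero_iff finite_lessThan not_False_eq_True)
    then show "T q $$ (i, i) \<noteq> 0" if "i \<le> n" for i using that by auto
    show "T q \<in> GL n K" using c TK by (auto simp: GL_def dest!: elements_matD)
  qed
  obtain L \<alpha> where L: "finite_extension K L" "number_field L" "K \<subseteq> L" and \<alpha>: "\<forall>p\<in>S. \<alpha> p \<in> L \<and> \<alpha> p \<noteq> 0"
    and above: "\<forall>P. closed_point L P --> (P \<inter> K \<in> S --> L \<subseteq> valued_field.approx L (ord_at L P) K
        \<and> (\<forall>x\<in>K - {0}. ord_at L P x = ord_at K (P \<inter> K) x) \<and> ord_at L P (\<alpha> (P \<inter> K)) = 1) \<and> (\<forall>p\<in>S. p \<noteq> P \<inter> K --> ord_at L P (\<alpha> p) = 0)"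
    by (rule ex_splitting_extension[OF K S, elim_format]) (assumption, elim exE conjE, rule that)
  define w where "w = (\<lambda>q b. ord_at K q (T q $$ (b, b)))"
  \<comment> \<open>\<open>T q\<close> is the unipotent matrix \<open>T' q\<close> times its own
    diagonal. The unipotent factor will be approximated over \<open>K\<close>, the diagonal one
    imitated by powers of the \<open>\<alpha> p\<close>.\<close>
  define T' where "T' = (\<lambda>q. mat ?m ?m (\<lambda>(i, j). T q $$ (i, j) / T q $$ (j, j)))"
  have T'K: "T' q $$ (i, j) \<in> K" if "q \<in> S" "i \<le> n" "j \<le> n" for q i j
    using K.divide_in[OF T(2)[OF that] T(2)[OF that(1,3,3)]] that by (simp add: T'_def)
  have "\<exists>m0. \<forall>M C. C \<in> carrier_mat ?m ?m --> (\<forall>i\<le>n. \<forall>j\<le>n. C $$ (i, j) - T' q $$ (i, j) \<in> val_ball K q (m0 + M)) -->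
    (\<exists>V\<in>carrier_mat ?m ?m. C = T' q * V \<and> (\<forall>i\<le>n. \<forall>j\<le>n. V $$ (i, j) - (if i = j then 1 else 0) \<in> val_ball K q M))" if q: "q \<in> S" for q
  proof -
    interpret q: closed_point_loc K q by unfold_locales (rule S(2)[OF q])
    have "det (T' q) = (\<Prod>i<?m. T' q $$ (i, i))" using AW[OF q] by (intro det_upper) (auto simp: T'_def T_def)
    also have "\<dots> = (\<Prod>i<?m. 1)" using T(3)[OF q] by (intro prod.cong) (auto simp: T'_def)
    finally have "det (T' q) \<noteq> 0" by simp
    moreover have "T' q \<in> carrier_mat ?m ?m" by (simp add: T'_def)
    ultimately have "T' q \<in> GL n K" using T'K[OF q] by (auto simp: GL_def less_Suc_eq_le dest!: elements_matD)
    then show ?thesis by (rule q.ex_right_factor)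
  qed
  then obtain m0 where m0: "\<And>q M C. q \<in> S ==> C \<in> carrier_mat ?m ?m ==> (\<forall>i\<le>n. \<forall>j\<le>n. C $$ (i, j) - T' q $$ (i, j) \<in> val_ball K q (m0 q + M)) ==>
    (\<exists>V\<in>carrier_mat ?m ?m. C = T' q * V \<and> (\<forall>i\<le>n. \<forall>j\<le>n. V $$ (i, j) - (if i = j then 1 else 0) \<in> val_ball K q M))" by metis
  \<comment> \<open>Passing from \<open>V\<close> to \<open>V'\<close> below multiplies the entry at
    \<open>(i, j)\<close> by an element of valuation \<open>w q j - w q i\<close>.
    \<open>E q\<close> outweighs all these differences, so \<open>V'\<close> is integral if
    \<open>V\<close> is 1 up to precision \<open>E q\<close>.\<close>
  define E where "E = (\<lambda>q. \<Sum>i\<le>n. \<Sum>j\<le>n. \<bar>w q i - w q j\<bar>)"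
  have E: "w q i - w q j \<le> E q" "0 \<le> E q" if "i \<le> n" "j \<le> n" for q i j
  proof -
    have "\<bar>w q i - w q j\<bar> \<le> (\<Sum>j\<le>n. \<bar>w q i - w q j\<bar>)" using that by (intro member_le_sum) auto
    also have "\<dots> \<le> E q" unfolding E_def using that by (intro member_le_sum) (auto intro: sum_nonneg)
    finally show "w q i - w q j \<le> E q" "0 \<le> E q" by linarith+
  qed
  define N where "N = (\<Sum>q\<in>S. nat (\<bar>m0 q\<bar> + E q))"
  have N: "m0 q + E q \<le> int N" if "q \<in> S" for q
  proof -
    have "nat (\<bar>m0 q\<bar> + E q) \<le> N" unfolding N_def using S(1) that by (intro member_le_sum) auto
    then show ?thesis by linarith
  qed
  have "\<forall>i j. \<exists>u. i \<le> n --> j \<le> n --> u \<in> K \<and> (\<forall>q\<in>S. u - T' q $$ (i, j) \<in> val_ball K q (int N)) \<and> (\<forall>q. closed_point K q --> q \<notin> S --> u \<in> val_ball K q 0)"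
  proof (intro allI)
    fix i j
    show "\<exists>u. i \<le> n --> j \<le> n --> u \<in> K \<and> (\<forall>q\<in>S. u - T' q $$ (i, j) \<in> val_ball K q (int N)) \<and> (\<forall>q. closed_point K q --> q \<notin> S --> u \<in> val_ball K q 0)"
    proof (cases "i \<le> n \<and> j \<le> n")
      case True
      then have "T' q $$ (i, j) \<in> K" if "q \<in> S" for q using T'K[OF that] by simp
      then show ?thesis using K.chinese_remainder_away[OF S, of "\<lambda>q. T' q $$ (i, j)" N] by blast
    qed blast
  qed
  then obtain u where u: "\<And>i j. i \<le> n ==> j \<le> n ==> u i j \<in> K"
    "\<And>i j q. i \<le> n ==> j \<le> n ==> q \<in> S ==> u i j - T' q $$ (i, j) \<in> val_ball K q (int N)"
    "\<And>i j q. i \<le> n ==> j \<le> n ==> closed_point K q ==> q \<notin> S ==> u i j \<in> val_ball K q 0" by metis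
  \<comment> \<open>Above the diagonal \<open>U\<close> approximates \<open>T' q\<close> for all
    \<open>q\<close> in \<open>S\<close> simultaneously; the remaining entries agree with those of
    \<open>T' q\<close>. Outside \<open>S\<close> all entries are integral, so \<open>U\<close> is
    invertible over the local rings there.\<close>
  define U where "U = mat ?m ?m (\<lambda>(i, j). if i = j then 1 else if i < j then u i j else 0)"
  \<comment> \<open>Since \<open>\<alpha> p\<close> has valuation 1 above \<open>p\<close> and 0
    elsewhere, \<open>\<delta> b\<close> has the valuation of the diagonal entry \<open>b\<close> of
    \<open>T q\<close> at the points above \<open>q\<close>, for every \<open>q\<close> in
    \<open>S\<close>, and is a unit at all other points.\<close>
  define \<delta> where "\<delta> = (\<lambda>b. \<Prod>p\<in>S. \<alpha> p powi w p b)"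
  define \<Gamma> where "\<Gamma> = mat ?m ?m (\<lambda>(i, j). U $$ (i, j) * \<delta> j)"
  interpret L: number_field_loc L by unfold_locales (rule L)
  have \<delta>: "\<delta> b \<in> L" "\<delta> b \<noteq> 0" for b using \<alpha> S(1) by (auto simp: \<delta>_def intro!: L.prod_in L.power_int_in)
  have c\<Gamma>: "\<Gamma> \<in> carrier_mat ?m ?m" by (simp add: \<Gamma>_def)
  have "det \<Gamma> = (\<Prod>i<?m. \<Gamma> $$ (i, i))" by (rule det_upper[OF c\<Gamma>]) (auto simp: \<Gamma>_def U_def)
  also have "\<dots> = (\<Prod>i<?m. \<delta> i)" by (intro prod.cong) (auto simp: \<Gamma>_def U_def)
  finally have d\<Gamma>: "det \<Gamma> = (\<Prod>i<?m. \<delta> i)" .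
  have UK: "U $$ (i, j) \<in> K" if "i \<le> n" "j \<le> n" for i j using u(1) that K.zero_in K.one_in by (auto simp: U_def)
  have "det \<Gamma> \<noteq> 0" unfolding d\<Gamma> using \<delta> by simp
  moreover have "\<Gamma> $$ (i, j) \<in> L" if "i \<le> n" "j \<le> n" for i j
    using L.mult_in[OF subsetD[OF L(3) UK[OF that]] \<delta>(1), of j] that by (simp add: \<Gamma>_def)
  ultimately have \<Gamma>GL: "\<Gamma> \<in> GL n L" using c\<Gamma> by (auto simp: GL_def less_Suc_eq_le dest!: elements_matD)
  have FL: "form L n d (F i)" if "i \<le> n" for i using form_mono[OF F[OF that] L(3)] .
  have "minimal_at L P n d F \<Gamma>" if P: "closed_point L P" for P
  proof -
    interpret point_above L P K
      by (intro point_above.intro closed_point_loc.intro number_field_loc.intro closed_point_loc_axioms.intro point_above_axioms.intro L K P)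
    have v\<delta>: "P.vp (\<delta> b) = (if q \<in> S then w q b else 0)" for b
    proof -
      have "P.vp (\<delta> b) = (\<Sum>p\<in>S. P.vp (\<alpha> p powi w p b))"
        unfolding \<delta>_def using \<alpha> by (intro P.v_prod) (auto intro: L.power_int_in)
      also have "\<dots> = (\<Sum>p\<in>S. if p = q then w p b else 0)"
        using \<alpha> above P by (intro sum.cong) (auto simp: P.v_power_int)
      finally show ?thesis using S(1) by simp
    qed
    have vd\<Gamma>: "P.vp (det \<Gamma>) = (\<Sum>i<?m. P.vp (\<delta> i))" unfolding d\<Gamma> using \<delta> by (intro P.v_prod) auto
    show ?thesis
    proof (cases "q \<in> S")
      case q: True
      have ord: "P.vp x = q.vp x" if "x \<in> K" "x \<noteq> 0" for x using above P q that by auto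
      have e1: "e = 1" using ord[OF \<pi>_in(1) q.\<pi>(2)] q.vp_\<pi> by (simp add: e_def)
      have B: "x \<in> P.B k" if "x \<in> q.B k" for x k using B_above[OF that] e1 by simp
      have min: "minimal_at L P n d F (A q)"
        by (rule minimal_above[OF e1 _ d F res A[OF q]]) (use above P q in auto)
      have TL: "T q $$ (i, i) \<in> L" "T q $$ (i, i) \<noteq> 0" "P.vp (T q $$ (i, i)) = w q i" if "i \<le> n" for i
        using T(2,3)[OF q] that ord KL by (auto simp: w_def)
      have "\<forall>i\<le>n. \<forall>j\<le>n. U $$ (i, j) - T' q $$ (i, j) \<in> q.B (m0 q + E q)"
      proof (intro allI impI)
        fix i j assume ij: "i \<le> n" "j \<le> n"
        have "T' q $$ (i, j) = (if i = j then 1 else 0)" if "j \<le> i" using AW[OF q ij(1), of j] T(3)[OF q] that ij by (auto simp: T'_def T_def)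
        then show "U $$ (i, j) - T' q $$ (i, j) \<in> q.B (m0 q + E q)"
          using q.B_mono[OF u(2)[OF ij q] N[OF q]] ij q.B_0 by (cases "i < j") (auto simp: U_def)
      qed
      then obtain V where V: "V \<in> carrier_mat ?m ?m" "U = T' q * V" "\<forall>i\<le>n. \<forall>j\<le>n. V $$ (i, j) - (if i = j then 1 else 0) \<in> q.B (E q)"
        using m0[OF q, of U "E q"] by (auto simp: U_def)
      \<comment> \<open>The inverse of the diagonal of \<open>T q\<close>, times \<open>V\<close>,
        times the diagonal matrix of \<open>\<delta>\<close>. It is the matrix that takes
        \<open>T q\<close> to \<open>\<Gamma>\<close>.\<close>
      define V' where "V' = mat ?m ?m (\<lambda>(i, j). V $$ (i, j) * (\<delta> j / T q $$ (i, i)))"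
      have cT: "T q \<in> carrier_mat ?m ?m" "det (T q) \<noteq> 0" using T(1)[OF q] by (auto simp: GL_def)
      have cV': "V' \<in> carrier_mat ?m ?m" by (simp add: V'_def)
      have \<Gamma>T: "\<Gamma> = T q * V'"
      proof (rule eq_matI)
        fix i j assume "i < dim_row (T q * V')" "j < dim_col (T q * V')"
        then have ij: "i \<le> n" "j \<le> n" using cT cV' by auto
        have "(T q * V') $$ (i, j) = (\<Sum>k\<le>n. T' q $$ (i, k) * V $$ (k, j) * \<delta> j)"
          unfolding mat_mult_index[OF cT(1) cV' ij] using ij T(3)[OF q] by (intro sum.cong) (auto simp: V'_def T'_def)
        also have "\<dots> = U $$ (i, j) * \<delta> j"
          unfolding V(2) using mat_mult_index[of "T' q" n V, OF _ V(1) ij] by (simp add: T'_def sum_distrib_right)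
        finally show "\<Gamma> $$ (i, j) = (T q * V') $$ (i, j)" using ij by (simp add: \<Gamma>_def)
      qed (use cT cV' in \<open>auto simp: \<Gamma>_def\<close>)
      have V'B: "V' $$ (i, j) \<in> P.B 0" if ij: "i \<le> n" "j \<le> n" for i j
      proof -
        have r: "\<delta> j / T q $$ (i, i) \<in> P.B (w q j - w q i)"
          using \<delta> TL[OF ij(1)] v\<delta>[of j] q P.v_divide[of "\<delta> j" "T q $$ (i, i)"] by (auto simp: P.B_def intro: L.divide_in)
        have Vij: "V $$ (i, j) - (if i = j then 1 else 0) \<in> P.B (E q)" using V(3) ij B by auto
        show ?thesis
        proof (cases "i = j")
          case True
          have "(V $$ (i, j) - 1) + 1 \<in> P.B 0" by (rule P.B_add) (use P.B_mono[OF Vij E(2)[OF ij]] True P.B_1 in auto)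
          then show ?thesis using P.B_mult[OF _ r, of _ 0] True ij by (simp add: V'_def)
        next
          case False
          then show ?thesis using P.B_mono[OF P.B_mult[OF Vij r], of 0] E(1)[OF ij, of q] ij by (simp add: V'_def)
        qed
      qed
      have dd: "det \<Gamma> = det (T q) * det V'" unfolding \<Gamma>T by (rule det_mult[OF cT(1) cV'])
      have d0: "det \<Gamma> \<noteq> 0" using \<Gamma>GL by (simp add: GL_def)
      have "P.vp (det (T q)) = (\<Sum>i<?m. w q i)"
        unfolding T(4)[OF q] using TL P.v_prod[of "{..<?m}" "\<lambda>i. T q $$ (i, i)"] by (simp add: less_Suc_eq_le del: sum.lessThan_Suc prod.lessThan_Suc)
      moreover have "det (T q) \<in> L" unfolding T(4)[OF q] using TL by (intro L.prod_in) auto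
      moreover have "det V' \<in> L" using P.B0.det_in[OF cV'] V'B P.B_sub by auto
      \<comment> \<open>Both \<open>\<Gamma>\<close> and \<open>T q\<close> are triangular, and by
        the choice of \<open>\<delta>\<close> their diagonal entries have equal valuations at
        \<open>P\<close>.\<close>
      ultimately have "P.vp (det V') = 0"
        using vd\<Gamma> v\<delta> q dd d0 P.v_mult[of "det (T q)" "det V'"] by auto
      then have V'O: "V' \<in> P.GLO n" using cV' V'B dd d0 by (auto simp: P.GLO_def)
      have Wq: "W q \<in> carrier_mat ?m ?m" "\<And>i j. i \<le> n ==> j \<le> n ==> W q $$ (i, j) \<in> q.B 0" "det (W q) \<noteq> 0" "q.vp (det (W q)) = 0"
        using W[OF q] by (auto simp: q.GLO_def)
      have "det (W q) \<in> K" using q.B0.det_in[OF Wq(1)] Wq(2) q.B_sub by auto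
      then have "W q \<in> P.GLO n" using Wq B ord by (auto simp: P.GLO_def)
      then have WV: "W q * V' \<in> P.GLO n" using V'O by (rule P.GLO_mult)
      have AL: "A q \<in> GL n L" using A(1)[OF q] KL by (auto simp: GL_def)
      have "\<Gamma> = A q * (W q * V')"
        unfolding \<Gamma>T T_def using assoc_mult_mat[OF _ Wq(1) cV', of "A q" ?m] A(1)[OF q] by (simp add: GL_def)
      then have "resultant_order L P n d (change_coords n \<Gamma> F) = resultant_order L P n d (change_coords n (A q) F)"
        using P.order_mult_GLO[OF d FL res AL WV] by simp
      then show ?thesis using min by (simp add: minimal_at_def)
    next
      case nS: False
      have "\<Gamma> $$ (i, j) \<in> P.B 0" if ij: "i \<le> n" "j \<le> n" for i j
      proof -
        have "U $$ (i, j) \<in> P.B 0" using B0_above[OF u(3)[OF ij q.closed_point nS]] ij P.B_0 P.B_1 by (auto simp: U_def)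
        moreover have "\<delta> j \<in> P.B 0" using \<delta> v\<delta> nS by (auto simp: P.B_def)
        ultimately show ?thesis using ij by (simp add: \<Gamma>_def P.B_mult0)
      qed
      moreover have "P.vp (det \<Gamma>) = 0" using vd\<Gamma> v\<delta> nS by simp
      ultimately have "\<Gamma> \<in> P.GLO n" using c\<Gamma> \<Gamma>GL by (simp add: P.GLO_def GL_def)
      then have "resultant_order L P n d (change_coords n \<Gamma> F) = resultant_order L P n d F" using P.order_GLO[OF d FL res] by simp
      also have "\<dots> = 0"
      proof (rule P.order_eq_0[OF d FL res])
        show "P.integral_coeffs n F (of_nat D)"
          unfolding P.integral_coeffs_def using D(1) DF OK_OL P.O_B by (auto intro: L.of_nat_in)
        have "\<rho> \<notin> P" using nS q.closed_point \<rho>(1) K.O_sub by (auto simp: S_def)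
        then show "P.vp (resultant n d (\<lambda>i. mconst (of_nat D) * F i)) = 0"
          using P.p_B[OF OK_OL[OF \<rho>(1)]] P.O_B[OF OK_OL[OF \<rho>(1)]] \<rho>(2) unfolding \<rho>_def[symmetric] by (auto simp: P.B_def)
      qed
      finally show ?thesis
        unfolding minimal_at_def using P.order_nonneg[OF d P.change_L[OF d FL res]] by simp
    qed
  qed
  then show ?thesis using L(1) \<Gamma>GL unfolding has_globally_minimal_presentation_def by blast
qed

theorem theorem3p5:
  fixes K :: "complex set" and n d :: nat and F :: "nat \<Rightarrow> (nat, complex) mpoly"
  assumes "number_field K"
    and "n \<ge> 1" and "d \<ge> 1"
    and "defines_morphism K n d F"
  shows "\<exists>L. finite_extension K L \<and> has_globally_minimal_presentation L n d F"
proof -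
  have form: "form K n d (F i)" if "i \<le> n" for i using assms(4) that by (simp add: defines_morphism_def)
  have "\<not> has_common_zero UNIV n F"
    by (rule no_complex_zero[OF form number_field_alg_numbers[OF assms(1)]]) (use assms(4) in \<open>auto simp: defines_morphism_def\<close>)
  then have "resultant n d F \<noteq> 0" using form_mono[OF form] by (subst res_nonzero_iff[OF assms(3)]) auto
  then show ?thesis by (intro ex_globally_minimal[OF assms(1,3) form])
qed

end
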